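(* Let $1<p<\infty$ and $\bar\omega\in\mathbf V$ be fixed. Then $\bar\omega$ is orbitally stable under the dynamics of the vorticity equation in the following sense: for any $\varepsilon>0$, there exists some $\delta>0$ such that for any $\omega_0\in L^\infty(D)$, if $\|\omega_0-\bar\omega\|_p<\delta$, then for any $t\in\mathbb R$ there exists some $\tilde\omega\in\mathcal O_{\bar\omega}$ such that $\|\omega(t,\cdot)-\tilde\omega\|_p<\varepsilon$, where $\omega(t,\mathbf x)$ is the Yudovich solution of the vorticity equation with initial vorticity $\omega_0$.
   Context: $D=\{\mathbf x\in\mathbb R^2: |\mathbf x|<1\}$ is the open unit disk, $(r,\theta)$ are polar coordinates, $x_1=r\cos\theta$, $x_2=r\sin\theta$, and $\|\cdot\|_p$ is the norm of $L^p(D)$. All functions are real-valued. $\mathcal G$ is the inverse of $-\Delta$ on $D$ with zero Dirichlet boundary condition: $-\Delta\mathcal G\omega=\omega$ in $D$, $\mathcal G\omega=0$ on $\partial D$. Write $\nabla^\perp=(\partial_{x_2},-\partial_{x_1})$. The vorticity equation (of the 2D incompressible Euler equation in $D$ with impermeable boundary) is $\partial_t\omega+\mathbf v\cdot\nabla\omega=0$ for $t\in\mathbb R$, $\mathbf x\in D$, with $\mathbf v=\nabla^\perp\mathcal G\omega$. Yudovich solution: for $\omega_0\in L^\infty(D)$ there is (Yudovich's theorem) a unique $\omega\in L^\infty(\mathbb R;L^\infty(D))$ such that (1) $\int_{\mathbb R}\int_D\omega(\partial_t\varphi+\nabla^\perp\mathcal G\omega\cdot\nabla\varphi)\,d\mathbf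 x\,dt=0$ for all $\varphi\in C_c^\infty(\mathbb R\times D)$; (2) $\omega\in C(\mathbb R;L^s(D))$ for all $s\in[1,\infty)$ and $\omega(0,\cdot)=\omega_0$; (3) for every $t\in\mathbb R$, $\omega(t,\cdot)$ is a rearrangement of $\omega_0$, i.e. $|\{\omega(t,\cdot)>s\}|=|\{\omega_0>s\}|$ for all $s\in\mathbb R$ ($|\cdot|$ is Lebesgue measure); (4) $E(\omega(t,\cdot))=E(\omega_0)$ for all $t\in\mathbb R$, where $E(v)=\frac12\int_D v\,\mathcal Gv\,d\mathbf x$. This $\omega$ is called the Yudovich solution with initial vorticity $\omega_0$. $J_n$ is the Bessel function of the first kind of order $n$ and $j$ is the first positive zero of $J_1$ ($j\approx 3.8317$). $\mathbf V=\mathrm{span}_{\mathbb R}\{J_0(jr),\,J_1(jr)\cos\theta,\,J_1(jr)\sin\theta\}$, a space of functions on $D$. For $\zeta:D\to\mathbb R$, its rotation orbit is $\mathcal O_\zeta=\{\zeta(r,\theta+\beta): \beta\in\mathbb R\}$. *)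

theory Defs
  imports "HOL-Analysis.Analysis"
begin

type_synonym plane = "real^2"

text \<open>Vorticities are functions on the unit disk. They are represented by total functions on the
  plane, of which only the values on the disk matter.\<close>

definition disk :: "plane set" where
  "disk = ball 0 1"

definition polar :: "real \<Rightarrow> real \<Rightarrow> plane" where
  "polar r \<theta> = vector [r * cos \<theta>, r * sin \<theta>]"

definition Linf :: "'a::euclidean_space set \<Rightarrow> ('a \<Rightarrow> real) set" where
  "Linf U = {f. f \<in> borel_measurable (lebesgue_on U) \<and>
                (\<exists>M. AE x in lebesgue_on U. \<bar>f x\<bar> \<le> M)}"

definition Lp :: "real \<Rightarrow> 'a::euclidean_space set \<Rightarrow> ('a \<Rightarrow> real) set" where
  "Lp p U = {f. f \<in> borel_measurable (lebesgue_on U) \<and>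
                set_integrable lebesgue U (\<lambda>x. \<bar>f x\<bar> powr p)}"

text \<open>Meaningful for members of \<^term>\<open>Lp p U\<close>; the Bochner integral of a non-integrable
  function is 0.\<close>

definition Lp_norm :: "real \<Rightarrow> 'a::euclidean_space set \<Rightarrow> ('a \<Rightarrow> real) \<Rightarrow> real" where
  "Lp_norm p U f = (LINT x:U|lebesgue. \<bar>f x\<bar> powr p) powr (1 / p)"

definition dir_deriv :: "'a::euclidean_space \<Rightarrow> ('a \<Rightarrow> real) \<Rightarrow> 'a \<Rightarrow> real" where
  "dir_deriv v f x = frechet_derivative f (at x) v"

definition grad :: "(plane \<Rightarrow> real) \<Rightarrow> plane \<Rightarrow> plane" where
  "grad f x = vector [dir_deriv (axis 1 1) f x, dir_deriv (axis 2 1) f x]"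

definition grad_perp :: "(plane \<Rightarrow> real) \<Rightarrow> plane \<Rightarrow> plane" where
  "grad_perp f x = vector [dir_deriv (axis 2 1) f x, - dir_deriv (axis 1 1) f x]"

definition laplacian :: "(plane \<Rightarrow> real) \<Rightarrow> plane \<Rightarrow> real" where
  "laplacian f x = (\<Sum>i\<in>UNIV. dir_deriv (axis i 1) (dir_deriv (axis i 1) f) x)"

text \<open>\<^term>\<open>foldr dir_deriv vs f\<close> is an iterated partial derivative of \<^term>\<open>f\<close>. Since all of
  them are differentiable, they are also continuous, so this is smoothness on the whole space.\<close>

definition smooth :: "('a::euclidean_space \<Rightarrow> real) \<Rightarrow> bool" where
  "smooth f \<longleftrightarrow> (\<forall>vs. set vs \<subseteq> Basis \<longrightarrow> (\<forall>x. foldr dir_deriv vs f differentiable (at x)))"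

text \<open>Smooth functions with compact support contained in \<^term>\<open>U\<close>, extended by 0 to the whole
  space.\<close>

definition test_functions :: "'a::euclidean_space set \<Rightarrow> ('a \<Rightarrow> real) set" where
  "test_functions U = {\<phi>. smooth \<phi> \<and> compact (closure {x. \<phi> x \<noteq> 0}) \<and>
                           closure {x. \<phi> x \<noteq> 0} \<subseteq> U}"

text \<open>The equation \<open>- \<Delta> u = w\<close> is understood in the sense of distributions, because for merely
  bounded \<^term>\<open>w\<close> the solution need not be twice differentiable; the boundary condition is
  pointwise. Prescribing the value 0 outside the disk (in particular on the boundary circle)
  makes the solution unique as a function on the plane.\<close>

definition dirichlet_solution :: "(plane \<Rightarrow> real) \<Rightarrow> (plane \<Rightarrow> real) \<Rightarrow> bool" where
  "dirichlet_solution w u \<longleftrightarrow>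
     continuous_on (closure disk) u \<and>
     (\<forall>x. x \<notin> disk \<longrightarrow> u x = 0) \<and>
     (\<forall>\<phi>\<in>test_functions disk.
        (LINT x:disk|lebesgue. u x * (- laplacian \<phi> x)) = (LINT x:disk|lebesgue. w x * \<phi> x))"

definition green :: "(plane \<Rightarrow> real) \<Rightarrow> plane \<Rightarrow> real" where
  "green w = (THE u. dirichlet_solution w u)"

definition energy :: "(plane \<Rightarrow> real) \<Rightarrow> real" where
  "energy v = 1 / 2 * (LINT x:disk|lebesgue. v x * green v x)"

text \<open>\<^term>\<open>\<omega> t\<close> is the vorticity at time \<^term>\<open>t\<close>. The space \<open>L\<^sup>\<infinity>(\<real>; L\<^sup>\<infinity>(D))\<close> is read as
  \<open>L\<^sup>\<infinity>(\<real> \<times> D)\<close>.\<close>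

definition yudovich_solution ::
  "(plane \<Rightarrow> real) \<Rightarrow> (real \<Rightarrow> plane \<Rightarrow> real) \<Rightarrow> bool" where
  "yudovich_solution \<omega>0 \<omega> \<longleftrightarrow>
     (\<lambda>(t, x). \<omega> t x) \<in> Linf (UNIV \<times> disk) \<and>
     (\<forall>\<phi>\<in>test_functions (UNIV \<times> disk).
        (LINT t|lebesgue. (LINT x:disk|lebesgue.
           \<omega> t x * (deriv (\<lambda>s. \<phi> (s, x)) t
                    + grad_perp (green (\<omega> t)) x \<bullet> grad (\<lambda>y. \<phi> (t, y)) x))) = 0) \<and>
     (\<forall>s\<ge>1. (\<forall>t. \<omega> t \<in> Lp s disk) \<and>
             (\<forall>t. ((\<lambda>\<tau>. Lp_norm s disk (\<lambda>x. \<omega> \<tau> x - \<omega> t x)) \<longlongrightarrow> 0) (at t))) \<and>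
     (AE x in lebesgue_on disk. \<omega> 0 x = \<omega>0 x) \<and>
     (\<forall>t s. measure lebesgue {x \<in> disk. \<omega> t x > s} = measure lebesgue {x \<in> disk. \<omega>0 x > s}) \<and>
     (\<forall>t. energy (\<omega> t) = energy \<omega>0)"

definition bessel_J :: "nat \<Rightarrow> real \<Rightarrow> real" where
  "bessel_J n x = (\<Sum>m. (-1) ^ m / (fact m * fact (m + n)) * (x / 2) ^ (2 * m + n))"

definition bessel_zero :: real where
  "bessel_zero = (LEAST x. 0 < x \<and> bessel_J 1 x = 0)"

text \<open>The span of three functions given in polar coordinates, as functions on the disk. There is
  no conflict at \<open>r = 0\<close>, where \<open>J\<^sub>1\<close> vanishes.\<close>

definition bessel_span :: "(plane \<Rightarrow> real) set" where
  "bessel_span = {v. \<exists>a b c. \<forall>r\<in>{0..<1}. \<forall>\<theta>.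
     v (polar r \<theta>) = a * bessel_J 0 (bessel_zero * r)
                   + b * (bessel_J 1 (bessel_zero * r) * cos \<theta>)
                   + c * (bessel_J 1 (bessel_zero * r) * sin \<theta>)}"

definition rotation_orbit :: "(plane \<Rightarrow> real) \<Rightarrow> (plane \<Rightarrow> real) set" where
  "rotation_orbit \<zeta> = {\<eta>. \<exists>\<beta>. \<forall>r\<in>{0..<1}. \<forall>\<theta>. \<eta> (polar r \<theta>) = \<zeta> (polar r (\<theta> + \<beta>))}"

end

theory Submission
  imports Defs
begin

text \<open>Let \<open>j\<close> be the first positive zero of \<open>J\<^sub>1\<close>, \<open>\<mu> = 1/j\<^sup>2\<close> and \<open>V\<close> the span of the three Bessel modes.
  The proof describes \<open>V\<close> by conserved quantities. On functions of mean zero the quadratic form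
  \<open>2 E(w) = \<integral> w G w\<close> has the largest eigenvalue \<open>\<mu>\<close>, with eigenspace \<open>V\<close>, and the rest of its
  spectrum is at most \<open>1/16\<close>, which is less than \<open>\<mu>\<close> because \<open>j < 4\<close>. Quantitatively
  (\<open>spectral_gap\<close>), \<open>2 E(w) \<le> \<mu> \<parallel>w\<parallel>\<^sup>2 - (\<mu> - 1/16) \<parallel>w - P w\<parallel>\<^sup>2\<close> with \<open>P\<close> the orthogonal projection
  of \<open>L\<^sup>2\<close> onto \<open>V\<close>, while \<open>2 E = \<mu> \<parallel>\<cdot>\<parallel>\<^sup>2\<close> on \<open>V\<close> (\<open>energy_comb\<close>). So a function of mean almost zero
  whose energy almost reaches \<open>\<mu>/2\<close> times its squared norm is close to \<open>V\<close> in mean square.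

Energy and distribution function are conserved. Hence a solution that starts near a member of \<open>V\<close>
  stays near \<open>V\<close>, and its projection to \<open>V\<close>, with coefficients \<open>(a, b, c)\<close>, has almost conserved
  \<open>L\<^sup>2\<close> norm and almost conserved third moment. By orthogonality and parity these two quantities
  are \<open>\<nu>\<^sub>0 a\<^sup>2 + \<nu>\<^sub>1 (b\<^sup>2 + c\<^sup>2)\<close> and \<open>A a\<^sup>3 + 3 B a (b\<^sup>2 + c\<^sup>2)\<close>, where \<open>B > 0\<close> (\<open>third_moment\<close>,
  \<open>moment_mixed_pos\<close>). Eliminating \<open>b\<^sup>2 + c\<^sup>2\<close> shows that \<open>a\<close> almost solves a cubic equation, which
  is not trivial because its linear coefficient is a positive multiple of \<open>B\<close>. The roots are
  isolated and \<open>a\<close> depends continuously on time, so \<open>a\<close> cannot leave a small neighbourhood of its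
  initial value (\<open>trapped\<close>). Then \<open>b\<^sup>2 + c\<^sup>2\<close> is almost determined too, and what remains free is the
  angle of \<open>(b, c)\<close>, that is, a rotation of the disk (\<open>orbit_rotate\<close>).

Exponents \<open>p \<noteq> 2\<close> are handled by truncation: clipping the vorticity at a height above \<open>sup \<bar>\<omega>bar\<bar>\<close>
  costs, uniformly in time, at most the initial distance in \<open>L\<^sup>p\<close>, because the norm of the
  clipped-off part depends on the distribution function only; and for functions with a common
  bound the \<open>L\<^sup>p\<close> and \<open>L\<^sup>2\<close> topologies agree. The energy is Lipschitz continuous on bounded sets of
  \<open>L\<^sup>q\<close> for every \<open>q\<close> with \<open>1 < q \<le> 2\<close>, since the Green operator maps \<open>L\<^sup>q\<close> to bounded functions
  (\<open>green_bound\<close>, \<open>energy_difference\<close>).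

The facts about the Poisson equation rest on one explicit computation. A mode is a radial function
  times a harmonic polynomial \<open>Re z\<^sup>n\<close> or \<open>Im z\<^sup>n\<close>; in the variable \<open>t = \<bar>x\<bar>\<^sup>2\<close> the Laplacian acts on
  it as \<open>U \<mapsto> 4 (t U'' + (n + 1) U')\<close>. Polynomials are finite sums of modes, the equation with
  polynomial right-hand side has an explicit polynomial solution, and polynomials are dense in
  \<open>L\<^sup>2\<close>. A maximum bound for the Poisson equation (\<open>sup_bound_log\<close>) carries existence over to
  bounded right-hand sides. The spectral gap is proved mode by mode, as an inequality for
  functions of one variable.\<close>

section \<open>The divergence theorem and Green's identity on the disk\<close>

abbreviation "MD \<equiv> lebesgue_on disk"

lemma open_disk [simp]: "open disk" and disk_sets [measurable, simp]: "disk \<in> sets lebesgue"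
  and mem_disk: "x \<in> disk \<longleftrightarrow> norm x < 1"
  by (auto simp: disk_def)

lemma space_MD [simp]: "space MD = disk"
  by (simp add: space_restrict_space)

lemma emeasure_disk: "emeasure lebesgue disk = ennreal pi"
  using emeasure_ball[of 1 "0::plane"] by (simp add: disk_def eval_unit_ball_vol)

lemma finite_measure_MD: "finite_measure MD"
  by (rule finite_measureI) (simp add: emeasure_restrict_space emeasure_disk)

lemma measure_MD: "measure MD disk = pi"
  by (simp add: emeasure_restrict_space emeasure_disk measure_def)

lemma set_integral_MD: "(LINT x:disk|lebesgue. f x) = (LINT x|MD. (f x::real))"
  by (simp add: set_lebesgue_integral_def integral_restrict_space)

lemma continuous_MD:
  "continuous_on UNIV f \<Longrightarrow> (f::plane \<Rightarrow> real) \<in> borel_measurable MD"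
  by (metis borel_measurable_continuous_onI measurable_completion measurable_lborel2 measurable_restrict_space1)

lemma integrable_MD_bounded:
  fixes f :: "plane \<Rightarrow> real"
  assumes "f \<in> borel_measurable MD" "\<And>x. x \<in> disk \<Longrightarrow> \<bar>f x\<bar> \<le> C"
  shows "integrable MD f"
  by (rule finite_measure.integrable_const_bound[OF finite_measure_MD, of _ C]) (use assms in auto)

lemma continuous_bounded_disk:
  fixes f :: "plane \<Rightarrow> real"
  assumes "continuous_on UNIV f"
  obtains C where "0 < C" "\<And>x. norm x \<le> 1 \<Longrightarrow> \<bar>f x\<bar> \<le> C"
proof -
  have "compact (f ` cball 0 1)"
    by (intro compact_continuous_image compact_cball continuous_on_subset[OF assms]) simp
  then have "bounded (f ` cball 0 1)" by (rule compact_imp_bounded)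
  then obtain C where "0 < C" "\<forall>y \<in> f ` cball 0 1. norm y \<le> C"
    unfolding bounded_pos by auto
  then show ?thesis using that[of C] by auto
qed

lemma integrable_MD_continuous:
  "continuous_on UNIV f \<Longrightarrow> integrable MD (f :: plane \<Rightarrow> real)"
proof -
  assume c: "continuous_on UNIV f"
  obtain C where "\<And>x. norm x \<le> 1 \<Longrightarrow> \<bar>f x\<bar> \<le> C" using continuous_bounded_disk[OF c] by blast
  then show ?thesis by (intro integrable_MD_bounded[of f C] continuous_MD c) (simp add: mem_disk)
qed

text \<open>Differentiation along lines in direction \<open>i\<close>, in relational form: such derivatives can be
  added, multiplied and composed without discussing total differentiability, and integration by
  parts works on such lines.\<close>

definition has_partial :: "2 \<Rightarrow> (plane \<Rightarrow> real) \<Rightarrow> (plane \<Rightarrow> real) \<Rightarrow> bool" where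
  "has_partial i f f' \<longleftrightarrow> (\<forall>x. ((\<lambda>s. f (x + s *\<^sub>R axis i 1)) has_real_derivative f' x) (at 0))"

lemma has_partial_line:
  assumes "has_partial i f f'"
  shows "((\<lambda>s. f (x + s *\<^sub>R axis i 1)) has_real_derivative f' (x + s *\<^sub>R axis i 1)) (at s)"
proof -
  have "((\<lambda>h. f ((x + s *\<^sub>R axis i 1) + h *\<^sub>R axis i 1)) has_real_derivative f' (x + s *\<^sub>R axis i 1)) (at 0)"
    using assms by (simp add: has_partial_def)
  then have "((\<lambda>h. f (x + (h + s) *\<^sub>R axis i 1)) has_real_derivative f' (x + s *\<^sub>R axis i 1)) (at 0)"
    by (simp add: algebra_simps)
  then show ?thesis
    using DERIV_shift[of "\<lambda>s. f (x + s *\<^sub>R axis i 1)" _ 0 s] by simp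
qed

lemma has_partial_const: "has_partial i (\<lambda>x. c) (\<lambda>x. 0)"
  by (simp add: has_partial_def)

lemma has_partial_coord: "has_partial i (\<lambda>x. x $ k) (\<lambda>x. if k = i then 1 else 0)"
  unfolding has_partial_def axis_def by (auto intro!: derivative_eq_intros)

lemma has_partial_add: "has_partial i f f' \<Longrightarrow> has_partial i g g' \<Longrightarrow> has_partial i (\<lambda>x. f x + g x) (\<lambda>x. f' x + g' x)"
  unfolding has_partial_def by (auto intro!: derivative_eq_intros)

lemma has_partial_mult: "has_partial i f f' \<Longrightarrow> has_partial i g g' \<Longrightarrow> has_partial i (\<lambda>x. f x * g x) (\<lambda>x. f' x * g x + f x * g' x)"
  unfolding has_partial_def by (auto intro!: derivative_eq_intros)

lemma has_partial_diff: "has_partial i f f' \<Longrightarrow> has_partial i g g' \<Longrightarrow> has_partial i (\<lambda>x. f x - g x) (\<lambda>x. f' x - g' x)"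
  unfolding has_partial_def by (auto intro!: derivative_eq_intros)

lemma has_partial_sum: "finite I \<Longrightarrow> (\<And>k. k \<in> I \<Longrightarrow> has_partial i (f k) (f' k)) \<Longrightarrow> has_partial i (\<lambda>x. \<Sum>k\<in>I. f k x) (\<lambda>x. \<Sum>k\<in>I. f' k x)"
  unfolding has_partial_def by (auto intro!: derivative_eq_intros)

lemma has_partial_compose:
  assumes "has_partial i f f'" "\<And>x. (g has_real_derivative g' (f x)) (at (f x))"
  shows "has_partial i (\<lambda>x. g (f x)) (\<lambda>x. g' (f x) * f' x)"
  unfolding has_partial_def
proof
  fix x
  have "((\<lambda>s. f (x + s *\<^sub>R axis i 1)) has_real_derivative f' x) (at 0)"
    using assms(1) by (simp add: has_partial_def)
  moreover have "(g has_real_derivative g' (f x)) (at (f (x + 0 *\<^sub>R axis i 1)))"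
    using assms(2)[of x] by simp
  ultimately show "((\<lambda>s. g (f (x + s *\<^sub>R axis i 1))) has_real_derivative g' (f x) * f' x) (at 0)"
    by (intro DERIV_chain2[where g="\<lambda>s. f (x + s *\<^sub>R axis i 1)"])
qed

text \<open>The partial derivative of a function that vanishes on the unit circle integrates to 0 over the
  disk: the extension of the function by 0 is Lipschitz along the coordinate direction, its
  difference quotients have integral 0 by translation invariance, and they converge boundedly.\<close>

lemma integral_partial_derivative_eq_0:
  fixes X X' :: "plane \<Rightarrow> real"
  assumes X: "has_partial i X X'" and cX: "continuous_on UNIV X" and cX': "continuous_on UNIV X'"
    and bd: "\<And>x. norm x = 1 \<Longrightarrow> X x = 0"
  shows "(LINT x|MD. X' x) = 0"
proof -
  define e :: plane where "e = axis i 1"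
  have ne: "norm e = 1" by (simp add: e_def)
  define g where "g x = (if norm x < 1 then X x else 0)" for x
  obtain L where L: "L > 0" "\<And>x. norm x \<le> 1 \<Longrightarrow> \<bar>X' x\<bar> \<le> L"
    using continuous_bounded_disk[OF cX'] by blast
  have seg: "\<bar>X (a + s *\<^sub>R e) - X a\<bar> \<le> L * s" if "norm a \<le> 1" "norm (a + s *\<^sub>R e) \<le> 1" "0 \<le> s" for a s
  proof (cases "s = 0")
    case False
    then have "s > 0" using that by simp
    then have "\<exists>z. 0 < z \<and> z < s \<and> X (a + s *\<^sub>R e) - X (a + 0 *\<^sub>R e) = (s - 0) * X' (a + z *\<^sub>R e)"
      by (intro MVT2[where f="\<lambda>s. X (a + s *\<^sub>R e)" and f'="\<lambda>z. X' (a + z *\<^sub>R e)"])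
         (auto simp: e_def intro: has_partial_line[OF X])
    then obtain z where z: "0 < z" "z < s" "X (a + s *\<^sub>R e) - X a = s * X' (a + z *\<^sub>R e)" by auto
    have "a + z *\<^sub>R e = (1 - z/s) *\<^sub>R a + (z/s) *\<^sub>R (a + s *\<^sub>R e)"
      using \<open>s > 0\<close> by (simp add: algebra_simps)
    moreover have "(1 - z/s) *\<^sub>R a + (z/s) *\<^sub>R (a + s *\<^sub>R e) \<in> cball 0 1"
      by (rule convexD[OF convex_cball]) (use that z \<open>s>0\<close> in \<open>auto simp: field_simps\<close>)
    ultimately have "\<bar>X' (a + z *\<^sub>R e)\<bar> \<le> L" using L(2) by simp
    then show ?thesis using z(3) \<open>s>0\<close> by (simp add: abs_mult mult.commute)
  qed (use that in auto)
  have Lip: "\<bar>g (x + h *\<^sub>R e) - g x\<bar> \<le> L * h" if h: "h > 0" for x h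
  proof -
    have cn: "continuous_on {0..h} (\<lambda>s. norm (x + s *\<^sub>R e))" by (intro continuous_intros)
    consider "norm x < 1" "norm (x + h *\<^sub>R e) < 1" | "norm x < 1" "norm (x + h *\<^sub>R e) \<ge> 1"
      | "norm x \<ge> 1" "norm (x + h *\<^sub>R e) < 1" | "norm x \<ge> 1" "norm (x + h *\<^sub>R e) \<ge> 1" by linarith
    then show ?thesis
    proof cases
      case 1 then show ?thesis using seg[of x h] h by (simp add: g_def)
    next
      case 2
      then obtain s where s: "0 \<le> s" "s \<le> h" "norm (x + s *\<^sub>R e) = 1"
        using IVT'[of "\<lambda>s. norm (x + s *\<^sub>R e)" 0 1 h] h cn by auto
      have "\<bar>X (x + s *\<^sub>R e) - X x\<bar> \<le> L * s" using seg[of x s] s 2 by simp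
      then have "\<bar>X x\<bar> \<le> L * s" using bd s(3) by simp
      also have "L * s \<le> L * h" using s L by simp
      finally show ?thesis using 2 by (simp add: g_def)
    next
      case 3
      then obtain s where s: "0 \<le> s" "s \<le> h" "norm (x + s *\<^sub>R e) = 1"
        using IVT2'[of "\<lambda>s. norm (x + s *\<^sub>R e)" h 1 0] h cn by auto
      have eq: "x + s *\<^sub>R e + (h - s) *\<^sub>R e = x + h *\<^sub>R e" by (simp add: algebra_simps)
      have "\<bar>X (x + s *\<^sub>R e + (h - s) *\<^sub>R e) - X (x + s *\<^sub>R e)\<bar> \<le> L * (h - s)"
        by (rule seg, use s in simp, unfold eq, use s 3 in auto)
      then have "\<bar>X (x + h *\<^sub>R e)\<bar> \<le> L * (h - s)" using bd s(3) eq by simp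
      also have "L * (h - s) \<le> L * h" using s L by simp
      finally show ?thesis using 3 by (simp add: g_def)
    next
      case 4 then show ?thesis using L h by (simp add: g_def)
    qed
  qed
  have gm [measurable]: "g \<in> borel_measurable borel"
    unfolding g_def by (intro measurable_If borel_measurable_continuous_onI[OF cX]) auto
  obtain C where C: "C > 0" "\<And>x. norm x \<le> 1 \<Longrightarrow> \<bar>X x\<bar> \<le> C"
    using continuous_bounded_disk[OF cX] by blast
  have fb: "emeasure lborel (cball (0::plane) 3) < \<infinity>" by (rule emeasure_lborel_cball_finite)
  have bint: "integrable lborel f" if "f \<in> borel_measurable borel" "\<And>x. \<bar>f x\<bar> \<le> K * indicator (cball 0 3) x"
    for f :: "plane \<Rightarrow> real" and K
    by (rule Bochner_Integration.integrable_bound[of _ "\<lambda>x. K * indicator (cball 0 3) x"])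
       (use that fb in \<open>auto intro!: AE_I2 order_trans[OF that(2)]\<close>)
  have gi: "integrable lborel g"
    by (rule bint[where K=C]) (use C gm in \<open>auto simp: g_def indicator_def\<close>)
  have gi_shift: "integrable lborel (\<lambda>x. g (x + v))" "(LINT x|lborel. g (x + v)) = (LINT x|lborel. g x)" for v
  proof -
    have d: "distr lborel borel ((+) v) = (lborel :: plane measure)" by (rule lborel_distr_plus)
    show "integrable lborel (\<lambda>x. g (x + v))"
      using integrable_distr_eq[of "(+) v" lborel borel g] gi d by (simp add: add.commute)
    show "(LINT x|lborel. g (x + v)) = (LINT x|lborel. g x)"
      using integral_distr[of "(+) v" lborel borel g] d by (simp add: add.commute)
  qed
  define h where "h n = 1 / real (Suc n)" for n
  have h: "h n > 0" "h n \<le> 1" for n by (auto simp: h_def)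
  define q where "q n x = (g (x + h n *\<^sub>R e) - g x) / h n" for n x
  have q0: "(LINT x|lborel. q n x) = 0" for n
    unfolding q_def using gi gi_shift by simp
  have "(\<lambda>n. LINT x|lborel. q n x) \<longlonglongrightarrow> (LINT x|lborel. indicator disk x * X' x)"
  proof (rule integral_dominated_convergence[where w="\<lambda>x. L * indicator (cball 0 3) x"])
    show "(\<lambda>x. indicator disk x * X' x) \<in> borel_measurable lborel"
      using borel_measurable_continuous_onI[OF cX'] by simp
    show "q n \<in> borel_measurable lborel" for n
      unfolding q_def by measurable
    show "integrable lborel (\<lambda>x::plane. L * indicator (cball 0 3) x)"
      by (intro integrable_mult_right integrable_real_indicator) (use fb in auto)
    show "AE x in lborel. norm (q n x) \<le> L * indicator (cball 0 3) x" for n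
    proof (rule AE_I2)
      fix x :: plane
      show "norm (q n x) \<le> L * indicator (cball 0 3) x"
      proof (cases "norm x \<le> 3")
        case True
        then show ?thesis using Lip[OF h(1), of x n] h[of n] by (auto simp: q_def divide_le_eq)
      next
        case False
        have "norm x \<le> norm (x + h n *\<^sub>R e) + norm (h n *\<^sub>R e)"
          by (metis add_diff_cancel norm_triangle_ineq4)
        then have "norm (x + h n *\<^sub>R e) > 1" using False h[of n] ne by simp
        then show ?thesis using False by (simp add: q_def g_def)
      qed
    qed
    have "negligible (sphere (0::plane) 1)" by (rule negligible_sphere)
    then have "AE x in lebesgue. x \<notin> sphere (0::plane) 1"
      unfolding negligible_iff_null_sets by (rule AE_not_in)
    then have "AE x in lborel. x \<notin> sphere (0::plane) 1" by (simp add: AE_completion_iff)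
    then show "AE x in lborel. (\<lambda>n. q n x) \<longlonglongrightarrow> indicator disk x * X' x"
    proof eventually_elim
      case (elim x)
      have h0: "h \<longlonglongrightarrow> 0" unfolding h_def by (rule LIMSEQ_Suc[OF lim_1_over_n])
      have xs: "(\<lambda>n. norm (x + h n *\<^sub>R e)) \<longlonglongrightarrow> norm (x + 0 *\<^sub>R e)"
        by (intro tendsto_intros h0)
      show ?case
      proof (cases "norm x < 1")
        case True
        then have ev: "\<forall>\<^sub>F n in sequentially. norm (x + h n *\<^sub>R e) < 1"
          using order_tendstoD(2)[OF xs] by simp
        have fl: "filterlim h (at 0) sequentially"
          using h0 by (simp add: filterlim_at h_def)
        have "((\<lambda>s. (X (x + s *\<^sub>R e) - X x) / s) \<longlongrightarrow> X' x) (at 0)"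
          using X by (simp add: has_partial_def e_def has_field_derivative_iff)
        then have "(\<lambda>n. (X (x + h n *\<^sub>R e) - X x) / h n) \<longlonglongrightarrow> X' x"
          by (rule filterlim_compose) (rule fl)
        moreover have "\<forall>\<^sub>F n in sequentially. (X (x + h n *\<^sub>R e) - X x) / h n = q n x"
          using ev by eventually_elim (simp add: q_def g_def True)
        ultimately have "(\<lambda>n. q n x) \<longlonglongrightarrow> X' x" by (rule Lim_transform_eventually)
        then show ?thesis using True by (simp add: mem_disk)
      next
        case False
        then have "norm x > 1" using elim by simp
        then have "\<forall>\<^sub>F n in sequentially. norm (x + h n *\<^sub>R e) > 1"
          using order_tendstoD(1)[OF xs] by simp
        then have "\<forall>\<^sub>F n in sequentially. 0 = q n x"
          by eventually_elim (use \<open>norm x > 1\<close> in \<open>simp add: q_def g_def\<close>)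
        then have "(\<lambda>n. q n x) \<longlonglongrightarrow> 0"
          by (intro Lim_transform_eventually[OF tendsto_const])
        then show ?thesis using False by (simp add: mem_disk)
      qed
    qed
  qed
  then have "(LINT x|lborel. indicator disk x * X' x) = 0"
    by (simp add: q0 LIMSEQ_const_iff)
  moreover have "(LINT x|lebesgue. indicator disk x * X' x) = (LINT x|lborel. indicator disk x * X' x)"
    by (rule integral_completion) (use borel_measurable_continuous_onI[OF cX'] in simp)
  ultimately show ?thesis by (simp add: integral_restrict_space)
qed

text \<open>A function together with its first and its unmixed second partial derivatives, all of them
  continuous. The Laplacian is the sum over \<open>i\<close> of the last argument; mixed derivatives never
  occur.\<close>

definition C2 :: "(plane \<Rightarrow> real) \<Rightarrow> (2 \<Rightarrow> plane \<Rightarrow> real) \<Rightarrow> (2 \<Rightarrow> plane \<Rightarrow> real) \<Rightarrow> bool" where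
  "C2 A A1 A2 \<longleftrightarrow> continuous_on UNIV A \<and>
     (\<forall>i. has_partial i A (A1 i) \<and> has_partial i (A1 i) (A2 i) \<and> continuous_on UNIV (A1 i) \<and> continuous_on UNIV (A2 i))"

text \<open>Every summand of the difference of the two sides is the partial derivative of \<open>A B\<^sub>i - A\<^sub>i B\<close>.
  Both boundary terms are killed by the vanishing of \<open>A\<close> to second order at the circle. This
  covers the two uses: \<open>A\<close> a test function, and \<open>A\<close> the square of a function that vanishes on the
  circle; \<open>B\<close> is free of boundary conditions.\<close>

lemma Green_identity:
  assumes A: "C2 A A1 A2" and B: "C2 B B1 B2"
    and bd: "\<And>x. norm x = 1 \<Longrightarrow> A x = 0" "\<And>x i. norm x = 1 \<Longrightarrow> A1 i x = 0"
  shows "(LINT x|MD. A x * (\<Sum>i\<in>UNIV. B2 i x)) = (LINT x|MD. (\<Sum>i\<in>UNIV. A2 i x) * B x)"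
proof -
  note c = A[unfolded C2_def] B[unfolded C2_def]
  have z: "(LINT x|MD. A x * B2 i x - A2 i x * B x) = 0" for i
  proof (rule integral_partial_derivative_eq_0[of i "\<lambda>x. A x * B1 i x - A1 i x * B x"])
    have "has_partial i (\<lambda>x. A x * B1 i x - A1 i x * B x)
        (\<lambda>x. (A1 i x * B1 i x + A x * B2 i x) - (A2 i x * B x + A1 i x * B1 i x))"
      using c by (intro has_partial_diff has_partial_mult) auto
    then show "has_partial i (\<lambda>x. A x * B1 i x - A1 i x * B x) (\<lambda>x. A x * B2 i x - A2 i x * B x)"
      by (simp add: algebra_simps)
  qed (use c bd in \<open>auto intro!: continuous_intros\<close>)
  have i: "integrable MD (\<lambda>x. A x * B2 i x)" "integrable MD (\<lambda>x. A2 i x * B x)" for i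
    using c by (auto intro!: integrable_MD_continuous continuous_intros)
  have "(LINT x|MD. A x * B2 i x) = (LINT x|MD. A2 i x * B x)" for i
    using z[of i] Bochner_Integration.integral_diff[OF i(1)[of i] i(2)[of i]] by linarith
  then show ?thesis using i
    by (simp add: sum_distrib_left sum_distrib_right Bochner_Integration.integral_sum)
qed

lemma C2I:
  assumes "continuous_on UNIV A" "\<And>i. has_partial i A (A1 i)" "\<And>i. has_partial i (A1 i) (A2 i)"
    "\<And>i. continuous_on UNIV (A1 i)" "\<And>i. continuous_on UNIV (A2 i)"
  shows "C2 A A1 A2"
  using assms by (simp add: C2_def)

lemma C2_mult:
  assumes "C2 A A1 A2" "C2 B B1 B2"
  shows "C2 (\<lambda>x. A x * B x) (\<lambda>i x. A1 i x * B x + A x * B1 i x)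
     (\<lambda>i x. A2 i x * B x + 2 * (A1 i x * B1 i x) + A x * B2 i x)"
proof (rule C2I)
  fix i
  note c = assms[unfolded C2_def]
  show "has_partial i (\<lambda>x. A x * B x) (\<lambda>x. A1 i x * B x + A x * B1 i x)"
    using c by (intro has_partial_mult) auto
  have "has_partial i (\<lambda>x. A1 i x * B x + A x * B1 i x)
     (\<lambda>x. (A2 i x * B x + A1 i x * B1 i x) + (A1 i x * B1 i x + A x * B2 i x))"
    using c by (intro has_partial_mult has_partial_add) auto
  then show "has_partial i (\<lambda>x. A1 i x * B x + A x * B1 i x)
     (\<lambda>x. A2 i x * B x + 2 * (A1 i x * B1 i x) + A x * B2 i x)"
    by (simp add: algebra_simps)
qed (use assms[unfolded C2_def] in \<open>auto intro!: continuous_intros\<close>)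

lemma C2_sum:
  assumes "finite I" "\<And>k. k \<in> I \<Longrightarrow> C2 (A k) (A1 k) (A2 k)"
  shows "C2 (\<lambda>x. \<Sum>k\<in>I. A k x) (\<lambda>i x. \<Sum>k\<in>I. A1 k i x) (\<lambda>i x. \<Sum>k\<in>I. A2 k i x)"
  using assms unfolding C2_def by (auto intro!: has_partial_sum continuous_intros)

section \<open>Modes: a radial function times a harmonic polynomial\<close>

text \<open>The squared distance from the origin is used as the radial variable because in it the modes
  of a polynomial are polynomials and the Bessel modes are entire functions.\<close>

definition rsq :: "plane \<Rightarrow> real" where "rsq x = (x$1)^2 + (x$2)^2"

lemma rsq_norm: "rsq x = (norm x)^2"
  by (simp add: rsq_def norm_vec_def L2_set_def sum_2)

definition to_complex :: "plane \<Rightarrow> complex" where "to_complex x = Complex (x$1) (x$2)"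

lemma norm_to_complex: "cmod (to_complex x) = norm x" and rsq_to_complex: "complex_of_real (rsq x) = to_complex x * cnj (to_complex x)"
  by (simp_all add: to_complex_def rsq_def cmod_def norm_vec_def L2_set_def sum_2 complex_eq_iff power2_eq_square)

text \<open>A single Boolean index lets real and imaginary parts, hence cosine and sine modes, share all
  statements.\<close>

definition re_or_im :: "bool \<Rightarrow> complex \<Rightarrow> real" where "re_or_im s = (if s then Re else Im)"

lemma bounded_linear_re_or_im: "bounded_linear (re_or_im s)"
  by (simp add: re_or_im_def bounded_linear_Re bounded_linear_Im)

text \<open>The harmonic polynomials \<open>r\<^sup>n cos (n \<theta>)\<close> and \<open>r\<^sup>n sin (n \<theta>)\<close>; the mode \<open>Y 0 False\<close> is zero.\<close>

definition Y :: "nat \<Rightarrow> bool \<Rightarrow> plane \<Rightarrow> real" where "Y n s x = re_or_im s (to_complex x ^ n)"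

lemma continuous_rsq [continuous_intros]: "continuous_on UNIV rsq"
  unfolding rsq_def by (intro continuous_intros)

lemma continuous_to_complex [continuous_intros]: "continuous_on UNIV to_complex"
  unfolding to_complex_def Complex_eq by (intro continuous_intros)

lemma continuous_re_or_im [continuous_intros]:
  "continuous_on UNIV f \<Longrightarrow> continuous_on UNIV (\<lambda>x. re_or_im s (f x))"
  by (rule bounded_linear.continuous_on[OF bounded_linear_re_or_im])

lemma continuous_Y [continuous_intros]: "continuous_on UNIV (Y n s)"
  unfolding Y_def by (intro continuous_intros)

text \<open>The complex number that corresponds to the coordinate direction \<open>i\<close>, so that lines in the
  plane become lines in the complex numbers.\<close>

definition axis_unit :: "2 \<Rightarrow> complex" where "axis_unit i = (if i = 1 then 1 else \<i>)"

lemma to_complex_line: "to_complex (x + s *\<^sub>R axis i 1) = to_complex x + of_real s * axis_unit i"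
  using exhaust_2[of i] by (auto simp: to_complex_def axis_unit_def axis_def complex_eq_iff)

lemma has_partial_re_or_im_power:
  "has_partial i (\<lambda>x. re_or_im s (a * to_complex x ^ m)) (\<lambda>x. re_or_im s (a * axis_unit i * of_nat m * to_complex x ^ (m - 1)))"
  unfolding has_partial_def to_complex_line
proof
  fix x
  have "((\<lambda>t. a * (to_complex x + t * axis_unit i) ^ m) has_field_derivative a * (of_nat m * (axis_unit i * (to_complex x + 0 * axis_unit i) ^ (m - 1)))) (at 0)"
    by (rule derivative_eq_intros refl | simp)+
  then have "((\<lambda>t. a * (to_complex x + of_real t * axis_unit i) ^ m) has_vector_derivative a * (of_nat m * (axis_unit i * (to_complex x + 0 * axis_unit i) ^ (m - 1)))) (at 0)"
    using has_vector_derivative_real_field[of "\<lambda>t. a * (to_complex x + t * axis_unit i) ^ m" _ 0 UNIV] by simp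
  then have "((\<lambda>t. re_or_im s (a * (to_complex x + of_real t * axis_unit i) ^ m)) has_vector_derivative re_or_im s (a * (of_nat m * (axis_unit i * (to_complex x + 0 * axis_unit i) ^ (m - 1))))) (at 0)"
    by (rule bounded_linear.has_vector_derivative[OF bounded_linear_re_or_im])
  then show "((\<lambda>t. re_or_im s (a * (to_complex x + of_real t * axis_unit i) ^ m)) has_real_derivative re_or_im s (a * axis_unit i * of_nat m * to_complex x ^ (m - 1))) (at 0)"
    by (simp add: has_real_derivative_iff_has_vector_derivative mult_ac)
qed

lemma C2_Y:
  "C2 (Y n s) (\<lambda>i x. re_or_im s (axis_unit i * of_nat n * to_complex x ^ (n - 1)))
     (\<lambda>i x. re_or_im s (axis_unit i * of_nat n * axis_unit i * of_nat (n - 1) * to_complex x ^ (n - 1 - 1)))"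
  using has_partial_re_or_im_power[of _ s 1 n] has_partial_re_or_im_power[of _ s _ "n - 1"]
  by (intro C2I continuous_intros) (auto simp: Y_def[abs_def])

lemma C2_radial:
  assumes "\<And>t. (U has_real_derivative U' t) (at t)" "\<And>t. (U' has_real_derivative U'' t) (at t)"
    "continuous_on UNIV U''"
  shows "C2 (\<lambda>x. U (rsq x)) (\<lambda>i x. U' (rsq x) * (2 * x$i)) (\<lambda>i x. U'' (rsq x) * (4 * (x$i)^2) + 2 * U' (rsq x))"
proof (rule C2I)
  have cU: "continuous_on UNIV U" "continuous_on UNIV U'"
    using assms(1,2) by (auto intro!: continuous_at_imp_continuous_on DERIV_isCont)
  have cR: "continuous_on UNIV (\<lambda>x. U (rsq x))" "continuous_on UNIV (\<lambda>x. U' (rsq x))" "continuous_on UNIV (\<lambda>x. U'' (rsq x))"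
    using cU assms(3) by (auto intro: continuous_on_compose2[OF _ continuous_rsq])
  show "continuous_on UNIV (\<lambda>x. U (rsq x))" by fact
  fix i
  have r: "has_partial i rsq (\<lambda>x. 2 * x$i)"
  proof -
    have "has_partial i rsq (\<lambda>x. ((if 1 = i then 1 else 0) * x$1 + x$1 * (if 1 = i then 1 else 0)) + ((if 2 = i then 1 else 0) * x$2 + x$2 * (if 2 = i then 1 else 0)))"
      unfolding rsq_def[abs_def] power2_eq_square by (intro has_partial_add has_partial_mult has_partial_coord)
    then show ?thesis using exhaust_2[of i] by auto
  qed
  show "has_partial i (\<lambda>x. U (rsq x)) (\<lambda>x. U' (rsq x) * (2 * x$i))"
    by (rule has_partial_compose[OF r]) (rule assms)
  have "has_partial i (\<lambda>x. U' (rsq x) * (2 * x$i)) (\<lambda>x. (U'' (rsq x) * (2 * x$i)) * (2 * x$i) + U' (rsq x) * (0 * x$i + 2 * (if i = i then 1 else 0)))"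
    by (intro has_partial_mult has_partial_compose[OF r] has_partial_const has_partial_coord assms)
  then show "has_partial i (\<lambda>x. U' (rsq x) * (2 * x$i)) (\<lambda>x. U'' (rsq x) * (4 * (x$i)^2) + 2 * U' (rsq x))"
    by (simp add: power2_eq_square algebra_simps)
  show "continuous_on UNIV (\<lambda>x. U' (rsq x) * (2 * x $ i))"
    by (intro continuous_intros cR)
  show "continuous_on UNIV (\<lambda>x. U'' (rsq x) * (4 * (x $ i)\<^sup>2) + 2 * U' (rsq x))"
    by (intro continuous_intros cR)
qed

text \<open>The product rule gives \<open>U(\<bar>x\<bar>\<^sup>2) \<Delta> Y + 2 \<nabla>U \<cdot> \<nabla>Y + Y \<Delta> U\<close>. The first term
  vanishes since \<open>Y\<close> is harmonic, and \<open>x \<cdot> \<nabla>Y = n Y\<close> by homogeneity. The Laplacian therefore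
  respects modes and acts on them as a second order operator in \<open>t = \<bar>x\<bar>\<^sup>2\<close>.\<close>

lemma mode_C2:
  assumes "\<And>t. (U has_real_derivative U' t) (at t)" "\<And>t. (U' has_real_derivative U'' t) (at t)"
    "continuous_on UNIV U''"
  obtains A1 A2 where "C2 (\<lambda>x. U (rsq x) * Y n s x) A1 A2"
    "\<And>x. (\<Sum>i\<in>UNIV. A2 i x) = 4 * (rsq x * U'' (rsq x) + (real n + 1) * U' (rsq x)) * Y n s x"
proof -
  have e: "x$1 * re_or_im s (axis_unit 1 * of_nat n * to_complex x ^ (n - 1)) + x$2 * re_or_im s (axis_unit 2 * of_nat n * to_complex x ^ (n - 1)) = n * Y n s x" for x
  proof (cases n)
    case (Suc m)
    have "x$1 * re_or_im s (axis_unit 1 * of_nat n * to_complex x ^ (n - 1)) + x$2 * re_or_im s (axis_unit 2 * of_nat n * to_complex x ^ (n - 1))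
      = re_or_im s (of_real (x$1) * (axis_unit 1 * of_nat n * to_complex x ^ (n - 1)) + of_real (x$2) * (axis_unit 2 * of_nat n * to_complex x ^ (n - 1)))"
      by (simp add: re_or_im_def)
    also have "of_real (x$1) * (axis_unit 1 * of_nat n * to_complex x ^ (n - 1)) + of_real (x$2) * (axis_unit 2 * of_nat n * to_complex x ^ (n - 1))
       = of_nat n * ((of_real (x$1) + \<i> * of_real (x$2)) * to_complex x ^ (n - 1))"
      by (simp add: axis_unit_def algebra_simps)
    also have "(of_real (x$1) + \<i> * of_real (x$2)) = to_complex x" by (simp add: to_complex_def complex_eq_iff)
    also have "to_complex x * to_complex x ^ (n - 1) = to_complex x ^ n" by (simp add: Suc)
    finally show ?thesis by (simp add: Y_def re_or_im_def)
  qed (simp add: re_or_im_def)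
  have h: "re_or_im s (axis_unit 1 * of_nat n * axis_unit 1 * of_nat (n - 1) * to_complex x ^ (n - 1 - 1)) +
     re_or_im s (axis_unit 2 * of_nat n * axis_unit 2 * of_nat (n - 1) * to_complex x ^ (n - 1 - 1)) = 0" for x
    by (simp add: axis_unit_def re_or_im_def)
  show ?thesis
  proof (rule that[OF C2_mult[OF C2_radial[OF assms] C2_Y]])
    fix x
    let ?p = "\<lambda>i. re_or_im s (axis_unit i * of_nat n * to_complex x ^ (n - 1))"
    let ?q = "\<lambda>i. re_or_im s (axis_unit i * of_nat n * axis_unit i * of_nat (n - 1) * to_complex x ^ (n - 1 - 1))"
    have "(\<Sum>i\<in>UNIV. (U'' (rsq x) * (4 * (x $ i)\<^sup>2) + 2 * U' (rsq x)) * Y n s x +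
         2 * (U' (rsq x) * (2 * x $ i) * ?p i) + U (rsq x) * ?q i)
      = (4 * U'' (rsq x) * rsq x + 4 * U' (rsq x)) * Y n s x + 4 * U' (rsq x) * (x$1 * ?p 1 + x$2 * ?p 2)
        + U (rsq x) * (?q 1 + ?q 2)"
      by (simp add: sum_2 rsq_def algebra_simps)
    also have "\<dots> = 4 * (rsq x * U'' (rsq x) + (real n + 1) * U' (rsq x)) * Y n s x"
      unfolding e h by (simp add: algebra_simps)
    finally show "(\<Sum>i\<in>UNIV. (U'' (rsq x) * (4 * (x $ i)\<^sup>2) + 2 * U' (rsq x)) * Y n s x +
         2 * (U' (rsq x) * (2 * x $ i) * ?p i) + U (rsq x) * ?q i) = 4 * (rsq x * U'' (rsq x) + (real n + 1) * U' (rsq x)) * Y n s x" .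
  qed
qed

section \<open>Test functions\<close>

lemma has_partial_dir_deriv:
  assumes "\<And>x. f differentiable (at x)"
  shows "has_partial i f (dir_deriv (axis i 1) f)"
  unfolding has_partial_def
proof
  fix x
  let ?F = "frechet_derivative f (at x)"
  have F: "(f has_derivative ?F) (at (x + 0 *\<^sub>R axis i 1))"
    using assms[of x] by (simp flip: frechet_derivative_works)
  have "((\<lambda>s. x + s *\<^sub>R axis i 1) has_derivative (\<lambda>s. s *\<^sub>R axis i 1)) (at 0)"
    by (auto intro!: derivative_eq_intros)
  from has_derivative_compose[OF this F]
  have "((\<lambda>s. f (x + s *\<^sub>R axis i 1)) has_derivative (\<lambda>s. ?F (s *\<^sub>R axis i 1))) (at 0)" .
  moreover have "(\<lambda>s. ?F (s *\<^sub>R axis i 1)) = (*) (?F (axis i 1))"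
    using linear_cmul[OF linear_frechet_derivative[OF assms[of x]]] by (auto simp: mult.commute)
  ultimately show "((\<lambda>s. f (x + s *\<^sub>R axis i 1)) has_real_derivative dir_deriv (axis i 1) f x) (at 0)"
    by (simp add: has_field_derivative_def dir_deriv_def)
qed

lemma test_C2:
  assumes "\<phi> \<in> test_functions disk"
  shows "C2 \<phi> (\<lambda>i. dir_deriv (axis i 1) \<phi>) (\<lambda>i. dir_deriv (axis i 1) (dir_deriv (axis i 1) \<phi>))"
proof -
  have s: "foldr dir_deriv vs \<phi> differentiable (at x)" if "set vs \<subseteq> Basis" for vs x
    using assms that by (auto simp: test_functions_def smooth_def)
  have ax: "axis i (1::real) \<in> (Basis :: plane set)" for i by (simp add: axis_in_Basis_iff)
  have d: "\<phi> differentiable (at x)" "dir_deriv (axis i 1) \<phi> differentiable (at x)"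
    "dir_deriv (axis i 1) (dir_deriv (axis i 1) \<phi>) differentiable (at x)" for x i
    using s[of "[]" x] s[of "[axis i 1]" x] s[of "[axis i 1, axis i 1]" x] ax[of i] by auto
  show ?thesis
    by (intro C2I has_partial_dir_deriv d continuous_at_imp_continuous_on ballI)
       (use d in \<open>auto intro: differentiable_imp_continuous_within\<close>)
qed

text \<open>The support is compact inside the open disk, so a test function is zero near the circle
  together with its derivatives.\<close>

lemma test_vanishes:
  assumes "\<phi> \<in> test_functions disk" "x \<notin> disk"
  shows "\<phi> x = 0" "dir_deriv v \<phi> x = 0"
proof -
  let ?K = "closure {x. \<phi> x \<noteq> 0}"
  have x: "x \<in> - ?K" "open (- ?K)" using assms by (auto simp: test_functions_def)
  have z: "\<phi> y = 0" if "y \<in> - ?K" for y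
    using that closure_subset[of "{x. \<phi> x \<noteq> 0}"] by auto
  show "\<phi> x = 0" by (rule z[OF x(1)])
  have "(\<phi> has_derivative (\<lambda>h. 0)) (at x)"
    by (rule has_derivative_transform_within_open[OF has_derivative_const[of 0] x(2,1)]) (rule z[symmetric])
  from frechet_derivative_at[OF this] show "dir_deriv v \<phi> x = 0"
    by (simp add: dir_deriv_def flip: \<open>_ = frechet_derivative \<phi> (at x)\<close>)
qed

lemma closure_disk: "closure disk = cball 0 1"
  by (simp add: disk_def)

text \<open>Classical solutions are solutions in the sense of distributions: Green's identity with the
  test function in the role of the factor that vanishes to second order.\<close>

lemma C2_dirichlet:
  assumes A: "C2 A A1 A2" and bd: "\<And>x. norm x = 1 \<Longrightarrow> A x = 0"
    and w: "\<And>x. x \<in> disk \<Longrightarrow> w x = - (\<Sum>i\<in>UNIV. A2 i x)"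
  shows "dirichlet_solution w (\<lambda>x. if x \<in> disk then A x else 0)"
  unfolding dirichlet_solution_def set_integral_MD
proof (intro conjI allI impI ballI)
  have "continuous_on (cball 0 1) A" using A by (auto simp: C2_def intro: continuous_on_subset)
  then show "continuous_on (closure disk) (\<lambda>x. if x \<in> disk then A x else 0)"
    unfolding closure_disk by (rule continuous_on_eq) (use bd in \<open>auto simp: mem_disk\<close>)
next
  fix \<phi> assume \<phi>: "\<phi> \<in> test_functions disk"
  have "(LINT x|MD. \<phi> x * (\<Sum>i\<in>UNIV. A2 i x)) = (LINT x|MD. laplacian \<phi> x * A x)"
    unfolding laplacian_def
    by (rule Green_identity[OF test_C2[OF \<phi>] A]) (use test_vanishes[OF \<phi>] in \<open>auto simp: mem_disk\<close>)
  moreover have "(LINT x|MD. w x * \<phi> x) = (LINT x|MD. - (\<phi> x * (\<Sum>i\<in>UNIV. A2 i x)))"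
    by (rule Bochner_Integration.integral_cong) (auto simp: w)
  moreover have "(LINT x|MD. (if x \<in> disk then A x else 0) * - laplacian \<phi> x) = (LINT x|MD. - (laplacian \<phi> x * A x))"
    by (rule Bochner_Integration.integral_cong) (auto simp: w)
  ultimately show "(LINT x|MD. (if x \<in> disk then A x else 0) * - laplacian \<phi> x) = (LINT x|MD. w x * \<phi> x)"
    by simp
qed auto

section \<open>A supremum bound for the Poisson equation\<close>

text \<open>The logarithm \<open>- ln \<bar>x - y\<bar>\<close>, smoothed at distance \<open>r\<close> from its pole and shifted so that it
  is nonnegative on the disk: \<open>\<bar>x - y\<bar>\<^sup>2 + r\<^sup>2 \<le> 2\<^sup>2 + 1\<close> there. Its negative Laplacian is
  nonnegative and has mass of order one in the ball of radius \<open>r\<close> about \<open>y\<close>.\<close>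

definition log_kernel :: "plane \<Rightarrow> real \<Rightarrow> plane \<Rightarrow> real" where
  "log_kernel y r x = 1/2 * ln (5 / ((norm (x - y))^2 + r^2))"

lemma norm2_plane: "(norm (x::plane))^2 = (x$1)^2 + (x$2)^2"
  using rsq_norm[of x] by (simp add: rsq_def)

lemma log_kernel_C2:
  assumes r: "r > 0"
  obtains B1 B2 where "C2 (log_kernel y r) B1 B2"
    "\<And>x. (\<Sum>i\<in>UNIV. B2 i x) = - 2 * r^2 / ((norm (x - y))^2 + r^2)^2"
proof -
  define P where "P x = (x$1 - y$1)^2 + (x$2 - y$2)^2 + r^2" for x :: plane
  have P0: "P x > 0" for x using r by (auto simp: P_def intro: add_nonneg_pos)
  have Pn: "P x = (norm (x - y))^2 + r^2" for x by (simp add: P_def norm2_plane)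
  have cP: "continuous_on UNIV P" unfolding P_def by (intro continuous_intros)
  have k: "log_kernel y r x = 1/2 * ln 5 - 1/2 * ln (P x)" for x
    using P0[of x] unfolding log_kernel_def Pn[symmetric] by (simp add: ln_div field_simps)
  have pP: "has_partial i P (\<lambda>x. 2 * (x$i - y$i))" for i
  proof -
    have "has_partial i P (\<lambda>x. ((((if 1 = i then 1 else 0) - 0) * (x$1 - y$1) + (x$1 - y$1) * ((if 1 = i then 1 else 0) - 0)) + (((if 2 = i then 1 else 0) - 0) * (x$2 - y$2) + (x$2 - y$2) * ((if 2 = i then 1 else 0) - 0))) + 0)"
      unfolding P_def[abs_def] power2_eq_square by (intro has_partial_add has_partial_diff has_partial_mult has_partial_coord has_partial_const)
    then show ?thesis using exhaust_2[of i] by auto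
  qed
  have p1: "has_partial i (log_kernel y r) (\<lambda>x. - (x$i - y$i) * inverse (P x))" for i
  proof -
    have "has_partial i (\<lambda>x. 1/2 * ln 5 - 1/2 * ln (P x)) (\<lambda>x. 0 - (0 * ln (P x) + 1/2 * (inverse (P x) * (2 * (x$i - y$i)))))"
      by (intro has_partial_diff has_partial_const has_partial_mult has_partial_compose[OF pP] DERIV_ln P0)
    moreover have "(\<lambda>x. 0 - (0 * ln (P x) + 1/2 * (inverse (P x) * (2 * (x$i - y$i))))) = (\<lambda>x. - (x$i - y$i) * inverse (P x))"
      by (simp add: fun_eq_iff algebra_simps)
    moreover have "log_kernel y r = (\<lambda>x. 1/2 * ln 5 - 1/2 * ln (P x))" using k by blast
    ultimately show ?thesis by (simp only:)
  qed
  have p2: "has_partial i (\<lambda>x. - (x$i - y$i) * inverse (P x)) (\<lambda>x. - inverse (P x) + 2 * (x$i - y$i)^2 * (inverse (P x))^2)" for i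
  proof -
    have "has_partial i (\<lambda>x. (0 - (x$i - y$i)) * inverse (P x)) (\<lambda>x. (0 - ((if i = i then 1 else 0) - 0)) * inverse (P x) + (0 - (x$i - y$i)) * (- (inverse (P x) ^ Suc (Suc 0)) * (2 * (x$i - y$i))))"
      by (intro has_partial_diff has_partial_const has_partial_mult has_partial_coord has_partial_compose[OF pP] DERIV_inverse) (use P0 in \<open>auto simp: less_imp_neq[symmetric]\<close>)
    then show ?thesis by (simp add: power2_eq_square algebra_simps)
  qed
  have ci: "continuous_on UNIV (\<lambda>x. inverse (P x))"
    by (intro continuous_intros cP) (use P0 in \<open>auto simp: less_imp_neq[symmetric]\<close>)
  show ?thesis
  proof (rule that[of "\<lambda>i x. - (x$i - y$i) * inverse (P x)" "\<lambda>i x. - inverse (P x) + 2 * (x$i - y$i)^2 * (inverse (P x))^2"])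
    have "continuous_on UNIV (\<lambda>x. 1/2 * ln 5 - 1/2 * ln (P x))"
      by (intro continuous_intros cP) (use P0 in \<open>auto simp: less_imp_neq[symmetric]\<close>)
    then show "C2 (log_kernel y r) (\<lambda>i x. - (x$i - y$i) * inverse (P x)) (\<lambda>i x. - inverse (P x) + 2 * (x$i - y$i)^2 * (inverse (P x))^2)"
      by (intro C2I p1 p2 continuous_intros ci) (simp add: k[abs_def])
    fix x
    have "(\<Sum>i\<in>UNIV. - inverse (P x) + 2 * (x$i - y$i)^2 * (inverse (P x))^2) = - 2 * inverse (P x) + 2 * (P x - r^2) * (inverse (P x))^2"
      by (simp add: sum_2 P_def algebra_simps)
    also have "\<dots> = - 2 * r^2 / (P x)^2"
      using P0[of x] by (simp add: field_simps power2_eq_square)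
    finally show "(\<Sum>i\<in>UNIV. - inverse (P x) + 2 * (x$i - y$i)^2 * (inverse (P x))^2) = - 2 * r^2 / ((norm (x - y))^2 + r^2)^2"
      by (simp add: Pn)
  qed
qed

lemma log_kernel_nonneg:
  assumes "norm x \<le> 1" "norm y \<le> 1" "0 < r" "r \<le> 1"
  shows "0 \<le> log_kernel y r x"
proof -
  have "norm (x - y) \<le> 2" using norm_triangle_ineq4[of x y] assms by linarith
  then have "(norm (x - y))^2 \<le> 2^2" by (intro power_mono) auto
  moreover have "r^2 \<le> 1" using assms by (simp add: power_le_one)
  ultimately have "(norm (x - y))^2 + r^2 \<le> 5" by simp
  moreover have "(norm (x - y))^2 + r^2 > 0" using assms by (simp add: add_nonneg_pos)
  ultimately have "1 \<le> 5 / ((norm (x - y))^2 + r^2)" by simp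
  then show ?thesis by (simp add: log_kernel_def)
qed

lemma measure_ball_MD:
  assumes "ball y r \<subseteq> disk" "0 < r"
  shows "measure MD (ball y r) = pi * r^2"
proof -
  have "measure MD (ball y r) = measure lebesgue (ball y r)"
    using assms by (simp add: measure_restrict_space)
  also have "\<dots> = pi * r^2"
    using emeasure_ball[of r y] assms by (simp add: eval_unit_ball_vol measure_def)
  finally show ?thesis .
qed

text \<open>A substitute for the representation by the Green function, for \<open>A\<close> that vanishes only to
  first order on the circle. Let \<open>S = \<bar>A y\<bar>\<close> be the maximum of \<open>\<bar>A\<bar>\<close>. The square \<open>A\<^sup>2\<close> vanishes to
  second order, so it can be tested against the smoothed logarithm centred at \<open>y\<close>. On one side
  \<open>\<Delta>(A\<^sup>2) \<ge> 2 A \<Delta>A \<ge> - 2 S \<bar>\<Delta>A\<bar>\<close>; on the other side the kernel has mass of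
  order one in a ball about \<open>y\<close> so small that \<open>A\<^sup>2 \<ge> S\<^sup>2/2\<close> in it. Dividing by \<open>S\<close> gives the bound.\<close>

lemma sup_bound_log:
  assumes A: "C2 A A1 A2" and bd: "\<And>x. norm x = 1 \<Longrightarrow> A x = 0"
  obtains y r where "norm y \<le> 1" "0 < r" "r \<le> 1"
    "\<And>x. norm x \<le> 1 \<Longrightarrow> \<bar>A x\<bar> \<le> 8 / pi * (LINT x|MD. \<bar>\<Sum>i\<in>UNIV. A2 i x\<bar> * log_kernel y r x)"
proof -
  note c = A[unfolded C2_def]
  let ?w = "\<lambda>x. \<Sum>i\<in>UNIV. A2 i x"
  have "\<exists>y\<in>cball 0 1. \<forall>x\<in>cball 0 1. \<bar>A x\<bar> \<le> \<bar>A y\<bar>"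
    by (rule continuous_attains_sup) (use c in \<open>auto intro!: continuous_intros intro: continuous_on_subset\<close>)
  then obtain y where y: "norm y \<le> 1" "\<And>x. norm x \<le> 1 \<Longrightarrow> \<bar>A x\<bar> \<le> \<bar>A y\<bar>" by auto
  define S where "S = \<bar>A y\<bar>"
  show ?thesis
  proof (cases "S = 0")
    case True
    then have "A x = 0" if "norm x \<le> 1" for x using y(2)[OF that] by (simp add: S_def)
    then show ?thesis
      by (intro that[of 0 1])
         (auto intro!: Bochner_Integration.integral_nonneg_AE AE_I2 divide_nonneg_pos mult_nonneg_nonneg log_kernel_nonneg simp: mem_disk)
  next
    case False
    then have S: "S > 0" by (simp add: S_def)
    then have ny: "norm y < 1" using bd[of y] y(1) by (force simp: S_def)
    have "isCont (\<lambda>x. (A x)^2) y" using c by (auto intro!: continuous_intros simp: continuous_on_eq_continuous_at)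
    moreover have "S^2/2 < (A y)^2" using S by (simp add: S_def)
    ultimately have "\<forall>\<^sub>F x in at y. S^2/2 < (A x)^2"
      unfolding isCont_def by (rule order_tendstoD)
    then obtain d where d: "d > 0" "\<And>x. x \<noteq> y \<Longrightarrow> dist x y < d \<Longrightarrow> S^2/2 < (A x)^2"
      unfolding eventually_at by auto
    have d': "S^2/2 < (A x)^2" if "dist x y < d" for x
      using d(2)[of x] that \<open>S^2/2 < (A y)^2\<close> by (cases "x = y") auto
    \<comment> \<open>The ball of radius \<open>r\<close> lies in the disk, and \<open>A\<^sup>2 \<ge> S\<^sup>2/2\<close> in it.\<close>
    define r where "r = min d (1 - norm y)"
    have r: "r > 0" "r \<le> 1" "r \<le> d" "r \<le> 1 - norm y"
      using d ny norm_ge_zero[of y] unfolding r_def by linarith+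
    have bsub: "ball y r \<subseteq> disk"
    proof
      fix x assume "x \<in> ball y r"
      then have "norm (x - y) < r" by (simp add: dist_norm norm_minus_commute)
      then show "x \<in> disk" using norm_triangle_ineq[of "x - y" y] r(4) by (simp add: mem_disk)
    qed
    obtain B1 B2 where B: "C2 (log_kernel y r) B1 B2"
      and B2: "\<And>x. (\<Sum>i\<in>UNIV. B2 i x) = - 2 * r^2 / ((norm (x - y))^2 + r^2)^2"
      using log_kernel_C2[OF r(1), of y] by blast
    have cB: "continuous_on UNIV (log_kernel y r)" using B by (simp add: C2_def)
    let ?I = "LINT x|MD. \<bar>?w x\<bar> * log_kernel y r x"
    have Ii: "integrable MD (\<lambda>x. \<bar>?w x\<bar> * log_kernel y r x)"
      using c by (intro integrable_MD_continuous continuous_intros cB) auto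
    have G: "(LINT x|MD. (A x * A x) * (\<Sum>i\<in>UNIV. B2 i x)) =
       (LINT x|MD. (\<Sum>i\<in>UNIV. A2 i x * A x + 2 * (A1 i x * A1 i x) + A x * A2 i x) * log_kernel y r x)"
      by (rule Green_identity[OF C2_mult[OF A A] B]) (use bd in auto)
    have "- (LINT x|MD. (\<Sum>i\<in>UNIV. A2 i x * A x + 2 * (A1 i x * A1 i x) + A x * A2 i x) * log_kernel y r x)
       = (LINT x|MD. - ((\<Sum>i\<in>UNIV. A2 i x * A x + 2 * (A1 i x * A1 i x) + A x * A2 i x) * log_kernel y r x))" by simp
    also have "\<dots> \<le> (LINT x|MD. 2 * S * (\<bar>?w x\<bar> * log_kernel y r x))"
    proof (rule integral_mono)
      show "integrable MD (\<lambda>x. - ((\<Sum>i\<in>UNIV. A2 i x * A x + 2 * (A1 i x * A1 i x) + A x * A2 i x) * log_kernel y r x))"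
        using c by (intro integrable_MD_continuous continuous_intros cB) auto
      show "integrable MD (\<lambda>x. 2 * S * (\<bar>?w x\<bar> * log_kernel y r x))" using Ii by simp
      fix x assume "x \<in> space MD"
      then have nx: "norm x \<le> 1" by (simp add: mem_disk)
      have l: "0 \<le> log_kernel y r x" using log_kernel_nonneg[OF nx y(1) r(1,2)] .
      have "(\<Sum>i\<in>UNIV. A2 i x * A x + 2 * (A1 i x * A1 i x) + A x * A2 i x) = 2 * A x * ?w x + 2 * ((A1 1 x)^2 + (A1 2 x)^2)"
        by (simp add: sum_2 algebra_simps power2_eq_square)
      then have "- (\<Sum>i\<in>UNIV. A2 i x * A x + 2 * (A1 i x * A1 i x) + A x * A2 i x) \<le> - (2 * A x * ?w x)"
        by simp
      also have "\<dots> \<le> 2 * (\<bar>A x\<bar> * \<bar>?w x\<bar>)"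
        using abs_ge_minus_self[of "A x * ?w x"] by (simp add: abs_mult)
      also have "\<dots> \<le> 2 * (S * \<bar>?w x\<bar>)"
        using y(2)[OF nx] by (simp add: S_def mult_right_mono)
      finally have "- (\<Sum>i\<in>UNIV. A2 i x * A x + 2 * (A1 i x * A1 i x) + A x * A2 i x) * log_kernel y r x \<le> 2 * (S * \<bar>?w x\<bar>) * log_kernel y r x"
        using l by (rule mult_right_mono)
      then show "- ((\<Sum>i\<in>UNIV. A2 i x * A x + 2 * (A1 i x * A1 i x) + A x * A2 i x) * log_kernel y r x) \<le> 2 * S * (\<bar>?w x\<bar> * log_kernel y r x)"
        by (simp only: mult_minus_left mult.assoc)
    qed
    also have "\<dots> = 2 * S * ?I" by simp
    finally have up: "- (LINT x|MD. (A x * A x) * (\<Sum>i\<in>UNIV. B2 i x)) \<le> 2 * S * ?I" unfolding G .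
    have "S^2 / (4 * r^2) * measure MD (ball y r) = (LINT x|MD. S^2 / (4 * r^2) * indicator (ball y r) x)"
      using bsub by (simp add: Int_absorb2)
    also have "\<dots> \<le> (LINT x|MD. - ((A x * A x) * (\<Sum>i\<in>UNIV. B2 i x)))"
    proof (rule integral_mono)
      show "integrable MD (\<lambda>x. S^2 / (4 * r^2) * indicator (ball y r) x)"
        using bsub emeasure_lborel_ball_finite[of y r] by (intro integrable_mult_right integrable_real_indicator)
          (auto simp: sets_restrict_space_iff emeasure_restrict_space Int_absorb2)
      show "integrable MD (\<lambda>x. - ((A x * A x) * (\<Sum>i\<in>UNIV. B2 i x)))"
        using c B by (intro integrable_MD_continuous continuous_intros) (auto simp: C2_def)
      fix x
      show "S^2 / (4 * r^2) * indicator (ball y r) x \<le> - ((A x * A x) * (\<Sum>i\<in>UNIV. B2 i x))"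
      proof (cases "x \<in> ball y r")
        case True
        then have dx: "dist x y < r" by (simp add: dist_commute)
        have 1: "(A x)^2 \<ge> S^2/2" using d'[of x] dx r(3) by simp
        have "(norm (x - y))^2 \<le> r^2" using dx by (intro power_mono) (auto simp: dist_norm)
        then have "((norm (x - y))^2 + r^2)^2 \<le> (2 * r^2)^2" by (intro power_mono) auto
        then have "2 * r^2 / (2 * r^2)^2 \<le> 2 * r^2 / ((norm (x - y))^2 + r^2)^2"
          using r(1) by (intro divide_left_mono) (auto intro!: mult_pos_pos add_nonneg_pos)
        then have 2: "1 / (2 * r^2) \<le> 2 * r^2 / ((norm (x - y))^2 + r^2)^2"
          using r(1) by (simp add: power2_eq_square)
        have "S^2/2 * (1 / (2 * r^2)) \<le> (A x)^2 * (2 * r^2 / ((norm (x - y))^2 + r^2)^2)"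
          by (intro mult_mono 1 2) auto
        then show ?thesis using True by (simp add: B2 power2_eq_square)
      qed (auto simp: B2)
    qed
    also have "\<dots> \<le> 2 * S * ?I" using up by simp
    finally have "S^2 / (4 * r^2) * (pi * r^2) \<le> 2 * S * ?I"
      by (simp add: measure_ball_MD[OF bsub r(1)])
    then have "S * (S * pi) \<le> S * (8 * ?I)" using r(1) by (simp add: power2_eq_square field_simps)
    then have "S * pi \<le> 8 * ?I" using S by simp
    then have "S \<le> 8 / pi * ?I" by (simp add: field_simps)
    then show ?thesis using that[OF y(1) r(1,2)] y(2) unfolding S_def by (meson order_trans)
  qed
qed

section \<open>Radial integrals\<close>

lemma emeasure_ball_plane: "0 \<le> r \<Longrightarrow> emeasure lborel (ball (a::plane) r) = ennreal (pi * r^2)"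
  and emeasure_cball_plane: "0 \<le> r \<Longrightarrow> emeasure lborel (cball (a::plane) r) = ennreal (pi * r^2)"
  using emeasure_ball[of r a] emeasure_cball[of r a] by (auto simp: eval_unit_ball_vol)

lemma rsq_borel [measurable]: "rsq \<in> borel_measurable borel"
  by (rule borel_measurable_continuous_onI[OF continuous_rsq])

text \<open>The image of the area measure on a disk under \<open>\<bar>x\<bar>\<^sup>2\<close> is \<open>\<pi>\<close> times Lebesgue measure, since
  the disk of radius \<open>\<surd>t\<close> has area \<open>\<pi> t\<close>. Integrals of radial functions become integrals over an
  interval with no Jacobian left.\<close>

lemma distr_rsq:
  assumes R: "R > 0"
  shows "distr (restrict_space lborel (ball 0 R)) borel rsq = density lborel (\<lambda>t. ennreal (pi * indicator {0..R\<^sup>2} t))"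
    (is "?N = ?M")
proof (rule measure_eqI_lessThan)
  have N: "emeasure ?N {x<..} = emeasure lborel {y \<in> ball 0 R. rsq y > x}" for x
  proof -
    have "rsq -` {x<..} \<inter> ball 0 R = {y \<in> ball 0 R. rsq y > x}" by auto
    moreover have "rsq \<in> borel_measurable (restrict_space lborel (ball 0 R))"
      by (rule measurable_restrict_space1) simp
    ultimately show ?thesis
      by (subst emeasure_distr) (auto simp: space_restrict_space intro: emeasure_restrict_space)
  qed
  have M: "emeasure ?M {x<..} = ennreal pi * emeasure lborel ({0..R\<^sup>2} \<inter> {x<..})" for x
  proof -
    have "emeasure ?M {x<..} = (\<integral>\<^sup>+t. ennreal pi * indicator ({0..R\<^sup>2} \<inter> {x<..}) t \<partial>lborel)"
      by (subst emeasure_density) (auto simp: indicator_def intro!: nn_integral_cong)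
    then show ?thesis by (simp add: nn_integral_cmult)
  qed
  show eq: "emeasure ?N {x<..} = emeasure ?M {x<..}" for x
  proof -
    consider "x < 0" | "0 \<le> x" "x \<le> R\<^sup>2" | "x > R\<^sup>2" by linarith
    then show ?thesis
    proof cases
      case 1
      then have "{y \<in> ball 0 R. rsq y > x} = ball 0 R" by (auto simp: rsq_norm intro: less_le_trans)
      moreover have "{0..R\<^sup>2} \<inter> {x<..} = {0..R\<^sup>2}" using 1 by auto
      ultimately show ?thesis using R unfolding N M by (simp add: emeasure_ball_plane ennreal_mult)
    next
      case 2
      have sq: "norm y \<le> sqrt x \<longleftrightarrow> (norm y)^2 \<le> x" for y :: plane
        using 2(1) by (metis norm_ge_zero real_sqrt_abs real_sqrt_le_iff abs_of_nonneg)
      have sR: "sqrt x \<le> R" using 2 R real_le_lsqrt by auto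
      have "{y \<in> ball 0 R. rsq y > x} = ball 0 R - cball 0 (sqrt x)"
        by (auto simp: rsq_norm sq)
      moreover have "emeasure lborel (ball (0::plane) R - cball 0 (sqrt x)) = ennreal (pi * R^2) - ennreal (pi * x)"
      proof (cases "sqrt x < R")
        case True
        then have "cball (0::plane) (sqrt x) \<subseteq> ball 0 R" by auto
        then show ?thesis using 2 R
          by (subst emeasure_Diff) (auto simp: emeasure_ball_plane emeasure_cball_plane)
      next
        case False
        then have "R = sqrt x" using sR by simp
        then have e: "ball (0::plane) R - cball 0 (sqrt x) = {}" by auto
        have "x = R^2" using \<open>R = sqrt x\<close> 2 by simp
        then show ?thesis unfolding e by simp
      qed
      moreover have "{0..R\<^sup>2} \<inter> {x<..} = {x<..R\<^sup>2}" using 2 by auto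
      ultimately show ?thesis using 2 unfolding N M
        by (simp add: ennreal_minus ennreal_mult[symmetric] algebra_simps)
    next
      case 3
      have "rsq y < R^2" if "norm y < R" for y using that by (simp add: rsq_norm power_strict_mono)
      then have e: "{y \<in> ball 0 R. rsq y > x} = {}" using 3 by force
      have "{0..R\<^sup>2} \<inter> {x<..} = {}" using 3 by auto
      then show ?thesis unfolding N M e by simp
    qed
  qed
  show "emeasure ?N {x<..} < \<infinity>" for x
  proof -
    have "emeasure lborel {y \<in> ball 0 R. rsq y > x} \<le> emeasure lborel (ball (0::plane) R)"
      by (rule emeasure_mono) auto
    then show ?thesis unfolding N using emeasure_lborel_ball_finite[of 0 R] by (rule le_less_trans)
  qed
qed auto

lemma integral_MD_borel:
  assumes "f \<in> borel_measurable borel"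
  shows "(LINT x|MD. f x) = (LINT x|restrict_space lborel disk. (f x :: real))"
proof -
  have "(LINT x|lebesgue. indicator disk x * f x) = (LINT x|lborel. indicator disk x * f x)"
    by (rule integral_completion) (use assms in simp)
  then show ?thesis by (simp add: integral_restrict_space)
qed

lemma integral_radial:
  assumes F: "continuous_on UNIV F"
  shows "(LINT x|MD. F (rsq x)) = pi * integral {0..1} (F :: real \<Rightarrow> real)"
proof -
  have Fm [measurable]: "F \<in> borel_measurable borel" by (rule borel_measurable_continuous_onI[OF F])
  have "(LINT x|MD. F (rsq x)) = (LINT x|restrict_space lborel (ball 0 1). F (rsq x))"
    by (subst integral_MD_borel) (auto simp: disk_def)
  also have "\<dots> = (LINT t|distr (restrict_space lborel (ball 0 1)) borel rsq. F t)"
    by (rule integral_distr[symmetric]) (auto intro: measurable_restrict_space1)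
  also have "\<dots> = (LINT t|lborel. (pi * indicator {0..1} t) *\<^sub>R F t)"
    unfolding distr_rsq[OF zero_less_one] by (subst integral_density) auto
  also have "\<dots> = pi * (LINT t:{0..1}|lborel. F t)"
    by (simp add: set_lebesgue_integral_def mult.assoc)
  also have "(LINT t:{0..1}|lborel. F t) = integral {0..1} F"
  proof (rule set_borel_integral_eq_integral(2))
    show "set_integrable lborel {0..1} F"
      by (rule borel_integrable_compact[of "{0..1}" F, unfolded set_integrable_def[symmetric]] | (unfold set_integrable_def, rule borel_integrable_compact)) (auto intro: continuous_on_subset[OF F])
  qed
  finally show ?thesis .
qed

text \<open>The singularity \<open>1 / \<bar>x - y\<bar>\<close> is integrable in the plane; the ball of radius 2 about \<open>y\<close>
  contains the unit disk whenever \<open>y\<close> lies in it.\<close>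

lemma nn_integral_inverse_norm:
  "(\<integral>\<^sup>+x\<in>ball (y::plane) 2. ennreal (1 / norm (x - y)) \<partial>lborel) = ennreal (4 * pi)"
proof -
  have "(\<integral>\<^sup>+x\<in>ball y 2. ennreal (1 / norm (x - y)) \<partial>lborel) =
        (\<integral>\<^sup>+x. ennreal (1 / norm (x - y)) * indicator (ball y 2) x \<partial>distr lborel borel ((+) y))"
    by (simp add: lborel_distr_plus)
  also have "\<dots> = (\<integral>\<^sup>+x. ennreal (1 / norm x) * indicator (ball (0::plane) 2) x \<partial>lborel)"
    by (subst nn_integral_distr) (auto intro!: nn_integral_cong simp: indicator_def dist_norm)
  also have "\<dots> = (\<integral>\<^sup>+x. ennreal (1 / sqrt (rsq x)) \<partial>restrict_space lborel (ball 0 2))"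
    by (subst nn_integral_restrict_space) (auto simp: rsq_norm)
  also have "\<dots> = (\<integral>\<^sup>+t. ennreal (1 / sqrt t) \<partial>distr (restrict_space lborel (ball 0 2)) borel rsq)"
    by (subst nn_integral_distr) (auto intro: measurable_restrict_space1)
  also have "\<dots> = (\<integral>\<^sup>+t. ennreal (pi * indicator {0..4} t) * ennreal (1 / sqrt t) \<partial>lborel)"
    by (subst distr_rsq) (auto simp: nn_integral_density)
  also have "\<dots> = (\<integral>\<^sup>+t. ennreal (pi * t powr (-1/2)) * indicator {0..4} t \<partial>lborel)"
    by (rule nn_integral_cong)
       (auto simp: indicator_def powr_minus powr_half_sqrt ennreal_mult[symmetric] field_simps)
  also have "\<dots> = ennreal (pi * (4 powr (-1/2 + 1) / (-1/2 + 1)))"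
    by (intro nn_integral_has_integral_lebesgue' has_integral_mult_right has_integral_powr_from_0) auto
  also have "pi * (4 powr (-1/2 + 1) / (-1/2 + 1)) = 4 * pi"
    using powr_half_sqrt[of 4] by simp
  finally show ?thesis .
qed

section \<open>Hoelder's inequality\<close>

lemma integral_le_nn:
  assumes "f \<in> borel_measurable M" "\<And>x. x \<in> space M \<Longrightarrow> 0 \<le> f x" "(\<integral>\<^sup>+x. ennreal (f x) \<partial>M) \<le> ennreal c" "0 \<le> c"
  shows "integrable M f" "(LINT x|M. f x) \<le> (c::real)"
proof -
  show i: "integrable M f"
    by (rule integrableI_bounded) (use assms in \<open>auto simp: cong: nn_integral_cong intro: le_less_trans\<close>)
  have "ennreal (LINT x|M. f x) = (\<integral>\<^sup>+x. ennreal (f x) \<partial>M)"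
    by (rule nn_integral_eq_integral[symmetric, OF i]) (use assms in auto)
  then have "ennreal (LINT x|M. f x) \<le> ennreal c" using assms(3) by simp
  then show "(LINT x|M. f x) \<le> c" using assms(4) by (simp add: ennreal_le_iff)
qed

text \<open>Young's inequality for the normalised factors. The norms enter through upper bounds \<open>a\<close> and
  \<open>b\<close> of the form \<open>\<integral> \<bar>f\<bar>\<^sup>p \<le> a\<^sup>p\<close>, so no roots have to be taken and the degenerate case of norm zero
  disappears.\<close>

lemma Hoelder:
  fixes f g :: "'a \<Rightarrow> real"
  assumes q: "1 < q" "1 < s" "1/q + 1/s = 1"
    and fm: "f \<in> borel_measurable M" and gm: "g \<in> borel_measurable M"
    and fi: "integrable M (\<lambda>x. \<bar>f x\<bar> powr q)" and gi: "integrable M (\<lambda>x. \<bar>g x\<bar> powr s)"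
    and fa: "(LINT x|M. \<bar>f x\<bar> powr q) \<le> a powr q" and gb: "(LINT x|M. \<bar>g x\<bar> powr s) \<le> b powr s"
    and ab: "0 < a" "0 < b"
  shows "integrable M (\<lambda>x. \<bar>f x\<bar> * \<bar>g x\<bar>)" "(LINT x|M. \<bar>f x\<bar> * \<bar>g x\<bar>) \<le> a * b"
proof -
  have Y: "\<bar>f x\<bar> * \<bar>g x\<bar> \<le> a * b * (\<bar>f x\<bar> powr q / (a powr q) / q + \<bar>g x\<bar> powr s / (b powr s) / s)" for x
  proof -
    have "(\<bar>f x\<bar> / a) * (\<bar>g x\<bar> / b) \<le> (\<bar>f x\<bar> / a) powr q / q + (\<bar>g x\<bar> / b) powr s / s"
      by (rule Youngs_inequality) (use q ab in auto)
    then have "a * b * ((\<bar>f x\<bar> / a) * (\<bar>g x\<bar> / b)) \<le> a * b * ((\<bar>f x\<bar> / a) powr q / q + (\<bar>g x\<bar> / b) powr s / s)"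
      using ab by (intro mult_left_mono) auto
    then show ?thesis using ab by (simp add: powr_divide)
  qed
  have ri: "integrable M (\<lambda>x. a * b * (\<bar>f x\<bar> powr q / (a powr q) / q + \<bar>g x\<bar> powr s / (b powr s) / s))"
    using fi gi by auto
  show i: "integrable M (\<lambda>x. \<bar>f x\<bar> * \<bar>g x\<bar>)"
  proof (rule Bochner_Integration.integrable_bound[OF ri])
    show "AE x in M. norm (\<bar>f x\<bar> * \<bar>g x\<bar>) \<le> norm (a * b * (\<bar>f x\<bar> powr q / (a powr q) / q + \<bar>g x\<bar> powr s / (b powr s) / s))"
    proof (rule AE_I2)
      fix x
      show "norm (\<bar>f x\<bar> * \<bar>g x\<bar>) \<le> norm (a * b * (\<bar>f x\<bar> powr q / (a powr q) / q + \<bar>g x\<bar> powr s / (b powr s) / s))"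
        unfolding real_norm_def abs_mult[of "\<bar>f x\<bar>" "\<bar>g x\<bar>"] abs_abs by (rule order_trans[OF Y abs_ge_self])
    qed
  qed (use fm gm in auto)
  have "(LINT x|M. \<bar>f x\<bar> * \<bar>g x\<bar>) \<le> (LINT x|M. a * b * (\<bar>f x\<bar> powr q / (a powr q) / q + \<bar>g x\<bar> powr s / (b powr s) / s))"
    by (rule integral_mono[OF i ri Y])
  also have "\<dots> = a * b * ((LINT x|M. \<bar>f x\<bar> powr q) / (a powr q) / q + (LINT x|M. \<bar>g x\<bar> powr s) / (b powr s) / s)"
    using fi gi by simp
  also have "\<dots> \<le> a * b * (1 / q + 1 / s)"
    using fa gb ab q by (intro mult_left_mono add_mono divide_right_mono) auto
  finally show "(LINT x|M. \<bar>f x\<bar> * \<bar>g x\<bar>) \<le> a * b" using q by simp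
qed

lemma continuous_abs_powr:
  "continuous_on UNIV f \<Longrightarrow> 0 < s \<Longrightarrow> continuous_on UNIV (\<lambda>x. \<bar>f x\<bar> powr (s::real))"
  by (intro continuous_on_powr' continuous_intros) auto

text \<open>Since \<open>ln v \<le> s v\<^bsup>1/s\<^esup>\<close>, the \<open>s\<close>-th power of the kernel is at most a constant times
  \<open>1 / \<bar>x - y\<bar>\<close>, uniformly in the pole \<open>y\<close> and in the smoothing radius \<open>r\<close>.\<close>

lemma log_kernel_Ls_bound:
  assumes s: "1 < s"
  obtains b where "0 < b" "\<And>y r. norm y \<le> 1 \<Longrightarrow> 0 < r \<Longrightarrow> r \<le> 1 \<Longrightarrow>
     (LINT x|MD. \<bar>log_kernel y r x\<bar> powr s) \<le> b powr s"
proof -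
  define K where "K = s powr s * sqrt 5 * (4 * pi)"
  have K: "K > 0" using s by (simp add: K_def)
  show ?thesis
  proof (rule that[of "K powr (1/s)"])
    show "0 < K powr (1/s)" using K by simp
    fix y :: plane and r :: real assume y: "norm y \<le> 1" and r: "0 < r" "r \<le> 1"
    have pt: "\<bar>log_kernel y r x\<bar> powr s \<le> s powr s * sqrt 5 * (1 / norm (x - y))" if x: "x \<in> disk" "x \<noteq> y" for x
    proof -
      have n: "norm (x - y) > 0" using x by simp
      have l0: "0 \<le> log_kernel y r x" using log_kernel_nonneg y r x by (simp add: mem_disk)
      let ?v = "sqrt 5 / norm (x - y)"
      have v0: "?v > 0" using n by simp
      have "log_kernel y r x \<le> 1/2 * ln (5 / (norm (x - y))^2)"
      proof -
        have "5 / ((norm (x - y))^2 + r^2) \<le> 5 / (norm (x - y))^2"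
          using n r by (intro divide_left_mono mult_pos_pos add_pos_pos) auto
        moreover have "0 < 5 / ((norm (x - y))^2 + r^2)"
          using n r by (intro divide_pos_pos add_pos_pos) auto
        ultimately show ?thesis unfolding log_kernel_def by (intro mult_left_mono ln_mono) auto
      qed
      also have "5 / (norm (x - y))^2 = ?v^2" by (simp add: power_divide)
      also have "1/2 * ln (?v^2) = ln ?v" using v0 by (simp add: ln_realpow)
      also have "\<dots> = s * ln (?v powr (1/s))" using s v0 by (simp add: ln_powr)
      also have "\<dots> \<le> s * ?v powr (1/s)"
      proof -
        have "0 < ?v powr (1/s)" using v0 by (subst powr_gt_zero) auto
        from ln_le_minus_one[OF this] show ?thesis using s by (intro mult_left_mono) auto
      qed
      finally have "log_kernel y r x powr s \<le> (s * ?v powr (1/s)) powr s"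
        using l0 s by (intro powr_mono2) auto
      also have "\<dots> = s powr s * ?v" using s v0 by (simp add: powr_mult powr_powr)
      finally show ?thesis using l0 by simp
    qed
    have [measurable]: "ball y 2 \<in> sets borel" "ball y 2 \<in> sets lborel" by auto
    have m: "(\<lambda>x. \<bar>log_kernel y r x\<bar> powr s) \<in> borel_measurable borel"
      unfolding log_kernel_def by measurable
    have "(\<integral>\<^sup>+x. ennreal (\<bar>log_kernel y r x\<bar> powr s) \<partial>restrict_space lborel disk)
       = (\<integral>\<^sup>+x\<in>disk. ennreal (\<bar>log_kernel y r x\<bar> powr s) \<partial>lborel)"
      by (rule nn_integral_restrict_space) auto
    also have "\<dots> \<le> (\<integral>\<^sup>+x. ennreal (s powr s * sqrt 5) * (ennreal (1 / norm (x - y)) * indicator (ball y 2) x) \<partial>lborel)"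
    proof (rule nn_integral_mono_AE)
      have "AE x in lborel. x \<noteq> y" by (rule AE_lborel_singleton)
      then show "AE x in lborel. ennreal (\<bar>log_kernel y r x\<bar> powr s) * indicator disk x
         \<le> ennreal (s powr s * sqrt 5) * (ennreal (1 / norm (x - y)) * indicator (ball y 2) x)"
      proof eventually_elim
        case (elim x)
        have "x \<in> ball y 2" if "x \<in> disk"
          using that y norm_triangle_ineq4[of y x] by (simp add: mem_disk dist_norm)
        then show ?case using pt[of x] elim s
          by (auto simp: indicator_def ennreal_mult[symmetric] simp del: times_divide_eq_right)
      qed
    qed
    also have "\<dots> = ennreal (s powr s * sqrt 5) * ennreal (4 * pi)"
      by (subst nn_integral_cmult, measurable) (simp add: nn_integral_inverse_norm)
    also have "\<dots> = ennreal K" using s by (simp add: K_def ennreal_mult[symmetric])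
    finally have "(LINT x|restrict_space lborel disk. \<bar>log_kernel y r x\<bar> powr s) \<le> K"
      using K m by (intro integral_le_nn) (auto intro: measurable_restrict_space1)
    also have "K = (K powr (1/s)) powr s" using K s by (simp add: powr_powr)
    finally show "(LINT x|MD. \<bar>log_kernel y r x\<bar> powr s) \<le> (K powr (1/s)) powr s"
      by (simp add: integral_MD_borel[OF m])
  qed
qed

text \<open>Hoelder's inequality in the previous bound: the kernel is bounded in every \<open>L\<^sup>s\<close> with finite
  \<open>s\<close>, so any \<open>q > 1\<close> is admissible for the Laplacian.\<close>

lemma sup_bound_Lq:
  assumes q: "1 < q"
  obtains C where "0 < C" "\<And>A A1 A2 a x. C2 A A1 A2 \<Longrightarrow> (\<And>x. norm x = 1 \<Longrightarrow> A x = 0) \<Longrightarrow> 0 < a \<Longrightarrow>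
     (LINT x|MD. \<bar>\<Sum>i\<in>UNIV. A2 i x\<bar> powr q) \<le> a powr q \<Longrightarrow> norm x \<le> 1 \<Longrightarrow> \<bar>A x\<bar> \<le> C * a"
proof -
  define s where "s = q / (q - 1)"
  have s: "1 < s" "1/q + 1/s = 1" using q by (auto simp: s_def field_simps)
  obtain b where b: "0 < b" "\<And>y r. norm y \<le> 1 \<Longrightarrow> 0 < r \<Longrightarrow> r \<le> 1 \<Longrightarrow>
     (LINT x|MD. \<bar>log_kernel y r x\<bar> powr s) \<le> b powr s" using log_kernel_Ls_bound[OF s(1)] by blast
  show ?thesis
  proof (rule that[of "8 / pi * b"])
    fix A :: "plane \<Rightarrow> real" and A1 A2 a and x :: plane
    assume A: "C2 A A1 A2" and bd: "\<And>x. norm x = 1 \<Longrightarrow> A x = 0" and a: "0 < a"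
      and wa: "(LINT x|MD. \<bar>\<Sum>i\<in>UNIV. A2 i x\<bar> powr q) \<le> a powr q" and x: "norm x \<le> 1"
    let ?w = "\<lambda>x. \<Sum>i\<in>UNIV. A2 i x"
    obtain y r where yr: "norm y \<le> 1" "0 < r" "r \<le> 1"
      "\<And>x. norm x \<le> 1 \<Longrightarrow> \<bar>A x\<bar> \<le> 8 / pi * (LINT x|MD. \<bar>?w x\<bar> * log_kernel y r x)"
      using sup_bound_log[OF A bd] by blast
    obtain B1 B2 where "C2 (log_kernel y r) B1 B2" using log_kernel_C2[OF yr(2)] by blast
    then have cl: "continuous_on UNIV (log_kernel y r)" by (simp add: C2_def)
    have cw: "continuous_on UNIV ?w" using A by (auto simp: C2_def intro!: continuous_intros)
    have "(LINT x|MD. \<bar>?w x\<bar> * log_kernel y r x) = (LINT x|MD. \<bar>?w x\<bar> * \<bar>log_kernel y r x\<bar>)"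
      by (rule Bochner_Integration.integral_cong) (auto simp: mem_disk log_kernel_nonneg yr)
    also have "\<dots> \<le> a * b"
      by (rule Hoelder(2)[OF q s]) (use cl cw wa b a yr q s in \<open>auto intro!: continuous_MD integrable_MD_continuous continuous_abs_powr\<close>)
    finally have "8 / pi * (LINT x|MD. \<bar>?w x\<bar> * log_kernel y r x) \<le> 8 / pi * (a * b)"
      by (intro mult_left_mono) auto
    then show "\<bar>A x\<bar> \<le> 8 / pi * b * a" using yr(4)[OF x] by (simp add: mult_ac)
  qed (use b in simp)
qed

section \<open>Essentially bounded functions\<close>

abbreviation "LI \<equiv> Linf disk"

lemma Linf_meas: "f \<in> LI \<Longrightarrow> f \<in> borel_measurable MD"
  by (simp add: Linf_def)

lemma LinfE:
  assumes "f \<in> LI" obtains M where "0 < M" "AE x in MD. \<bar>f x\<bar> \<le> M"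
proof -
  obtain M where M: "AE x in MD. \<bar>f x\<bar> \<le> M" using assms by (auto simp: Linf_def)
  have "AE x in MD. \<bar>f x\<bar> \<le> max 1 M" using M by eventually_elim simp
  then show ?thesis using that[of "max 1 M"] by simp
qed

lemma LinfI: "f \<in> borel_measurable MD \<Longrightarrow> AE x in MD. \<bar>f x\<bar> \<le> M \<Longrightarrow> f \<in> LI"
  by (auto simp: Linf_def)

lemma LinfI': "f \<in> borel_measurable MD \<Longrightarrow> (\<And>x. x \<in> disk \<Longrightarrow> \<bar>f x\<bar> \<le> M) \<Longrightarrow> f \<in> LI"
  by (rule LinfI[of _ M]) auto

lemma Linf_integrable: "f \<in> LI \<Longrightarrow> integrable MD f"
proof -
  assume f: "f \<in> LI"
  obtain M where M: "AE x in MD. \<bar>f x\<bar> \<le> M" by (rule LinfE[OF f])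
  show ?thesis
    by (rule finite_measure.integrable_const_bound[OF finite_measure_MD _ Linf_meas[OF f], of M]) (use M in simp)
qed

lemma Linf_add: "f \<in> LI \<Longrightarrow> g \<in> LI \<Longrightarrow> (\<lambda>x. f x + g x) \<in> LI"
proof -
  assume f: "f \<in> LI" and g: "g \<in> LI"
  obtain M where M: "AE x in MD. \<bar>f x\<bar> \<le> M" by (rule LinfE[OF f])
  obtain N where N: "AE x in MD. \<bar>g x\<bar> \<le> N" by (rule LinfE[OF g])
  from M N have "AE x in MD. \<bar>f x + g x\<bar> \<le> M + N" by eventually_elim linarith
  then show ?thesis by (rule LinfI[rotated]) (intro borel_measurable_add Linf_meas f g)
qed

lemma Linf_mult: "f \<in> LI \<Longrightarrow> g \<in> LI \<Longrightarrow> (\<lambda>x. f x * g x) \<in> LI"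
proof -
  assume f: "f \<in> LI" and g: "g \<in> LI"
  obtain M where M: "0 < M" "AE x in MD. \<bar>f x\<bar> \<le> M" by (rule LinfE[OF f])
  obtain N where N: "AE x in MD. \<bar>g x\<bar> \<le> N" by (rule LinfE[OF g])
  from M(2) N have "AE x in MD. \<bar>f x * g x\<bar> \<le> M * N"
  proof eventually_elim
    case (elim x)
    then show ?case using M(1) by (auto simp: abs_mult intro!: mult_mono)
  qed
  then show ?thesis by (rule LinfI[rotated]) (intro borel_measurable_times Linf_meas f g)
qed

lemma Linf_cont: "continuous_on UNIV f \<Longrightarrow> f \<in> LI"
  using continuous_bounded_disk[of f] by (metis LinfI' continuous_MD less_imp_le mem_disk)

lemma Linf_cont_cball:
  assumes "continuous_on (cball 0 1) u" shows "u \<in> LI"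
proof -
  have "u measurable_on disk"
    by (rule continuous_imp_measurable_on_sets_lebesgue[THEN measurable_on_iff_borel_measurable[THEN iffD2, rotated]])
       (use assms in \<open>auto intro: continuous_on_subset simp: disk_def\<close>)
  then have m: "u \<in> borel_measurable MD" by (simp add: measurable_on_iff_borel_measurable)
  have "bounded (u ` cball 0 1)"
    by (intro compact_imp_bounded compact_continuous_image assms compact_cball)
  then obtain B where "\<forall>y\<in>u ` cball 0 1. norm y \<le> B" unfolding bounded_pos by auto
  then show ?thesis by (intro LinfI'[OF m, of B]) (auto simp: mem_disk)
qed

lemma Linf_const: "(\<lambda>x. c) \<in> LI"
  by (rule Linf_cont) simp

lemma Linf_cmult: "f \<in> LI \<Longrightarrow> (\<lambda>x. c * f x) \<in> LI"
  by (rule Linf_mult[OF Linf_const])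

lemma Linf_diff: "f \<in> LI \<Longrightarrow> g \<in> LI \<Longrightarrow> (\<lambda>x. f x - g x) \<in> LI"
  using Linf_add[of f "\<lambda>x. -1 * g x"] Linf_cmult[of g "-1"] by simp

lemma Linf_power: "f \<in> LI \<Longrightarrow> (\<lambda>x. f x ^ k) \<in> LI"
  by (induction k) (auto intro: Linf_const Linf_mult)

lemma Linf_abs: "f \<in> LI \<Longrightarrow> (\<lambda>x. \<bar>f x\<bar>) \<in> LI"
proof -
  assume f: "f \<in> LI"
  obtain M where "AE x in MD. \<bar>f x\<bar> \<le> M" by (rule LinfE[OF f])
  then have "AE x in MD. \<bar>\<bar>f x\<bar>\<bar> \<le> M" by simp
  then show ?thesis by (rule LinfI[rotated]) (intro borel_measurable_abs Linf_meas f)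
qed

lemma Linf_powr: "f \<in> LI \<Longrightarrow> 0 \<le> p \<Longrightarrow> (\<lambda>x. \<bar>f x\<bar> powr p) \<in> LI"
proof -
  assume f: "f \<in> LI" and p: "0 \<le> p"
  obtain M where M: "0 < M" "AE x in MD. \<bar>f x\<bar> \<le> M" by (rule LinfE[OF f])
  from M(2) have "AE x in MD. \<bar>\<bar>f x\<bar> powr p\<bar> \<le> M powr p"
    by eventually_elim (use p in \<open>auto intro: powr_mono2\<close>)
  then show ?thesis
    by (rule LinfI[rotated]) (use Linf_meas[OF f] in measurable)
qed

text \<open>Convergence in mean square implies convergence in mean; the form \<open>2 \<bar>d\<bar> \<le> h + d\<^sup>2 / h\<close> of the
  arithmetic-geometric mean inequality gives it without square roots.\<close>

lemma L1_le_L2: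
  assumes d: "d \<in> LI" and h: "0 < h" and i: "(LINT x|MD. (d x)^2) \<le> h^2"
  shows "(LINT x|MD. \<bar>d x\<bar>) \<le> 3 * h"
proof -
  have 1: "\<bar>d x\<bar> \<le> 1/2 * (h + (d x)^2 / h)" for x
  proof -
    have "0 \<le> (h - \<bar>d x\<bar>)^2 / h" using h by simp
    also have "(h - \<bar>d x\<bar>)^2 / h = h - 2 * \<bar>d x\<bar> + (d x)^2 / h"
      using h by (simp add: power2_eq_square field_simps)
    finally show ?thesis by simp
  qed
  have "(LINT x|MD. \<bar>d x\<bar>) \<le> (LINT x|MD. 1/2 * (h + (d x)^2 / h))"
  proof (rule integral_mono[OF _ _ 1])
    show "integrable MD (\<lambda>x. \<bar>d x\<bar>)" by (intro Linf_integrable Linf_abs d)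
    show "integrable MD (\<lambda>x. 1/2 * (h + (d x)^2 / h))"
      using Linf_integrable[OF Linf_power[OF d]] Linf_integrable[OF Linf_const]
      by (intro integrable_mult_right Bochner_Integration.integrable_add integrable_divide) auto
  qed
  also have "\<dots> = 1/2 * (h * pi + (LINT x|MD. (d x)^2) / h)"
    using Linf_integrable[OF Linf_power[OF d, of 2]] Linf_integrable[OF Linf_const[of h]]
    by (simp add: measure_MD)
  also have "\<dots> \<le> 1/2 * (h * pi + h^2 / h)"
    using i h by (intro mult_left_mono add_left_mono divide_right_mono) auto
  also have "\<dots> = h * ((pi + 1) / 2)" using h by (simp add: power2_eq_square field_simps)
  also have "\<dots> \<le> h * 3" using h pi_less_4 by (intro mult_left_mono) auto
  finally show ?thesis by simp
qed

section \<open>Polynomials as finite sums of modes\<close>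

text \<open>Real polynomials in the plane, written in \<open>z\<close> and its conjugate. In this form closure under
  products is evident and every generator is a mode.\<close>

inductive zpoly :: "(plane \<Rightarrow> real) \<Rightarrow> bool" where
  gen: "zpoly (\<lambda>x. Re (\<alpha> * to_complex x ^ a * cnj (to_complex x) ^ b))"
| add: "zpoly f \<Longrightarrow> zpoly g \<Longrightarrow> zpoly (\<lambda>x. f x + g x)"

lemma zpoly_mult: "zpoly f \<Longrightarrow> zpoly g \<Longrightarrow> zpoly (\<lambda>x. f x * g x)"
proof (induction rule: zpoly.induct)
  case (gen \<alpha> a b)
  from gen show ?case
  proof (induction rule: zpoly.induct)
    case (gen \<beta> c d)
    have R: "Re A * Re B = Re (A * B / 2) + Re (A * cnj B / 2)" for A B
      by (simp add: field_simps)
    have e: "Re (\<alpha> * to_complex x ^ a * cnj (to_complex x) ^ b) * Re (\<beta> * to_complex x ^ c * cnj (to_complex x) ^ d) =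
      Re (\<alpha> * \<beta> / 2 * to_complex x ^ (a + c) * cnj (to_complex x) ^ (b + d)) + Re (\<alpha> * cnj \<beta> / 2 * to_complex x ^ (a + d) * cnj (to_complex x) ^ (b + c))" for x
      unfolding R by (rule arg_cong2[where f="(+)"]; rule arg_cong[where f=Re]; simp add: power_add mult_ac)
    show ?case unfolding e by (intro zpoly.intros)
  qed (simp add: distrib_left zpoly.add)
qed (simp add: distrib_right zpoly.add)

lemma zpoly_const: "zpoly (\<lambda>x. c)"
  using zpoly.gen[of "of_real c" 0 0] by simp

lemma zpoly_real_polynomial: "real_polynomial_function f \<Longrightarrow> zpoly f"
proof (induction rule: real_polynomial_function.induct)
  case (linear f)
  interpret bounded_linear f by fact
  have "f x = Re (Complex (f (axis 1 1)) (- f (axis 2 1)) * to_complex x ^ 1 * cnj (to_complex x) ^ 0)" for x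
  proof -
    have "x = x$1 *\<^sub>R axis 1 1 + x$2 *\<^sub>R axis 2 1"
      by (auto simp: vec_eq_iff axis_def forall_2)
    then have "f x = f (x$1 *\<^sub>R axis 1 1 + x$2 *\<^sub>R axis 2 1)" by simp
    also have "\<dots> = x$1 * f (axis 1 1) + x$2 * f (axis 2 1)" by (simp add: add scaleR)
    finally have "f x = x$1 * f (axis 1 1) + x$2 * f (axis 2 1)" .
    then show ?thesis by (simp add: to_complex_def mult.commute)
  qed
  then have e: "f = (\<lambda>x. Re (Complex (f (axis 1 1)) (- f (axis 2 1)) * to_complex x ^ 1 * cnj (to_complex x) ^ 0))" by blast
  show ?case by (subst e) (rule zpoly.gen)
qed (auto intro: zpoly_const zpoly.add zpoly_mult)

text \<open>The index \<open>(n, s)\<close> names the harmonic polynomial \<open>Y n s\<close>; \<open>p\<close> gives its radial coefficient,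
  a polynomial in \<open>\<bar>x\<bar>\<^sup>2\<close>.\<close>

definition poly_mode_sum :: "(nat \<times> bool) set \<Rightarrow> (nat \<times> bool \<Rightarrow> real poly) \<Rightarrow> plane \<Rightarrow> real" where
  "poly_mode_sum I p x = (\<Sum>k\<in>I. poly (p k) (rsq x) * Y (fst k) (snd k) x)"

definition modal :: "(plane \<Rightarrow> real) \<Rightarrow> bool" where
  "modal f \<longleftrightarrow> (\<exists>I p. finite I \<and> f = poly_mode_sum I p)"

lemma modal_add:
  assumes "modal f" "modal g" shows "modal (\<lambda>x. f x + g x)"
proof -
  obtain I p J q where I: "finite I" "f = poly_mode_sum I p" and J: "finite J" "g = poly_mode_sum J q"
    using assms by (auto simp: modal_def)
  let ?r = "\<lambda>k. (if k \<in> I then p k else 0) + (if k \<in> J then q k else 0)"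
  have "f x + g x = poly_mode_sum (I \<union> J) ?r x" for x
  proof -
    have "f x = (\<Sum>k\<in>I \<union> J. poly (if k \<in> I then p k else 0) (rsq x) * Y (fst k) (snd k) x)"
      unfolding I(2) poly_mode_sum_def using I(1) J(1) by (intro sum.mono_neutral_cong_left) auto
    moreover have "g x = (\<Sum>k\<in>I \<union> J. poly (if k \<in> J then q k else 0) (rsq x) * Y (fst k) (snd k) x)"
      unfolding J(2) poly_mode_sum_def using I(1) J(1) by (intro sum.mono_neutral_cong_left) auto
    ultimately show ?thesis by (simp add: poly_mode_sum_def sum.distrib[symmetric] distrib_right)
  qed
  then have "(\<lambda>x. f x + g x) = poly_mode_sum (I \<union> J) ?r" by blast
  then show ?thesis unfolding modal_def using I(1) J(1) by blast
qed

lemma modal_single: "modal (\<lambda>x. poly f (rsq x) * Y n s x)"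
  unfolding modal_def poly_mode_sum_def
  by (intro exI[of _ "{(n, s)}"] exI[of _ "\<lambda>_. f"]) auto

text \<open>A common factor \<open>\<bar>z\<bar>\<^sup>2\<close> is split off \<open>z\<^sup>a z\<^bsup>*b\<^esup>\<close> as often as possible; what is left is a power
  of \<open>z\<close> or of its conjugate.\<close>

lemma zpoly_modal: "zpoly f \<Longrightarrow> modal f"
proof (induction rule: zpoly.induct)
  case (gen \<alpha> a b)
  have *: "modal (\<lambda>x. Re (\<beta> * to_complex x ^ n * of_real (rsq x ^ k)))" for \<beta> n k
  proof -
    have "modal (\<lambda>x. poly (monom (Re \<beta>) k) (rsq x) * Y n True x + poly (monom (- Im \<beta>) k) (rsq x) * Y n False x)"
      by (intro modal_add modal_single)
    moreover have "poly (monom (Re \<beta>) k) (rsq x) * Y n True x + poly (monom (- Im \<beta>) k) (rsq x) * Y n False x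
       = Re (\<beta> * to_complex x ^ n * of_real (rsq x ^ k))" for x
      by (simp add: Y_def re_or_im_def poly_monom algebra_simps)
    ultimately show ?thesis by simp
  qed
  show ?case
  proof (cases "b \<le> a")
    case True
    have e: "\<alpha> * to_complex x ^ a * cnj (to_complex x) ^ b = \<alpha> * to_complex x ^ (a - b) * of_real (rsq x ^ b)" for x
    proof -
      have "to_complex x ^ a = to_complex x ^ (a - b) * to_complex x ^ b" using True by (simp flip: power_add)
      then show ?thesis by (simp add: rsq_to_complex power_mult_distrib mult_ac)
    qed
    show ?thesis unfolding e by (rule *)
  next
    case False
    have e: "Re (\<alpha> * to_complex x ^ a * cnj (to_complex x) ^ b) = Re (cnj \<alpha> * to_complex x ^ (b - a) * of_real (rsq x ^ a))" for x
    proof -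
      have "to_complex x ^ b = to_complex x ^ (b - a) * to_complex x ^ a" using False by (simp flip: power_add)
      then have "cnj (\<alpha> * to_complex x ^ a * cnj (to_complex x) ^ b) = cnj \<alpha> * to_complex x ^ (b - a) * of_real (rsq x ^ a)"
        by (simp add: rsq_to_complex power_mult_distrib mult_ac)
      then show ?thesis by (metis complex_cnj(1) complex_cnj_cnj cnj.simps(1))
    qed
    show ?thesis unfolding e by (rule *)
  qed
qed (rule modal_add)

lemma continuous_poly_mode_sum: "finite I \<Longrightarrow> continuous_on UNIV (poly_mode_sum I p)"
  unfolding poly_mode_sum_def by (intro continuous_intros)

lemma modal_continuous: "modal f \<Longrightarrow> continuous_on UNIV f"
  by (auto simp: modal_def continuous_poly_mode_sum)

section \<open>Density of the polynomials\<close>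

lemma modal_dense_continuous:
  assumes "continuous_on UNIV f" "0 < e"
  obtains g where "modal g" "\<And>x. norm x \<le> 1 \<Longrightarrow> \<bar>f x - g x\<bar> < e"
proof -
  have "\<exists>g. real_polynomial_function g \<and> (\<forall>x\<in>cball 0 1. \<bar>f x - g x\<bar> < e)"
  proof (rule Stone_Weierstrass_HOL[of "cball 0 1" real_polynomial_function f e])
    fix x y :: plane assume "x \<in> cball 0 1 \<and> y \<in> cball 0 1 \<and> x \<noteq> y"
    then obtain i where "x $ i \<noteq> y $ i" by (auto simp: vec_eq_iff)
    then show "\<exists>f. real_polynomial_function f \<and> f x \<noteq> f y"
      by (intro exI[of _ "\<lambda>x. x $ i"]) (auto intro: bounded_linear_vec_nth)
  next
    fix f assume "real_polynomial_function (f :: plane \<Rightarrow> real)"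
    then show "continuous_on (cball 0 1) f"
      by (intro continuous_on_polymonial_function) (simp add: real_polynomial_function_eq)
  qed (use assms in \<open>auto intro: continuous_on_subset\<close>)
  then obtain g where g: "real_polynomial_function g" "\<And>x. norm x \<le> 1 \<Longrightarrow> \<bar>f x - g x\<bar> < e" by auto
  show ?thesis by (rule that[OF zpoly_modal[OF zpoly_real_polynomial[OF g(1)]] g(2)])
qed

text \<open>A bounded function is an almost everywhere limit of continuous functions. These may be
  clamped at its bound, so that convergence is dominated, and are then approximated uniformly by
  polynomials (Stone and Weierstrass).\<close>

lemma modal_dense_L2:
  assumes w: "w \<in> LI" and e: "0 < e"
  obtains g where "modal g" "(LINT x|MD. (g x - w x)^2) \<le> e^2"
proof -
  obtain M where M: "0 < M" "AE x in MD. \<bar>w x\<bar> \<le> M" using LinfE[OF w] .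
  have "w measurable_on disk" using Linf_meas[OF w] by (simp add: measurable_on_iff_borel_measurable)
  then obtain N g where N: "negligible N" and g: "\<And>n. continuous_on UNIV (g n)"
    "\<And>x. x \<notin> N \<Longrightarrow> (\<lambda>n. g n x) \<longlonglongrightarrow> (if x \<in> disk then w x else 0)"
    unfolding measurable_on_def by blast
  define h where "h n x = max (-M) (min M (g n x))" for n :: nat and x
  have ch: "continuous_on UNIV (h n)" for n unfolding h_def by (intro continuous_intros g)
  have hb: "\<bar>h n x\<bar> \<le> M" for n x using M(1) by (auto simp: h_def)
  have "AE x in lebesgue. x \<notin> N"
    using N unfolding negligible_iff_null_sets by (rule AE_not_in)
  then have aeN: "AE x in MD. x \<notin> N" by (subst AE_restrict_space_iff) auto
  have "(\<lambda>n. LINT x|MD. (h n x - w x)^2) \<longlonglongrightarrow> (LINT x|MD. 0)"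
  proof (rule integral_dominated_convergence[where w="\<lambda>x. (2 * M)^2"])
    show "(\<lambda>x. (h n x - w x)\<^sup>2) \<in> borel_measurable MD" for n
      by (intro Linf_meas Linf_power Linf_diff Linf_cont ch w)
    show "integrable MD (\<lambda>x. (2 * M)^2)" by (rule Linf_integrable[OF Linf_const])
    show "AE x in MD. norm ((h n x - w x)^2) \<le> (2 * M)^2" for n
      using M(2)
    proof eventually_elim
      case (elim x)
      have "\<bar>h n x - w x\<bar> \<le> 2 * M" using hb[of n x] elim by linarith
      then show ?case using abs_le_square_iff[of "h n x - w x" "2 * M"] M(1) by simp
    qed
    show "AE x in MD. (\<lambda>n. (h n x - w x)^2) \<longlonglongrightarrow> 0"
      using M(2) aeN AE_space[of MD]
    proof eventually_elim
      case (elim x)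
      have "(\<lambda>n. h n x) \<longlonglongrightarrow> max (-M) (min M (w x))"
        unfolding h_def using g(2)[of x] elim by (intro tendsto_intros) auto
      also have "max (-M) (min M (w x)) = w x" using elim by auto
      finally have "(\<lambda>n. (h n x - w x)^2) \<longlonglongrightarrow> (w x - w x)^2" by (intro tendsto_intros)
      then show ?case by simp
    qed
  qed auto
  then have "\<forall>\<^sub>F n in sequentially. (LINT x|MD. (h n x - w x)^2) < e^2/4"
    using e by (intro order_tendstoD(2)) auto
  then obtain n where n: "(LINT x|MD. (h n x - w x)^2) < e^2/4"
    by (meson eventually_sequentially order_refl)
  obtain v where v: "modal v" "\<And>x. norm x \<le> 1 \<Longrightarrow> \<bar>h n x - v x\<bar> < e/4"
    using modal_dense_continuous[OF ch, of "e/4" n] e by auto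
  have vL: "v \<in> LI" by (intro Linf_cont modal_continuous v)
  have i1: "integrable MD (\<lambda>x. (v x - w x)^2)" "integrable MD (\<lambda>x. (h n x - w x)^2)"
    by (intro Linf_integrable Linf_power Linf_diff vL w Linf_cont ch)+
  have i2: "integrable MD (\<lambda>x. 2 * (h n x - w x)^2 + 2 * (e/4)^2)"
    using i1 Linf_integrable[OF Linf_const] by auto
  have "(LINT x|MD. (v x - w x)^2) \<le> (LINT x|MD. 2 * (h n x - w x)^2 + 2 * (e/4)^2)"
  proof (rule integral_mono[OF i1(1) i2])
    fix x assume "x \<in> space MD"
    then have "\<bar>h n x - v x\<bar> \<le> \<bar>e/4\<bar>" using v(2)[of x] by (simp add: mem_disk)
    then have "(h n x - v x)^2 \<le> (e/4)^2" by (simp only: abs_le_square_iff)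
    moreover have "0 \<le> ((h n x - w x) + (h n x - v x))^2" by simp
    ultimately show "(v x - w x)^2 \<le> 2 * (h n x - w x)^2 + 2 * (e/4)^2"
      by (simp add: power2_eq_square algebra_simps)
  qed
  also have "\<dots> = 2 * (LINT x|MD. (h n x - w x)^2) + 2 * (e/4)^2 * pi"
    using i1 Linf_integrable[OF Linf_const] by (simp add: measure_MD)
  also have "\<dots> \<le> 2 * (e^2/4) + 2 * (e/4)^2 * 4"
    using n pi_less_4 by (intro add_mono mult_left_mono) auto
  also have "\<dots> = e^2" by (simp add: power2_eq_square)
  finally show ?thesis using that v(1) by blast
qed

section \<open>The Poisson equation with polynomial right-hand side\<close>

lemma pderiv_sum: "pderiv (sum f A) = (\<Sum>x\<in>A. pderiv (f x))"
  by (induction A rule: infinite_finite_induct) (auto simp: pderiv_add)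

text \<open>The polynomial \<open>U\<close> with \<open>- 4 (t U'' + (n + 1) U') = f\<close> and \<open>U 1 = 0\<close>: the monomial \<open>t\<^sup>b\<close> has
  the solution \<open>(1 - t\<^bsup>b+1\<^esup>) / (4 (b + 1) (b + 1 + n))\<close>.\<close>

definition radial_inverse :: "nat \<Rightarrow> real poly \<Rightarrow> real poly" where
  "radial_inverse n f = (\<Sum>b\<le>degree f. smult (coeff f b / (4 * (real b + 1) * (real b + 1 + real n))) (1 - monom 1 (b + 1)))"

lemma poly_radial_inverse_1: "poly (radial_inverse n f) 1 = 0"
  by (simp add: radial_inverse_def poly_sum poly_monom)

lemma poly_radial_inverse:
  "- 4 * (t * poly (pderiv (pderiv (radial_inverse n f))) t + (real n + 1) * poly (pderiv (radial_inverse n f)) t) = poly f t"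
proof -
  define c where "c b = coeff f b / (4 * (real b + 1) * (real b + 1 + real n))" for b
  have d1: "pderiv (radial_inverse n f) = (\<Sum>b\<le>degree f. smult (c b) (- monom (real b + 1) b))"
    by (simp add: radial_inverse_def pderiv_sum pderiv_smult pderiv_diff pderiv_monom add.commute c_def)
  have d2: "pderiv (pderiv (radial_inverse n f)) = (\<Sum>b\<le>degree f. smult (c b) (- monom (real b * (real b + 1)) (b - 1)))"
    unfolding d1 by (simp add: pderiv_sum pderiv_smult pderiv_minus pderiv_monom)
  have e: "t * (real b * (real b + 1) * t ^ (b - 1)) = real b * (real b + 1) * t ^ b" for b
    by (cases b) auto
  have p1: "poly (pderiv (radial_inverse n f)) t = (\<Sum>b\<le>degree f. c b * - ((real b + 1) * t ^ b))"
    unfolding d1 by (simp add: poly_sum poly_monom)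
  have p2: "t * poly (pderiv (pderiv (radial_inverse n f))) t = (\<Sum>b\<le>degree f. c b * - (real b * (real b + 1) * t ^ b))"
    unfolding d2 e[symmetric] by (simp add: poly_sum poly_monom sum_distrib_left mult_ac)
  have "- 4 * (t * poly (pderiv (pderiv (radial_inverse n f))) t + (real n + 1) * poly (pderiv (radial_inverse n f)) t)
     = (\<Sum>b\<le>degree f. - 4 * (c b * - (real b * (real b + 1) * t ^ b) + (real n + 1) * (c b * - ((real b + 1) * t ^ b))))"
    unfolding p1 p2 sum_distrib_left sum.distrib[symmetric] by (rule refl)
  also have "\<dots> = (\<Sum>b\<le>degree f. coeff f b * t ^ b)"
  proof (rule sum.cong[OF refl])
    fix b
    have "- 4 * (c b * - (real b * (real b + 1) * t ^ b) + (real n + 1) * (c b * - ((real b + 1) * t ^ b)))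
       = c b * (4 * (real b + 1) * (real b + 1 + real n)) * t ^ b"
      by (simp add: algebra_simps)
    also have "4 * (real b + 1) * (real b + 1 + real n) \<noteq> 0"
      by (simp add: add_nonneg_eq_0_iff)
    then have "c b * (4 * (real b + 1) * (real b + 1 + real n)) = coeff f b" by (simp add: c_def)
    finally show "- 4 * (c b * - (real b * (real b + 1) * t ^ b) + (real n + 1) * (c b * - ((real b + 1) * t ^ b))) = coeff f b * t ^ b" .
  qed
  also have "\<dots> = poly f t" by (simp add: poly_altdef)
  finally show ?thesis .
qed

text \<open>The coefficients of the solution of the Dirichlet problem whose right-hand side is the
  polynomial with coefficients \<open>p\<close>.\<close>

definition potential_coeffs :: "(nat \<times> bool \<Rightarrow> real poly) \<Rightarrow> nat \<times> bool \<Rightarrow> real poly" where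
  "potential_coeffs p k = radial_inverse (fst k) (p k)"

lemma poly_mode_sum_potential_C2:
  assumes "finite I"
  obtains A1 A2 where "C2 (poly_mode_sum I (potential_coeffs p)) A1 A2" "\<And>x. (\<Sum>i\<in>UNIV. A2 i x) = - poly_mode_sum I p x"
proof -
  have "\<exists>B. C2 (\<lambda>x. poly (potential_coeffs p k) (rsq x) * Y (fst k) (snd k) x) (fst B) (snd B) \<and>
     (\<forall>x. (\<Sum>i\<in>UNIV. snd B i x) = - poly (p k) (rsq x) * Y (fst k) (snd k) x)" for k
  proof -
    obtain B1 B2 where B: "C2 (\<lambda>x. poly (potential_coeffs p k) (rsq x) * Y (fst k) (snd k) x) B1 B2"
      "\<And>x. (\<Sum>i\<in>UNIV. B2 i x) = 4 * (rsq x * poly (pderiv (pderiv (potential_coeffs p k))) (rsq x) + (real (fst k) + 1) * poly (pderiv (potential_coeffs p k)) (rsq x)) * Y (fst k) (snd k) x"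
      by (rule mode_C2[of "poly (potential_coeffs p k)" "poly (pderiv (potential_coeffs p k))" "poly (pderiv (pderiv (potential_coeffs p k)))" "fst k" "snd k"])
         (auto intro!: poly_DERIV continuous_intros)
    have "(\<Sum>i\<in>UNIV. B2 i x) = - poly (p k) (rsq x) * Y (fst k) (snd k) x" for x
    proof -
      have "4 * (rsq x * poly (pderiv (pderiv (potential_coeffs p k))) (rsq x) + (real (fst k) + 1) * poly (pderiv (potential_coeffs p k)) (rsq x)) = - poly (p k) (rsq x)"
        using poly_radial_inverse[of "rsq x" "fst k" "p k"] unfolding potential_coeffs_def by linarith
      then show ?thesis unfolding B(2) by (simp only:)
    qed
    then show ?thesis using B(1) by (intro exI[of _ "(B1, B2)"]) simp
  qed
  then obtain B where B: "\<And>k. C2 (\<lambda>x. poly (potential_coeffs p k) (rsq x) * Y (fst k) (snd k) x) (fst (B k)) (snd (B k))"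
     "\<And>k x. (\<Sum>i\<in>UNIV. snd (B k) i x) = - poly (p k) (rsq x) * Y (fst k) (snd k) x"
    using choice[of "\<lambda>k B. C2 (\<lambda>x. poly (potential_coeffs p k) (rsq x) * Y (fst k) (snd k) x) (fst B) (snd B) \<and>
      (\<forall>x. (\<Sum>i\<in>UNIV. snd B i x) = - poly (p k) (rsq x) * Y (fst k) (snd k) x)"] by blast
  show ?thesis
  proof (rule that)
    show "C2 (poly_mode_sum I (potential_coeffs p)) (\<lambda>i x. \<Sum>k\<in>I. fst (B k) i x) (\<lambda>i x. \<Sum>k\<in>I. snd (B k) i x)"
      unfolding poly_mode_sum_def[abs_def] by (rule C2_sum[OF assms B(1)])
    show "(\<Sum>i\<in>UNIV. \<Sum>k\<in>I. snd (B k) i x) = - poly_mode_sum I p x" for x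
      by (subst sum.swap) (simp add: B(2) poly_mode_sum_def sum_negf)
  qed
qed

lemma poly_mode_sum_potential_bd: "norm x = 1 \<Longrightarrow> poly_mode_sum I (potential_coeffs p) x = 0"
  by (simp add: poly_mode_sum_def rsq_norm potential_coeffs_def poly_radial_inverse_1)

lemma C2_diff:
  assumes "C2 A A1 A2" "C2 B B1 B2"
  shows "C2 (\<lambda>x. A x - B x) (\<lambda>i x. A1 i x - B1 i x) (\<lambda>i x. A2 i x - B2 i x)"
  using assms unfolding C2_def by (intro conjI allI has_partial_diff continuous_intros) blast+

text \<open>The right-hand side is approximated by polynomials in \<open>L\<^sup>2\<close>. By the supremum bound their
  explicit potentials form a uniform Cauchy sequence, so the limit is continuous up to the circle,
  vanishes on it, and inherits the weak equation. Besides existence, the approximating potentials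
  and the rate are part of the statement, because estimates for the Green operator are obtained as
  limits of estimates for polynomials.\<close>

lemma green_approximation:
  assumes w: "w \<in> LI"
  obtains u I p C where "dirichlet_solution w u" "0 < C"
    "\<And>k. finite (I k)" "\<And>k. (LINT x|MD. (poly_mode_sum (I k) (p k) x - w x)^2) \<le> (1 / real (Suc k))^2"
    "\<And>k x. x \<in> disk \<Longrightarrow> \<bar>poly_mode_sum (I k) (potential_coeffs (p k)) x - u x\<bar> \<le> C / real (Suc k)"
proof -
  have "\<exists>I p. finite I \<and> (LINT x|MD. (poly_mode_sum I p x - w x)^2) \<le> (1 / real (Suc k))^2" for k
  proof -
    obtain g where "modal g" "(LINT x|MD. (g x - w x)^2) \<le> (1 / real (Suc k))^2"
      by (rule modal_dense_L2[OF w, of "1 / real (Suc k)"]) auto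
    then show ?thesis unfolding modal_def by blast
  qed
  then have "\<exists>I. \<forall>k. \<exists>p. finite (I k) \<and> (LINT x|MD. (poly_mode_sum (I k) p x - w x)^2) \<le> (1 / real (Suc k))^2"
    by (intro choice) blast
  then obtain I where "\<forall>k. \<exists>p. finite (I k) \<and> (LINT x|MD. (poly_mode_sum (I k) p x - w x)^2) \<le> (1 / real (Suc k))^2" ..
  from choice[OF this] obtain p where
    "\<forall>k. finite (I k) \<and> (LINT x|MD. (poly_mode_sum (I k) (p k) x - w x)^2) \<le> (1 / real (Suc k))^2" ..
  then have Ip: "\<And>k. finite (I k)" "\<And>k. (LINT x|MD. (poly_mode_sum (I k) (p k) x - w x)^2) \<le> (1 / real (Suc k))^2"
    by auto
  define h where "h k = 1 / real (Suc k)" for k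
  have h: "h k > 0" for k by (simp add: h_def)
  have h0: "h \<longlonglongrightarrow> 0" unfolding h_def by (rule LIMSEQ_Suc[OF lim_1_over_n])
  define W where "W k = poly_mode_sum (I k) (p k)" for k
  define A where "A k = poly_mode_sum (I k) (potential_coeffs (p k))" for k
  have WL: "W k \<in> LI" for k unfolding W_def by (intro Linf_cont continuous_poly_mode_sum Ip)
  have Wh: "(LINT x|MD. (W k x - w x)^2) \<le> (h k)^2" for k using Ip(2) by (simp add: W_def h_def)
  have bdA: "A k x = 0" if "norm x = 1" for k x using poly_mode_sum_potential_bd[OF that] by (simp add: A_def)
  have "\<exists>A1 A2. C2 (A k) A1 A2 \<and> (\<forall>x. (\<Sum>i\<in>UNIV. A2 i x) = - W k x)" for k
    unfolding A_def W_def by (rule poly_mode_sum_potential_C2[OF Ip(1), of k "p k"]) blast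
  then obtain A1 A2 where A: "\<And>k. C2 (A k) (A1 k) (A2 k)" "\<And>k x. (\<Sum>i\<in>UNIV. A2 k i x) = - W k x" by metis
  obtain C where C: "0 < C" "\<And>A A1 A2 a x. C2 A A1 A2 \<Longrightarrow> (\<And>x. norm x = 1 \<Longrightarrow> A x = 0) \<Longrightarrow> 0 < a \<Longrightarrow>
     (LINT x|MD. \<bar>\<Sum>i\<in>UNIV. A2 i x\<bar> powr 2) \<le> a powr 2 \<Longrightarrow> norm x \<le> 1 \<Longrightarrow> \<bar>A x\<bar> \<le> C * a"
    using sup_bound_Lq[of 2] by auto
  have Cauchy: "\<bar>A k x - A l x\<bar> \<le> C * (2 * (h k + h l))" if x: "norm x \<le> 1" for k l x
  proof (rule C(2)[OF C2_diff[OF A(1) A(1)]])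
    show "0 < 2 * (h k + h l)" using h[of k] h[of l] by simp
    have i: "integrable MD (\<lambda>x. (W k x - W l x)^2)" "integrable MD (\<lambda>x. (W k x - w x)^2)" for k l
      by (intro Linf_integrable Linf_power Linf_diff WL w)+
    have "(LINT x|MD. \<bar>\<Sum>i\<in>UNIV. A2 k i x - A2 l i x\<bar> powr 2) = (LINT x|MD. (W k x - W l x)^2)"
      by (rule Bochner_Integration.integral_cong) (auto simp: sum_subtractf A(2) power2_commute)
    also have "\<dots> \<le> (LINT x|MD. 2 * (W k x - w x)^2 + 2 * (W l x - w x)^2)"
    proof (rule integral_mono)
      fix x
      have "0 \<le> ((W k x - w x) + (W l x - w x))^2" by simp
      then show "(W k x - W l x)^2 \<le> 2 * (W k x - w x)^2 + 2 * (W l x - w x)^2"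
        by (simp add: power2_eq_square algebra_simps)
    qed (use i in auto)
    also have "\<dots> = 2 * (LINT x|MD. (W k x - w x)^2) + 2 * (LINT x|MD. (W l x - w x)^2)"
      using i by simp
    also have "\<dots> \<le> 2 * (h k)^2 + 2 * (h l)^2" using Wh[of k] Wh[of l] by simp
    also have "\<dots> \<le> (2 * (h k + h l))^2"
      using h[of k] h[of l] by (simp add: power2_eq_square algebra_simps)
    finally show "(LINT x|MD. \<bar>\<Sum>i\<in>UNIV. A2 k i x - A2 l i x\<bar> powr 2) \<le> (2 * (h k + h l)) powr 2"
      using h[of k] h[of l] by simp
  qed (use x bdA in auto)
  have "\<exists>y. (\<lambda>k. A k x) \<longlonglongrightarrow> y" if x: "norm x \<le> 1" for x
  proof -
    have "Cauchy (\<lambda>k. A k x)"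
    proof (rule metric_CauchyI)
      fix e :: real assume e: "0 < e"
      have "(\<lambda>k. C * (4 * h k)) \<longlonglongrightarrow> C * (4 * 0)" by (intro tendsto_intros h0)
      then have "\<forall>\<^sub>F k in sequentially. C * (4 * h k) < e" using e by (intro order_tendstoD(2)) auto
      then obtain N where N: "C * (4 * h N) < e" by (meson eventually_sequentially order_refl)
      have hm: "h k \<le> h N" if "k \<ge> N" for k using that by (simp add: h_def frac_le)
      have "dist (A k x) (A l x) < e" if "k \<ge> N" "l \<ge> N" for k l
      proof -
        have "dist (A k x) (A l x) \<le> C * (2 * (h k + h l))" using Cauchy[OF x] by (simp add: dist_real_def)
        also have "\<dots> \<le> C * (4 * h N)" using hm[OF that(1)] hm[OF that(2)] C(1) by simp
        finally show ?thesis using N by simp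
      qed
      then show "\<exists>M. \<forall>m\<ge>M. \<forall>n\<ge>M. dist (A m x) (A n x) < e" by blast
    qed
    then show ?thesis using Cauchy_convergent convergent_def by blast
  qed
  then obtain u0 where u0: "\<And>x. norm x \<le> 1 \<Longrightarrow> (\<lambda>k. A k x) \<longlonglongrightarrow> u0 x" by metis
  have close: "\<bar>A k x - u0 x\<bar> \<le> 2 * C * h k" if x: "norm x \<le> 1" for k x
  proof (rule LIMSEQ_le)
    show "(\<lambda>l. \<bar>A k x - A l x\<bar>) \<longlonglongrightarrow> \<bar>A k x - u0 x\<bar>" by (intro tendsto_intros u0 x)
    have "(\<lambda>l. C * (2 * (h k + h l))) \<longlonglongrightarrow> C * (2 * (h k + 0))" by (intro tendsto_intros h0)
    then show "(\<lambda>l. C * (2 * (h k + h l))) \<longlonglongrightarrow> 2 * C * h k" by (simp add: mult_ac)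
    show "\<exists>N. \<forall>n\<ge>N. \<bar>A k x - A n x\<bar> \<le> C * (2 * (h k + h n))" using Cauchy[OF x] by blast
  qed
  define u where "u x = (if x \<in> disk then u0 x else 0)" for x
  have uu0: "u x = u0 x" if "norm x \<le> 1" for x
  proof (cases "norm x = 1")
    case True
    then have "(\<lambda>k. A k x) = (\<lambda>k. 0)" using bdA by blast
    then have "u0 x = 0" using u0[OF that] by (simp add: LIMSEQ_const_iff)
    then show ?thesis using True by (simp add: u_def mem_disk)
  qed (use that in \<open>auto simp: u_def mem_disk\<close>)
  have cont: "continuous_on (cball 0 1) u"
  proof (rule uniform_limit_theorem)
    show "\<forall>\<^sub>F k in sequentially. continuous_on (cball 0 1) (A k)"
    proof (rule always_eventually, rule allI)
      fix k
      have "continuous_on UNIV (A k)" using A(1)[of k] by (simp add: C2_def)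
      then show "continuous_on (cball 0 1) (A k)" by (rule continuous_on_subset) simp
    qed
    show "uniform_limit (cball 0 1) A u sequentially"
    proof (rule uniform_limitI)
      fix e :: real assume e: "0 < e"
      have "(\<lambda>k. 2 * C * h k) \<longlonglongrightarrow> 2 * C * 0" by (intro tendsto_intros h0)
      then have "\<forall>\<^sub>F k in sequentially. 2 * C * h k < e" using e by (intro order_tendstoD(2)) auto
      then show "\<forall>\<^sub>F n in sequentially. \<forall>x\<in>cball 0 1. dist (A n x) (u x) < e"
        by eventually_elim (auto simp: dist_real_def uu0 intro: le_less_trans[OF close])
    qed
  qed simp
  have uL: "u \<in> LI" by (rule Linf_cont_cball[OF cont])
  have sol: "dirichlet_solution w u"
    unfolding dirichlet_solution_def set_integral_MD closure_disk
  proof (intro conjI allI impI ballI cont)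
    fix \<phi> assume \<phi>: "\<phi> \<in> test_functions disk"
    note tC = test_C2[OF \<phi>, unfolded C2_def]
    have cl: "continuous_on UNIV (laplacian \<phi>)"
      unfolding laplacian_def[abs_def] using tC by (auto intro!: continuous_intros)
    have c\<phi>: "continuous_on UNIV \<phi>" using tC by blast
    obtain B where B: "0 < B" "\<And>x. norm x \<le> 1 \<Longrightarrow> \<bar>laplacian \<phi> x\<bar> \<le> B"
      using continuous_bounded_disk[OF cl] by blast
    obtain B' where B': "0 < B'" "\<And>x. norm x \<le> 1 \<Longrightarrow> \<bar>\<phi> x\<bar> \<le> B'"
      using continuous_bounded_disk[OF c\<phi>] by blast
    have AL: "A k \<in> LI" for k using A(1) by (auto simp: C2_def intro: Linf_cont)
    have eqk: "(LINT x|MD. A k x * - laplacian \<phi> x) = (LINT x|MD. W k x * \<phi> x)" for k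
    proof -
      have "dirichlet_solution (W k) (\<lambda>x. if x \<in> disk then A k x else 0)"
        by (rule C2_dirichlet[OF A(1) bdA]) (auto simp: A(2))
      then have "(LINT x|MD. (if x \<in> disk then A k x else 0) * - laplacian \<phi> x) = (LINT x|MD. W k x * \<phi> x)"
        using \<phi> by (auto simp: dirichlet_solution_def set_integral_MD)
      moreover have "(LINT x|MD. (if x \<in> disk then A k x else 0) * - laplacian \<phi> x) = (LINT x|MD. A k x * - laplacian \<phi> x)"
        by (rule Bochner_Integration.integral_cong) auto
      ultimately show ?thesis by simp
    qed
    have iu: "integrable MD (\<lambda>x. f x * - laplacian \<phi> x)" if "f \<in> LI" for f
      using Linf_integrable[OF Linf_mult[OF that Linf_cont[OF cl]]] by simp
    have iw: "integrable MD (\<lambda>x. f x * \<phi> x)" if "f \<in> LI" for f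
      using Linf_integrable[OF Linf_mult[OF that Linf_cont[OF c\<phi>]]] .
    have l1: "(\<lambda>k. LINT x|MD. A k x * - laplacian \<phi> x) \<longlonglongrightarrow> (LINT x|MD. u x * - laplacian \<phi> x)"
    proof (rule LIM_zero_cancel, rule Lim_null_comparison)
      show "(\<lambda>k. 2 * C * h k * B * pi) \<longlonglongrightarrow> 0"
        using tendsto_mult[OF tendsto_mult[OF tendsto_mult[OF tendsto_const[of "2*C"] h0] tendsto_const[of B]] tendsto_const[of pi]] by simp
      show "\<forall>\<^sub>F k in sequentially. norm ((LINT x|MD. A k x * - laplacian \<phi> x) - (LINT x|MD. u x * - laplacian \<phi> x)) \<le> 2 * C * h k * B * pi"
      proof (rule always_eventually, rule allI)
        fix k
        have "(LINT x|MD. A k x * - laplacian \<phi> x) - (LINT x|MD. u x * - laplacian \<phi> x) = (LINT x|MD. (A k x - u x) * - laplacian \<phi> x)"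
          using iu[OF AL] iu[OF uL] by (simp add: left_diff_distrib)
        also have "norm \<dots> \<le> (LINT x|MD. norm ((A k x - u x) * - laplacian \<phi> x))" by (rule integral_norm_bound)
        also have "\<dots> \<le> (LINT x|MD. 2 * C * h k * B)"
        proof (rule integral_mono)
          show "integrable MD (\<lambda>x. norm ((A k x - u x) * - laplacian \<phi> x))"
            by (intro integrable_norm iu Linf_diff AL uL)
          show "integrable MD (\<lambda>x. 2 * C * h k * B)" by (rule Linf_integrable[OF Linf_const])
          fix x assume "x \<in> space MD"
          then have x: "norm x \<le> 1" by (simp add: mem_disk)
          have "\<bar>A k x - u x\<bar> * \<bar>laplacian \<phi> x\<bar> \<le> (2 * C * h k) * B"
            using close[OF x, of k] B(2)[OF x] C(1) h[of k] by (intro mult_mono) (auto simp: uu0[OF x])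
          then show "norm ((A k x - u x) * - laplacian \<phi> x) \<le> 2 * C * h k * B" by (simp add: abs_mult)
        qed
        also have "\<dots> = 2 * C * h k * B * pi" by (simp add: measure_MD)
        finally show "norm ((LINT x|MD. A k x * - laplacian \<phi> x) - (LINT x|MD. u x * - laplacian \<phi> x)) \<le> 2 * C * h k * B * pi" .
      qed
    qed
    have l2: "(\<lambda>k. LINT x|MD. W k x * \<phi> x) \<longlonglongrightarrow> (LINT x|MD. w x * \<phi> x)"
    proof (rule LIM_zero_cancel, rule Lim_null_comparison)
      show "(\<lambda>k. 3 * h k * B') \<longlonglongrightarrow> 0"
        using tendsto_mult[OF tendsto_mult[OF tendsto_const[of 3] h0] tendsto_const[of B']] by simp
      show "\<forall>\<^sub>F k in sequentially. norm ((LINT x|MD. W k x * \<phi> x) - (LINT x|MD. w x * \<phi> x)) \<le> 3 * h k * B'"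
      proof (rule always_eventually, rule allI)
        fix k
        have d: "(\<lambda>x. W k x - w x) \<in> LI" by (intro Linf_diff WL w)
        have "(LINT x|MD. W k x * \<phi> x) - (LINT x|MD. w x * \<phi> x) = (LINT x|MD. (W k x - w x) * \<phi> x)"
          using iw[OF WL] iw[OF w] by (simp add: left_diff_distrib)
        also have "norm \<dots> \<le> (LINT x|MD. norm ((W k x - w x) * \<phi> x))" by (rule integral_norm_bound)
        also have "\<dots> \<le> (LINT x|MD. \<bar>W k x - w x\<bar> * B')"
        proof (rule integral_mono)
          show "integrable MD (\<lambda>x. norm ((W k x - w x) * \<phi> x))" by (intro integrable_norm iw d)
          show "integrable MD (\<lambda>x. \<bar>W k x - w x\<bar> * B')"
            by (intro integrable_mult_left Linf_integrable Linf_abs d)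
          fix x assume "x \<in> space MD"
          then show "norm ((W k x - w x) * \<phi> x) \<le> \<bar>W k x - w x\<bar> * B'"
            using B'(2)[of x] by (auto simp: mem_disk abs_mult intro!: mult_left_mono)
        qed
        also have "\<dots> = (LINT x|MD. \<bar>W k x - w x\<bar>) * B'" by simp
        also have "\<dots> \<le> 3 * h k * B'"
          using L1_le_L2[OF d h Wh] B'(1) by (intro mult_right_mono) auto
        finally show "norm ((LINT x|MD. W k x * \<phi> x) - (LINT x|MD. w x * \<phi> x)) \<le> 3 * h k * B'" .
      qed
    qed
    show "(LINT x|MD. u x * - laplacian \<phi> x) = (LINT x|MD. w x * \<phi> x)"
      using LIMSEQ_unique[OF l1[unfolded eqk] l2] .
  qed (simp add: u_def)
  show ?thesis
  proof (rule that[OF sol, of "2 * C" I p])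
    show "\<bar>poly_mode_sum (I k) (potential_coeffs (p k)) x - u x\<bar> \<le> 2 * C / real (Suc k)" if "x \<in> disk" for k x
      using close[of x k] that uu0[of x] by (simp add: A_def h_def mem_disk)
  qed (use C Ip in auto)
qed

section \<open>Smooth cut-off functions\<close>

text \<open>The flat functions \<open>P(1/t) e\<^bsup>-1/t\<^esup>\<close>, extended by zero. Allowing polynomial factors makes the
  family closed under differentiation.\<close>

definition psi :: "real poly \<Rightarrow> real \<Rightarrow> real" where
  "psi P t = (if t > 0 then poly P (1 / t) * exp (- (1 / t)) else 0)"

lemma poly_exp_tendsto_0: "((\<lambda>y. poly P y * exp (- y)) \<longlongrightarrow> 0) at_top" for P :: "real poly"
proof -
  have "((\<lambda>y. \<Sum>i\<le>degree P. coeff P i * (y ^ i / exp y)) \<longlongrightarrow> (\<Sum>i\<le>degree P. coeff P i * 0)) at_top"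
    by (intro tendsto_intros tendsto_power_div_exp_0)
  moreover have "(\<lambda>y. \<Sum>i\<le>degree P. coeff P i * (y ^ i / exp y)) = (\<lambda>y. poly P y * exp (- y))"
    by (simp add: fun_eq_iff poly_altdef sum_distrib_right exp_minus divide_inverse mult.assoc)
  ultimately show ?thesis by simp
qed

lemma DERIV_psi: "(psi P has_real_derivative psi ([:0, 0, 1:] * (P - pderiv P)) t) (at t)"
proof -
  consider "t > 0" | "t < 0" | "t = 0" by linarith
  then show ?thesis
  proof cases
    case 1
    have "((\<lambda>t. poly P (1 / t) * exp (- (1 / t))) has_real_derivative psi ([:0, 0, 1:] * (P - pderiv P)) t) (at t)"
      using 1 by (auto intro!: derivative_eq_intros DERIV_chain2[OF poly_DERIV] simp: psi_def field_simps power2_eq_square)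
    then show ?thesis
      by (rule has_field_derivative_transform_within_open[where S="{0<..}"]) (use 1 in \<open>auto simp: psi_def\<close>)
  next
    case 2
    have "((\<lambda>t. 0) has_real_derivative psi ([:0, 0, 1:] * (P - pderiv P)) t) (at t)"
      using 2 by (simp add: psi_def)
    then show ?thesis
      by (rule has_field_derivative_transform_within_open[where S="{..<0}"]) (use 2 in \<open>auto simp: psi_def\<close>)
  next
    case 3
    have r: "((\<lambda>h. psi P h / h) \<longlongrightarrow> 0) (at_right 0)"
    proof -
      have "((\<lambda>h. poly (pCons 0 P) (inverse h) * exp (- inverse h)) \<longlongrightarrow> 0) (at_right 0)"
        by (rule filterlim_compose[OF poly_exp_tendsto_0 filterlim_inverse_at_top_right])
      moreover have "\<forall>\<^sub>F h in at_right 0. poly (pCons 0 P) (inverse h) * exp (- inverse h) = psi P h / h"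
        using eventually_at_right_less[of 0] by eventually_elim (simp add: psi_def field_simps)
      ultimately show ?thesis by (rule Lim_transform_eventually)
    qed
    have l: "((\<lambda>h. psi P h / h) \<longlongrightarrow> 0) (at_left 0)"
    proof (rule Lim_transform_eventually[OF tendsto_const])
      show "\<forall>\<^sub>F h in at_left 0. 0 = psi P h / h"
        unfolding eventually_at_filter by (simp add: psi_def)
    qed
    have "((\<lambda>h. psi P h / h) \<longlongrightarrow> 0) (at 0)" using filterlim_split_at[OF l r] .
    then show ?thesis using 3 by (simp add: has_field_derivative_iff psi_def)
  qed
qed

text \<open>A class of functions that contains the cut-off functions and is closed under
  differentiation; smoothness of all its members then follows at once.\<close>

inductive smooth_expr :: "(real \<Rightarrow> real) \<Rightarrow> bool" where
  const: "smooth_expr (\<lambda>t. c)"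
| ident: "smooth_expr (\<lambda>t. t)"
| psi: "smooth_expr (psi P)"
| affine: "smooth_expr g \<Longrightarrow> smooth_expr (\<lambda>t. g (a + b * t))"
| add: "smooth_expr f \<Longrightarrow> smooth_expr g \<Longrightarrow> smooth_expr (\<lambda>t. f t + g t)"
| mult: "smooth_expr f \<Longrightarrow> smooth_expr g \<Longrightarrow> smooth_expr (\<lambda>t. f t * g t)"
| inverse: "smooth_expr f \<Longrightarrow> (\<And>t. f t \<noteq> 0) \<Longrightarrow> smooth_expr (\<lambda>t. inverse (f t))"

lemma smooth_expr_DERIV: "smooth_expr f \<Longrightarrow> \<exists>f'. smooth_expr f' \<and> (\<forall>t. (f has_real_derivative f' t) (at t))"
proof (induction rule: smooth_expr.induct)
  case (const c)
  show ?case by (intro exI[of _ "\<lambda>t. 0"]) (auto intro: smooth_expr.const)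
next
  case ident
  show ?case by (intro exI[of _ "\<lambda>t. 1"]) (auto intro: smooth_expr.const)
next
  case (psi P)
  show ?case using DERIV_psi smooth_expr.psi by blast
next
  case (affine g a b)
  then obtain g' where g: "smooth_expr g'" "\<And>t. (g has_real_derivative g' t) (at t)" by blast
  have "((\<lambda>t. g (a + b * t)) has_real_derivative b * g' (a + b * t)) (at t)" for t
  proof -
    have "((\<lambda>t. a + b * t) has_real_derivative b) (at t)" by (auto intro!: derivative_eq_intros)
    from DERIV_chain2[OF g(2) this] show ?thesis by (simp add: mult.commute)
  qed
  then show ?case by (intro exI[of _ "\<lambda>t. b * g' (a + b * t)"] conjI allI smooth_expr.mult smooth_expr.const smooth_expr.affine g)
next
  case (add f g)
  then obtain f' g' where "smooth_expr f'" "smooth_expr g'" "\<And>t. (f has_real_derivative f' t) (at t)"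
    "\<And>t. (g has_real_derivative g' t) (at t)" by blast
  then show ?case by (intro exI[of _ "\<lambda>t. f' t + g' t"] conjI allI smooth_expr.add DERIV_add)
next
  case (mult f g)
  then obtain f' g' where d: "smooth_expr f'" "smooth_expr g'" "\<And>t. (f has_real_derivative f' t) (at t)"
    "\<And>t. (g has_real_derivative g' t) (at t)" by blast
  show ?case
  proof (intro exI[of _ "\<lambda>t. f' t * g t + g' t * f t"] conjI allI)
    show "smooth_expr (\<lambda>t. f' t * g t + g' t * f t)" by (intro smooth_expr.add smooth_expr.mult d mult)
  qed (intro DERIV_mult d)
next
  case (inverse f)
  then obtain f' where d: "smooth_expr f'" "\<And>t. (f has_real_derivative f' t) (at t)" by blast
  have "((\<lambda>t. inverse (f t)) has_real_derivative (-1) * (inverse (f t) * f' t * inverse (f t))) (at t)" for t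
    using DERIV_inverse'[OF d(2) inverse(2)] by simp
  moreover have "smooth_expr (\<lambda>t. (-1) * (inverse (f t) * f' t * inverse (f t)))"
    by (intro smooth_expr.mult smooth_expr.const smooth_expr.inverse inverse d)
  ultimately show ?case by blast
qed

lemma smooth_expr_poly: "smooth_expr (poly P)"
proof (induction P)
  case 0
  have "poly 0 = (\<lambda>t::real. 0)" by auto
  then show ?case using smooth_expr.const[of 0] by simp
next
  case (pCons a P)
  have "poly (pCons a P) = (\<lambda>t. a + t * poly P t)" by auto
  then show ?case using smooth_expr.add[OF smooth_expr.const[of a] smooth_expr.mult[OF smooth_expr.ident pCons.IH]] by simp
qed

text \<open>The corresponding class in the plane: products of coordinates with radial functions, again
  closed under partial derivatives.\<close>

inductive smooth_planar :: "(plane \<Rightarrow> real) \<Rightarrow> bool" where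
  coord: "smooth_planar (\<lambda>x. x $ i)"
| radial: "smooth_expr g \<Longrightarrow> smooth_planar (\<lambda>x. g (rsq x))"
| add: "smooth_planar f \<Longrightarrow> smooth_planar g \<Longrightarrow> smooth_planar (\<lambda>x. f x + g x)"
| mult: "smooth_planar f \<Longrightarrow> smooth_planar g \<Longrightarrow> smooth_planar (\<lambda>x. f x * g x)"

lemma smooth_planar_const: "smooth_planar (\<lambda>x. c)"
  using smooth_planar.radial[OF smooth_expr.const[of c]] .

lemma smooth_planar_derivative:
  "smooth_planar f \<Longrightarrow> \<exists>D. (\<forall>x. (f has_derivative D x) (at x)) \<and> (\<forall>i. smooth_planar (\<lambda>x. D x (axis i 1)))"
proof (induction rule: smooth_planar.induct)
  case (coord k)
  have "((\<lambda>x. x $ k) has_derivative (\<lambda>h. h $ k)) (at x)" for x :: plane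
    by (rule bounded_linear_imp_has_derivative[OF bounded_linear_vec_nth])
  moreover have "smooth_planar (\<lambda>x. axis i 1 $ k)" for i :: 2 by (rule smooth_planar_const)
  ultimately show ?case by (intro exI[of _ "\<lambda>x h. h $ k"]) blast
next
  case (radial g)
  then obtain g' where g: "smooth_expr g'" "\<And>t. (g has_real_derivative g' t) (at t)" using smooth_expr_DERIV by blast
  have r: "(rsq has_derivative (\<lambda>h. 2 * x$1 * h$1 + 2 * x$2 * h$2)) (at x)" for x
    unfolding rsq_def[abs_def]
    by (auto intro!: derivative_eq_intros bounded_linear_imp_has_derivative[OF bounded_linear_vec_nth] simp: fun_eq_iff)
  have "((\<lambda>x. g (rsq x)) has_derivative (\<lambda>h. g' (rsq x) * (2 * x$1 * h$1 + 2 * x$2 * h$2))) (at x)" for x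
    using has_derivative_compose[OF r, of g "\<lambda>h. g' (rsq x) * h"] g(2)[of "rsq x"]
    by (simp add: has_field_derivative_def)
  moreover have "smooth_planar (\<lambda>x. g' (rsq x) * (2 * x$1 * axis i 1 $ 1 + 2 * x$2 * axis i 1 $ 2))" for i
    by (intro smooth_planar.mult smooth_planar.add smooth_planar_const smooth_planar.coord smooth_planar.radial g)
  ultimately show ?case by (intro exI[of _ "\<lambda>x h. g' (rsq x) * (2 * x$1 * h$1 + 2 * x$2 * h$2)"]) blast
next
  case (add f g)
  then obtain D E where D: "\<And>x. (f has_derivative D x) (at x)" "\<And>i. smooth_planar (\<lambda>x. D x (axis i 1))"
    and E: "\<And>x. (g has_derivative E x) (at x)" "\<And>i. smooth_planar (\<lambda>x. E x (axis i 1))" by blast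
  show ?case
    by (intro exI[of _ "\<lambda>x h. D x h + E x h"] conjI allI has_derivative_add D(1) E(1) smooth_planar.add D(2) E(2))
next
  case (mult f g)
  then obtain D E where D: "\<And>x. (f has_derivative D x) (at x)" "\<And>i. smooth_planar (\<lambda>x. D x (axis i 1))"
    and E: "\<And>x. (g has_derivative E x) (at x)" "\<And>i. smooth_planar (\<lambda>x. E x (axis i 1))" by blast
  show ?case
    by (intro exI[of _ "\<lambda>x h. f x * E x h + D x h * g x"] conjI allI has_derivative_mult D(1) E(1)
         smooth_planar.add smooth_planar.mult D(2) E(2) mult(1,2))
qed

text \<open>The notion of smoothness asks for differentiability of all iterated partial derivatives;
  each of them stays in the class.\<close>

lemma smooth_planar_smooth:
  assumes "smooth_planar f" shows "smooth f"
proof -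
  have "smooth_planar (foldr dir_deriv vs f)" if "set vs \<subseteq> Basis" for vs
    using that
  proof (induction vs)
    case (Cons v vs)
    let ?g = "foldr dir_deriv vs f"
    from Cons obtain i where v: "v = axis i 1" by (auto simp: Basis_vec_def)
    from Cons have "smooth_planar ?g" by simp
    then obtain D where D: "\<And>x. (?g has_derivative D x) (at x)" "\<And>i. smooth_planar (\<lambda>x. D x (axis i 1))"
      using smooth_planar_derivative by blast
    have "dir_deriv v ?g = (\<lambda>x. D x (axis i 1))"
      using frechet_derivative_at[OF D(1)] by (simp add: fun_eq_iff dir_deriv_def v)
    then show ?case using D(2) by simp
  qed (simp add: assms)
  then show ?thesis unfolding smooth_def using smooth_planar_derivative differentiable_def by blast
qed

lemma smooth_planar_Y: "smooth_planar (Y n s)"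
proof -
  have "smooth_planar (\<lambda>x. Re (to_complex x ^ n)) \<and> smooth_planar (\<lambda>x. Im (to_complex x ^ n))"
  proof (induction n)
    case 0
    show ?case using smooth_planar_const[of 1] smooth_planar_const[of 0] by simp
  next
    case (Suc n)
    have "smooth_planar (\<lambda>x. x$1 * Re (to_complex x ^ n) + (-1) * (x$2 * Im (to_complex x ^ n)))"
      "smooth_planar (\<lambda>x. x$1 * Im (to_complex x ^ n) + x$2 * Re (to_complex x ^ n))"
      using Suc by (intro smooth_planar.intros smooth_planar_const; blast)+
    then show ?case by (simp add: to_complex_def)
  qed
  then show ?thesis by (cases s) (auto simp: Y_def[abs_def] re_or_im_def)
qed

text \<open>A smooth transition from 0 on the left of 1 to 1 on the right of 2.\<close>

definition step :: "real \<Rightarrow> real" where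
  "step t = psi 1 (t - 1) * inverse (psi 1 (t - 1) + psi 1 (2 - t))"

lemma step_denominator: "psi 1 (t - 1) + psi 1 (2 - t) > 0"
  by (auto simp: psi_def intro: add_pos_pos)

lemma smooth_expr_step: "smooth_expr step"
proof -
  have "smooth_expr (\<lambda>t. psi 1 (- 1 + 1 * t))" "smooth_expr (\<lambda>t. psi 1 (2 + (- 1) * t))"
    by (intro smooth_expr.affine smooth_expr.psi)+
  then have *: "smooth_expr (\<lambda>t. psi 1 (t - 1))" "smooth_expr (\<lambda>t. psi 1 (2 - t))" by (simp_all add: algebra_simps)
  show ?thesis unfolding step_def[abs_def]
    by (intro smooth_expr.mult smooth_expr.inverse smooth_expr.add *) (use step_denominator less_imp_neq in metis)
qed

lemma step_0: "t \<le> 1 \<Longrightarrow> step t = 0" and step_1: "2 \<le> t \<Longrightarrow> step t = 1"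
  by (simp_all add: step_def psi_def)

lemma step_range: "0 \<le> step t" "step t \<le> 1"
proof -
  have "0 \<le> psi 1 s" for s by (simp add: psi_def)
  then have *: "0 \<le> psi 1 (t - 1)" "0 \<le> psi 1 (2 - t)" by auto
  then show "0 \<le> step t" "step t \<le> 1"
    using step_denominator[of t] by (auto simp: step_def field_simps)
qed

lemma step_derivatives:
  obtains h1 h2 K where "\<And>t. (step has_real_derivative h1 t) (at t)" "\<And>t. (h1 has_real_derivative h2 t) (at t)"
    "continuous_on UNIV h2" "0 < K" "\<And>t. \<bar>h1 t\<bar> \<le> K" "\<And>t. \<bar>h2 t\<bar> \<le> K" "\<And>t. 2 < t \<Longrightarrow> h1 t = 0" "\<And>t. 2 < t \<Longrightarrow> h2 t = 0"
proof -
  obtain h1 where h1: "smooth_expr h1" "\<And>t. (step has_real_derivative h1 t) (at t)" using smooth_expr_DERIV[OF smooth_expr_step] by blast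
  obtain h2 where h2: "smooth_expr h2" "\<And>t. (h1 has_real_derivative h2 t) (at t)" using smooth_expr_DERIV[OF h1(1)] by blast
  obtain h3 where h3: "\<And>t. (h2 has_real_derivative h3 t) (at t)" using smooth_expr_DERIV[OF h2(1)] by blast
  have z1: "h1 t = 0" if "t < 1 \<or> 2 < t" for t
  proof -
    obtain S c where S: "open S" "t \<in> S" "\<And>s. s \<in> S \<Longrightarrow> step s = c"
    proof (cases "t < 1")
      case True then show ?thesis using that[of "{..<1}" 0] step_0 by auto
    next
      case False then show ?thesis using that[of "{2<..}" 1] step_1 \<open>t < 1 \<or> 2 < t\<close> by auto
    qed
    have "((\<lambda>s. c) has_real_derivative h1 t) (at t)"
      by (rule has_field_derivative_transform_within_open[OF h1(2) S(1,2)]) (use S(3) in simp)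
    then show ?thesis using DERIV_unique DERIV_const by blast
  qed
  have z2: "h2 t = 0" if "t < 1 \<or> 2 < t" for t
  proof -
    obtain S where S: "open S" "t \<in> S" "\<And>s. s \<in> S \<Longrightarrow> h1 s = 0"
    proof (cases "t < 1")
      case True then show ?thesis using that[of "{..<1}"] z1 by auto
    next
      case False then show ?thesis using that[of "{2<..}"] z1 \<open>t < 1 \<or> 2 < t\<close> by auto
    qed
    have "((\<lambda>s. 0) has_real_derivative h2 t) (at t)"
      by (rule has_field_derivative_transform_within_open[OF h2(2) S(1,2)]) (use S(3) in simp)
    then show ?thesis using DERIV_unique DERIV_const by blast
  qed
  have c: "continuous_on UNIV h1" "continuous_on UNIV h2"
    using h2(2) h3 by (auto intro!: continuous_at_imp_continuous_on DERIV_isCont)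
  have bnd: "\<exists>K>0. \<forall>t\<in>{1..2}. \<bar>h t\<bar> \<le> K" if "continuous_on UNIV h" for h :: "real \<Rightarrow> real"
  proof -
    have "bounded (h ` {1..2})"
      by (intro compact_imp_bounded compact_continuous_image continuous_on_subset[OF that]) auto
    then show ?thesis unfolding bounded_pos by auto
  qed
  obtain K1 K2 where K: "K1 > 0" "K2 > 0" "\<And>t. 1 \<le> t \<Longrightarrow> t \<le> 2 \<Longrightarrow> \<bar>h1 t\<bar> \<le> K1" "\<And>t. 1 \<le> t \<Longrightarrow> t \<le> 2 \<Longrightarrow> \<bar>h2 t\<bar> \<le> K2"
    using bnd[OF c(1)] bnd[OF c(2)] by auto
  show ?thesis
  proof (rule that[OF h1(2) h2(2) c(2), of "max K1 K2"])
    fix t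
    show "\<bar>h1 t\<bar> \<le> max K1 K2" "\<bar>h2 t\<bar> \<le> max K1 K2"
      using K(1,2) K(3,4)[of t] z1[of t] z2[of t] by (cases "1 \<le> t \<and> t \<le> 2"; force)+
  qed (use K z1 z2 in auto)
qed

text \<open>The factor \<open>step (k (1 - \<bar>x\<bar>\<^sup>2))\<close> vanishes where \<open>1 - \<bar>x\<bar>\<^sup>2 \<le> 1/k\<close> and equals 1 where
  \<open>1 - \<bar>x\<bar>\<^sup>2 \<ge> 2/k\<close>.\<close>

lemma cutoff_test_function:
  assumes k: "1 \<le> k"
  shows "(\<lambda>x. (step (k * (1 - rsq x)) * poly U (rsq x)) * Y n s x) \<in> test_functions disk"
proof -
  let ?f = "\<lambda>x. (step (k * (1 - rsq x)) * poly U (rsq x)) * Y n s x"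
  have "smooth_expr (\<lambda>t. step (k + (- k) * t))" by (rule smooth_expr.affine[OF smooth_expr_step])
  then have "smooth_expr (\<lambda>t. step (k * (1 - t)) * poly U t)"
    by (intro smooth_expr.mult smooth_expr_poly) (simp add: algebra_simps)
  from smooth_planar.mult[OF smooth_planar.radial[OF this] smooth_planar_Y] have sm: "smooth ?f" by (rule smooth_planar_smooth)
  let ?K = "{x. rsq x \<le> 1 - 1 / k}"
  have cK: "closed ?K" by (rule closed_Collect_le[OF continuous_rsq continuous_on_const])
  have sub: "{x. ?f x \<noteq> 0} \<subseteq> ?K"
  proof
    fix x assume "x \<in> {x. ?f x \<noteq> 0}"
    then have "\<not> k * (1 - rsq x) \<le> 1" using step_0[of "k * (1 - rsq x)"] by auto
    then show "x \<in> ?K" using k by (simp add: field_simps)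
  qed
  have cl: "closure {x. ?f x \<noteq> 0} \<subseteq> ?K" by (rule closure_minimal[OF sub cK])
  have Kd: "?K \<subseteq> disk"
  proof
    fix x assume "x \<in> ?K"
    then have "rsq x \<le> 1 - 1 / k" by simp
    moreover have "0 < 1 / k" using k by simp
    ultimately have "rsq x < 1" by linarith
    then have "(norm x)^2 < 1" by (simp only: rsq_norm)
    then show "x \<in> disk" by (simp only: mem_disk abs_square_less_1 abs_norm_cancel)
  qed
  have "bounded (closure {x. ?f x \<noteq> 0})"
    by (rule bounded_subset[of disk]) (use cl Kd in \<open>auto simp: disk_def\<close>)
  then have "compact (closure {x. ?f x \<noteq> 0})" by (simp add: compact_eq_bounded_closed)
  then show ?thesis using sm cl Kd unfolding test_functions_def by blast
qed

section \<open>Uniqueness for the Dirichlet problem\<close>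

lemma abs_Y_le: "norm x \<le> 1 \<Longrightarrow> \<bar>Y n s x\<bar> \<le> 1"
proof -
  assume x: "norm x \<le> 1"
  have "\<bar>Y n s x\<bar> \<le> cmod (to_complex x ^ n)" by (simp add: Y_def re_or_im_def abs_Re_le_cmod abs_Im_le_cmod)
  also have "\<dots> = norm x ^ n" by (simp add: norm_power norm_to_complex)
  also have "\<dots> \<le> 1" using x by (intro power_le_one) auto
  finally show ?thesis .
qed

lemma measure_annulus:
  assumes "0 \<le> a" "a < 1"
  shows "{x \<in> disk. a < rsq x} \<in> sets MD" "measure MD {x \<in> disk. a < rsq x} = pi * (1 - a)"
proof -
  have sq: "norm y \<le> sqrt a \<longleftrightarrow> rsq y \<le> a" for y :: plane
  proof -
    have "rsq y \<le> a \<longleftrightarrow> sqrt ((norm y)^2) \<le> sqrt a" unfolding rsq_norm real_sqrt_le_iff ..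
    then show ?thesis by simp
  qed
  have e: "{x \<in> disk. a < rsq x} = ball 0 1 - cball 0 (sqrt a)"
    by (auto simp: disk_def sq not_le)
  then show s: "{x \<in> disk. a < rsq x} \<in> sets MD"
    by (auto simp: sets_restrict_space_iff)
  have "emeasure MD {x \<in> disk. a < rsq x} = emeasure lebesgue (ball 0 1 - cball (0::plane) (sqrt a))"
    unfolding e using e by (subst emeasure_restrict_space) auto
  also have "\<dots> = emeasure lebesgue (ball (0::plane) 1) - emeasure lebesgue (cball (0::plane) (sqrt a))"
  proof (rule emeasure_Diff)
    show "cball (0::plane) (sqrt a) \<subseteq> ball 0 1"
    proof
      fix x :: plane assume "x \<in> cball 0 (sqrt a)"
      moreover have "sqrt a < 1" using assms by simp
      ultimately show "x \<in> ball 0 1" unfolding mem_ball mem_cball by linarith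
    qed
  qed (use assms emeasure_cball_plane[of "sqrt a" 0] in auto)
  also have "\<dots> = ennreal (pi * (1 - a))"
    using assms by (simp add: emeasure_ball_plane emeasure_cball_plane ennreal_minus algebra_simps)
  finally show "measure MD {x \<in> disk. a < rsq x} = pi * (1 - a)"
    using assms by (simp add: measure_def)
qed

lemma poly_bound: "\<exists>B>0. \<forall>t\<in>{0..1}. \<bar>poly U t\<bar> \<le> (B::real)"
proof -
  have "bounded (poly U ` {0..1})"
    by (intro compact_imp_bounded compact_continuous_image) (auto intro!: continuous_intros)
  then show ?thesis unfolding bounded_pos by auto
qed

lemma continuous_small_near_boundary:
  fixes d :: "plane \<Rightarrow> real"
  assumes cd: "continuous_on (cball 0 1) d" and d0: "\<And>x. norm x = 1 \<Longrightarrow> d x = 0" and e: "0 < e"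
  obtains a where "0 < a" "\<And>x. x \<in> disk \<Longrightarrow> 1 - a < rsq x \<Longrightarrow> \<bar>d x\<bar> \<le> e"
proof -
  have "uniformly_continuous_on (cball 0 1) d" by (rule compact_uniformly_continuous[OF cd]) simp
  then obtain a where a: "0 < a" "\<And>x y. norm x \<le> 1 \<Longrightarrow> norm y \<le> 1 \<Longrightarrow> dist y x < a \<Longrightarrow> dist (d y) (d x) < e"
    unfolding uniformly_continuous_on_def using e by fastforce
  show ?thesis
  proof (rule that[of "min a 1"])
    fix x assume x: "x \<in> disk" "1 - min a 1 < rsq x"
    then have nx: "norm x < 1" "rsq x > 0" by (auto simp: mem_disk)
    then have x0: "norm x > 0" by (auto simp: rsq_norm)
    have "rsq x \<le> norm x" unfolding rsq_norm power2_eq_square using nx(1) by (simp add: mult_left_le)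
    then have "1 - norm x < a" using x(2) by linarith
    moreover have "norm (x - (1 / norm x) *\<^sub>R x) = 1 - norm x"
    proof -
      have "x - (1 / norm x) *\<^sub>R x = (1 - 1 / norm x) *\<^sub>R x" by (simp add: scaleR_left_diff_distrib)
      then have "norm (x - (1 / norm x) *\<^sub>R x) = \<bar>1 - 1 / norm x\<bar> * norm x" by simp
      also have "\<dots> = 1 - norm x" using nx x0 by (simp add: abs_if field_simps)
      finally show ?thesis .
    qed
    ultimately have "dist (d x) (d ((1 / norm x) *\<^sub>R x)) < e"
      using a(2)[of "(1 / norm x) *\<^sub>R x" x] nx x0 by (simp add: dist_norm)
    moreover have "d ((1 / norm x) *\<^sub>R x) = 0" using x0 by (intro d0) simp
    ultimately show "\<bar>d x\<bar> \<le> e" by simp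
  qed (use a in simp)
qed

text \<open>A continuous function \<open>d\<close> that is zero on the circle and orthogonal to the Laplacians of
  test functions is also orthogonal to the Laplacian of a mode \<open>U Y\<close> that vanishes on the circle
  only to first order. To see this the mode is cut off at distance about \<open>1/k\<close> from the circle.
  The Laplacian of the cut-off mode differs from that of the mode only on an annulus of area
  \<open>3 \<pi> / k\<close>. There the difference is \<open>O(k)\<close>: two derivatives of the cut-off cost \<open>k\<^sup>2\<close>, but they
  are multiplied by \<open>U = O(1/k)\<close>. Since \<open>\<bar>d\<bar>\<close> is small near the circle, the error tends to zero.\<close>

lemma harmonic_orthogonal_modes:
  assumes cd: "continuous_on (cball 0 1) d" and d0: "\<And>x. norm x = 1 \<Longrightarrow> d x = 0"
    and hd: "\<And>\<phi>. \<phi> \<in> test_functions disk \<Longrightarrow> (LINT x|MD. d x * laplacian \<phi> x) = 0"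
    and U: "poly U 1 = 0"
  shows "(LINT x|MD. d x * (4 * (rsq x * poly (pderiv (pderiv U)) (rsq x) + (real n + 1) * poly (pderiv U) (rsq x)) * Y n s x)) = 0"
proof -
  define LU where "LU t = 4 * (t * poly (pderiv (pderiv U)) t + (real n + 1) * poly (pderiv U) t)" for t
  have dL: "d \<in> LI" by (rule Linf_cont_cball[OF cd])
  obtain h1 h2 K where h: "\<And>t. (step has_real_derivative h1 t) (at t)" "\<And>t. (h1 has_real_derivative h2 t) (at t)"
    "continuous_on UNIV h2" "0 < K" "\<And>t. \<bar>h1 t\<bar> \<le> K" "\<And>t. \<bar>h2 t\<bar> \<le> K" "\<And>t. 2 < t \<Longrightarrow> h1 t = 0" "\<And>t. 2 < t \<Longrightarrow> h2 t = 0"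
    using step_derivatives by blast
  obtain B0 where B0: "0 < B0" "\<And>t. 0 \<le> t \<Longrightarrow> t \<le> 1 \<Longrightarrow> \<bar>LU t\<bar> \<le> B0"
  proof -
    let ?Q = "smult 4 (pCons 0 (pderiv (pderiv U)) + smult (real n + 1) (pderiv U))"
    have "poly ?Q t = LU t" for t by (simp add: LU_def)
    then show ?thesis using that poly_bound[of ?Q] by auto
  qed
  obtain B1 where B1: "0 < B1" "\<And>t. 0 \<le> t \<Longrightarrow> t \<le> 1 \<Longrightarrow> \<bar>poly (pderiv U) t\<bar> \<le> B1"
    using poly_bound[of "pderiv U"] by auto
  \<comment> \<open>Dividing by \<open>t - 1\<close> makes \<open>U = O(1 - t)\<close> explicit.\<close>
  obtain V where V: "U = [:-1, 1:] * V" using U by (metis poly_eq_0_iff_dvd dvd_def)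
  obtain B2 where B2: "0 < B2" "\<And>t. 0 \<le> t \<Longrightarrow> t \<le> 1 \<Longrightarrow> \<bar>poly V t\<bar> \<le> B2"
    using poly_bound[of V] by auto
  have UB: "\<bar>poly U t\<bar> \<le> (1 - t) * B2" if "0 \<le> t" "t \<le> 1" for t
  proof -
    have "poly U t = (t - 1) * poly V t" by (subst V) (simp add: algebra_simps)
    then have "\<bar>poly U t\<bar> = (1 - t) * \<bar>poly V t\<bar>" using that by (simp add: abs_mult)
    also have "\<dots> \<le> (1 - t) * B2" using that B2 by (intro mult_left_mono) auto
    finally show ?thesis .
  qed
  define BD where "BD = B0 + 4 * (3 * K * B2 + 2 * K * B1 + (real n + 1) * K * 3 * B2)"
  have BD: "BD > 0" unfolding BD_def using B0(1) B1(1) B2(1) h(4) by (intro add_pos_nonneg) auto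
  define I where "I = (LINT x|MD. d x * (LU (rsq x) * Y n s x))"
  have small: "\<bar>I\<bar> \<le> e * (BD * pi * 3)" if e: "0 < e" for e
  proof -
    obtain a where a: "0 < a" "\<And>x. x \<in> disk \<Longrightarrow> 1 - a < rsq x \<Longrightarrow> \<bar>d x\<bar> \<le> e"
      using continuous_small_near_boundary[OF cd d0 e] by blast
    \<comment> \<open>The annulus \<open>1 - 3/k < \<bar>x\<bar>\<^sup>2\<close> must lie where \<open>\<bar>d\<bar> \<le> e\<close>.\<close>
    define k where "k = 3 + 3 / a"
    have k: "k \<ge> 3" "3 / k \<le> a" using a(1) by (auto simp: k_def field_simps)
    let ?V = "\<lambda>t. step (k * (1 - t)) * poly U t"
    let ?V1 = "\<lambda>t. - k * h1 (k * (1 - t)) * poly U t + step (k * (1 - t)) * poly (pderiv U) t"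
    let ?V2 = "\<lambda>t. k^2 * h2 (k * (1 - t)) * poly U t - 2 * k * h1 (k * (1 - t)) * poly (pderiv U) t + step (k * (1 - t)) * poly (pderiv (pderiv U)) t"
    have ds: "((\<lambda>t. step (k * (1 - t))) has_real_derivative - k * h1 (k * (1 - t))) (at t)"
      "((\<lambda>t. h1 (k * (1 - t))) has_real_derivative - k * h2 (k * (1 - t))) (at t)" for t
    proof -
      have l: "((\<lambda>t. k * (1 - t)) has_real_derivative - k) (at t)" by (auto intro!: derivative_eq_intros)
      show "((\<lambda>t. step (k * (1 - t))) has_real_derivative - k * h1 (k * (1 - t))) (at t)"
        "((\<lambda>t. h1 (k * (1 - t))) has_real_derivative - k * h2 (k * (1 - t))) (at t)"
        using DERIV_chain2[OF h(1) l] DERIV_chain2[OF h(2) l] by (simp_all add: mult.commute)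
    qed
    have d1: "(?V has_real_derivative ?V1 t) (at t)" for t
      by (rule derivative_eq_intros ds poly_DERIV refl | simp)+
    have d2: "(?V1 has_real_derivative ?V2 t) (at t)" for t
      by (rule derivative_eq_intros ds poly_DERIV refl | simp add: power2_eq_square algebra_simps)+
    have cs: "continuous_on UNIV step" "continuous_on UNIV h1"
      using h(1,2) by (auto intro!: continuous_at_imp_continuous_on DERIV_isCont)
    have c2: "continuous_on UNIV ?V2"
      by (intro continuous_intros continuous_on_compose2[OF h(3)] continuous_on_compose2[OF cs(1)] continuous_on_compose2[OF cs(2)]) auto
    obtain A1 A2 where A: "C2 (\<lambda>x. ?V (rsq x) * Y n s x) A1 A2"
      "\<And>x. (\<Sum>i\<in>UNIV. A2 i x) = 4 * (rsq x * ?V2 (rsq x) + (real n + 1) * ?V1 (rsq x)) * Y n s x"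
      by (rule mode_C2[OF d1 d2 c2]) blast
    let ?phi = "\<lambda>x. ?V (rsq x) * Y n s x"
    have t\<phi>: "?phi \<in> test_functions disk" using cutoff_test_function[of k U n s] k by simp
    have "laplacian ?phi x = (\<Sum>i\<in>UNIV. A2 i x)" for x
    proof -
      note tC = test_C2[OF t\<phi>]
      have u1: "f' = g'" if "has_partial i f f'" "has_partial i f g'" for i f f' g'
        using that unfolding has_partial_def by (auto intro: DERIV_unique)
      have 1: "dir_deriv (axis i 1) ?phi = A1 i" for i
        using tC A(1) u1[of i ?phi] unfolding C2_def by blast
      have "dir_deriv (axis i 1) (dir_deriv (axis i 1) ?phi) = A2 i" for i
        using tC A(1) u1[of i "A1 i"] unfolding C2_def 1 by blast
      then show ?thesis by (simp add: laplacian_def)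
    qed
    then have z: "(LINT x|MD. d x * (4 * (rsq x * ?V2 (rsq x) + (real n + 1) * ?V1 (rsq x)) * Y n s x)) = 0"
      using hd[OF t\<phi>] by (simp add: A(2))
    let ?W = "\<lambda>x. 4 * (rsq x * ?V2 (rsq x) + (real n + 1) * ?V1 (rsq x)) * Y n s x"
    let ?X = "\<lambda>x. LU (rsq x) * Y n s x"
    have cW: "continuous_on UNIV ?W"
    proof -
      have "continuous_on UNIV (A2 i)" for i using A(1) unfolding C2_def by blast
      then have "continuous_on UNIV (\<lambda>x. \<Sum>i\<in>UNIV. A2 i x)" by (intro continuous_intros)
      then show ?thesis by (simp only: A(2))
    qed
    have cX: "continuous_on UNIV ?X"
      unfolding LU_def by (intro continuous_intros)
    have il: "integrable MD (\<lambda>x. d x * ?W x)" "integrable MD (\<lambda>x. d x * ?X x)"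
      by (intro Linf_integrable Linf_mult dL Linf_cont cW cX)+
    let ?S = "{x \<in> disk. 1 - 3 / k < rsq x}"
    have S: "?S \<in> sets MD" "measure MD ?S = pi * (3 / k)"
      using measure_annulus[of "1 - 3 / k"] k(1) by auto
    have Ieq: "I = (LINT x|MD. d x * ?X x - d x * ?W x)" unfolding I_def using il z by simp
    have "\<bar>I\<bar> \<le> (LINT x|MD. norm (d x * ?X x - d x * ?W x))"
      unfolding Ieq real_norm_def[symmetric] by (rule integral_norm_bound)
    also have "\<dots> \<le> (LINT x|MD. (e * (BD * k)) * indicator ?S x)"
    proof (rule integral_mono)
      show "integrable MD (\<lambda>x. norm (d x * ?X x - d x * ?W x))" using il by auto
      show "integrable MD (\<lambda>x. (e * (BD * k)) * indicator ?S x)"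
        using S(1) finite_measure.emeasure_finite[OF finite_measure_MD, of ?S]
        by (intro integrable_mult_right integrable_real_indicator) (auto simp: top.not_eq_extremum)
      fix x assume "x \<in> space MD"
      then have x: "x \<in> disk" by simp
      define t where "t = rsq x"
      have t: "0 \<le> t" "t \<le> 1" using x by (auto simp: t_def rsq_norm mem_disk power_le_one)
      have Yx: "\<bar>Y n s x\<bar> \<le> 1" using abs_Y_le x by (simp add: mem_disk)
      define D where "D = LU t - 4 * (t * ?V2 t + (real n + 1) * ?V1 t)"
      have eq: "d x * ?X x - d x * ?W x = d x * (D * Y n s x)" by (simp add: D_def t_def algebra_simps)
      show "norm (d x * ?X x - d x * ?W x) \<le> (e * (BD * k)) * indicator ?S x"
      proof (cases "1 - 3 / k < t")
        case False
        then have kt: "2 < k * (1 - t)" using k(1) by (simp add: field_simps)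
        then have "h1 (k * (1 - t)) = 0" "h2 (k * (1 - t)) = 0" using h(7,8) by auto
        then have "D = 0" using step_1[OF less_imp_le[OF kt]] by (simp add: D_def LU_def)
        then show ?thesis unfolding eq using e BD k by simp
      next
        case True
        then have tk: "k * (1 - t) \<le> 3" using k(1) by (simp add: field_simps)
        let ?s = "k * (1 - t)"
        have de: "\<bar>d x\<bar> \<le> e" using a(2)[OF x] True k(2) by (simp add: t_def)
        have Deq: "D = (1 - step ?s) * LU t - 4 * (t * (k^2 * h2 ?s * poly U t) - t * (2 * k * h1 ?s * poly (pderiv U) t) - (real n + 1) * (k * h1 ?s * poly U t))"
          by (simp add: D_def LU_def algebra_simps)
        have kU: "k * \<bar>poly U t\<bar> \<le> 3 * B2"
        proof -
          have "k * \<bar>poly U t\<bar> \<le> k * ((1 - t) * B2)" using UB[OF t] k(1) by (intro mult_left_mono) auto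
          also have "\<dots> = (k * (1 - t)) * B2" by simp
          also have "\<dots> \<le> 3 * B2" using tk B2(1) by (intro mult_right_mono) auto
          finally show ?thesis .
        qed
        have b1: "\<bar>(1 - step ?s) * LU t\<bar> \<le> B0 * k"
        proof -
          have "\<bar>(1 - step ?s) * LU t\<bar> \<le> 1 * B0"
            unfolding abs_mult using step_range[of ?s] B0(2)[OF t] by (intro mult_mono) auto
          also have "\<dots> \<le> B0 * k" using B0(1) k(1) by simp
          finally show ?thesis .
        qed
        have b2: "\<bar>t * (k^2 * h2 ?s * poly U t)\<bar> \<le> 3 * K * B2 * k"
        proof -
          have "\<bar>t * (k^2 * h2 ?s * poly U t)\<bar> = t * (k * (\<bar>h2 ?s\<bar> * (k * \<bar>poly U t\<bar>)))"
            using t k(1) by (simp add: abs_mult power2_eq_square)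
          also have "\<dots> \<le> 1 * (k * (K * (3 * B2)))"
            using t k(1) h(4) h(6)[of ?s] B2(1) by (intro mult_mono kU) auto
          finally show ?thesis by (simp add: mult_ac)
        qed
        have b3: "\<bar>t * (2 * k * h1 ?s * poly (pderiv U) t)\<bar> \<le> 2 * K * B1 * k"
        proof -
          have "\<bar>t * (2 * k * h1 ?s * poly (pderiv U) t)\<bar> = t * (2 * k * (\<bar>h1 ?s\<bar> * \<bar>poly (pderiv U) t\<bar>))"
            using t k(1) by (simp add: abs_mult)
          also have "\<dots> \<le> 1 * (2 * k * (K * B1))"
            using t k(1) h(4) h(5)[of ?s] B1 by (intro mult_mono) auto
          finally show ?thesis by (simp add: mult_ac)
        qed
        have b4: "\<bar>(real n + 1) * (k * h1 ?s * poly U t)\<bar> \<le> (real n + 1) * K * 3 * B2 * k"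
        proof -
          have "\<bar>(real n + 1) * (k * h1 ?s * poly U t)\<bar> = (real n + 1) * (\<bar>h1 ?s\<bar> * (k * \<bar>poly U t\<bar>))"
            using k(1) by (simp add: abs_mult)
          also have "\<dots> \<le> (real n + 1) * (K * (3 * B2))"
            using h(4) h(5)[of ?s] B2(1) k(1) by (intro mult_mono kU) auto
          also have "\<dots> \<le> (real n + 1) * (K * (3 * B2)) * k"
            using h(4) B2(1) k(1) mult_left_mono[of 1 k "(real n + 1) * (K * (3 * B2))"] by simp
          finally show ?thesis by (simp add: mult_ac)
        qed
        have "\<bar>D\<bar> \<le> B0 * k + 4 * (3 * K * B2 * k + 2 * K * B1 * k + (real n + 1) * K * 3 * B2 * k)"
        proof -
          have "\<bar>p - 4 * (q - r - s)\<bar> \<le> P + 4 * (Q + R + S)"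
            if "\<bar>p\<bar> \<le> P" "\<bar>q\<bar> \<le> Q" "\<bar>r\<bar> \<le> R" "\<bar>s\<bar> \<le> S" for p q r s P Q R S :: real
            using that unfolding abs_le_iff by auto
          from this[OF b1 b2 b3 b4] show ?thesis unfolding Deq .
        qed
        also have "\<dots> = BD * k" by (simp add: BD_def algebra_simps)
        finally have DK: "\<bar>D\<bar> \<le> BD * k" .
        have "\<bar>d x * (D * Y n s x)\<bar> \<le> e * ((BD * k) * 1)"
          unfolding abs_mult using de DK Yx e BD k(1) by (intro mult_mono) auto
        then show ?thesis unfolding eq using True x by (simp add: t_def)
      qed
    qed
    also have "\<dots> = (e * (BD * k)) * (pi * (3 / k))"
    proof -
      have "?S \<inter> disk = ?S" by auto
      then show ?thesis using S by simp
    qed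
    also have "\<dots> = e * (BD * pi * 3)" using k(1) by simp
    finally show ?thesis by simp
  qed
  have "I = 0"
  proof (rule ccontr)
    assume "I \<noteq> 0"
    then have "\<bar>I\<bar> / (4 * (BD * pi * 3)) > 0" using BD by simp
    from small[OF this] have "\<bar>I\<bar> \<le> \<bar>I\<bar> / 4" using BD by simp
    then show False using \<open>I \<noteq> 0\<close> by simp
  qed
  then show ?thesis by (simp add: I_def LU_def)
qed

text \<open>The difference of two solutions satisfies the hypotheses of the previous lemma. Every
  polynomial is a sum of Laplacians of modes that vanish on the circle, so the difference is
  orthogonal to all polynomials, hence zero almost everywhere, and everywhere by continuity.\<close>

lemma dirichlet_solution_unique:
  assumes u: "dirichlet_solution w u" and v: "dirichlet_solution w v"
  shows "u = v"
proof -
  define d where "d x = u x - v x" for x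
  have cuv: "continuous_on (cball 0 1) u" "continuous_on (cball 0 1) v"
    using u v by (auto simp: dirichlet_solution_def closure_disk)
  then have cd: "continuous_on (cball 0 1) d" unfolding d_def by (intro continuous_intros)
  have d0: "d x = 0" if "x \<notin> disk" for x using u v that by (simp add: dirichlet_solution_def d_def)
  have dL: "d \<in> LI" and uvL: "u \<in> LI" "v \<in> LI" using Linf_cont_cball cd cuv by auto
  have hd: "(LINT x|MD. d x * laplacian \<phi> x) = 0" if \<phi>: "\<phi> \<in> test_functions disk" for \<phi>
  proof -
    have "continuous_on UNIV (laplacian \<phi>)"
      unfolding laplacian_def[abs_def] using test_C2[OF \<phi>] by (auto simp: C2_def intro!: continuous_intros)
    then have l: "laplacian \<phi> \<in> LI" by (rule Linf_cont)
    have "(LINT x|MD. u x * - laplacian \<phi> x) = (LINT x|MD. v x * - laplacian \<phi> x)"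
      using u v \<phi> by (simp add: dirichlet_solution_def set_integral_MD)
    moreover have "integrable MD (\<lambda>x. u x * laplacian \<phi> x)" "integrable MD (\<lambda>x. v x * laplacian \<phi> x)"
      by (intro Linf_integrable Linf_mult uvL l)+
    ultimately show ?thesis by (simp add: d_def left_diff_distrib)
  qed
  have mode: "(LINT x|MD. d x * (poly f (rsq x) * Y n s x)) = 0" for f n s
  proof -
    have "(LINT x|MD. d x * (4 * (rsq x * poly (pderiv (pderiv (radial_inverse n f))) (rsq x) + (real n + 1) * poly (pderiv (radial_inverse n f)) (rsq x)) * Y n s x)) = 0"
      by (rule harmonic_orthogonal_modes[OF cd _ hd poly_radial_inverse_1]) (auto intro: d0 simp: mem_disk)
    moreover have "4 * (rsq x * poly (pderiv (pderiv (radial_inverse n f))) (rsq x) + (real n + 1) * poly (pderiv (radial_inverse n f)) (rsq x)) = - poly f (rsq x)" for x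
      using poly_radial_inverse[of "rsq x" n f] by linarith
    ultimately show ?thesis by simp
  qed
  have modal0: "(LINT x|MD. d x * g x) = 0" if mg: "modal g" for g
  proof -
    obtain I p where I: "finite I" "g = poly_mode_sum I p" using mg by (auto simp: modal_def)
    have "(LINT x|MD. d x * g x) = (LINT x|MD. (\<Sum>k\<in>I. d x * (poly (p k) (rsq x) * Y (fst k) (snd k) x)))"
      by (simp add: I(2) poly_mode_sum_def sum_distrib_left)
    also have "\<dots> = (\<Sum>k\<in>I. LINT x|MD. d x * (poly (p k) (rsq x) * Y (fst k) (snd k) x))"
      by (intro Bochner_Integration.integral_sum Linf_integrable Linf_mult dL Linf_cont continuous_intros)
    finally show ?thesis by (simp add: mode)
  qed
  have "bounded (d ` cball 0 1)" by (intro compact_imp_bounded compact_continuous_image cd) simp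
  then obtain B where B: "0 < B" "\<And>x. norm x \<le> 1 \<Longrightarrow> \<bar>d x\<bar> \<le> B" unfolding bounded_pos by auto
  have i2: "integrable MD (\<lambda>x. (d x)^2)" by (intro Linf_integrable Linf_power dL)
  have sm: "(LINT x|MD. (d x)^2) \<le> B * (3 * e)" if e: "0 < e" for e
  proof -
    obtain g where g: "modal g" "(LINT x|MD. (g x - d x)^2) \<le> e^2" by (rule modal_dense_L2[OF dL e])
    have gL: "g \<in> LI" by (intro Linf_cont modal_continuous g)
    have gd: "(\<lambda>x. g x - d x) \<in> LI" by (intro Linf_diff gL dL)
    have ig: "integrable MD (\<lambda>x. d x * g x)" by (intro Linf_integrable Linf_mult gL dL)
    have "(LINT x|MD. (d x)^2) = (LINT x|MD. (d x)^2 - d x * g x)" using modal0[OF g(1)] ig i2 by simp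
    also have "\<dots> \<le> (LINT x|MD. B * \<bar>g x - d x\<bar>)"
    proof (rule integral_mono)
      show "integrable MD (\<lambda>x. B * \<bar>g x - d x\<bar>)" by (intro Linf_integrable Linf_cmult Linf_abs gd)
      fix x assume "x \<in> space MD"
      then have "\<bar>d x\<bar> \<le> B" using B by (simp add: mem_disk)
      have "(d x)^2 - d x * g x = d x * (d x - g x)" by (simp add: power2_eq_square algebra_simps)
      also have "\<dots> \<le> \<bar>d x\<bar> * \<bar>g x - d x\<bar>" by (metis abs_ge_self abs_minus_commute abs_mult)
      also have "\<dots> \<le> B * \<bar>g x - d x\<bar>" using \<open>\<bar>d x\<bar> \<le> B\<close> by (intro mult_right_mono) auto
      finally show "(d x)^2 - d x * g x \<le> B * \<bar>g x - d x\<bar>" .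
    qed (use i2 ig in auto)
    also have "\<dots> \<le> B * (3 * e)" using L1_le_L2[OF gd e g(2)] B(1) by (simp add: mult_left_mono)
    finally show ?thesis .
  qed
  have "(LINT x|MD. (d x)^2) \<le> 0"
  proof (rule field_le_epsilon)
    fix e :: real assume "0 < e"
    then have "0 < e / (3 * B)" using B(1) by simp
    from sm[OF this] show "(LINT x|MD. (d x)^2) \<le> 0 + e" using B(1) by simp
  qed
  then have "(LINT x|MD. (d x)^2) = 0" by (simp add: order_antisym)
  then have "AE x in MD. (d x)^2 = 0"
    by (subst (asm) integral_nonneg_eq_0_iff_AE[OF i2]) auto
  then have "AE x in lebesgue. x \<in> disk \<longrightarrow> d x = 0" by (simp add: AE_restrict_space_iff)
  then obtain N where N: "N \<in> null_sets lebesgue" "{x. \<not> (x \<in> disk \<longrightarrow> d x = 0)} \<subseteq> N"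
    by (auto simp: eventually_ae_filter)
  let ?S = "{x \<in> disk. d x \<noteq> 0}"
  have "negligible ?S" using N by (auto simp: negligible_iff_null_sets[symmetric] intro: negligible_subset)
  moreover have "open ?S"
  proof -
    have "continuous_on disk d" by (rule continuous_on_subset[OF cd]) (auto simp: disk_def)
    then have "open (disk \<inter> d -` (-{0}))" by (rule continuous_open_preimage) auto
    moreover have "disk \<inter> d -` (-{0}) = ?S" by auto
    ultimately show ?thesis by simp
  qed
  ultimately have "?S = {}" using open_not_negligible by blast
  then have "d x = 0" for x using d0 by (cases "x \<in> disk") auto
  then show ?thesis by (simp add: d_def fun_eq_iff)
qed

lemma green_eqI: "dirichlet_solution w u \<Longrightarrow> green w = u"
  unfolding green_def by (rule the_equality) (auto intro: dirichlet_solution_unique)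

section \<open>Bessel functions\<close>

text \<open>The Bessel--Clifford function: \<open>J\<^sub>n x = (x/2)\<^sup>n C\<^sub>n (x\<^sup>2/4)\<close>. Differentiation just shifts the
  index and changes the sign.\<close>

definition bessel_clifford :: "nat \<Rightarrow> real \<Rightarrow> real" where
  "bessel_clifford n t = (\<Sum>m. (-1) ^ m / (fact m * fact (m + n)) * t ^ m)"

lemma summable_bessel_clifford: "summable (\<lambda>m. (-1) ^ m / (fact m * fact (m + n)) * t ^ m :: real)"
proof (rule summable_comparison_test')
  show "summable (\<lambda>m. \<bar>t\<bar> ^ m / fact m)" using summable_exp[of "\<bar>t\<bar>"] by (simp add: field_simps)
  fix m :: nat
  have "1 \<le> (fact (m + n) :: real)" by simp
  then have "fact m \<le> fact m * (fact (m + n) :: real)" by (simp del: fact_ge_1)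
  then have "\<bar>t\<bar> ^ m / (fact m * fact (m + n)) \<le> \<bar>t\<bar> ^ m / fact m"
    by (intro divide_left_mono) auto
  then show "norm ((-1) ^ m / (fact m * fact (m + n)) * t ^ m) \<le> \<bar>t\<bar> ^ m / fact m"
    by (simp add: norm_mult norm_divide norm_power power_abs abs_mult)
qed

lemma DERIV_bessel_clifford: "(bessel_clifford n has_real_derivative - bessel_clifford (Suc n) t) (at t)"
proof -
  have "((\<lambda>t. \<Sum>m. (-1) ^ m / (fact m * fact (m + n)) * t ^ m) has_real_derivative
        (\<Sum>m. diffs (\<lambda>m. (-1) ^ m / (fact m * fact (m + n))) m * t ^ m)) (at t)"
    by (rule termdiffs_strong_converges_everywhere) (rule summable_bessel_clifford)
  moreover have "diffs (\<lambda>m. (-1) ^ m / (fact m * fact (m + n))) m = - ((-1) ^ m / (fact m * fact (m + Suc n)) :: real)" for m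
    by (simp add: diffs_def field_simps del: of_nat_Suc)
  ultimately have "((\<lambda>t. bessel_clifford n t) has_real_derivative (\<Sum>m. - ((-1) ^ m / (fact m * fact (m + Suc n)) * t ^ m))) (at t)"
    by (simp add: bessel_clifford_def[abs_def])
  then show ?thesis unfolding bessel_clifford_def[abs_def] by (simp only: suminf_minus[OF summable_bessel_clifford])
qed

lemma bessel_clifford_recurrence: "(real n + 1) * bessel_clifford (Suc n) t = bessel_clifford n t + t * bessel_clifford (Suc (Suc n)) t"
proof -
  let ?c = "\<lambda>n m. (-1) ^ m / (fact m * fact (m + n)) :: real"
  have s: "(\<lambda>m. ?c n m * t ^ m) sums bessel_clifford n t" for n
    unfolding bessel_clifford_def by (rule summable_sums[OF summable_bessel_clifford])
  let ?b = "\<lambda>m. if m = 0 then 0 else ?c (Suc (Suc n)) (m - 1) * t ^ m"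
  have "(\<lambda>m. ?b (Suc m)) sums (t * bessel_clifford (Suc (Suc n)) t)"
    using sums_mult[OF s[of "Suc (Suc n)"], of t] by (simp add: mult_ac)
  then have b: "?b sums (t * bessel_clifford (Suc (Suc n)) t)" using sums_Suc_iff[of ?b] by simp
  have eq: "?c n m * t ^ m + ?b m = (real n + 1) * (?c (Suc n) m * t ^ m)" for m
  proof (cases m)
    case 0
    have "(fact (Suc n) :: real) = (real n + 1) * fact n" by simp
    moreover have "real n + 1 \<noteq> 0" by (metis of_nat_Suc of_nat_0_neq add.commute nat.simps(3) of_nat_eq_0_iff)
    ultimately show ?thesis using 0 by (simp del: fact_Suc)
  next
    case (Suc k)
    have f1: "(fact m :: real) = (real k + 1) * fact k" using Suc by simp
    have f2: "(fact (m + Suc n) :: real) = (real m + real n + 1) * fact (m + n)" by simp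
    have i: "k + Suc (Suc n) = m + Suc n" "m - 1 = k" "m \<noteq> 0" using Suc by auto
    have sg: "(-1) ^ m = - ((-1) ^ k :: real)" using Suc by simp
    have nz: "(fact k :: real) \<noteq> 0" "(fact (m + n) :: real) \<noteq> 0" "real k + 1 \<noteq> 0" "real m + real n + 1 \<noteq> 0"
      by auto
    have "?c n m + ?c (Suc (Suc n)) (m - 1) = (real n + 1) * ?c (Suc n) m"
      unfolding i f1 f2 sg using nz by (simp add: divide_simps) (simp add: Suc algebra_simps)
    moreover have "?c n m * t ^ m + ?b m = (?c n m + ?c (Suc (Suc n)) (m - 1)) * t ^ m"
      using i(3) by (simp only: if_False distrib_right)
    ultimately show ?thesis by (simp only: mult.assoc)
  qed
  have "(\<lambda>m. ?c n m * t ^ m + ?b m) sums (bessel_clifford n t + t * bessel_clifford (Suc (Suc n)) t)" by (rule sums_add[OF s b])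
  moreover have "(\<lambda>m. ?c n m * t ^ m + ?b m) sums ((real n + 1) * bessel_clifford (Suc n) t)"
    unfolding eq by (rule sums_mult[OF s])
  ultimately show ?thesis by (rule sums_unique2[symmetric])
qed

lemma bessel_J_bessel_clifford: "bessel_J n x = (x / 2) ^ n * bessel_clifford n (x\<^sup>2 / 4)"
proof -
  have "(\<lambda>m. (x/2)^n * ((-1) ^ m / (fact m * fact (m + n)) * (x\<^sup>2 / 4) ^ m)) sums ((x / 2) ^ n * bessel_clifford n (x\<^sup>2 / 4))"
    unfolding bessel_clifford_def by (intro sums_mult summable_sums summable_bessel_clifford)
  moreover have eq: "(x/2)^n * ((-1) ^ m / (fact m * fact (m + n)) * (x\<^sup>2 / 4) ^ m)
      = (-1) ^ m / (fact m * fact (m + n)) * (x / 2) ^ (2 * m + n)" for m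
  proof -
    have "(x\<^sup>2 / 4) ^ m = (x / 2) ^ (2 * m)" by (simp add: power_mult power_divide)
    then show ?thesis by (simp add: power_add mult_ac)
  qed
  ultimately have "(\<lambda>m. (-1) ^ m / (fact m * fact (m + n)) * (x / 2) ^ (2 * m + n)) sums ((x / 2) ^ n * bessel_clifford n (x\<^sup>2 / 4))"
    by (simp only:)
  then show ?thesis unfolding bessel_J_def by (rule sums_unique[symmetric])
qed

lemma isCont_bessel_clifford: "isCont (bessel_clifford n) t"
  using DERIV_bessel_clifford by (rule DERIV_isCont)

lemma continuous_bessel_clifford: "continuous_on S (bessel_clifford n)"
  by (intro continuous_at_imp_continuous_on ballI isCont_bessel_clifford)

lemma bessel_clifford_1_at_0: "bessel_clifford 1 0 = 1"
proof -
  have "bessel_clifford 1 0 = (\<Sum>m. (-1) ^ m / (fact m * fact (m + 1)) * 0 ^ m :: real)" by (simp add: bessel_clifford_def)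
  also have "\<dots> = (\<Sum>m\<in>{0}. (-1) ^ m / (fact m * fact (m + 1)) * 0 ^ m)"
    by (rule suminf_finite) auto
  finally show ?thesis by simp
qed

text \<open>The first five terms of the alternating series add up to \<open>- 1/45\<close>, and the rest is bounded
  by a geometric series with sum \<open>32/2025\<close>. As \<open>4 = 4\<^sup>2 / 4\<close>, this means \<open>J\<^sub>1 4 < 0\<close>.\<close>

lemma bessel_clifford_1_at_4: "bessel_clifford 1 4 < 0"
proof -
  let ?f = "\<lambda>m. (-1) ^ m / (fact m * fact (m + 1)) * 4 ^ m :: real"
  have head: "(\<Sum>m<5. ?f m) = - 1 / 45"
    by (simp add: numeral_eq_Suc lessThan_Suc fact_numeral)
  have tail: "(\<Sum>m. ?f (m + 5)) \<le> (\<Sum>m. (8 / 675) * (1 / 4) ^ m)"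
  proof (rule suminf_le)
    show "summable (\<lambda>m. ?f (m + 5))" using summable_bessel_clifford[of 1 4] by (subst summable_iff_shift) simp
    show "summable (\<lambda>m. (8 / 675 :: real) * (1 / 4) ^ m)" by (intro summable_mult summable_geometric) simp
    fix m
    have "4 ^ (m + 5) / (fact (m + 5) * fact (m + 6)) \<le> (8 / 675 :: real) * (1 / 4) ^ m"
    proof (induction m)
      case 0 show ?case by (simp add: fact_numeral)
    next
      case (Suc m)
      have f: "fact (Suc m + 5) = (real m + 6) * fact (m + 5)" "fact (Suc m + 6) = (real m + 7) * fact (m + 6)"
        using fact_Suc[of "m + 5", where 'a = real] fact_Suc[of "m + 6", where 'a = real] by (simp_all del: fact_Suc)
      have "4 ^ (Suc m + 5) / (fact (Suc m + 5) * fact (Suc m + 6)) = 4 ^ (m + 5) / (fact (m + 5) * fact (m + 6)) * (4 / ((real m + 6) * (real m + 7)))"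
        unfolding f by (simp add: mult_ac power_add del: fact_Suc)
      also have "\<dots> \<le> 4 ^ (m + 5) / (fact (m + 5) * fact (m + 6)) * (1 / 4 :: real)"
      proof (rule mult_left_mono)
        have "6 * 7 \<le> (real m + 6) * (real m + 7)" by (intro mult_mono) auto
        then show "4 / ((real m + 6) * (real m + 7)) \<le> 1 / 4" by (simp add: divide_le_eq)
      qed simp
      also have "\<dots> \<le> (8 / 675) * (1 / 4) ^ m * (1 / 4)" using Suc by (intro mult_right_mono) auto
      finally show ?case by simp
    qed
    moreover have "?f (m + 5) \<le> \<bar>?f (m + 5)\<bar>" by (rule abs_ge_self)
    moreover have "\<bar>?f (m + 5)\<bar> = 4 ^ (m + 5) / (fact (m + 5) * fact (m + 6))"
      by (simp add: abs_mult power_abs add.commute)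
    ultimately show "?f (m + 5) \<le> (8 / 675) * (1 / 4) ^ m" by linarith
  qed
  have "(\<Sum>m. (8 / 675 :: real) * (1 / 4) ^ m) = 8 / 675 * (4 / 3)"
    by (subst suminf_mult) (auto simp: suminf_geometric)
  moreover have "bessel_clifford 1 4 = (\<Sum>m. ?f (m + 5)) + (\<Sum>m<5. ?f m)"
    unfolding bessel_clifford_def by (rule suminf_split_initial_segment[OF summable_bessel_clifford])
  ultimately show ?thesis using head tail by simp
qed

abbreviation "jj \<equiv> bessel_zero"

text \<open>The first zero of the Bessel function exists and is less than 4 because the function changes
  sign before 4; the set of zeros is closed, so there is a least one.\<close>

lemma bessel_zero_props:
  shows "0 < jj" "jj < 4" "bessel_clifford 1 (jj\<^sup>2 / 4) = 0" "\<And>t. 0 \<le> t \<Longrightarrow> t < jj\<^sup>2 / 4 \<Longrightarrow> 0 < bessel_clifford 1 t"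
proof -
  let ?Z = "{0..4} \<inter> bessel_clifford 1 -` {0}"
  have "closed (bessel_clifford 1 -` {0})" by (intro closed_vimage continuous_bessel_clifford) auto
  then have "compact ?Z" by (intro compact_Int_closed) auto
  moreover have "\<exists>t\<ge>0. t \<le> 4 \<and> bessel_clifford 1 t = 0"
    by (rule IVT2') (use bessel_clifford_1_at_0 bessel_clifford_1_at_4 continuous_bessel_clifford in auto)
  then have "?Z \<noteq> {}" by auto
  ultimately have "\<exists>t0\<in>?Z. \<forall>t\<in>?Z. t0 \<le> t" by (rule compact_attains_inf)
  then obtain t0 where t0: "t0 \<in> ?Z" "\<And>t. t \<in> ?Z \<Longrightarrow> t0 \<le> t" by metis
  have t0': "0 < t0" "t0 < 4" using t0(1) bessel_clifford_1_at_0 bessel_clifford_1_at_4 by (auto simp: less_le)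
  have pos: "0 < bessel_clifford 1 t" if "0 \<le> t" "t < t0" for t
  proof (rule ccontr)
    assume "\<not> 0 < bessel_clifford 1 t"
    then have "\<exists>s\<ge>0. s \<le> t \<and> bessel_clifford 1 s = 0"
      by (intro IVT2') (use that bessel_clifford_1_at_0 continuous_bessel_clifford in auto)
    then show False using t0(2) that t0' by fastforce
  qed
  have J: "bessel_J 1 x = 0 \<longleftrightarrow> bessel_clifford 1 (x\<^sup>2 / 4) = 0" if "0 < x" for x
    using that by (simp add: bessel_J_bessel_clifford)
  have j: "jj = 2 * sqrt t0" unfolding bessel_zero_def
  proof (rule Least_equality)
    show "0 < 2 * sqrt t0 \<and> bessel_J 1 (2 * sqrt t0) = 0"
      using t0' t0(1) J[of "2 * sqrt t0"] by (simp add: power_mult_distrib)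
    fix y assume y: "0 < y \<and> bessel_J 1 y = 0"
    then have "bessel_clifford 1 (y\<^sup>2 / 4) = 0" using J by blast
    then have "\<not> y\<^sup>2 / 4 < t0" using pos[of "y\<^sup>2 / 4"] by auto
    then have "sqrt (4 * t0) \<le> y" using y by (intro real_le_lsqrt) auto
    then show "2 * sqrt t0 \<le> y" by (simp add: real_sqrt_mult)
  qed
  show "0 < jj" "jj < 4" "bessel_clifford 1 (jj\<^sup>2 / 4) = 0"
    using t0' t0(1) real_sqrt_less_mono[of t0 4] by (auto simp: j power_mult_distrib)
  show "0 < bessel_clifford 1 t" if "0 \<le> t" "t < jj\<^sup>2 / 4" for t
    using pos[of t] that t0' by (simp add: j power_mult_distrib)
qed

text \<open>The radial factor of the Bessel modes in the variable \<open>t = r\<^sup>2\<close>: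
  \<open>J\<^sub>n (j r) = r\<^sup>n radial_bessel n (r\<^sup>2)\<close>.\<close>

definition radial_bessel :: "nat \<Rightarrow> real \<Rightarrow> real" where
  "radial_bessel n t = (jj / 2) ^ n * bessel_clifford n (jj\<^sup>2 / 4 * t)"

lemma DERIV_radial_bessel: "(radial_bessel n has_real_derivative - (jj / 2) * radial_bessel (Suc n) t) (at t)"
proof -
  have "((\<lambda>t. jj\<^sup>2 / 4 * t) has_real_derivative jj\<^sup>2 / 4) (at t)" by (auto intro!: derivative_eq_intros)
  from DERIV_cmult[OF DERIV_chain2[OF DERIV_bessel_clifford this], of "(jj/2)^n" n] show ?thesis
    by (simp add: radial_bessel_def[abs_def] power2_eq_square mult_ac)
qed

lemma radial_bessel_recurrence: "(real n + 1) * radial_bessel (Suc n) t = jj / 2 * (radial_bessel n t + t * radial_bessel (Suc (Suc n)) t)"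
proof -
  have "(real n + 1) * radial_bessel (Suc n) t = (jj / 2) ^ Suc n * ((real n + 1) * bessel_clifford (Suc n) (jj\<^sup>2 / 4 * t))"
    by (simp add: radial_bessel_def mult_ac)
  then show ?thesis unfolding bessel_clifford_recurrence by (simp add: radial_bessel_def power2_eq_square algebra_simps)
qed

lemma continuous_radial_bessel: "continuous_on S (radial_bessel n)"
  by (intro continuous_at_imp_continuous_on ballI DERIV_isCont[OF DERIV_radial_bessel])

lemma bessel_J_radial_bessel: "bessel_J n (jj * r) = r ^ n * radial_bessel n (r\<^sup>2)"
  by (simp add: bessel_J_bessel_clifford radial_bessel_def power_mult_distrib power_divide mult_ac)

lemma radial_bessel_1: "radial_bessel 1 1 = 0"
  using bessel_zero_props(3) by (simp add: radial_bessel_def)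

lemma radial_bessel_pos: "0 \<le> t \<Longrightarrow> t < 1 \<Longrightarrow> 0 < radial_bessel 1 t"
  using bessel_zero_props(1,4) by (simp add: radial_bessel_def mult_less_cancel_left_pos[of "jj\<^sup>2/4", of t 1, simplified])

text \<open>The largest eigenvalue of the Green operator on functions of mean zero.\<close>

definition mu :: real where "mu = 1 / jj\<^sup>2"

lemma mu_bounds: "1 / 16 < mu" "0 < mu"
proof -
  have "jj\<^sup>2 < 4\<^sup>2" using bessel_zero_props(1,2) by (intro power_strict_mono) auto
  then show "1 / 16 < mu" "0 < mu" using bessel_zero_props(1) by (auto simp: mu_def field_simps)
qed

section \<open>One-dimensional spectral inequalities\<close>

abbreviation I01 :: "(real \<Rightarrow> real) \<Rightarrow> real" where "I01 F \<equiv> integral {0..1} F"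

lemma cont_integrable: "continuous_on UNIV F \<Longrightarrow> (F :: real \<Rightarrow> real) integrable_on {a..b}"
  by (intro integrable_continuous_interval) (rule continuous_on_subset, auto)

lemma FTC:
  assumes "\<And>t. (F has_real_derivative F' t) (at t)" "a \<le> b"
  shows "integral {a..b} F' = F b - F a"
  using assms by (intro integral_unique fundamental_theorem_of_calculus)
    (auto simp: has_real_derivative_iff_has_vector_derivative[symmetric] intro: has_field_derivative_at_within)

text \<open>Integration by parts in one variable: both boundary terms vanish, at 0 because of the weight
  and at 1 because of \<open>U 1 = 0\<close>.\<close>

lemma energy_identity:
  fixes U U1 U2 :: "real \<Rightarrow> real"
  assumes U: "\<And>t. (U has_real_derivative U1 t) (at t)" "\<And>t. (U1 has_real_derivative U2 t) (at t)"
    and c: "continuous_on UNIV U2" and U1: "U 1 = 0"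
  shows "I01 (\<lambda>t. t ^ n * (- 4 * (t * U2 t + (real n + 1) * U1 t)) * U t) = I01 (\<lambda>t. 4 * t ^ (n + 1) * (U1 t)\<^sup>2)"
proof -
  have cU: "continuous_on UNIV U" "continuous_on UNIV U1"
    using U by (auto intro!: continuous_at_imp_continuous_on DERIV_isCont)
  have d: "((\<lambda>t. - 4 * t ^ (n + 1) * U1 t * U t) has_real_derivative
     t ^ n * (- 4 * (t * U2 t + (real n + 1) * U1 t)) * U t - 4 * t ^ (n + 1) * (U1 t)\<^sup>2) (at t)" for t
    by (rule derivative_eq_intros U refl | simp add: power2_eq_square algebra_simps)+
  have "I01 (\<lambda>t. t ^ n * (- 4 * (t * U2 t + (real n + 1) * U1 t)) * U t - 4 * t ^ (n + 1) * (U1 t)\<^sup>2) = 0"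
    using FTC[OF d, of 0 1] U1 by simp
  moreover have "I01 (\<lambda>t. t ^ n * (- 4 * (t * U2 t + (real n + 1) * U1 t)) * U t - 4 * t ^ (n + 1) * (U1 t)\<^sup>2)
     = I01 (\<lambda>t. t ^ n * (- 4 * (t * U2 t + (real n + 1) * U1 t)) * U t) - I01 (\<lambda>t. 4 * t ^ (n + 1) * (U1 t)\<^sup>2)"
    by (intro Henstock_Kurzweil_Integration.integral_diff cont_integrable continuous_intros cU c)
  ultimately show ?thesis by simp
qed

lemma radial_inverse_energy:
  "I01 (\<lambda>t. t ^ n * poly f t * poly (radial_inverse n f) t) = I01 (\<lambda>t. 4 * t ^ (n + 1) * (poly (pderiv (radial_inverse n f)) t)\<^sup>2)"
  using energy_identity[of "poly (radial_inverse n f)" "poly (pderiv (radial_inverse n f))" "poly (pderiv (pderiv (radial_inverse n f)))" n]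
  by (simp add: poly_DERIV continuous_intros poly_radial_inverse_1 poly_radial_inverse[simplified] del: minus_mult_left mult_minus_left)

text \<open>With \<open>V = U'\<close> the right-hand side is \<open>f = - 4 (t V' + (n + 1) V)\<close> and
  \<open>\<integral> t\<^sup>n f U = \<integral> 4 t\<^bsup>n+1\<^esup> V\<^sup>2\<close>. After subtraction of a suitable exact derivative \<open>D\<close>, of nonnegative
  integral, \<open>t\<^sup>n f\<^sup>2\<close> minus \<open>8 n\<close> times the integrand \<open>4 t\<^bsup>n+1\<^esup> V\<^sup>2\<close> becomes a sum of nonnegatively
  weighted squares, so the quotient of the two integrals is at most \<open>1/(8 n)\<close>. This is at most
  \<open>1/16\<close> for \<open>n \<ge> 2\<close>.\<close>

lemma spectral_high:
  assumes n: "2 \<le> n"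
  shows "I01 (\<lambda>t. t ^ n * poly f t * poly (radial_inverse n f) t) \<le> 1 / 16 * I01 (\<lambda>t. t ^ n * (poly f t)\<^sup>2)"
proof -
  define V where "V = poly (pderiv (radial_inverse n f))"
  define V' where "V' = poly (pderiv (pderiv (radial_inverse n f)))"
  have V: "(V has_real_derivative V' t) (at t)" for t unfolding V_def V'_def by (rule poly_DERIV)
  have cV: "continuous_on UNIV V" "continuous_on UNIV V'" unfolding V_def V'_def by (intro continuous_intros)+
  have f: "poly f t = - 4 * (t * V' t + (real n + 1) * V t)" for t
    using poly_radial_inverse[of t n f] by (simp add: V_def V'_def)
  \<comment> \<open>\<open>D\<close> is the derivative of \<open>16 V\<^sup>2 ((n + 1) t\<^bsup>n+1\<^esup> - 2 t\<^bsup>n+2\<^esup>)\<close>; the choice makes the square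
    \<open>(t (V' + 2 V))\<^sup>2\<close> appear below.\<close>
  let ?D = "\<lambda>t. 16 * (2 * V t * V' t * ((real n + 1) * t ^ (n + 1) - 2 * t ^ (n + 2)) + (V t)\<^sup>2 * ((real n + 1)\<^sup>2 * t ^ n - 2 * (real n + 2) * t ^ (n + 1)))"
  have d: "((\<lambda>t. 16 * (V t)\<^sup>2 * ((real n + 1) * t ^ (n + 1) - 2 * t ^ (n + 2))) has_real_derivative ?D t) (at t)" for t
    by (rule derivative_eq_intros V refl | simp add: power2_eq_square algebra_simps)+
  have iD: "I01 ?D = 16 * (V 1)\<^sup>2 * (real n - 1)"
    using FTC[OF d, of 0 1] by (simp add: algebra_simps)
  have pt: "?D t + 8 * real n * (4 * t ^ (n + 1) * (V t)\<^sup>2) \<le> t ^ n * (poly f t)\<^sup>2" if t: "t \<in> {0..1}" for t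
  proof -
    have e: "t ^ n * (poly f t)\<^sup>2 - (?D t + 8 * real n * (4 * t ^ (n + 1) * (V t)\<^sup>2))
       = 16 * t ^ n * ((t * (V' t + 2 * V t))\<^sup>2 + 4 * t * (1 - t) * (V t)\<^sup>2)"
      unfolding f by (simp add: power2_eq_square algebra_simps)
    have "0 \<le> 16 * t ^ n * ((t * (V' t + 2 * V t))\<^sup>2 + 4 * t * (1 - t) * (V t)\<^sup>2)"
      using t by (intro mult_nonneg_nonneg add_nonneg_nonneg) auto
    then show ?thesis using e by linarith
  qed
  have "I01 (\<lambda>t. ?D t + 8 * real n * (4 * t ^ (n + 1) * (V t)\<^sup>2)) \<le> I01 (\<lambda>t. t ^ n * (poly f t)\<^sup>2)"
    by (rule integral_le[OF _ _ pt]) (intro cont_integrable continuous_intros cV)+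
  moreover have "I01 (\<lambda>t. ?D t + 8 * real n * (4 * t ^ (n + 1) * (V t)\<^sup>2)) = I01 ?D + 8 * real n * I01 (\<lambda>t. 4 * t ^ (n + 1) * (V t)\<^sup>2)"
    by (intro integral_unique has_integral_add has_integral_mult_right integrable_integral cont_integrable continuous_intros cV)
  moreover have "0 \<le> I01 ?D" using n unfolding iD by simp
  ultimately have "8 * real n * I01 (\<lambda>t. 4 * t ^ (n + 1) * (V t)\<^sup>2) \<le> I01 (\<lambda>t. t ^ n * (poly f t)\<^sup>2)" by linarith
  moreover have Q0: "0 \<le> I01 (\<lambda>t. 4 * t ^ (n + 1) * (V t)\<^sup>2)"
    by (intro Henstock_Kurzweil_Integration.integral_nonneg cont_integrable continuous_intros cV) auto
  then have "16 * I01 (\<lambda>t. 4 * t ^ (n + 1) * (V t)\<^sup>2) \<le> 8 * real n * I01 (\<lambda>t. 4 * t ^ (n + 1) * (V t)\<^sup>2)"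
    using n by (intro mult_right_mono) auto
  ultimately show ?thesis unfolding radial_inverse_energy V_def by linarith
qed

lemma discriminant_le:
  fixes G b c :: real
  assumes "\<And>x. 0 \<le> G - 2 * x * b + x\<^sup>2 * c" "0 \<le> G"
  shows "b\<^sup>2 \<le> G * c"
proof (cases "0 < c")
  case True
  have "0 \<le> (G - 2 * (b / c) * b + (b / c)\<^sup>2 * c) * c" using assms(1)[of "b / c"] True by simp
  also have "\<dots> = G * c - b\<^sup>2" using True by (simp add: power2_eq_square field_simps)
  finally show ?thesis by simp
next
  case False
  have "c = 0"
  proof (rule ccontr)
    assume "c \<noteq> 0"
    then have c: "c < 0" using False by simp
    let ?x = "sqrt ((G + 1) / (- c))"
    have x2: "?x\<^sup>2 = (G + 1) / (- c)" using c assms(2) by (intro real_sqrt_pow2) (auto intro!: divide_nonneg_pos simp: divide_nonneg_neg)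
    have "0 \<le> (G - 2 * ?x * b + ?x\<^sup>2 * c) + (G - 2 * (- ?x) * b + (- ?x)\<^sup>2 * c)"
      by (intro add_nonneg_nonneg assms(1))
    also have "\<dots> = 2 * (G + ?x\<^sup>2 * c)" by simp
    also have "\<dots> = - 2" unfolding x2 using c by (simp add: field_simps)
    finally show False by simp
  qed
  moreover have "b = 0"
  proof (rule ccontr)
    assume "b \<noteq> 0"
    then show False using assms(1)[of "(G + 1) / (2 * b)"] \<open>c = 0\<close> by (simp add: field_simps)
  qed
  ultimately show ?thesis by simp
qed

lemma integral_square_expand:
  assumes g: "continuous_on UNIV g" and e: "continuous_on UNIV e"
  shows "integral {a..b} (\<lambda>s. s ^ n * (g s - x - y * e s)\<^sup>2) =
    integral {a..b} (\<lambda>s. s ^ n * (g s)\<^sup>2) + x\<^sup>2 * integral {a..b} (\<lambda>s. s ^ n) + y\<^sup>2 * integral {a..b} (\<lambda>s. s ^ n * (e s)\<^sup>2)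
    - 2 * x * integral {a..b} (\<lambda>s. s ^ n * g s) - 2 * y * integral {a..b} (\<lambda>s. s ^ n * g s * e s)
    + 2 * x * y * integral {a..b} (\<lambda>s. s ^ n * (e s :: real))"
proof -
  have "((\<lambda>s. s ^ n * (g s)\<^sup>2 + x\<^sup>2 * s ^ n + y\<^sup>2 * (s ^ n * (e s)\<^sup>2) - 2 * x * (s ^ n * g s)
       - 2 * y * (s ^ n * g s * e s) + 2 * x * y * (s ^ n * e s)) has_integral
     (integral {a..b} (\<lambda>s. s ^ n * (g s)\<^sup>2) + x\<^sup>2 * integral {a..b} (\<lambda>s. s ^ n) + y\<^sup>2 * integral {a..b} (\<lambda>s. s ^ n * (e s)\<^sup>2)
    - 2 * x * integral {a..b} (\<lambda>s. s ^ n * g s) - 2 * y * integral {a..b} (\<lambda>s. s ^ n * g s * e s)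
    + 2 * x * y * integral {a..b} (\<lambda>s. s ^ n * e s))) {a..b}"
    by (intro has_integral_add has_integral_diff has_integral_mult_right integrable_integral cont_integrable continuous_intros g e)
  moreover have "(\<lambda>s. s ^ n * (g s)\<^sup>2 + x\<^sup>2 * s ^ n + y\<^sup>2 * (s ^ n * (e s)\<^sup>2) - 2 * x * (s ^ n * g s)
       - 2 * y * (s ^ n * g s * e s) + 2 * x * y * (s ^ n * e s)) = (\<lambda>s. s ^ n * (g s - x - y * e s)\<^sup>2)"
    by (simp add: fun_eq_iff power2_eq_square algebra_simps)
  ultimately show ?thesis by (simp add: integral_unique)
qed

text \<open>The primitive \<open>N t\<close> is the weighted inner product of \<open>g\<close> with the indicator function of
  \<open>[0, t]\<close>. As \<open>g\<close> is orthogonal to \<open>e\<close>, and to constants if \<open>b \<noteq> 0\<close> is admitted, one may first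
  add the constant \<open>b\<close> to the indicator and then project it off \<open>e\<close>. The Cauchy--Schwarz
  inequality with the improved vector saves the term \<open>(M t)\<^sup>2 / E\<close>, which after integration over
  \<open>t\<close> is the eigenvalue that belongs to \<open>e\<close>. It is proved through the discriminant of the
  nonnegative quadratic polynomial in \<open>x\<close>.\<close>

lemma deflated_bound:
  fixes g e N M :: "real \<Rightarrow> real"
  assumes g: "continuous_on UNIV g" and e: "continuous_on UNIV e"
    and N: "\<And>t. (N has_real_derivative t ^ n * g t) (at t)" "N 0 = 0"
    and M: "\<And>t. (M has_real_derivative t ^ n * e t) (at t)" "M 0 = 0"
    and E: "E = I01 (\<lambda>t. t ^ n * (e t)\<^sup>2)" "0 < E"
    and orth: "I01 (\<lambda>t. t ^ n * g t * e t) = 0"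
    and t: "0 \<le> t" "t \<le> 1"
    and b: "b * N 1 = 0" "b * M 1 = 0"
  shows "(N t)\<^sup>2 \<le> I01 (\<lambda>t. t ^ n * (g t)\<^sup>2) *
     (((1 + b)\<^sup>2 * t ^ (n + 1) + b\<^sup>2 * (1 - t ^ (n + 1))) / (real n + 1) - (M t)\<^sup>2 / E)"
proof (rule discriminant_le)
  let ?G = "I01 (\<lambda>t. t ^ n * (g t)\<^sup>2)"
  let ?th = "((1 + b)\<^sup>2 * t ^ (n + 1) + b\<^sup>2 * (1 - t ^ (n + 1))) / (real n + 1)"
  show "0 \<le> ?G"
    by (intro Henstock_Kurzweil_Integration.integral_nonneg cont_integrable continuous_intros g) auto
  fix x
  \<comment> \<open>This coefficient removes the component along \<open>e\<close>.\<close>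
  define y where "y = - x * M t / E"
  have split: "integral {0..t} F + integral {t..1} F = I01 F" if "continuous_on UNIV F" for F :: "real \<Rightarrow> real"
    by (rule Henstock_Kurzweil_Integration.integral_combine) (use t cont_integrable[OF that] in auto)
  have s: "integral {0..t} (\<lambda>s. s ^ n * (g s)\<^sup>2) + integral {t..1} (\<lambda>s. s ^ n * (g s)\<^sup>2) = ?G"
    "integral {0..t} (\<lambda>s. s ^ n * (e s)\<^sup>2) + integral {t..1} (\<lambda>s. s ^ n * (e s)\<^sup>2) = E"
    "integral {0..t} (\<lambda>s. s ^ n * g s * e s) + integral {t..1} (\<lambda>s. s ^ n * g s * e s) = 0"
    unfolding E(1) using orth by (auto intro!: split[THEN trans] continuous_intros g e)
  have iN: "integral {0..t} (\<lambda>s. s ^ n * g s) = N t" "integral {t..1} (\<lambda>s. s ^ n * g s) = N 1 - N t"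
    "integral {0..t} (\<lambda>s. s ^ n * e s) = M t" "integral {t..1} (\<lambda>s. s ^ n * e s) = M 1 - M t"
    using FTC[OF N(1)] FTC[OF M(1)] t N(2) M(2) by auto
  have nz: "real n + 1 \<noteq> 0" using of_nat_0_le_iff[of n, where 'a = real] by linarith
  have dp: "((\<lambda>s. s ^ (n + 1) / (real n + 1)) has_real_derivative s ^ n) (at s)" for s
  proof -
    have "((\<lambda>s. s ^ (n + 1) / (real n + 1)) has_real_derivative (real (n + 1) * s ^ n) / (real n + 1)) (at s)"
      using DERIV_cdivide[OF DERIV_pow[of "n + 1" s UNIV], of "real n + 1"] by simp
    also have "real (n + 1) = real n + 1" by simp
    finally show ?thesis using nz by simp
  qed
  have ip: "integral {0..t} (\<lambda>s. s ^ n) = t ^ (n + 1) / (real n + 1)"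
    "integral {t..1} (\<lambda>s. s ^ n) = (1 - t ^ (n + 1)) / (real n + 1)"
    using FTC[OF dp] t by (auto simp: diff_divide_distrib)
  have "0 \<le> integral {0..t} (\<lambda>s. s ^ n * (g s - x * (1 + b) - y * e s)\<^sup>2) + integral {t..1} (\<lambda>s. s ^ n * (g s - x * b - y * e s)\<^sup>2)"
    using t by (intro add_nonneg_nonneg Henstock_Kurzweil_Integration.integral_nonneg cont_integrable continuous_intros g e) auto
  also have "\<dots> = (integral {0..t} (\<lambda>s. s ^ n * (g s)\<^sup>2) + integral {t..1} (\<lambda>s. s ^ n * (g s)\<^sup>2))
     + ((x * (1 + b))\<^sup>2 * (t ^ (n + 1) / (real n + 1)) + (x * b)\<^sup>2 * ((1 - t ^ (n + 1)) / (real n + 1)))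
     + y\<^sup>2 * (integral {0..t} (\<lambda>s. s ^ n * (e s)\<^sup>2) + integral {t..1} (\<lambda>s. s ^ n * (e s)\<^sup>2))
     - 2 * x * (N t + b * N 1) - 2 * y * (integral {0..t} (\<lambda>s. s ^ n * g s * e s) + integral {t..1} (\<lambda>s. s ^ n * g s * e s))
     + 2 * x * y * (M t + b * M 1)"
    unfolding integral_square_expand[OF g e] iN ip by (simp add: algebra_simps)
  also have "\<dots> = ?G + ((x * (1 + b))\<^sup>2 * (t ^ (n + 1) / (real n + 1)) + (x * b)\<^sup>2 * ((1 - t ^ (n + 1)) / (real n + 1)))
     + y\<^sup>2 * E - 2 * x * (N t + 0) - 2 * y * 0 + 2 * x * y * (M t + 0)"
    unfolding s b by (rule refl)
  also have "(x * (1 + b))\<^sup>2 * (t ^ (n + 1) / (real n + 1)) + (x * b)\<^sup>2 * ((1 - t ^ (n + 1)) / (real n + 1)) = x\<^sup>2 * ?th"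
  proof -
    have "x2 * p * (T / c) + x2 * q * (S / c) = x2 * ((p * T + q * S) / c)" for x2 p q T S c :: real
      by (simp add: algebra_simps add_divide_distrib)
    then show ?thesis unfolding power_mult_distrib[of x] .
  qed
  also have "y\<^sup>2 * E = x\<^sup>2 * ((M t)\<^sup>2 / E)" using E(2) by (simp add: y_def power2_eq_square)
  also have "?G + x\<^sup>2 * ?th + x\<^sup>2 * ((M t)\<^sup>2 / E) - 2 * x * (N t + 0) - 2 * y * 0 + 2 * x * y * (M t + 0)
     = ?G - 2 * x * N t + x\<^sup>2 * (?th - (M t)\<^sup>2 / E)"
    using E(2) by (simp add: y_def power2_eq_square algebra_simps)
  finally show "0 \<le> ?G - 2 * x * N t + x\<^sup>2 * (?th - (M t)\<^sup>2 / E)" .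
qed

text \<open>The radial factor of the squared norm of a Bessel mode; the other factor is \<open>angular_mass\<close>.\<close>

definition radial_mass :: "nat \<Rightarrow> real" where "radial_mass n = I01 (\<lambda>t. t ^ n * (radial_bessel n t)\<^sup>2)"

lemma integral_pos_continuous:
  assumes c: "continuous_on UNIV F" and nn: "\<And>t. 0 \<le> t \<Longrightarrow> t \<le> 1 \<Longrightarrow> 0 \<le> F t" and s: "0 \<le> s" "s \<le> 1" "0 < F s"
  shows "0 < I01 (F :: real \<Rightarrow> real)"
proof -
  have "0 \<le> I01 F" by (intro Henstock_Kurzweil_Integration.integral_nonneg cont_integrable c) (use nn in auto)
  moreover have "I01 F \<noteq> 0"
  proof
    assume "I01 F = 0"
    then have "(F has_integral 0) {0..1}" using cont_integrable[OF c, of 0 1] integrable_integral by force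
    then have "F s = 0"
      using has_integral_0_cbox_imp_0[of 0 1 F s] continuous_on_subset[OF c] nn s by (auto simp: box_real)
    then show False using s by simp
  qed
  ultimately show ?thesis by simp
qed

lemma bessel_clifford_0_at_0: "bessel_clifford 0 0 = 1"
proof -
  have "bessel_clifford 0 0 = (\<Sum>m. (-1) ^ m / (fact m * fact (m + 0)) * 0 ^ m :: real)" by (simp add: bessel_clifford_def)
  also have "\<dots> = (\<Sum>m\<in>{0}. (-1) ^ m / (fact m * fact (m + 0)) * 0 ^ m)"
    by (rule suminf_finite) auto
  finally show ?thesis by simp
qed

lemma radial_mass_pos: "0 < radial_mass 0" "0 < radial_mass 1"
proof -
  show "0 < radial_mass 0" unfolding radial_mass_def
  proof (rule integral_pos_continuous[where s=0])
    have "radial_bessel 0 0 = 1" by (simp add: radial_bessel_def bessel_clifford_0_at_0)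
    then show "0 < 0 ^ 0 * (radial_bessel 0 0)\<^sup>2" by simp
  qed (auto intro!: continuous_intros continuous_radial_bessel)
  show "0 < radial_mass 1" unfolding radial_mass_def
    by (rule integral_pos_continuous[where s="1/2"])
       (use radial_bessel_pos[of "1/2"] in \<open>auto intro!: continuous_intros continuous_radial_bessel mult_pos_pos\<close>)
qed

text \<open>For \<open>n = 0\<close> (with mean zero) and \<open>n = 1\<close> the function \<open>e = radial_bessel n\<close> is an
  eigenfunction with eigenvalue \<open>\<mu>\<close>. All other eigenvalues together are at most the trace of the
  operator minus \<open>\<mu>\<close>. The trace is \<open>1/8\<close> in both cases, and \<open>1/8 - \<mu> < 1/16\<close>. The trace inequality
  is obtained by integrating the bound of \<open>deflated_bound\<close> over \<open>t\<close>: \<open>f\<close> is split into \<open>a e + g\<close>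
  with \<open>g\<close> orthogonal to \<open>e\<close>, and the energies of the two parts add.\<close>

lemma spectral_low:
  assumes n: "n = 0 \<or> n = 1" and mean: "n = 0 \<Longrightarrow> I01 (poly f) = 0"
  shows "I01 (\<lambda>t. t ^ n * poly f t * poly (radial_inverse n f) t) \<le>
     1/16 * I01 (\<lambda>t. t ^ n * (poly f t)\<^sup>2) +
     (mu - 1/16) * ((I01 (\<lambda>t. t ^ n * poly f t * radial_bessel n t))\<^sup>2 / radial_mass n)"
proof -
  define e where "e = radial_bessel n"
  define E where "E = radial_mass n"
  have E: "E = I01 (\<lambda>t. t ^ n * (e t)\<^sup>2)" "0 < E" using n radial_mass_pos by (auto simp: E_def radial_mass_def e_def)
  have j0: "0 < jj" using bessel_zero_props by simp
  have ce: "continuous_on UNIV e" unfolding e_def by (rule continuous_radial_bessel)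
  \<comment> \<open>Four times the negative derivative of the potential: \<open>t\<^bsup>n+1\<^esup> W\<close> is the primitive of \<open>t\<^sup>n f\<close>.
    \<open>We\<close> is the same for \<open>e\<close>.\<close>
  define W where "W t = - 4 * poly (pderiv (radial_inverse n f)) t" for t
  define We where "We t = 2 / jj * radial_bessel (Suc n) t" for t
  define a where "a = I01 (\<lambda>t. t ^ n * poly f t * e t) / E"
  define g where "g t = poly f t - a * e t" for t
  define Wg where "Wg t = W t - a * We t" for t
  define N where "N t = t ^ (n + 1) * Wg t" for t
  define M where "M t = t ^ (n + 1) * We t" for t
  have cg: "continuous_on UNIV g" unfolding g_def by (intro continuous_intros ce)
  have cWe: "continuous_on UNIV We" unfolding We_def by (intro continuous_intros continuous_radial_bessel)
  have cWg: "continuous_on UNIV Wg" unfolding Wg_def W_def by (intro continuous_intros cWe)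
  have de: "(e has_real_derivative - (jj\<^sup>2 / 4) * We t) (at t)" for t
    using DERIV_radial_bessel[of n t] j0 by (simp add: e_def We_def power2_eq_square)
  have dM: "(M has_real_derivative t ^ n * e t) (at t)" for t
  proof -
    have "(M has_real_derivative (real n + 1) * t ^ n * We t + t ^ (n + 1) * (2 / jj * (- (jj / 2) * radial_bessel (Suc (Suc n)) t))) (at t)"
      unfolding M_def We_def by (rule derivative_eq_intros DERIV_radial_bessel refl | simp add: algebra_simps)+
    also have "(real n + 1) * t ^ n * We t + t ^ (n + 1) * (2 / jj * (- (jj / 2) * radial_bessel (Suc (Suc n)) t))
       = t ^ n * (2 / jj * ((real n + 1) * radial_bessel (Suc n) t) - t * radial_bessel (Suc (Suc n)) t)"
      using j0 by (simp add: We_def algebra_simps add_divide_distrib)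
    also have "\<dots> = t ^ n * e t" unfolding radial_bessel_recurrence using j0 by (simp add: e_def algebra_simps)
    finally show ?thesis .
  qed
  have dNW: "((\<lambda>t. t ^ (n + 1) * W t) has_real_derivative t ^ n * poly f t) (at t)" for t
  proof -
    have "((\<lambda>t. t ^ (n + 1) * W t) has_real_derivative t ^ n * (- 4 * (t * poly (pderiv (pderiv (radial_inverse n f))) t + (real n + 1) * poly (pderiv (radial_inverse n f)) t))) (at t)"
      unfolding W_def by (rule derivative_eq_intros poly_DERIV refl | simp add: algebra_simps)+
    then show ?thesis unfolding poly_radial_inverse .
  qed
  have dN: "(N has_real_derivative t ^ n * g t) (at t)" for t
  proof -
    have "((\<lambda>t. t ^ (n + 1) * W t - a * M t) has_real_derivative t ^ n * poly f t - a * (t ^ n * e t)) (at t)"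
      by (intro DERIV_diff DERIV_cmult dNW dM)
    then show ?thesis by (simp add: N_def[abs_def] Wg_def M_def g_def algebra_simps)
  qed
  have N0: "N 0 = 0" "M 0 = 0" by (auto simp: N_def M_def)
  have M1: "M 1 = 0" if "n = 0" using that radial_bessel_1 by (simp add: M_def We_def)
  have N1: "N 1 = 0" if "n = 0"
  proof -
    have "W 1 = 0" using FTC[OF dNW, of 0 1] mean that by simp
    then show ?thesis using M1[OF that] by (simp add: N_def Wg_def M_def)
  qed
  have e1: "e 1 = 0" if "n = 1" using that radial_bessel_1 by (simp add: e_def)
  have orth: "I01 (\<lambda>t. t ^ n * g t * e t) = 0"
  proof -
    have "I01 (\<lambda>t. t ^ n * g t * e t) = I01 (\<lambda>t. t ^ n * poly f t * e t - a * (t ^ n * (e t)\<^sup>2))"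
      by (rule integral_cong) (simp add: g_def power2_eq_square algebra_simps)
    also have "\<dots> = I01 (\<lambda>t. t ^ n * poly f t * e t) - a * E"
      unfolding E(1) by (subst Henstock_Kurzweil_Integration.integral_diff) (auto intro!: cont_integrable continuous_intros ce)
    finally show ?thesis using E(2) by (simp add: a_def)
  qed
  have parts: "I01 (\<lambda>t. t ^ (n + 1) * X t * We t) = 4 * mu * I01 (\<lambda>t. t ^ n * h t * e t)"
    if X: "\<And>t. ((\<lambda>t. t ^ (n + 1) * X t) has_real_derivative t ^ n * h t) (at t)" "n = 0 \<Longrightarrow> X 1 = 0"
      "continuous_on UNIV X" "continuous_on UNIV h" for X h
  proof -
    have d: "((\<lambda>t. (t ^ (n + 1) * X t) * e t) has_real_derivative t ^ n * h t * e t + (- (jj\<^sup>2 / 4) * We t) * (t ^ (n + 1) * X t)) (at t)" for t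
      by (rule DERIV_mult[OF X(1) de])
    have "I01 (\<lambda>t. t ^ n * h t * e t + (- (jj\<^sup>2 / 4) * We t) * (t ^ (n + 1) * X t)) = X 1 * e 1"
      using FTC[OF d, of 0 1] by simp
    also have "\<dots> = 0" using n X(2) e1 by auto
    finally have "I01 (\<lambda>t. t ^ n * h t * e t + (- (jj\<^sup>2 / 4)) * (t ^ (n + 1) * X t * We t)) = 0"
      by (simp add: mult_ac)
    moreover have "I01 (\<lambda>t. t ^ n * h t * e t + (- (jj\<^sup>2 / 4)) * (t ^ (n + 1) * X t * We t)) =
       I01 (\<lambda>t. t ^ n * h t * e t) + (- (jj\<^sup>2 / 4)) * I01 (\<lambda>t. t ^ (n + 1) * X t * We t)"
      by (subst Henstock_Kurzweil_Integration.integral_add) (auto intro!: cont_integrable continuous_intros ce cWe X(3,4))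
    ultimately show ?thesis using j0 by (simp add: mu_def field_simps)
  qed
  have IWe: "I01 (\<lambda>t. t ^ (n + 1) * (We t)\<^sup>2) = 4 * mu * E"
    using parts[of We e, OF dM[unfolded M_def[abs_def]]] M1 cWe ce by (simp add: M_def E(1) power2_eq_square mult_ac)
  have Icross: "I01 (\<lambda>t. t ^ (n + 1) * Wg t * We t) = 0"
    using parts[of Wg g, OF dN[unfolded N_def[abs_def]]] N1 cWg cg orth by (simp add: N_def)
  define G where "G = I01 (\<lambda>t. t ^ n * (g t)\<^sup>2)"
  have G0: "0 \<le> G" unfolding G_def
    by (intro Henstock_Kurzweil_Integration.integral_nonneg cont_integrable continuous_intros cg) auto
  have FG: "I01 (\<lambda>t. t ^ n * (poly f t)\<^sup>2) = G + a\<^sup>2 * E"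
  proof -
    have "I01 (\<lambda>t. t ^ n * (poly f t)\<^sup>2) = I01 (\<lambda>t. t ^ n * (g t)\<^sup>2 + 2 * a * (t ^ n * g t * e t) + a\<^sup>2 * (t ^ n * (e t)\<^sup>2))"
      by (rule integral_cong) (simp add: g_def power2_eq_square algebra_simps)
    also have "\<dots> = G + 2 * a * I01 (\<lambda>t. t ^ n * g t * e t) + a\<^sup>2 * E"
      unfolding G_def E(1)
      by (intro integral_unique has_integral_add has_integral_mult_right integrable_integral cont_integrable continuous_intros cg ce)
    finally show ?thesis by (simp add: orth)
  qed
  have QW: "I01 (\<lambda>t. t ^ n * poly f t * poly (radial_inverse n f) t) = 1/4 * I01 (\<lambda>t. t ^ (n + 1) * (W t)\<^sup>2)"
    unfolding radial_inverse_energy W_def by (simp add: power_mult_distrib flip: Henstock_Kurzweil_Integration.integral_mult_right)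
      (simp add: mult_ac)
  have Wsplit: "I01 (\<lambda>t. t ^ (n + 1) * (W t)\<^sup>2) = I01 (\<lambda>t. t ^ (n + 1) * (Wg t)\<^sup>2) + a\<^sup>2 * (4 * mu * E)"
  proof -
    have "I01 (\<lambda>t. t ^ (n + 1) * (W t)\<^sup>2) = I01 (\<lambda>t. t ^ (n + 1) * (Wg t)\<^sup>2 + 2 * a * (t ^ (n + 1) * Wg t * We t) + a\<^sup>2 * (t ^ (n + 1) * (We t)\<^sup>2))"
      by (rule integral_cong) (simp add: Wg_def power2_eq_square algebra_simps)
    also have "\<dots> = I01 (\<lambda>t. t ^ (n + 1) * (Wg t)\<^sup>2) + 2 * a * I01 (\<lambda>t. t ^ (n + 1) * Wg t * We t) + a\<^sup>2 * I01 (\<lambda>t. t ^ (n + 1) * (We t)\<^sup>2)"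
      by (intro integral_unique has_integral_add has_integral_mult_right integrable_integral cont_integrable continuous_intros cWg cWe)
    finally show ?thesis unfolding Icross IWe by simp
  qed
  \<comment> \<open>Up to the weight, the squared norm of the indicator function of \<open>[0, t]\<close>, after projecting
    off constants if \<open>n = 0\<close>. Its integral is four times the trace.\<close>
  define th where "th t = (if n = 0 then 1 - t else 1/2 :: real)" for t
  have pt: "t ^ (n + 1) * (Wg t)\<^sup>2 \<le> G * (th t - t ^ (n + 1) * (We t)\<^sup>2 / E)" if t: "t \<in> {0..1}" for t
  proof (cases "t = 0")
    case True
    then show ?thesis using G0 by (simp add: th_def)
  next
    case False
    then have t0: "0 < t" "t \<le> 1" using t by auto
    \<comment> \<open>For \<open>n = 0\<close> constants are orthogonal to \<open>g\<close>; \<open>t\<close> is the mean of the indicator function.\<close>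
    define b where "b = (if n = 0 then - t else 0)"
    have "(N t)\<^sup>2 \<le> G * (((1 + b)\<^sup>2 * t ^ (n + 1) + b\<^sup>2 * (1 - t ^ (n + 1))) / (real n + 1) - (M t)\<^sup>2 / E)"
      unfolding G_def
      by (rule deflated_bound[OF cg ce dN N0(1) dM N0(2) E orth]) (use t0 N1 M1 in \<open>auto simp: b_def\<close>)
    also have "((1 + b)\<^sup>2 * t ^ (n + 1) + b\<^sup>2 * (1 - t ^ (n + 1))) / (real n + 1) = t ^ (n + 1) * th t"
      using n by (auto simp: b_def th_def power2_eq_square algebra_simps)
    finally have "t ^ (n + 1) * (t ^ (n + 1) * (Wg t)\<^sup>2) \<le> t ^ (n + 1) * (G * (th t - t ^ (n + 1) * (We t)\<^sup>2 / E))"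
      by (simp add: N_def M_def power_mult_distrib power2_eq_square algebra_simps)
    then show ?thesis using t0 by (simp add: mult_le_cancel_left_pos del: power_Suc)
  qed
  have cth: "continuous_on UNIV th" using n by (auto simp: th_def intro!: continuous_intros)
  have "I01 (\<lambda>t. t ^ (n + 1) * (Wg t)\<^sup>2) \<le> I01 (\<lambda>t. G * (th t - t ^ (n + 1) * (We t)\<^sup>2 / E))"
    using E(2) by (intro integral_le pt cont_integrable continuous_intros cWg cWe cth) auto
  also have "\<dots> = G * (I01 th - I01 (\<lambda>t. t ^ (n + 1) * (We t)\<^sup>2) / E)"
    using E(2) by (intro integral_unique has_integral_diff has_integral_mult_right has_integral_divide integrable_integral cont_integrable continuous_intros cWe cth)
  also have "I01 th = 1/2"
  proof (cases "n = 0")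
    case True
    have "((\<lambda>t. t - t\<^sup>2 / 2) has_real_derivative 1 - t) (at t)" for t :: real
      by (auto intro!: derivative_eq_intros)
    from FTC[OF this, of 0 1] show ?thesis using True by (simp add: th_def[abs_def])
  qed (simp add: th_def[abs_def])
  also have "G * (1/2 - I01 (\<lambda>t. t ^ (n + 1) * (We t)\<^sup>2) / E) = G * (1/2 - 4 * mu)"
    unfolding IWe using E(2) by simp
  finally have "I01 (\<lambda>t. t ^ (n + 1) * (Wg t)\<^sup>2) \<le> G * (1/2 - 4 * mu)" .
  then have "I01 (\<lambda>t. t ^ n * poly f t * poly (radial_inverse n f) t) \<le> 1/4 * (G * (1/2 - 4 * mu) + a\<^sup>2 * (4 * mu * E))"
    unfolding QW Wsplit by simp
  also have "\<dots> = (1/8 - mu) * G + mu * (a\<^sup>2 * E)"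
    by (simp add: algebra_simps)
  also have "\<dots> \<le> 1/16 * G + mu * (a\<^sup>2 * E)"
    using mu_bounds G0 by (intro add_right_mono mult_right_mono) auto
  also have "\<dots> = 1/16 * (G + a\<^sup>2 * E) + (mu - 1/16) * (a\<^sup>2 * E)"
    by (simp add: algebra_simps)
  also have "a\<^sup>2 * E = (I01 (\<lambda>t. t ^ n * poly f t * radial_bessel n t))\<^sup>2 / radial_mass n"
    using E(2) by (simp add: a_def e_def power_divide power2_eq_square flip: E_def)
  finally show ?thesis unfolding FG[unfolded \<open>a\<^sup>2 * E = _\<close>] .
qed

section \<open>Orthogonality of the modes\<close>

definition rot :: "real \<Rightarrow> plane \<Rightarrow> plane" where
  "rot b x = vector [cos b * x$1 - sin b * x$2, sin b * x$1 + cos b * x$2]"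

lemma to_complex_rot: "to_complex (rot b x) = cis b * to_complex x"
  by (simp add: to_complex_def rot_def complex_eq_iff)

lemma rsq_rot: "rsq (rot b x) = rsq x"
proof -
  have "of_real (rsq (rot b x)) = (of_real (rsq x) :: complex)"
    unfolding rsq_to_complex to_complex_rot by (simp add: cis_mult cis_cnj algebra_simps)
  then show ?thesis by simp
qed

text \<open>A linear change of variables with determinant 1 that maps the disk onto itself.\<close>

lemma integral_rot:
  assumes f: "continuous_on UNIV f"
  shows "(LINT x|MD. f (rot b x)) = (LINT x|MD. (f x :: real))"
proof -
  have lin: "linear (rot b)"
    by (rule linearI) (auto simp: rot_def vec_eq_iff forall_2 algebra_simps)
  have img: "rot b ` disk = disk"
  proof
    have n: "norm (rot c x) = norm x" for c x
      using rsq_rot[of c x] by (simp add: rsq_norm)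
    show "rot b ` disk \<subseteq> disk" by (auto simp: mem_disk n)
    show "disk \<subseteq> rot b ` disk"
    proof
      fix x assume "x \<in> disk"
      have "to_complex (rot b (rot (- b) x)) = to_complex x" by (simp add: to_complex_rot cis_mult flip: mult.assoc)
      then have "x = rot b (rot (- b) x)" by (simp add: to_complex_def vec_eq_iff forall_2)
      then show "x \<in> rot b ` disk" using \<open>x \<in> disk\<close> by (metis image_eqI mem_disk n)
    qed
  qed
  have "det (matrix (rot b)) = 1"
    by (simp add: det_2 matrix_def rot_def axis_def flip: power2_eq_square)
  have fL: "integrable MD f" by (rule integrable_MD_continuous[OF f])
  have cr: "continuous_on UNIV (\<lambda>x. f (rot b x))"
    by (rule continuous_on_compose2[OF f linear_continuous_on[OF lin[THEN linear_linear[THEN iffD2]]]]) auto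
  let ?v = "\<lambda>x. vec (f x) :: real^1"
  have "f absolutely_integrable_on disk"
    using fL by (simp add: set_integrable_def integrable_restrict_space)
  then have ai: "?v absolutely_integrable_on rot b ` disk"
    unfolding img by (simp add: absolutely_integrable_on_1_iff)
  have "integral (rot b ` disk) ?v = \<bar>det (matrix (rot b))\<bar> *\<^sub>R integral disk (?v \<circ> rot b)"
    by (rule integral_change_of_variables_linear[OF lin]) (use ai in blast)
  then have "integral disk ?v = integral disk (\<lambda>x. vec (f (rot b x)) :: real^1)"
    using img \<open>det _ = 1\<close> by (simp add: o_def)
  then have "integral disk f = integral disk (\<lambda>x. f (rot b x))"
    by (simp add: integral_on_1_eq)
  then show ?thesis
    by (simp add: lebesgue_integral_eq_integral fL integrable_MD_continuous[OF cr])
qed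

lemma integral_antisymmetric:
  assumes "continuous_on UNIV h" "\<And>x. h (rot b x) = - h x"
  shows "(LINT x|MD. (h x :: real)) = 0"
  using integral_rot[OF assms(1), of b] by (simp add: assms(2))

text \<open>The mean over the unit circle of the square of \<open>cos (n \<theta>)\<close> or \<open>sin (n \<theta>)\<close>.\<close>

definition angular_mass :: "nat \<Rightarrow> bool \<Rightarrow> real" where
  "angular_mass n s = (if n = 0 then (if s then 1 else 0) else 1/2)"

text \<open>The product of two harmonic polynomials is a combination of real and imaginary parts of
  \<open>z\<^sup>n z\<^sup>m\<close> and \<open>z\<^sup>n z\<^bsup>*m\<^esup>\<close>. A rotation by \<open>\<pi>/(n + m)\<close>, respectively \<open>\<pi>/(n - m)\<close>, changes their signs,
  so all integrals vanish except that of \<open>z\<^sup>n z\<^bsup>*n\<^esup> = \<bar>z\<bar>\<^bsup>2n\<^esup>\<close>.\<close>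

lemma mode_orthogonality:
  assumes F: "continuous_on UNIV F"
  shows "(LINT x|MD. F (rsq x) * (Y n s x * Y m s' x)) =
     (if n = m \<and> s = s' then angular_mass n s * pi * I01 (\<lambda>t. t ^ n * F t) else 0)"
proof -
  have cF: "continuous_on UNIV (\<lambda>x. F (rsq x))" by (rule continuous_on_compose2[OF F continuous_rsq]) auto
  show ?thesis
  proof (cases "n = 0 \<and> m = 0")
    case True
    have "(LINT x|MD. F (rsq x)) = pi * I01 F" by (rule integral_radial[OF F])
    then show ?thesis using True by (auto simp: Y_def re_or_im_def angular_mass_def)
  next
    case False
    have cP: "continuous_on UNIV (\<lambda>x. F (rsq x) * re_or_im \<sigma> (to_complex x ^ n * to_complex x ^ m))"
      "continuous_on UNIV (\<lambda>x. F (rsq x) * re_or_im \<sigma> (to_complex x ^ n * cnj (to_complex x ^ m)))" for \<sigma>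
      by (intro continuous_intros cF)+
    have P0: "(LINT x|MD. F (rsq x) * re_or_im \<sigma> (to_complex x ^ n * to_complex x ^ m)) = 0" for \<sigma>
    proof (rule integral_antisymmetric[OF cP(1)])
      fix x
      let ?b = "pi / real (n + m)"
      have "to_complex (rot ?b x) ^ n * to_complex (rot ?b x) ^ m = cis ?b ^ (n + m) * (to_complex x ^ n * to_complex x ^ m)"
        by (simp add: to_complex_rot power_mult_distrib power_add mult_ac)
      also have "cis ?b ^ (n + m) = - 1"
      proof -
        have "cis ?b ^ (n + m) = cis (real (n + m) * ?b)" by (rule Complex.DeMoivre)
        also have "real (n + m) * ?b = pi" using False by (simp del: of_nat_add)
        finally show ?thesis by simp
      qed
      finally show "F (rsq (rot ?b x)) * re_or_im \<sigma> (to_complex (rot ?b x) ^ n * to_complex (rot ?b x) ^ m) = - (F (rsq x) * re_or_im \<sigma> (to_complex x ^ n * to_complex x ^ m))"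
        by (simp add: rsq_rot re_or_im_def algebra_simps)
    qed
    have Q0: "(LINT x|MD. F (rsq x) * re_or_im \<sigma> (to_complex x ^ n * cnj (to_complex x ^ m))) = 0" if "n \<noteq> m" for \<sigma>
    proof (rule integral_antisymmetric[OF cP(2)])
      fix x
      let ?b = "pi / (real n - real m)"
      have "to_complex (rot ?b x) ^ n * cnj (to_complex (rot ?b x) ^ m) = (cis ?b ^ n * cnj (cis ?b ^ m)) * (to_complex x ^ n * cnj (to_complex x ^ m))"
        by (simp add: to_complex_rot power_mult_distrib mult_ac)
      also have "cis ?b ^ n * cnj (cis ?b ^ m) = cis ((real n - real m) * ?b)"
        by (simp add: Complex.DeMoivre cis_mult cis_cnj algebra_simps diff_divide_distrib)
      also have "\<dots> = - 1" using that by simp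
      finally show "F (rsq (rot ?b x)) * re_or_im \<sigma> (to_complex (rot ?b x) ^ n * cnj (to_complex (rot ?b x) ^ m)) = - (F (rsq x) * re_or_im \<sigma> (to_complex x ^ n * cnj (to_complex x ^ m)))"
        by (simp add: rsq_rot re_or_im_def algebra_simps)
    qed
    have Q1: "(LINT x|MD. F (rsq x) * re_or_im \<sigma> (to_complex x ^ n * cnj (to_complex x ^ m))) = (if \<sigma> then pi * I01 (\<lambda>t. t ^ n * F t) else 0)" if "n = m" for \<sigma>
    proof -
      have "to_complex x ^ n * cnj (to_complex x ^ m) = of_real (rsq x ^ n)" for x
        using that by (simp add: rsq_to_complex power_mult_distrib)
      then have "(LINT x|MD. F (rsq x) * re_or_im \<sigma> (to_complex x ^ n * cnj (to_complex x ^ m))) = (LINT x|MD. (if \<sigma> then rsq x ^ n * F (rsq x) else 0))"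
        by (simp add: re_or_im_def mult.commute)
      moreover have "continuous_on UNIV (\<lambda>t. t ^ n * F t)" by (intro continuous_intros F)
      from integral_radial[OF this] have "(LINT x|MD. rsq x ^ n * F (rsq x)) = pi * I01 (\<lambda>t. t ^ n * F t)" .
      ultimately show ?thesis by simp
    qed
    let ?P = "\<lambda>\<sigma> x. F (rsq x) * re_or_im \<sigma> (to_complex x ^ n * to_complex x ^ m)"
    let ?Q = "\<lambda>\<sigma> x. F (rsq x) * re_or_im \<sigma> (to_complex x ^ n * cnj (to_complex x ^ m))"
    have i: "integrable MD (?P \<sigma>)" "integrable MD (?Q \<sigma>)" for \<sigma>
      by (intro integrable_MD_continuous cP)+
    define \<sigma> where "\<sigma> = (s = s')"
    define p q where "p = (if s = s' \<and> \<not> s then - 1/2 else 1/2 :: real)" and "q = (if s \<and> \<not> s' then - 1/2 else 1/2 :: real)"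
    have "F (rsq x) * (Y n s x * Y m s' x) = p * ?P \<sigma> x + q * ?Q \<sigma> x" for x
      by (cases s; cases s') (simp_all add: Y_def re_or_im_def \<sigma>_def p_def q_def algebra_simps del: complex_cnj_power)
    then have "(LINT x|MD. F (rsq x) * (Y n s x * Y m s' x)) = p * (LINT x|MD. ?P \<sigma> x) + q * (LINT x|MD. ?Q \<sigma> x)"
      using i by simp
    then show ?thesis
      using P0 Q0 Q1 False by (cases "n = m") (auto simp: \<sigma>_def q_def angular_mass_def)
  qed
qed

text \<open>Sums of modes with arbitrary radial coefficients, so that polynomials and Bessel modes are
  covered by the same orthogonality relation.\<close>

definition mode_sum :: "(nat \<times> bool) set \<Rightarrow> (nat \<times> bool \<Rightarrow> real \<Rightarrow> real) \<Rightarrow> plane \<Rightarrow> real" where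
  "mode_sum I f x = (\<Sum>k\<in>I. f k (rsq x) * Y (fst k) (snd k) x)"

lemma continuous_mode:
  "continuous_on UNIV f \<Longrightarrow> continuous_on UNIV (\<lambda>x. f (rsq x) * Y n s x)"
  by (intro continuous_intros continuous_on_compose2[OF _ continuous_rsq]) auto

lemma mode_sum_inner:
  assumes I: "finite I" and J: "finite J" and f: "\<And>k. continuous_on UNIV (f k)" and g: "\<And>k. continuous_on UNIV (g k)"
  shows "(LINT x|MD. mode_sum I f x * mode_sum J g x) =
     (\<Sum>k\<in>I \<inter> J. angular_mass (fst k) (snd k) * pi * I01 (\<lambda>t. t ^ fst k * (f k t * g k t)))"
proof -
  have "(LINT x|MD. mode_sum I f x * mode_sum J g x) =
    (LINT x|MD. (\<Sum>k\<in>I. \<Sum>l\<in>J. (f k (rsq x) * g l (rsq x)) * (Y (fst k) (snd k) x * Y (fst l) (snd l) x)))"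
    by (simp add: mode_sum_def sum_product mult_ac)
  also have "\<dots> = (\<Sum>k\<in>I. \<Sum>l\<in>J. LINT x|MD. (f k (rsq x) * g l (rsq x)) * (Y (fst k) (snd k) x * Y (fst l) (snd l) x))"
  proof -
    have "continuous_on UNIV (\<lambda>x. (f k (rsq x) * g l (rsq x)) * (Y (fst k) (snd k) x * Y (fst l) (snd l) x))" for k l
      by (intro continuous_intros continuous_on_compose2[OF f continuous_rsq] continuous_on_compose2[OF g continuous_rsq]) auto
    then have i: "integrable MD (\<lambda>x. (f k (rsq x) * g l (rsq x)) * (Y (fst k) (snd k) x * Y (fst l) (snd l) x))" for k l
      by (rule integrable_MD_continuous)
    show ?thesis using i by (simp add: Bochner_Integration.integral_sum)
  qed
  also have "\<dots> = (\<Sum>k\<in>I. \<Sum>l\<in>J. if k = l then angular_mass (fst k) (snd k) * pi * I01 (\<lambda>t. t ^ fst k * (f k t * g l t)) else 0)"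
    by (intro sum.cong refl, subst mode_orthogonality) (auto intro!: continuous_intros f g simp: prod_eq_iff)
  also have "\<dots> = (\<Sum>k\<in>I. if k \<in> J then angular_mass (fst k) (snd k) * pi * I01 (\<lambda>t. t ^ fst k * (f k t * g k t)) else 0)"
    using J by (intro sum.cong refl) (simp add: sum.delta)
  also have "\<dots> = (\<Sum>k\<in>I \<inter> J. angular_mass (fst k) (snd k) * pi * I01 (\<lambda>t. t ^ fst k * (f k t * g k t)))"
    using I by (simp add: sum.inter_restrict)
  finally show ?thesis .
qed

section \<open>The eigenfunctions\<close>

text \<open>The indices of \<open>J\<^sub>0 (j r)\<close>, \<open>J\<^sub>1 (j r) cos \<theta>\<close> and \<open>J\<^sub>1 (j r) sin \<theta>\<close>.\<close>

definition ground_modes :: "(nat \<times> bool) set" where "ground_modes = {(0, True), (1, True), (1, False)}"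

definition ground_mode :: "nat \<times> bool \<Rightarrow> plane \<Rightarrow> real" where
  "ground_mode k x = radial_bessel (fst k) (rsq x) * Y (fst k) (snd k) x"

text \<open>The squared \<open>L\<^sup>2\<close> norm of the eigenfunction.\<close>

definition nu :: "nat \<times> bool \<Rightarrow> real" where "nu k = angular_mass (fst k) (snd k) * pi * radial_mass (fst k)"

definition comb :: "(nat \<times> bool \<Rightarrow> real) \<Rightarrow> plane \<Rightarrow> real" where
  "comb a x = (\<Sum>k\<in>ground_modes. a k * ground_mode k x)"

text \<open>The Fourier coefficient, so that \<open>comb (coef w)\<close> is the orthogonal projection of \<open>w\<close> onto
  the span of the eigenfunctions.\<close>

definition coef :: "(plane \<Rightarrow> real) \<Rightarrow> nat \<times> bool \<Rightarrow> real" where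
  "coef w k = (LINT x|MD. w x * ground_mode k x) / nu k"

lemma finite_ground_modes: "finite ground_modes" by (simp add: ground_modes_def)

lemma nu_pos: "k \<in> ground_modes \<Longrightarrow> 0 < nu k"
  using radial_mass_pos by (auto simp: ground_modes_def nu_def angular_mass_def)

lemma continuous_ground_mode: "continuous_on UNIV (ground_mode k)"
  unfolding ground_mode_def[abs_def] by (rule continuous_mode[OF continuous_radial_bessel])

lemma continuous_comb: "continuous_on UNIV (comb a)"
  unfolding comb_def[abs_def] by (intro continuous_intros continuous_ground_mode)

lemma ground_mode_mode_sum: "ground_mode k = mode_sum {k} (\<lambda>k. radial_bessel (fst k))"
  by (simp add: fun_eq_iff ground_mode_def mode_sum_def)

lemma ground_mode_inner: "(LINT x|MD. ground_mode k x * ground_mode l x) = (if k = l then nu k else 0)"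
  unfolding ground_mode_mode_sum by (subst mode_sum_inner) (auto intro: continuous_radial_bessel simp: nu_def radial_mass_def power2_eq_square)

lemma comb_inner_ground_mode: "l \<in> ground_modes \<Longrightarrow> (LINT x|MD. comb a x * ground_mode l x) = a l * nu l"
proof -
  assume l: "l \<in> ground_modes"
  have "(LINT x|MD. comb a x * ground_mode l x) = (LINT x|MD. (\<Sum>k\<in>ground_modes. a k * (ground_mode k x * ground_mode l x)))"
    by (simp add: comb_def sum_distrib_right mult.assoc)
  also have "\<dots> = (\<Sum>k\<in>ground_modes. a k * (LINT x|MD. ground_mode k x * ground_mode l x))"
    by (subst Bochner_Integration.integral_sum) (auto intro!: integrable_MD_continuous continuous_intros continuous_ground_mode)
  also have "\<dots> = (\<Sum>k\<in>ground_modes. if k = l then a k * nu k else 0)"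
    by (intro sum.cong) (auto simp: ground_mode_inner)
  finally show ?thesis using l finite_ground_modes by simp
qed

lemma comb_norm: "(LINT x|MD. comb a x * comb b x) = (\<Sum>k\<in>ground_modes. a k * b k * nu k)"
proof -
  have "(LINT x|MD. comb a x * comb b x) = (LINT x|MD. (\<Sum>k\<in>ground_modes. b k * (comb a x * ground_mode k x)))"
    unfolding comb_def[of b] sum_distrib_left by (simp only: mult.left_commute)
  also have "\<dots> = (\<Sum>k\<in>ground_modes. b k * (LINT x|MD. comb a x * ground_mode k x))"
    by (subst Bochner_Integration.integral_sum) (auto intro!: integrable_MD_continuous continuous_intros continuous_ground_mode continuous_comb)
  finally show ?thesis by (simp add: comb_inner_ground_mode mult_ac cong: sum.cong)
qed

lemma I01_radial_bessel_0: "I01 (radial_bessel 0) = 0"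
proof -
  have d: "((\<lambda>t. 2 / jj * (t * radial_bessel 1 t)) has_real_derivative radial_bessel 0 t) (at t)" for t
  proof -
    have "((\<lambda>t. 2 / jj * (t * radial_bessel 1 t)) has_real_derivative 2 / jj * (radial_bessel 1 t + t * (- (jj / 2) * radial_bessel (Suc 1) t))) (at t)"
      by (rule derivative_eq_intros DERIV_radial_bessel refl | simp)+
    also have "2 / jj * (radial_bessel 1 t + t * (- (jj / 2) * radial_bessel (Suc 1) t)) = radial_bessel 0 t"
      using radial_bessel_recurrence[of 0 t] bessel_zero_props(1) by (simp add: algebra_simps)
    finally show ?thesis .
  qed
  show ?thesis using FTC[OF d, of 0 1] radial_bessel_1 by simp
qed

text \<open>For \<open>J\<^sub>0 (j r)\<close> the mean is zero because \<open>t radial_bessel 1 t\<close> is, up to a constant, a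
  primitive of \<open>radial_bessel 0\<close> and vanishes at 0 and at 1; for the other two by symmetry.\<close>

lemma integral_ground_mode: "k \<in> ground_modes \<Longrightarrow> (LINT x|MD. ground_mode k x) = 0"
proof -
  assume k: "k \<in> ground_modes"
  have "(LINT x|MD. ground_mode k x) = (LINT x|MD. radial_bessel (fst k) (rsq x) * (Y (fst k) (snd k) x * Y 0 True x))"
    by (simp add: ground_mode_def Y_def[of 0] re_or_im_def)
  also have "\<dots> = 0"
    by (subst mode_orthogonality) (use k in \<open>auto simp: ground_modes_def I01_radial_bessel_0 intro: continuous_radial_bessel\<close>)
  finally show ?thesis .
qed

lemma integral_comb: "(LINT x|MD. comb a x) = 0"
proof -
  have "(LINT x|MD. comb a x) = (\<Sum>k\<in>ground_modes. a k * (LINT x|MD. ground_mode k x))"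
    unfolding comb_def by (subst Bochner_Integration.integral_sum) (auto intro!: integrable_MD_continuous continuous_intros continuous_ground_mode)
  then show ?thesis by (simp add: integral_ground_mode)
qed

text \<open>Each mode satisfies \<open>- \<Delta> \<mu> u = u\<close>. Only \<open>J\<^sub>0 (j r)\<close> is not zero on the circle; it is
  constant there, and subtracting this constant leaves the Laplacian unchanged.\<close>

lemma green_comb:
  assumes v: "\<And>x. x \<in> disk \<Longrightarrow> v x = comb a x"
  shows "green v = (\<lambda>x. if x \<in> disk then mu * (comb a x - a (0, True) * radial_bessel 0 1) else 0)"
proof -
  have j0: "0 < jj" by (rule bessel_zero_props)
  have "\<exists>B. C2 (\<lambda>x. mu * (radial_bessel (fst k) (rsq x) - radial_bessel (fst k) 1) * Y (fst k) (snd k) x) (fst B) (snd B) \<and>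
     (\<forall>x. (\<Sum>i\<in>UNIV. snd B i x) = - ground_mode k x)" for k
  proof -
    let ?n = "fst k"
    have d: "((\<lambda>t. mu * (radial_bessel ?n t - radial_bessel ?n 1)) has_real_derivative mu * (- (jj / 2) * radial_bessel (Suc ?n) t)) (at t)"
      "((\<lambda>t. mu * (- (jj / 2) * radial_bessel (Suc ?n) t)) has_real_derivative mu * (- (jj / 2) * (- (jj / 2) * radial_bessel (Suc (Suc ?n)) t))) (at t)" for t
      by (rule derivative_eq_intros DERIV_radial_bessel refl | simp)+
    have c: "continuous_on UNIV (\<lambda>t. mu * (- (jj / 2) * (- (jj / 2) * radial_bessel (Suc (Suc ?n)) t)))"
      by (intro continuous_intros continuous_radial_bessel)
    obtain B1 B2 where B: "C2 (\<lambda>x. mu * (radial_bessel ?n (rsq x) - radial_bessel ?n 1) * Y ?n (snd k) x) B1 B2"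
      "\<And>x. (\<Sum>i\<in>UNIV. B2 i x) = 4 * (rsq x * (mu * (- (jj / 2) * (- (jj / 2) * radial_bessel (Suc (Suc ?n)) (rsq x)))) + (real ?n + 1) * (mu * (- (jj / 2) * radial_bessel (Suc ?n) (rsq x)))) * Y ?n (snd k) x"
      by (rule mode_C2[OF d c]) blast
    have "4 * (t * (mu * (- (jj / 2) * (- (jj / 2) * radial_bessel (Suc (Suc ?n)) t))) + (real ?n + 1) * (mu * (- (jj / 2) * radial_bessel (Suc ?n) t))) = - radial_bessel ?n t" for t
    proof -
      have "4 * (t * (mu * (- (jj / 2) * (- (jj / 2) * radial_bessel (Suc (Suc ?n)) t))) + (real ?n + 1) * (mu * (- (jj / 2) * radial_bessel (Suc ?n) t)))
        = mu * (jj * (jj * t * radial_bessel (Suc (Suc ?n)) t - 2 * ((real ?n + 1) * radial_bessel (Suc ?n) t)))"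
        by (simp add: algebra_simps)
      also have "\<dots> = mu * (jj * (- jj * radial_bessel ?n t))" unfolding radial_bessel_recurrence by (simp add: algebra_simps)
      also have "\<dots> = - radial_bessel ?n t" using j0 by (simp add: mu_def power2_eq_square)
      finally show ?thesis .
    qed
    then have "(\<Sum>i\<in>UNIV. B2 i x) = - ground_mode k x" for x unfolding B(2) by (simp add: ground_mode_def)
    then show ?thesis using B(1) by (intro exI[of _ "(B1, B2)"]) simp
  qed
  then obtain B where B: "\<And>k. C2 (\<lambda>x. mu * (radial_bessel (fst k) (rsq x) - radial_bessel (fst k) 1) * Y (fst k) (snd k) x) (fst (B k)) (snd (B k))"
     "\<And>k x. (\<Sum>i\<in>UNIV. snd (B k) i x) = - ground_mode k x"
    using choice[of "\<lambda>k B. C2 (\<lambda>x. mu * (radial_bessel (fst k) (rsq x) - radial_bessel (fst k) 1) * Y (fst k) (snd k) x) (fst B) (snd B) \<and>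
     (\<forall>x. (\<Sum>i\<in>UNIV. snd B i x) = - ground_mode k x)"] by blast
  have cst: "C2 (\<lambda>x. a k) (\<lambda>i x. 0) (\<lambda>i x. 0)" for k
    by (intro C2I has_partial_const continuous_intros)
  have Ck: "C2 (\<lambda>x. a k * (mu * (radial_bessel (fst k) (rsq x) - radial_bessel (fst k) 1) * Y (fst k) (snd k) x))
     (\<lambda>i x. a k * fst (B k) i x) (\<lambda>i x. a k * snd (B k) i x)" for k
    using C2_mult[OF cst B(1)] by simp
  let ?A = "\<lambda>x. \<Sum>k\<in>ground_modes. a k * (mu * (radial_bessel (fst k) (rsq x) - radial_bessel (fst k) 1) * Y (fst k) (snd k) x)"
  have "C2 ?A (\<lambda>i x. \<Sum>k\<in>ground_modes. a k * fst (B k) i x) (\<lambda>i x. \<Sum>k\<in>ground_modes. a k * snd (B k) i x)"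
    by (rule C2_sum[OF finite_ground_modes Ck])
  moreover have "?A x = 0" if "norm x = 1" for x using that by (simp add: rsq_norm)
  moreover have "v x = - (\<Sum>i\<in>UNIV. \<Sum>k\<in>ground_modes. a k * snd (B k) i x)" if "x \<in> disk" for x
    using v[OF that] by (subst sum.swap) (simp add: comb_def B(2) flip: sum_distrib_left sum_negf)
  ultimately have "dirichlet_solution v (\<lambda>x. if x \<in> disk then ?A x else 0)"
    by (rule C2_dirichlet)
  then have "green v = (\<lambda>x. if x \<in> disk then ?A x else 0)" by (rule green_eqI)
  moreover have eqA: "?A x = mu * (comb a x - a (0, True) * radial_bessel 0 1)" for x
    using radial_bessel_1 by (simp add: ground_modes_def comb_def ground_mode_def Y_def[of 0] re_or_im_def algebra_simps)
  ultimately show ?thesis by (simp only: eqA)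
qed

lemma energy_MD: "energy v = 1/2 * (LINT x|MD. v x * green v x)"
  by (simp add: energy_def set_integral_MD)

text \<open>The constant by which the potential differs from \<open>\<mu>\<close> times the function does not contribute,
  because the function has mean zero.\<close>

lemma energy_comb:
  assumes v: "\<And>x. x \<in> disk \<Longrightarrow> v x = comb a x"
  shows "2 * energy v = mu * (LINT x|MD. (v x)\<^sup>2)"
proof -
  have "2 * energy v = (LINT x|MD. mu * (comb a x * comb a x) - (mu * (a (0, True) * radial_bessel 0 1)) * comb a x)"
  proof -
    have "green v = (\<lambda>x. if x \<in> disk then mu * (comb a x - a (0, True) * radial_bessel 0 1) else 0)"
      by (rule green_comb) (rule v)
    then show ?thesis
      unfolding energy_MD by (auto intro!: Bochner_Integration.integral_cong simp: v algebra_simps)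
  qed
  also have "\<dots> = mu * (LINT x|MD. comb a x * comb a x)"
    by (subst Bochner_Integration.integral_diff)
       (auto intro!: integrable_MD_continuous continuous_intros continuous_comb simp: integral_comb)
  also have "(LINT x|MD. comb a x * comb a x) = (LINT x|MD. (v x)\<^sup>2)"
    by (rule Bochner_Integration.integral_cong) (auto simp: v power2_eq_square)
  finally show ?thesis .
qed

section \<open>The spectral gap\<close>

text \<open>By orthogonality both sides are sums over the modes, and the inequality holds for each of
  them. Mean zero concerns the radial mode only; it is what \<open>spectral_low\<close> needs for \<open>n = 0\<close>.\<close>

lemma spectral_gap_modal:
  assumes I: "finite I" and mean: "(LINT x|MD. poly_mode_sum I p x) = 0"
  shows "(LINT x|MD. poly_mode_sum I p x * poly_mode_sum I (potential_coeffs p) x) \<le>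
     1/16 * (LINT x|MD. (poly_mode_sum I p x)\<^sup>2) + (mu - 1/16) * (\<Sum>k\<in>ground_modes. (LINT x|MD. poly_mode_sum I p x * ground_mode k x)\<^sup>2 / nu k)"
proof -
  have fs: "poly_mode_sum I p = mode_sum I (\<lambda>k. poly (p k))" for I p by (simp add: fun_eq_iff poly_mode_sum_def mode_sum_def)
  have cp: "continuous_on UNIV (poly q)" for q :: "real poly" by (intro continuous_intros)
  let ?c = "\<lambda>k. angular_mass (fst k) (snd k) * pi"
  let ?F = "\<lambda>k. I01 (\<lambda>t. t ^ fst k * (poly (p k) t)\<^sup>2)"
  let ?X = "\<lambda>k. I01 (\<lambda>t. t ^ fst k * poly (p k) t * radial_bessel (fst k) t)"
  have c0: "0 \<le> ?c k" for k by (simp add: angular_mass_def)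
  have Q: "(LINT x|MD. poly_mode_sum I p x * poly_mode_sum I (potential_coeffs p) x) = (\<Sum>k\<in>I. ?c k * I01 (\<lambda>t. t ^ fst k * poly (p k) t * poly (radial_inverse (fst k) (p k)) t))"
    unfolding fs by (subst mode_sum_inner[OF I I cp cp]) (simp add: potential_coeffs_def mult.assoc)
  have N: "(LINT x|MD. (poly_mode_sum I p x)\<^sup>2) = (\<Sum>k\<in>I. ?c k * ?F k)"
    unfolding fs power2_eq_square by (subst mode_sum_inner[OF I I cp cp]) simp
  have P: "(LINT x|MD. poly_mode_sum I p x * ground_mode k x) = (if k \<in> I then ?c k * ?X k else 0)" for k
    unfolding fs ground_mode_mode_sum by (subst mode_sum_inner[OF I _ cp continuous_radial_bessel]) (auto simp: mult.assoc)
  have m0: "I01 (poly (p (0, True))) = 0" if "(0, True) \<in> I"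
  proof -
    have one: "mode_sum {(0, True)} (\<lambda>_ _. 1) x = 1" for x by (simp add: mode_sum_def Y_def re_or_im_def)
    have "(LINT x|MD. mode_sum I (\<lambda>k. poly (p k)) x * mode_sum {(0, True)} (\<lambda>_ _. 1) x) = pi * I01 (poly (p (0, True)))"
      using that by (subst mode_sum_inner[OF I _ cp]) (auto simp: angular_mass_def intro: continuous_intros)
    then show ?thesis using mean unfolding fs one by simp
  qed
  have each: "?c k * I01 (\<lambda>t. t ^ fst k * poly (p k) t * poly (radial_inverse (fst k) (p k)) t)
     \<le> 1/16 * (?c k * ?F k) + (mu - 1/16) * (if k \<in> ground_modes then (?c k * ?X k)\<^sup>2 / nu k else 0)" if k: "k \<in> I" for k
  proof (cases "2 \<le> fst k")
    case True
    have "?c k * I01 (\<lambda>t. t ^ fst k * poly (p k) t * poly (radial_inverse (fst k) (p k)) t) \<le> ?c k * (1/16 * ?F k)"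
      by (rule mult_left_mono[OF spectral_high[OF True] c0])
    moreover have "k \<notin> ground_modes" using True by (auto simp: ground_modes_def)
    ultimately show ?thesis by simp
  next
    case False
    then have n: "fst k = 0 \<or> fst k = 1" by linarith
    show ?thesis
    proof (cases "k = (0, False)")
      case True
      then show ?thesis by (simp add: angular_mass_def ground_modes_def)
    next
      case False
      then have kK: "k \<in> ground_modes" using n by (cases k; cases "snd k") (auto simp: ground_modes_def)
      have "?c k * I01 (\<lambda>t. t ^ fst k * poly (p k) t * poly (radial_inverse (fst k) (p k)) t) \<le>
         ?c k * (1/16 * ?F k + (mu - 1/16) * ((?X k)\<^sup>2 / radial_mass (fst k)))"
      proof (rule mult_left_mono[OF spectral_low[OF n] c0])
        assume "fst k = 0"
        then have "k = (0, True)" using kK by (auto simp: ground_modes_def)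
        then show "I01 (poly (p k)) = 0" using m0 k by simp
      qed
      also have "\<dots> = 1/16 * (?c k * ?F k) + (mu - 1/16) * (?c k * (?X k)\<^sup>2 / radial_mass (fst k))"
        by (simp add: algebra_simps)
      also have "?c k * (?X k)\<^sup>2 / radial_mass (fst k) = (?c k * ?X k)\<^sup>2 / nu k"
      proof -
        have "?c k \<noteq> 0" using kK by (auto simp: ground_modes_def angular_mass_def)
        then show ?thesis by (simp add: nu_def power2_eq_square)
      qed
      finally show ?thesis using kK by simp
    qed
  qed
  have "(\<Sum>k\<in>I. ?c k * I01 (\<lambda>t. t ^ fst k * poly (p k) t * poly (radial_inverse (fst k) (p k)) t))
     \<le> (\<Sum>k\<in>I. 1/16 * (?c k * ?F k) + (mu - 1/16) * (if k \<in> ground_modes then (?c k * ?X k)\<^sup>2 / nu k else 0))"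
    by (rule sum_mono[OF each])
  also have "\<dots> = 1/16 * (\<Sum>k\<in>I. ?c k * ?F k) + (mu - 1/16) * (\<Sum>k\<in>I. if k \<in> ground_modes then (?c k * ?X k)\<^sup>2 / nu k else 0)"
    by (simp add: sum.distrib sum_distrib_left)
  also have "(\<Sum>k\<in>I. if k \<in> ground_modes then (?c k * ?X k)\<^sup>2 / nu k else 0) = (\<Sum>k\<in>I \<inter> ground_modes. (?c k * ?X k)\<^sup>2 / nu k)"
    using I by (simp add: sum.inter_restrict)
  also have "\<dots> = (\<Sum>k\<in>ground_modes. if k \<in> I then (?c k * ?X k)\<^sup>2 / nu k else 0)"
    by (subst Int_commute) (simp add: sum.inter_restrict finite_ground_modes)
  also have "\<dots> = (\<Sum>k\<in>ground_modes. (LINT x|MD. poly_mode_sum I p x * ground_mode k x)\<^sup>2 / nu k)"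
    unfolding P by (rule sum.cong) auto
  finally show ?thesis unfolding Q N .
qed

section \<open>The Green operator on bounded functions\<close>

lemma green_solution: "w \<in> LI \<Longrightarrow> dirichlet_solution w (green w)"
  using green_approximation[of w] green_eqI by metis

lemma green_LI: "w \<in> LI \<Longrightarrow> green w \<in> LI"
  using green_solution Linf_cont_cball by (auto simp: dirichlet_solution_def closure_disk)

lemma test_LI:
  assumes "\<phi> \<in> test_functions disk" shows "\<phi> \<in> LI" "laplacian \<phi> \<in> LI"
proof -
  note c = test_C2[OF assms, unfolded C2_def]
  show "\<phi> \<in> LI" using c by (intro Linf_cont) blast
  show "laplacian \<phi> \<in> LI"
    unfolding laplacian_def[abs_def] by (intro Linf_cont continuous_intros) (use c in blast)
qed

lemma green_diff:
  assumes w: "w1 \<in> LI" "w2 \<in> LI"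
  shows "green (\<lambda>x. w1 x - w2 x) = (\<lambda>x. green w1 x - green w2 x)"
proof (rule green_eqI)
  note s = green_solution[OF w(1), unfolded dirichlet_solution_def set_integral_MD]
    green_solution[OF w(2), unfolded dirichlet_solution_def set_integral_MD]
  show "dirichlet_solution (\<lambda>x. w1 x - w2 x) (\<lambda>x. green w1 x - green w2 x)"
    unfolding dirichlet_solution_def set_integral_MD
  proof (intro conjI allI impI ballI)
    fix \<phi> assume \<phi>: "\<phi> \<in> test_functions disk"
    have i: "integrable MD (\<lambda>x. green w1 x * - laplacian \<phi> x)" "integrable MD (\<lambda>x. green w2 x * - laplacian \<phi> x)"
      "integrable MD (\<lambda>x. w1 x * \<phi> x)" "integrable MD (\<lambda>x. w2 x * \<phi> x)"
      using Linf_integrable[OF Linf_mult[OF green_LI[OF w(1)] test_LI(2)[OF \<phi>]]]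
        Linf_integrable[OF Linf_mult[OF green_LI[OF w(2)] test_LI(2)[OF \<phi>]]]
        Linf_integrable[OF Linf_mult[OF w(1) test_LI(1)[OF \<phi>]]] Linf_integrable[OF Linf_mult[OF w(2) test_LI(1)[OF \<phi>]]]
      by auto
    have "(LINT x|MD. green w1 x * - laplacian \<phi> x) - (LINT x|MD. green w2 x * - laplacian \<phi> x) = (LINT x|MD. w1 x * \<phi> x) - (LINT x|MD. w2 x * \<phi> x)"
      using s \<phi> by simp
    then show "(LINT x|MD. (green w1 x - green w2 x) * - laplacian \<phi> x) = (LINT x|MD. (w1 x - w2 x) * \<phi> x)"
      unfolding left_diff_distrib using i by simp
  qed (use s in \<open>auto intro!: continuous_intros\<close>)
qed

lemma powr_add_bound:
  fixes a b q :: real assumes "0 \<le> q"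
  shows "\<bar>a + b\<bar> powr q \<le> 2 powr q * (\<bar>a\<bar> powr q + \<bar>b\<bar> powr q)"
proof -
  have "\<bar>a + b\<bar> \<le> 2 * max \<bar>a\<bar> \<bar>b\<bar>" by auto
  then have "\<bar>a + b\<bar> powr q \<le> (2 * max \<bar>a\<bar> \<bar>b\<bar>) powr q" using assms by (intro powr_mono2) auto
  also have "\<dots> = 2 powr q * (max \<bar>a\<bar> \<bar>b\<bar>) powr q" by (simp add: powr_mult)
  also have "\<dots> \<le> 2 powr q * (\<bar>a\<bar> powr q + \<bar>b\<bar> powr q)" by (intro mult_left_mono) (auto simp: max_def)
  finally show ?thesis .
qed

text \<open>Below the threshold \<open>e\<close> the first summand suffices, above it the second: a lower power is
  controlled by a higher one up to a small constant.\<close>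

lemma powr_split:
  fixes d e p q :: real assumes "0 < q" "q \<le> p" "0 < e"
  shows "\<bar>d\<bar> powr q \<le> e powr q + e powr (q - p) * \<bar>d\<bar> powr p"
proof (cases "\<bar>d\<bar> \<le> e")
  case True
  then have "\<bar>d\<bar> powr q \<le> e powr q" using assms by (intro powr_mono2) auto
  then show ?thesis by (simp add: add_increasing2)
next
  case False
  then have "\<bar>d\<bar> powr (q - p) \<le> e powr (q - p)" using assms by (intro powr_mono2') auto
  moreover have "\<bar>d\<bar> powr q = \<bar>d\<bar> powr (q - p) * \<bar>d\<bar> powr p"
    by (simp flip: powr_add)
  ultimately have "\<bar>d\<bar> powr q \<le> e powr (q - p) * \<bar>d\<bar> powr p" by (simp add: mult_right_mono)
  then show ?thesis by (simp add: add_increasing)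
qed

lemma powr_le_square:
  fixes d e q :: real assumes "0 < q" "q \<le> 2" "0 < e"
  shows "\<bar>d\<bar> powr q \<le> e powr q + e powr (q - 2) * d\<^sup>2"
  using powr_split[of q 2 e d] assms by (cases "d = 0") auto

text \<open>The supremum bound for polynomials, passed to the limit. The approximation is controlled in
  \<open>L\<^sup>2\<close>, hence in \<open>L\<^sup>q\<close> because \<open>q \<le> 2\<close>.\<close>

lemma green_bound:
  assumes q: "1 < q" "q \<le> 2"
  obtains C where "0 < C" "\<And>w a x. w \<in> LI \<Longrightarrow> 0 < a \<Longrightarrow> (LINT x|MD. \<bar>w x\<bar> powr q) \<le> a powr q \<Longrightarrow> \<bar>green w x\<bar> \<le> C * a"
proof -
  obtain C where C: "0 < C" "\<And>A A1 A2 a x. C2 A A1 A2 \<Longrightarrow> (\<And>x. norm x = 1 \<Longrightarrow> A x = 0) \<Longrightarrow> 0 < a \<Longrightarrow>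
     (LINT x|MD. \<bar>\<Sum>i\<in>UNIV. A2 i x\<bar> powr q) \<le> a powr q \<Longrightarrow> norm x \<le> 1 \<Longrightarrow> \<bar>A x\<bar> \<le> C * a"
    using sup_bound_Lq[OF q(1)] by blast
  show ?thesis
  proof (rule that[of "C * 4"])
    fix w :: "plane \<Rightarrow> real" and a :: real and x :: plane
    assume w: "w \<in> LI" and a: "0 < a" and wa: "(LINT x|MD. \<bar>w x\<bar> powr q) \<le> a powr q"
    obtain u I p D where u: "dirichlet_solution w u" "0 < D" "\<And>k. finite (I k)"
      "\<And>k. (LINT x|MD. (poly_mode_sum (I k) (p k) x - w x)^2) \<le> (1 / real (Suc k))^2"
      "\<And>k x. x \<in> disk \<Longrightarrow> \<bar>poly_mode_sum (I k) (potential_coeffs (p k)) x - u x\<bar> \<le> D / real (Suc k)"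
      by (rule green_approximation[OF w]) (rule that)
    have gu: "green w = u" by (rule green_eqI[OF u(1)])
    define W where "W k = poly_mode_sum (I k) (p k)" for k
    define h where "h k = 1 / real (Suc k)" for k
    have h0: "h \<longlonglongrightarrow> 0" unfolding h_def by (rule LIMSEQ_Suc[OF lim_1_over_n])
    have WL: "W k \<in> LI" for k unfolding W_def by (intro Linf_cont continuous_poly_mode_sum u(3))
    define e where "e = a / 8"
    have e: "0 < e" using a by (simp add: e_def)
    have epi: "e powr q * pi \<le> a powr q / 2"
    proof -
      have "e powr q = a powr q * (1/8) powr q" unfolding e_def using a powr_mult[of a "1/8" q] by simp
      also have "\<dots> \<le> a powr q * (1/8) powr 1" using q by (intro mult_left_mono powr_mono') auto
      finally have "e powr q * pi \<le> a powr q * (1/8) * 4" using pi_less_4 by (intro mult_mono) auto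
      then show ?thesis by simp
    qed
    have "(\<lambda>k. e powr (q - 2) * (h k)\<^sup>2) \<longlonglongrightarrow> e powr (q - 2) * 0\<^sup>2" by (intro tendsto_intros h0)
    then have ev: "\<forall>\<^sub>F k in sequentially. e powr (q - 2) * (h k)\<^sup>2 < a powr q / 2"
      using a by (intro order_tendstoD(2)) auto
    have bnd: "\<bar>u x\<bar> \<le> C * (4 * a) + D * h k" if x: "x \<in> disk" and k: "e powr (q - 2) * (h k)\<^sup>2 < a powr q / 2" for k
    proof -
      have dL: "(\<lambda>x. W k x - w x) \<in> LI" by (intro Linf_diff WL w)
      have id: "integrable MD (\<lambda>x. \<bar>W k x - w x\<bar> powr q)" "integrable MD (\<lambda>x. \<bar>w x\<bar> powr q)" "integrable MD (\<lambda>x. \<bar>W k x\<bar> powr q)"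
        using q by (auto intro!: Linf_integrable Linf_powr dL w WL)
      have id2: "integrable MD (\<lambda>x. (W k x - w x)\<^sup>2)" by (intro Linf_integrable Linf_power dL)
      have "(LINT x|MD. \<bar>W k x - w x\<bar> powr q) \<le> (LINT x|MD. e powr q + e powr (q - 2) * (W k x - w x)\<^sup>2)"
        using id(1) id2 Linf_integrable[OF Linf_const] powr_le_square[of q e] q e by (intro integral_mono) auto
      also have "\<dots> = e powr q * pi + e powr (q - 2) * (LINT x|MD. (W k x - w x)\<^sup>2)"
        using id2 Linf_integrable[OF Linf_const] by (simp add: measure_MD)
      also have "\<dots> \<le> e powr q * pi + e powr (q - 2) * (h k)\<^sup>2"
        using u(4)[of k] by (intro add_left_mono mult_left_mono) (auto simp: W_def h_def)
      also have "\<dots> \<le> a powr q" using epi k by simp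
      finally have dq: "(LINT x|MD. \<bar>W k x - w x\<bar> powr q) \<le> a powr q" .
      have "(LINT x|MD. \<bar>W k x\<bar> powr q) \<le> (LINT x|MD. 2 powr q * (\<bar>w x\<bar> powr q + \<bar>W k x - w x\<bar> powr q))"
      proof (rule integral_mono)
        fix x
        show "\<bar>W k x\<bar> powr q \<le> 2 powr q * (\<bar>w x\<bar> powr q + \<bar>W k x - w x\<bar> powr q)"
          using powr_add_bound[of q "w x" "W k x - w x"] q by simp
      qed (use id in auto)
      also have "\<dots> = 2 powr q * ((LINT x|MD. \<bar>w x\<bar> powr q) + (LINT x|MD. \<bar>W k x - w x\<bar> powr q))"
        using id by simp
      also have "\<dots> \<le> 2 powr q * (a powr q + a powr q)" using wa dq by (intro mult_left_mono add_mono) auto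
      also have "\<dots> \<le> 2 powr q * (2 powr q * a powr q)"
      proof -
        have "2 powr 1 \<le> 2 powr q" using q by (intro powr_mono) auto
        then have "2 * a powr q \<le> 2 powr q * a powr q" by (intro mult_right_mono) auto
        then show ?thesis by (intro mult_left_mono) auto
      qed
      also have "\<dots> = (4 * a) powr q"
        using a powr_mult[of 2 2 q] by (simp add: powr_mult)
      finally have Wq: "(LINT x|MD. \<bar>W k x\<bar> powr q) \<le> (4 * a) powr q" .
      obtain A1 A2 where A: "C2 (poly_mode_sum (I k) (potential_coeffs (p k))) A1 A2" "\<And>x. (\<Sum>i\<in>UNIV. A2 i x) = - poly_mode_sum (I k) (p k) x"
        using poly_mode_sum_potential_C2[OF u(3)] by blast
      have "\<bar>poly_mode_sum (I k) (potential_coeffs (p k)) x\<bar> \<le> C * (4 * a)"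
        by (rule C(2)[OF A(1) poly_mode_sum_potential_bd]) (use a Wq x in \<open>auto simp: A(2) W_def mem_disk\<close>)
      moreover have "D / real (Suc k) = D * h k" by (simp add: h_def)
      ultimately show ?thesis using u(5)[OF x, of k] by linarith
    qed
    show "\<bar>green w x\<bar> \<le> C * 4 * a"
    proof (cases "x \<in> disk")
      case True
      have "(\<lambda>k. C * (4 * a) + D * h k) \<longlonglongrightarrow> C * (4 * a) + D * 0" by (intro tendsto_intros h0)
      moreover have "\<forall>\<^sub>F k in sequentially. \<bar>u x\<bar> \<le> C * (4 * a) + D * h k"
        using ev by eventually_elim (rule bnd[OF True])
      ultimately have "\<bar>u x\<bar> \<le> C * (4 * a) + D * 0" by (intro tendsto_lowerbound) auto
      then show ?thesis by (simp add: gu mult.assoc)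
    next
      case False
      then have "u x = 0" using u(1) by (simp add: dirichlet_solution_def)
      then show ?thesis using C(1) a by (simp add: gu)
    qed
  qed (use C in simp)
qed

lemma L1_le_Lq:
  assumes q: "1 < q" and f: "f \<in> LI" and a: "0 < a" "(LINT x|MD. \<bar>f x\<bar> powr q) \<le> a powr q"
  shows "(LINT x|MD. \<bar>f x\<bar>) \<le> 4 * a"
proof -
  define s where "s = q / (q - 1)"
  have s: "1 < s" "1/q + 1/s = 1" using q by (auto simp: s_def field_simps)
  have "(LINT x|MD. \<bar>f x\<bar> * \<bar>1\<bar>) \<le> a * 4"
  proof (rule Hoelder(2)[OF q s])
    have "pi \<le> 4 powr 1" using pi_less_4 by simp
    also have "\<dots> \<le> 4 powr s" using s by (intro powr_mono) auto
    finally show "(LINT x|MD. \<bar>1\<bar> powr s) \<le> 4 powr s" by (simp add: measure_MD)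
  qed (use a q f Linf_integrable[OF Linf_const] in \<open>auto intro!: Linf_integrable Linf_powr Linf_meas\<close>)
  then show ?thesis by simp
qed

text \<open>By \<open>green_bound\<close> the bilinear form \<open>\<integral> f G w\<close> is continuous in \<open>L\<^sup>q\<close>, and the difference of
  the energies is a sum of two such forms with the difference \<open>w1 - w2\<close> in one place.\<close>

lemma energy_difference:
  assumes q: "1 < q" "q \<le> 2"
  obtains C where "0 < C" "\<And>w1 w2 a b. w1 \<in> LI \<Longrightarrow> w2 \<in> LI \<Longrightarrow> 0 < a \<Longrightarrow> 0 < b \<Longrightarrow>
     (LINT x|MD. \<bar>w1 x - w2 x\<bar> powr q) \<le> a powr q \<Longrightarrow> (LINT x|MD. \<bar>w1 x\<bar> powr q) \<le> b powr q \<Longrightarrow>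
     (LINT x|MD. \<bar>w2 x\<bar> powr q) \<le> b powr q \<Longrightarrow> \<bar>energy w1 - energy w2\<bar> \<le> C * a * b"
proof -
  obtain C where C: "0 < C" "\<And>w a x. w \<in> LI \<Longrightarrow> 0 < a \<Longrightarrow> (LINT x|MD. \<bar>w x\<bar> powr q) \<le> a powr q \<Longrightarrow> \<bar>green w x\<bar> \<le> C * a"
    using green_bound[OF q] by blast
  have half: "\<bar>LINT x|MD. f x * green w x\<bar> \<le> 4 * a * (C * b)"
    if f: "f \<in> LI" "0 < a" "(LINT x|MD. \<bar>f x\<bar> powr q) \<le> a powr q" and w: "w \<in> LI" "0 < b" "(LINT x|MD. \<bar>w x\<bar> powr q) \<le> b powr q"
    for f w a b
  proof -
    have "\<bar>LINT x|MD. f x * green w x\<bar> \<le> (LINT x|MD. \<bar>f x * green w x\<bar>)" by (rule integral_abs_bound)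
    also have "\<dots> \<le> (LINT x|MD. \<bar>f x\<bar> * (C * b))"
    proof (rule integral_mono)
      show "integrable MD (\<lambda>x. \<bar>f x * green w x\<bar>)" by (intro Linf_integrable Linf_abs Linf_mult f green_LI w)
      show "integrable MD (\<lambda>x. \<bar>f x\<bar> * (C * b))" by (intro integrable_mult_left Linf_integrable Linf_abs f)
      show "\<bar>f x * green w x\<bar> \<le> \<bar>f x\<bar> * (C * b)" for x
        unfolding abs_mult by (intro mult_left_mono C(2) w) auto
    qed
    also have "\<dots> = (LINT x|MD. \<bar>f x\<bar>) * (C * b)" by simp
    also have "\<dots> \<le> 4 * a * (C * b)" using L1_le_Lq[OF q(1) f] C(1) w(2) by (intro mult_right_mono) auto
    finally show ?thesis .
  qed
  show ?thesis
  proof (rule that[of "4 * C"])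
    fix w1 w2 a b
    assume A: "w1 \<in> LI" "w2 \<in> LI" "0 < a" "0 < b" "(LINT x|MD. \<bar>w1 x - w2 x\<bar> powr q) \<le> a powr q"
      "(LINT x|MD. \<bar>w1 x\<bar> powr q) \<le> b powr q" "(LINT x|MD. \<bar>w2 x\<bar> powr q) \<le> b powr q"
    have dL: "(\<lambda>x. w1 x - w2 x) \<in> LI" by (intro Linf_diff A)
    have i: "integrable MD (\<lambda>x. f x * green g x)" if "f \<in> LI" "g \<in> LI" for f g
      by (intro Linf_integrable Linf_mult that green_LI)
    have "2 * (energy w1 - energy w2) = (LINT x|MD. w1 x * green w1 x) - (LINT x|MD. w2 x * green w2 x)"
      by (simp add: energy_MD)
    also have "\<dots> = (LINT x|MD. (w1 x - w2 x) * green w1 x + w2 x * green (\<lambda>x. w1 x - w2 x) x)"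
      unfolding green_diff[OF A(1,2)] using i A(1,2) by (simp add: algebra_simps)
    also have "\<dots> = (LINT x|MD. (w1 x - w2 x) * green w1 x) + (LINT x|MD. w2 x * green (\<lambda>x. w1 x - w2 x) x)"
      by (intro Bochner_Integration.integral_add i dL A)
    finally have "2 * \<bar>energy w1 - energy w2\<bar> \<le> \<bar>LINT x|MD. (w1 x - w2 x) * green w1 x\<bar> + \<bar>LINT x|MD. w2 x * green (\<lambda>x. w1 x - w2 x) x\<bar>"
      by linarith
    also have "\<dots> \<le> 4 * a * (C * b) + 4 * b * (C * a)"
      by (intro add_mono half dL A)
    finally show "\<bar>energy w1 - energy w2\<bar> \<le> 4 * C * a * b" by (simp add: mult_ac)
  qed (use C in simp)
qed

lemma inner_L2_tendsto:
  assumes f: "\<And>k. f k \<in> LI" "F \<in> LI" "\<And>k. (LINT x|MD. (f k x - F x)\<^sup>2) \<le> (h k)\<^sup>2"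
    and g: "\<And>k. g k \<in> LI" "G \<in> LI" "\<And>k. (LINT x|MD. (g k x - G x)\<^sup>2) \<le> (h k)\<^sup>2"
    and h: "\<And>k. 0 < h k" "h \<longlonglongrightarrow> 0"
  shows "(\<lambda>k. LINT x|MD. f k x * g k x) \<longlonglongrightarrow> (LINT x|MD. F x * G x)"
proof -
  obtain M where M: "0 < M" "AE x in MD. \<bar>F x\<bar> \<le> M" by (rule LinfE[OF f(2)])
  obtain N where N: "0 < N" "AE x in MD. \<bar>G x\<bar> \<le> N" by (rule LinfE[OF g(2)])
  show ?thesis
  proof (rule LIM_zero_cancel, rule Lim_null_comparison)
  have "(\<lambda>k. M * (3 * h k) + N * (3 * h k) + (h k)\<^sup>2) \<longlonglongrightarrow> M * (3 * 0) + N * (3 * 0) + 0\<^sup>2"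
    by (intro tendsto_intros h)
  then show "(\<lambda>k. M * (3 * h k) + N * (3 * h k) + (h k)\<^sup>2) \<longlonglongrightarrow> 0" by simp
  show "\<forall>\<^sub>F k in sequentially. norm ((LINT x|MD. f k x * g k x) - (LINT x|MD. F x * G x)) \<le> M * (3 * h k) + N * (3 * h k) + (h k)\<^sup>2"
  proof (rule always_eventually, rule allI)
    fix k
    have dL: "(\<lambda>x. f k x - F x) \<in> LI" "(\<lambda>x. g k x - G x) \<in> LI" by (intro Linf_diff f g)+
    have i: "integrable MD (\<lambda>x. \<bar>f k x - F x\<bar>)" "integrable MD (\<lambda>x. \<bar>g k x - G x\<bar>)"
      "integrable MD (\<lambda>x. (f k x - F x)\<^sup>2)" "integrable MD (\<lambda>x. (g k x - G x)\<^sup>2)"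
      by (intro Linf_integrable Linf_abs Linf_power dL)+
    have ip: "integrable MD (\<lambda>x. f k x * g k x)" "integrable MD (\<lambda>x. F x * G x)"
      by (intro Linf_integrable Linf_mult f g)+
    have "(LINT x|MD. f k x * g k x) - (LINT x|MD. F x * G x) = (LINT x|MD. f k x * g k x - F x * G x)"
      using ip by simp
    also have "\<bar>\<dots>\<bar> \<le> (LINT x|MD. \<bar>f k x * g k x - F x * G x\<bar>)" by (rule integral_abs_bound)
    also have "\<dots> \<le> (LINT x|MD. M * \<bar>g k x - G x\<bar> + N * \<bar>f k x - F x\<bar> + 1/2 * ((f k x - F x)\<^sup>2 + (g k x - G x)\<^sup>2))"
    proof (rule integral_mono_AE)
      show "integrable MD (\<lambda>x. \<bar>f k x * g k x - F x * G x\<bar>)" using ip by auto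
      show "integrable MD (\<lambda>x. M * \<bar>g k x - G x\<bar> + N * \<bar>f k x - F x\<bar> + 1/2 * ((f k x - F x)\<^sup>2 + (g k x - G x)\<^sup>2))"
        using i by auto
      show "AE x in MD. \<bar>f k x * g k x - F x * G x\<bar> \<le> M * \<bar>g k x - G x\<bar> + N * \<bar>f k x - F x\<bar> + 1/2 * ((f k x - F x)\<^sup>2 + (g k x - G x)\<^sup>2)"
        using M(2) N(2)
      proof eventually_elim
        case (elim x)
        define c d where "c = f k x - F x" and "d = g k x - G x"
        have "f k x * g k x - F x * G x = F x * d + G x * c + c * d" by (simp add: c_def d_def algebra_simps)
        then have "\<bar>f k x * g k x - F x * G x\<bar> \<le> \<bar>F x\<bar> * \<bar>d\<bar> + \<bar>G x\<bar> * \<bar>c\<bar> + \<bar>c * d\<bar>"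
          using abs_triangle_ineq[of "F x * d + G x * c" "c * d"] abs_triangle_ineq[of "F x * d" "G x * c"] by (simp add: abs_mult)
        also have "\<dots> \<le> M * \<bar>d\<bar> + N * \<bar>c\<bar> + 1/2 * (c\<^sup>2 + d\<^sup>2)"
        proof (intro add_mono mult_right_mono elim)
          have "0 \<le> (\<bar>c\<bar> - \<bar>d\<bar>)\<^sup>2" by simp
          then show "\<bar>c * d\<bar> \<le> 1/2 * (c\<^sup>2 + d\<^sup>2)" by (simp add: power2_diff abs_mult)
        qed auto
        finally show ?case by (simp add: c_def d_def)
      qed
    qed
    also have "\<dots> = M * (LINT x|MD. \<bar>g k x - G x\<bar>) + N * (LINT x|MD. \<bar>f k x - F x\<bar>) + 1/2 * ((LINT x|MD. (f k x - F x)\<^sup>2) + (LINT x|MD. (g k x - G x)\<^sup>2))"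
      using i by simp
    also have "\<dots> \<le> M * (3 * h k) + N * (3 * h k) + 1/2 * ((h k)\<^sup>2 + (h k)\<^sup>2)"
      using L1_le_L2[OF dL(1) h(1) f(3)] L1_le_L2[OF dL(2) h(1) g(3)] M(1) N(1) f(3)[of k] g(3)[of k]
      by (intro add_mono mult_left_mono) auto
    finally show "norm ((LINT x|MD. f k x * g k x) - (LINT x|MD. F x * G x)) \<le> M * (3 * h k) + N * (3 * h k) + (h k)\<^sup>2" by simp
  qed
  qed
qed

lemma modal_const: "modal (\<lambda>x. c)"
  using modal_single[of "[:c:]" 0 True] by (simp add: Y_def re_or_im_def)

text \<open>Subtracting the mean from an approximation costs no more than the approximation error, since
  the limit has mean zero.\<close>

lemma modal_mean_zero_approx:
  assumes w: "w \<in> LI" and m: "(LINT x|MD. w x) = 0" and e: "0 < e"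
  obtains g where "modal g" "(LINT x|MD. g x) = 0" "(LINT x|MD. (g x - w x)\<^sup>2) \<le> e\<^sup>2"
proof -
  obtain g where g: "modal g" "(LINT x|MD. (g x - w x)\<^sup>2) \<le> (e/8)\<^sup>2"
    by (rule modal_dense_L2[OF w, of "e/8"]) (use e in auto)
  have gL: "g \<in> LI" by (intro Linf_cont modal_continuous g)
  have dL: "(\<lambda>x. g x - w x) \<in> LI" by (intro Linf_diff gL w)
  define c where "c = (LINT x|MD. g x) / pi"
  have "pi * \<bar>c\<bar> = \<bar>LINT x|MD. g x - w x\<bar>"
    using Linf_integrable[OF gL] Linf_integrable[OF w] m by (simp add: c_def abs_divide)
  also have "\<dots> \<le> (LINT x|MD. \<bar>g x - w x\<bar>)" by (rule integral_abs_bound)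
  also have "\<dots> \<le> 3 * (e/8)" by (rule L1_le_L2[OF dL _ g(2)]) (use e in simp)
  finally have "3 * \<bar>c\<bar> \<le> 3 * (e/8)" using pi_gt3 mult_right_mono[of 3 pi "\<bar>c\<bar>"] by simp
  then have c: "c\<^sup>2 \<le> (e/8)\<^sup>2" using e abs_le_square_iff[of c "e/8"] by simp
  let ?g = "\<lambda>x. g x + - c"
  have mg: "modal ?g" by (intro modal_add g modal_const)
  have i: "integrable MD (\<lambda>x. (g x - w x)\<^sup>2)" by (intro Linf_integrable Linf_power dL)
  have "(LINT x|MD. ?g x) = (LINT x|MD. g x) - c * pi"
    using Linf_integrable[OF gL] Linf_integrable[OF Linf_const] by (simp add: measure_MD)
  then have "(LINT x|MD. ?g x) = 0" by (simp add: c_def)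
  moreover have "(LINT x|MD. (?g x - w x)\<^sup>2) \<le> (LINT x|MD. 2 * (g x - w x)\<^sup>2 + 2 * c\<^sup>2)"
  proof (rule integral_mono)
    show "integrable MD (\<lambda>x. (?g x - w x)\<^sup>2)"
      by (intro Linf_integrable Linf_power Linf_diff Linf_add gL Linf_const w)
    fix x
    have "0 \<le> ((g x - w x) + c)\<^sup>2" by simp
    then show "(?g x - w x)\<^sup>2 \<le> 2 * (g x - w x)\<^sup>2 + 2 * c\<^sup>2" by (simp add: power2_eq_square algebra_simps)
  qed (use i Linf_integrable[OF Linf_const] in auto)
  moreover have "(LINT x|MD. 2 * (g x - w x)\<^sup>2 + 2 * c\<^sup>2) = 2 * (LINT x|MD. (g x - w x)\<^sup>2) + 2 * c\<^sup>2 * pi"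
    using i Linf_integrable[OF Linf_const] by (simp add: measure_MD)
  moreover have "2 * (LINT x|MD. (g x - w x)\<^sup>2) + 2 * c\<^sup>2 * pi \<le> 2 * (e/8)\<^sup>2 + 2 * (e/8)\<^sup>2 * 4"
    using g(2) c pi_less_4 by (intro add_mono mult_mono) auto
  moreover have "2 * (e/8)\<^sup>2 + 2 * (e/8)\<^sup>2 * 4 \<le> e\<^sup>2" by (simp add: power2_eq_square)
  ultimately show ?thesis using that[OF mg] by linarith
qed

text \<open>The inequality for polynomials passes to the limit: right-hand sides converge in \<open>L\<^sup>2\<close> and,
  by the supremum bound, potentials converge uniformly. The last sum is \<open>\<parallel>P w\<parallel>\<^sup>2\<close>, with \<open>P\<close> the
  projection onto the three eigenfunctions.\<close>

theorem spectral_gap: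
  assumes w: "w \<in> LI" and m: "(LINT x|MD. w x) = 0"
  shows "2 * energy w \<le> 1/16 * (LINT x|MD. (w x)\<^sup>2) + (mu - 1/16) * (\<Sum>k\<in>ground_modes. (LINT x|MD. w x * ground_mode k x)\<^sup>2 / nu k)"
proof -
  define h where "h k = 1 / real (Suc k)" for k
  have h: "0 < h k" for k by (simp add: h_def)
  have h0: "h \<longlonglongrightarrow> 0" unfolding h_def by (rule LIMSEQ_Suc[OF lim_1_over_n])
  have "\<exists>g. modal g \<and> (LINT x|MD. g x) = 0 \<and> (LINT x|MD. (g x - w x)\<^sup>2) \<le> (h k)\<^sup>2" for k
    by (rule modal_mean_zero_approx[OF w m h]) blast
  then obtain g where g: "\<And>k. modal (g k)" "\<And>k. (LINT x|MD. g k x) = 0" "\<And>k. (LINT x|MD. (g k x - w x)\<^sup>2) \<le> (h k)\<^sup>2"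
    using choice[of "\<lambda>k g. modal g \<and> (LINT x|MD. g x) = 0 \<and> (LINT x|MD. (g x - w x)\<^sup>2) \<le> (h k)\<^sup>2"] by blast
  have gL: "g k \<in> LI" for k by (intro Linf_cont modal_continuous g)
  have ineq: "(LINT x|MD. g k x * green (g k) x) \<le> 1/16 * (LINT x|MD. g k x * g k x) + (mu - 1/16) * (\<Sum>l\<in>ground_modes. (LINT x|MD. g k x * ground_mode l x)\<^sup>2 / nu l)" for k
  proof -
    obtain I p where I: "finite I" "g k = poly_mode_sum I p" using g(1)[of k] by (auto simp: modal_def)
    obtain A1 A2 where A: "C2 (poly_mode_sum I (potential_coeffs p)) A1 A2" "\<And>x. (\<Sum>i\<in>UNIV. A2 i x) = - poly_mode_sum I p x"
      using poly_mode_sum_potential_C2[OF I(1)] by blast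
    have "dirichlet_solution (g k) (\<lambda>x. if x \<in> disk then poly_mode_sum I (potential_coeffs p) x else 0)"
      by (rule C2_dirichlet[OF A(1) poly_mode_sum_potential_bd]) (auto simp: A(2) I(2))
    then have gr: "green (g k) = (\<lambda>x. if x \<in> disk then poly_mode_sum I (potential_coeffs p) x else 0)" by (rule green_eqI)
    have "(LINT x|MD. g k x * green (g k) x) = (LINT x|MD. poly_mode_sum I p x * poly_mode_sum I (potential_coeffs p) x)"
      unfolding gr unfolding I(2) by (rule Bochner_Integration.integral_cong) auto
    then show ?thesis using spectral_gap_modal[OF I(1), of p] g(2)[of k] unfolding I(2) by (simp add: power2_eq_square)
  qed
  obtain C where C: "0 < C" "\<And>w a x. w \<in> LI \<Longrightarrow> 0 < a \<Longrightarrow> (LINT x|MD. \<bar>w x\<bar> powr 2) \<le> a powr 2 \<Longrightarrow> \<bar>green w x\<bar> \<le> C * a"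
    using green_bound[of 2] by auto
  define h' where "h' k = (1 + 2 * C) * h k" for k
  have h': "0 < h' k" "h k \<le> h' k" "2 * C * h k \<le> h' k" for k
    using h[of k] C(1) by (auto simp: h'_def algebra_simps intro!: add_pos_pos mult_pos_pos)
  have h'0: "h' \<longlonglongrightarrow> 0" using tendsto_mult[OF tendsto_const[of "1 + 2 * C"] h0] by (simp add: h'_def[abs_def])
  have g3: "(LINT x|MD. (g k x - w x)\<^sup>2) \<le> (h' k)\<^sup>2" for k
    using g(3)[of k] power_mono[OF h'(2)[of k], of 2] h[of k] by simp
  have G3: "(LINT x|MD. (green (g k) x - green w x)\<^sup>2) \<le> (h' k)\<^sup>2" for k
  proof -
    have dL: "(\<lambda>x. g k x - w x) \<in> LI" by (intro Linf_diff gL w)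
    have b: "\<bar>green (g k) x - green w x\<bar> \<le> C * h k" for x
    proof -
      have "\<bar>green (\<lambda>x. g k x - w x) x\<bar> \<le> C * h k"
        by (rule C(2)[OF dL h]) (use g(3)[of k] h[of k] in simp)
      then show ?thesis by (simp add: green_diff[OF gL w])
    qed
    have "(LINT x|MD. (green (g k) x - green w x)\<^sup>2) \<le> (LINT x|MD. (C * h k)\<^sup>2)"
    proof (rule integral_mono)
      show "integrable MD (\<lambda>x. (green (g k) x - green w x)\<^sup>2)"
        by (intro Linf_integrable Linf_power Linf_diff green_LI gL w)
      fix x
      show "(green (g k) x - green w x)\<^sup>2 \<le> (C * h k)\<^sup>2"
        using b[of x] abs_le_square_iff[of "green (g k) x - green w x" "C * h k"] C(1) h[of k] by simp
    qed (use Linf_integrable[OF Linf_const] in auto)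
    also have "\<dots> = (C * h k)\<^sup>2 * pi" by (simp add: measure_MD)
    also have "\<dots> \<le> (C * h k)\<^sup>2 * 4" using pi_less_4 by (intro mult_left_mono) auto
    also have "\<dots> = (2 * C * h k)\<^sup>2" by (simp add: power_mult_distrib)
    also have "\<dots> \<le> (h' k)\<^sup>2" using h'(3)[of k] C(1) h[of k] by (intro power_mono) auto
    finally show ?thesis .
  qed
  have cst: "(LINT x|MD. (ground_mode l x - ground_mode l x)\<^sup>2) \<le> (h' k)\<^sup>2" for l k by simp
  have psL: "ground_mode l \<in> LI" for l by (rule Linf_cont[OF continuous_ground_mode])
  have lhs: "(\<lambda>k. LINT x|MD. g k x * green (g k) x) \<longlonglongrightarrow> (LINT x|MD. w x * green w x)"
    by (rule inner_L2_tendsto[OF gL w g3 green_LI[OF gL] green_LI[OF w] G3 h'(1) h'0])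
  have sq: "(\<lambda>k. LINT x|MD. g k x * g k x) \<longlonglongrightarrow> (LINT x|MD. w x * w x)"
    by (rule inner_L2_tendsto[OF gL w g3 gL w g3 h'(1) h'0])
  have pr: "(\<lambda>k. LINT x|MD. g k x * ground_mode l x) \<longlonglongrightarrow> (LINT x|MD. w x * ground_mode l x)" for l
    by (rule inner_L2_tendsto[OF gL w g3 psL psL cst h'(1) h'0])
  have rhs: "(\<lambda>k. 1/16 * (LINT x|MD. g k x * g k x) + (mu - 1/16) * (\<Sum>l\<in>ground_modes. (LINT x|MD. g k x * ground_mode l x)\<^sup>2 / nu l))
     \<longlonglongrightarrow> 1/16 * (LINT x|MD. w x * w x) + (mu - 1/16) * (\<Sum>l\<in>ground_modes. (LINT x|MD. w x * ground_mode l x)\<^sup>2 / nu l)"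
    by (intro tendsto_intros sq pr) (use nu_pos in force)
  have "(LINT x|MD. w x * green w x) \<le> 1/16 * (LINT x|MD. w x * w x) + (mu - 1/16) * (\<Sum>l\<in>ground_modes. (LINT x|MD. w x * ground_mode l x)\<^sup>2 / nu l)"
    by (rule LIMSEQ_le[OF lhs rhs]) (use ineq in blast)
  then show ?thesis by (simp add: energy_MD power2_eq_square)
qed

section \<open>Moments of the eigenfunctions\<close>

lemma comb_explicit:
  "comb a x = a (0, True) * radial_bessel 0 (rsq x) + radial_bessel 1 (rsq x) * (a (1, True) * Y 1 True x + a (1, False) * Y 1 False x)"
  by (simp add: comb_def ground_modes_def ground_mode_def Y_def[of 0] re_or_im_def algebra_simps)

text \<open>The two third moments of the eigenfunctions that do not vanish by symmetry: \<open>\<integral> J\<^sub>0(j r)\<^sup>3\<close>,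
  and \<open>\<integral> J\<^sub>0(j r) (J\<^sub>1(j r) cos \<theta>)\<^sup>2\<close>, the latter reduced to a radial integral.\<close>

definition moment_radial :: real where "moment_radial = (LINT x|MD. (radial_bessel 0 (rsq x)) ^ 3)"
definition moment_mixed :: real where "moment_mixed = pi / 2 * I01 (\<lambda>t. t * (radial_bessel 0 t * (radial_bessel 1 t)\<^sup>2))"

text \<open>Positivity is not visible from the integrand, in which \<open>J\<^sub>0\<close> changes sign. But
  \<open>(t\<^sup>2 e\<^sub>1\<^sup>3)' = (3 j/2) t e\<^sub>0 e\<^sub>1\<^sup>2 - t e\<^sub>1\<^sup>3\<close> with \<open>e\<^sub>i = radial_bessel i\<close>, and the left-hand side
  integrates to zero since \<open>e\<^sub>1\<close> vanishes at 1. So the integral is a positive multiple of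
  \<open>\<integral> t e\<^sub>1\<^sup>3\<close>, where \<open>e\<^sub>1 > 0\<close>.\<close>

lemma moment_mixed_pos: "0 < moment_mixed"
proof -
  have j0: "0 < jj" by (rule bessel_zero_props)
  have d: "((\<lambda>t. t\<^sup>2 * (radial_bessel 1 t) ^ 3) has_real_derivative 3 * jj / 2 * (t * (radial_bessel 0 t * (radial_bessel 1 t)\<^sup>2)) - t * (radial_bessel 1 t) ^ 3) (at t)" for t
  proof -
    have "((\<lambda>t. t\<^sup>2 * (radial_bessel 1 t) ^ 3) has_real_derivative 2 * t * (radial_bessel 1 t) ^ 3 + 3 * t * (radial_bessel 1 t)\<^sup>2 * (t * (- (jj / 2) * radial_bessel (Suc 1) t))) (at t)"
      by (rule derivative_eq_intros DERIV_radial_bessel refl | simp add: power2_eq_square power3_eq_cube algebra_simps)+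
    also have "t * (- (jj / 2) * radial_bessel (Suc 1) t) = jj / 2 * radial_bessel 0 t - radial_bessel 1 t"
      using radial_bessel_recurrence[of 0 t] by (simp add: algebra_simps)
    also have "2 * t * (radial_bessel 1 t) ^ 3 + 3 * t * (radial_bessel 1 t)\<^sup>2 * (jj / 2 * radial_bessel 0 t - radial_bessel 1 t) = 3 * jj / 2 * (t * (radial_bessel 0 t * (radial_bessel 1 t)\<^sup>2)) - t * (radial_bessel 1 t) ^ 3"
      by (simp add: power2_eq_square power3_eq_cube algebra_simps)
    finally show ?thesis .
  qed
  have "I01 (\<lambda>t. 3 * jj / 2 * (t * (radial_bessel 0 t * (radial_bessel 1 t)\<^sup>2)) - t * (radial_bessel 1 t) ^ 3) = 0"
    using FTC[OF d, of 0 1] radial_bessel_1 by simp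
  moreover have "I01 (\<lambda>t. 3 * jj / 2 * (t * (radial_bessel 0 t * (radial_bessel 1 t)\<^sup>2)) - t * (radial_bessel 1 t) ^ 3)
     = 3 * jj / 2 * I01 (\<lambda>t. t * (radial_bessel 0 t * (radial_bessel 1 t)\<^sup>2)) - I01 (\<lambda>t. t * (radial_bessel 1 t) ^ 3)"
    by (intro integral_unique has_integral_diff has_integral_mult_right integrable_integral cont_integrable continuous_intros continuous_radial_bessel)
  moreover have "0 < I01 (\<lambda>t. t * (radial_bessel 1 t) ^ 3)"
  proof (rule integral_pos_continuous[where s="1/2"])
    fix t :: real assume "0 \<le> t" "t \<le> 1"
    then show "0 \<le> t * (radial_bessel 1 t) ^ 3" using radial_bessel_pos[of t] radial_bessel_1 by (cases "t = 1") auto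
  qed (use radial_bessel_pos[of "1/2"] in \<open>auto intro!: continuous_intros continuous_radial_bessel\<close>)
  ultimately have "0 < 3 * jj / 2 * I01 (\<lambda>t. t * (radial_bessel 0 t * (radial_bessel 1 t)\<^sup>2))" by linarith
  then show ?thesis using j0 by (simp add: moment_mixed_def zero_less_mult_iff)
qed

text \<open>Terms of odd degree in the two angular modes change sign under the half turn and drop out;
  the mixed product of cosine and sine mode vanishes by orthogonality.\<close>

lemma third_moment:
  "(LINT x|MD. (comb a x) ^ 3) = moment_radial * a (0, True) ^ 3 + 3 * moment_mixed * a (0, True) * ((a (1, True))\<^sup>2 + (a (1, False))\<^sup>2)"
proof -
  let ?e = "\<lambda>x. radial_bessel 0 (rsq x)"
  let ?l = "\<lambda>x. radial_bessel 1 (rsq x) * (a (1, True) * Y 1 True x + a (1, False) * Y 1 False x)"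
  let ?a = "a (0, True)"
  have ce: "continuous_on UNIV ?e" "continuous_on UNIV (\<lambda>x. radial_bessel 1 (rsq x))"
    by (rule continuous_on_compose2[OF continuous_radial_bessel continuous_rsq subset_UNIV])+
  have cl: "continuous_on UNIV ?l" by (intro continuous_intros ce)
  have Yr: "Y 1 s (rot pi x) = - Y 1 s x" for s x by (simp add: Y_def to_complex_rot re_or_im_def)
  have lr: "?l (rot pi x) = - ?l x" for x unfolding Yr rsq_rot by (simp add: algebra_simps)
  have z1: "(LINT x|MD. (?e x)\<^sup>2 * ?l x) = 0"
  proof (rule integral_antisymmetric[where b=pi])
    show "continuous_on UNIV (\<lambda>x. (?e x)\<^sup>2 * ?l x)" by (intro continuous_intros ce cl)
    show "(?e (rot pi x))\<^sup>2 * ?l (rot pi x) = - ((?e x)\<^sup>2 * ?l x)" for x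
      unfolding lr unfolding rsq_rot by simp
  qed
  have z2: "(LINT x|MD. (?l x) ^ 3) = 0"
  proof (rule integral_antisymmetric[where b=pi])
    show "continuous_on UNIV (\<lambda>x. (?l x) ^ 3)" by (intro continuous_intros cl)
    show "(?l (rot pi x)) ^ 3 = - ((?l x) ^ 3)" for x unfolding lr by simp
  qed
  let ?F = "\<lambda>t. radial_bessel 0 t * (radial_bessel 1 t)\<^sup>2"
  have cF: "continuous_on UNIV ?F" by (intro continuous_intros continuous_radial_bessel)
  have o: "(LINT x|MD. ?F (rsq x) * (Y 1 s x * Y 1 s' x)) = (if s = s' then moment_mixed else 0)" for s s'
    unfolding mode_orthogonality[OF cF] by (simp add: angular_mass_def moment_mixed_def)
  have io: "integrable MD (\<lambda>x. ?F (rsq x) * (Y 1 s x * Y 1 s' x))" for s s'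
    by (intro integrable_MD_continuous continuous_intros continuous_on_compose2[OF cF continuous_rsq]) auto
  have z3: "(LINT x|MD. ?e x * (?l x)\<^sup>2) = moment_mixed * ((a (1, True))\<^sup>2 + (a (1, False))\<^sup>2)"
  proof -
    have "(LINT x|MD. ?e x * (?l x)\<^sup>2) = (LINT x|MD. (a (1, True))\<^sup>2 * (?F (rsq x) * (Y 1 True x * Y 1 True x))
       + 2 * a (1, True) * a (1, False) * (?F (rsq x) * (Y 1 True x * Y 1 False x))
       + (a (1, False))\<^sup>2 * (?F (rsq x) * (Y 1 False x * Y 1 False x)))"
      by (rule Bochner_Integration.integral_cong) (auto simp: power2_eq_square algebra_simps)
    also have "\<dots> = (a (1, True))\<^sup>2 * (LINT x|MD. ?F (rsq x) * (Y 1 True x * Y 1 True x))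
       + 2 * a (1, True) * a (1, False) * (LINT x|MD. ?F (rsq x) * (Y 1 True x * Y 1 False x))
       + (a (1, False))\<^sup>2 * (LINT x|MD. ?F (rsq x) * (Y 1 False x * Y 1 False x))"
      using io by simp
    finally show ?thesis unfolding o by (simp add: algebra_simps)
  qed
  have i: "integrable MD (\<lambda>x. (?e x) ^ 3)" "integrable MD (\<lambda>x. (?e x)\<^sup>2 * ?l x)" "integrable MD (\<lambda>x. ?e x * (?l x)\<^sup>2)" "integrable MD (\<lambda>x. (?l x) ^ 3)"
    by (intro integrable_MD_continuous continuous_intros ce cl)+
  have "(LINT x|MD. (comb a x) ^ 3) = (LINT x|MD. ?a ^ 3 * (?e x) ^ 3 + 3 * ?a\<^sup>2 * ((?e x)\<^sup>2 * ?l x) + 3 * ?a * (?e x * (?l x)\<^sup>2) + (?l x) ^ 3)"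
  proof (rule Bochner_Integration.integral_cong)
    fix x
    have "(?a * E + L) ^ 3 = ?a ^ 3 * E ^ 3 + 3 * ?a\<^sup>2 * (E\<^sup>2 * L) + 3 * ?a * (E * L\<^sup>2) + L ^ 3" for E L :: real
      by (simp add: power2_eq_square power3_eq_cube algebra_simps)
    then show "(comb a x) ^ 3 = ?a ^ 3 * (?e x) ^ 3 + 3 * ?a\<^sup>2 * ((?e x)\<^sup>2 * ?l x) + 3 * ?a * (?e x * (?l x)\<^sup>2) + (?l x) ^ 3"
      unfolding comb_explicit .
  qed simp
  also have "\<dots> = ?a ^ 3 * (LINT x|MD. (?e x) ^ 3) + 3 * ?a\<^sup>2 * (LINT x|MD. (?e x)\<^sup>2 * ?l x) + 3 * ?a * (LINT x|MD. ?e x * (?l x)\<^sup>2) + (LINT x|MD. (?l x) ^ 3)"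
    using i by simp
  finally show ?thesis unfolding z1 z2 z3 by (simp add: moment_radial_def)
qed

lemma ground_mode_bound: "\<exists>B>0. \<forall>k\<in>ground_modes. \<forall>x\<in>disk. \<bar>ground_mode k x\<bar> \<le> B"
proof -
  have "\<exists>B>0. \<forall>x\<in>disk. \<bar>ground_mode k x\<bar> \<le> B" for k
    by (rule continuous_bounded_disk[OF continuous_ground_mode[of k]]) (auto simp: mem_disk)
  then obtain B where B: "\<And>k. 0 < B k" "\<And>k x. x \<in> disk \<Longrightarrow> \<bar>ground_mode k x\<bar> \<le> B k" by metis
  show ?thesis
  proof (intro exI[of _ "\<Sum>k\<in>ground_modes. B k"] conjI ballI)
    show "0 < (\<Sum>k\<in>ground_modes. B k)" by (intro sum_pos finite_ground_modes B(1)) (simp add: ground_modes_def)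
    fix k x assume "k \<in> ground_modes" "x \<in> disk"
    then show "\<bar>ground_mode k x\<bar> \<le> (\<Sum>k\<in>ground_modes. B k)"
      using B member_le_sum[OF _ _ finite_ground_modes, of k B] by (meson less_imp_le order_trans)
  qed
qed

lemma coef_bound:
  assumes B: "0 < B" "\<And>x. x \<in> disk \<Longrightarrow> \<bar>ground_mode k x\<bar> \<le> B" and k: "k \<in> ground_modes" and f: "f \<in> LI"
  shows "\<bar>coef f k\<bar> \<le> B / nu k * (LINT x|MD. \<bar>f x\<bar>)"
proof -
  have "\<bar>LINT x|MD. f x * ground_mode k x\<bar> \<le> (LINT x|MD. \<bar>f x * ground_mode k x\<bar>)" by (rule integral_abs_bound)
  also have "\<dots> \<le> (LINT x|MD. B * \<bar>f x\<bar>)"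
  proof (rule integral_mono)
    show "integrable MD (\<lambda>x. \<bar>f x * ground_mode k x\<bar>)" by (intro Linf_integrable Linf_abs Linf_mult f Linf_cont continuous_ground_mode)
    show "integrable MD (\<lambda>x. B * \<bar>f x\<bar>)" by (intro Linf_integrable Linf_cmult Linf_abs f)
    fix x assume "x \<in> space MD"
    then show "\<bar>f x * ground_mode k x\<bar> \<le> B * \<bar>f x\<bar>"
      unfolding abs_mult using B(2)[of x] by (subst mult.commute) (auto intro!: mult_right_mono)
  qed
  also have "\<dots> = B * (LINT x|MD. \<bar>f x\<bar>)" by simp
  finally show ?thesis using nu_pos[OF k] by (simp add: coef_def divide_right_mono)
qed

lemma coef_diff:
  assumes "f \<in> LI" "g \<in> LI" shows "coef (\<lambda>x. f x - g x) k = coef f k - coef g k"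
proof -
  have "integrable MD (\<lambda>x. f x * ground_mode k x)" "integrable MD (\<lambda>x. g x * ground_mode k x)"
    by (intro Linf_integrable Linf_mult assms Linf_cont continuous_ground_mode)+
  then show ?thesis by (simp add: coef_def left_diff_distrib diff_divide_distrib)
qed

lemma coef_comb: "k \<in> ground_modes \<Longrightarrow> coef (comb a) k = a k"
  using nu_pos[of k] by (simp add: coef_def comb_inner_ground_mode)

lemma comb_bound:
  assumes B: "0 < B" "\<And>k x. k \<in> ground_modes \<Longrightarrow> x \<in> disk \<Longrightarrow> \<bar>ground_mode k x\<bar> \<le> B" and x: "x \<in> disk"
  shows "\<bar>comb a x\<bar> \<le> B * (\<Sum>k\<in>ground_modes. \<bar>a k\<bar>)"
proof -
  have "\<bar>comb a x\<bar> \<le> (\<Sum>k\<in>ground_modes. \<bar>a k * ground_mode k x\<bar>)" unfolding comb_def by (rule sum_abs)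
  also have "\<dots> \<le> (\<Sum>k\<in>ground_modes. B * \<bar>a k\<bar>)"
    unfolding abs_mult using B x by (intro sum_mono) (metis abs_ge_zero mult.commute mult_left_mono)
  finally show ?thesis by (simp add: sum_distrib_left)
qed

lemma comb_diff: "comb a x - comb b x = comb (\<lambda>k. a k - b k) x"
  by (simp add: comb_def sum_subtractf left_diff_distrib)

text \<open>Pythagoras, with the orthogonality of the eigenfunctions.\<close>

lemma distance_to_projection:
  assumes v: "v \<in> LI"
  shows "(LINT x|MD. (v x - comb (coef v) x)\<^sup>2) = (LINT x|MD. (v x)\<^sup>2) - (\<Sum>k\<in>ground_modes. (coef v k)\<^sup>2 * nu k)"
proof -
  let ?c = "comb (coef v)"
  have cL: "?c \<in> LI" by (rule Linf_cont[OF continuous_comb])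
  have i: "integrable MD (\<lambda>x. (v x)\<^sup>2)" "integrable MD (\<lambda>x. v x * ?c x)" "integrable MD (\<lambda>x. ?c x * ?c x)"
    by (intro Linf_integrable Linf_power Linf_mult v cL)+
  have vc: "(LINT x|MD. v x * ?c x) = (\<Sum>k\<in>ground_modes. (coef v k)\<^sup>2 * nu k)"
  proof -
    have "(LINT x|MD. v x * ?c x) = (LINT x|MD. (\<Sum>k\<in>ground_modes. coef v k * (v x * ground_mode k x)))"
      unfolding comb_def sum_distrib_left by (simp only: mult.left_commute)
    also have "\<dots> = (\<Sum>k\<in>ground_modes. coef v k * (LINT x|MD. v x * ground_mode k x))"
    proof -
      have "integrable MD (\<lambda>x. v x * ground_mode k x)" for k
        by (intro Linf_integrable Linf_mult v Linf_cont continuous_ground_mode)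
      then show ?thesis by (subst Bochner_Integration.integral_sum) auto
    qed
    also have "\<dots> = (\<Sum>k\<in>ground_modes. (coef v k)\<^sup>2 * nu k)"
    proof (rule sum.cong[OF refl])
      fix k assume "k \<in> ground_modes"
      then have "(LINT x|MD. v x * ground_mode k x) = coef v k * nu k" using nu_pos[of k] by (simp add: coef_def)
      then show "coef v k * (LINT x|MD. v x * ground_mode k x) = (coef v k)\<^sup>2 * nu k" by (simp add: power2_eq_square)
    qed
    finally show ?thesis .
  qed
  have "(LINT x|MD. (v x - ?c x)\<^sup>2) = (LINT x|MD. (v x)\<^sup>2 - 2 * (v x * ?c x) + ?c x * ?c x)"
    by (simp add: power2_eq_square algebra_simps)
  also have "\<dots> = (LINT x|MD. (v x)\<^sup>2) - 2 * (LINT x|MD. v x * ?c x) + (LINT x|MD. ?c x * ?c x)"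
    using i by simp
  finally show ?thesis unfolding vc comb_norm by (simp add: power2_eq_square)
qed

lemma cube_diff_bound:
  fixes x y K :: real assumes "\<bar>x\<bar> \<le> K" "\<bar>y\<bar> \<le> K"
  shows "\<bar>x ^ 3 - y ^ 3\<bar> \<le> 3 * K\<^sup>2 * \<bar>x - y\<bar>"
proof -
  have K: "0 \<le> K" using assms by linarith
  have "\<bar>x * x\<bar> \<le> K * K" "\<bar>x * y\<bar> \<le> K * K" "\<bar>y * y\<bar> \<le> K * K"
    unfolding abs_mult by (intro mult_mono assms K abs_ge_zero)+
  then have "\<bar>x * x + x * y + y * y\<bar> \<le> 3 * K\<^sup>2" unfolding power2_eq_square by linarith
  then have "\<bar>x - y\<bar> * \<bar>x * x + x * y + y * y\<bar> \<le> \<bar>x - y\<bar> * (3 * K\<^sup>2)" by (intro mult_left_mono) auto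
  moreover have "x ^ 3 - y ^ 3 = (x - y) * (x * x + x * y + y * y)" by (simp add: power3_eq_cube algebra_simps)
  ultimately show ?thesis by (simp add: abs_mult mult_ac)
qed

section \<open>Almost maximisers of the energy\<close>

lemma integral_bounded:
  assumes "f \<in> LI" "\<And>x. x \<in> disk \<Longrightarrow> f x \<le> c" shows "(LINT x|MD. f x) \<le> c * pi"
proof -
  have "(LINT x|MD. f x) \<le> (LINT x|MD. c)"
    using assms by (intro integral_mono Linf_integrable Linf_const) auto
  then show ?thesis by (simp add: measure_MD mult.commute)
qed

text \<open>The quantitative heart of the proof. After removing its small mean, \<open>v\<close> satisfies the
  spectral gap inequality. As its energy almost reaches \<open>\<mu> S / 2\<close>, this leaves at most \<open>O(h)\<close> for
  the squared distance from the span of the eigenfunctions. Hence the projection has almost the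
  same \<open>L\<^sup>2\<close> norm as \<open>v\<close> and, as both are bounded, almost the same third moment; only a square root
  of the \<open>L\<^sup>2\<close> error is available for the latter. The numerical factors \<open>4 h\<close>, \<open>8 M h\<close>, \<open>12 M\<^sup>2 h\<close>
  are those delivered by \<open>truncated_rearrangement\<close>. The constant \<open>K\<close> does not depend on \<open>v\<close>, \<open>h\<close>,
  \<open>S\<close> or \<open>T\<close>.\<close>

lemma near_maximiser:
  assumes M: "1 \<le> M" and C0: "0 \<le> C0"
  obtains K where "0 < K"
   "\<And>v h S T. v \<in> LI \<Longrightarrow> \<forall>x. \<bar>v x\<bar> \<le> M \<Longrightarrow> 0 < h \<Longrightarrow> h \<le> 1 \<Longrightarrow> \<bar>LINT x|MD. v x\<bar> \<le> 4 * h \<Longrightarrow>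
      \<bar>(LINT x|MD. (v x)\<^sup>2) - S\<bar> \<le> 8 * M * h \<Longrightarrow> \<bar>(LINT x|MD. (v x) ^ 3) - T\<bar> \<le> 12 * M\<^sup>2 * h \<Longrightarrow>
      mu * S - C0 * h \<le> 2 * energy v \<Longrightarrow>
      (LINT x|MD. (v x - comb (coef v) x)\<^sup>2) \<le> K * h \<and>
      \<bar>(\<Sum>k\<in>ground_modes. (coef v k)\<^sup>2 * nu k) - S\<bar> \<le> K * h \<and>
      \<bar>(LINT x|MD. (comb (coef v) x) ^ 3) - T\<bar> \<le> K * sqrt h \<and>
      (\<forall>k\<in>ground_modes. \<bar>coef v k\<bar> \<le> K) \<and> (\<forall>x\<in>disk. \<bar>comb (coef v) x\<bar> \<le> K)"
proof -
  obtain C where C: "0 < C" "\<And>w1 w2 a b. w1 \<in> LI \<Longrightarrow> w2 \<in> LI \<Longrightarrow> 0 < a \<Longrightarrow> 0 < b \<Longrightarrow>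
     (LINT x|MD. \<bar>w1 x - w2 x\<bar> powr 2) \<le> a powr 2 \<Longrightarrow> (LINT x|MD. \<bar>w1 x\<bar> powr 2) \<le> b powr 2 \<Longrightarrow>
     (LINT x|MD. \<bar>w2 x\<bar> powr 2) \<le> b powr 2 \<Longrightarrow> \<bar>energy w1 - energy w2\<bar> \<le> C * a * b"
    using energy_difference[of 2] by auto
  obtain B where B: "0 < B" "\<And>k x. k \<in> ground_modes \<Longrightarrow> x \<in> disk \<Longrightarrow> \<bar>ground_mode k x\<bar> \<le> B" using ground_mode_bound by blast
  have g: "0 < mu - 1/16" using mu_bounds by simp
  define K1 where "K1 = (C0 + 128 * C * M + 8 * M * mu) / (mu - 1/16)"
  define Kc where "Kc = (\<Sum>k\<in>ground_modes. B / nu k * (M * 4))"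
  define Kb where "Kb = M + B * (3 * Kc)"
  define K where "K = K1 + (8 * M + K1) + (3 * Kb\<^sup>2 * (3 * sqrt K1) + 12 * M\<^sup>2) + Kc + Kb"
  have num: "0 < C0 + 128 * C * M + 8 * M * mu"
    using M C0 C(1) mu_bounds(2) by (intro add_pos_pos add_nonneg_pos mult_pos_pos) auto
  have K1: "0 < K1" using g num by (simp add: K1_def)
  have Kc1: "B / nu k * (M * 4) \<le> Kc" if "k \<in> ground_modes" for k
    unfolding Kc_def using that finite_ground_modes M B(1) nu_pos by (intro member_le_sum) (auto intro!: divide_nonneg_pos mult_nonneg_nonneg)
  have "0 \<le> B / nu (0, True) * (M * 4)" using M B(1) nu_pos[of "(0, True)"] by (simp add: ground_modes_def)
  then have Kc0: "0 \<le> Kc" using Kc1[of "(0, True)"] by (simp add: ground_modes_def)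
  have Kb: "M \<le> Kb" "B * (3 * Kc) \<le> Kb" using Kc0 B(1) M by (auto simp: Kb_def)
  have Kall: "0 < K" "K1 \<le> K" "8 * M + K1 \<le> K" "3 * Kb\<^sup>2 * (3 * sqrt K1) + 12 * M\<^sup>2 \<le> K" "Kc \<le> K" "Kb \<le> K"
  proof -
    have "0 < 8 * M + K1" "0 \<le> 3 * Kb\<^sup>2 * (3 * sqrt K1) + 12 * M\<^sup>2" "0 < Kb" using K1 M Kb by auto
    then show "0 < K" "K1 \<le> K" "8 * M + K1 \<le> K" "3 * Kb\<^sup>2 * (3 * sqrt K1) + 12 * M\<^sup>2 \<le> K" "Kc \<le> K" "Kb \<le> K"
      unfolding K_def using K1 Kc0 by linarith+
  qed
  show ?thesis
  proof (rule that[OF Kall(1)])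
    fix v :: "plane \<Rightarrow> real" and h S T :: real
    assume vL: "v \<in> LI" and vM: "\<forall>x. \<bar>v x\<bar> \<le> M" and h: "0 < h" "h \<le> 1" and v1: "\<bar>LINT x|MD. v x\<bar> \<le> 4 * h"
      and v2: "\<bar>(LINT x|MD. (v x)\<^sup>2) - S\<bar> \<le> 8 * M * h" and v3: "\<bar>(LINT x|MD. (v x) ^ 3) - T\<bar> \<le> 12 * M\<^sup>2 * h"
      and e: "mu * S - C0 * h \<le> 2 * energy v"
    have v: "v \<in> LI" "\<And>x. \<bar>v x\<bar> \<le> M" using vL vM by auto
    define m where "m = (LINT x|MD. v x) / pi"
    define w where "w x = v x - m" for x
    let ?c = "coef v"
    let ?D = "LINT x|MD. (v x - comb ?c x)\<^sup>2"
    have wL: "w \<in> LI" unfolding w_def by (intro Linf_diff v Linf_const)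
    have cL: "comb ?c \<in> LI" by (rule Linf_cont[OF continuous_comb])
    have iv: "integrable MD v" "integrable MD (\<lambda>x. (v x)\<^sup>2)" by (intro Linf_integrable Linf_power v(1))+
    have "\<bar>m\<bar> \<le> 4 * h / pi" using v1 by (simp add: m_def divide_right_mono)
    also have "\<dots> \<le> 4 * h / 2" using h pi_ge_two by (intro divide_left_mono) auto
    finally have mb: "\<bar>m\<bar> \<le> 2 * h" by simp
    have w0: "(LINT x|MD. w x) = 0" unfolding w_def using iv Linf_integrable[OF Linf_const] by (simp add: m_def measure_MD)
    have w2: "(LINT x|MD. (w x)\<^sup>2) = (LINT x|MD. (v x)\<^sup>2) - pi * m\<^sup>2"
    proof -
      have "(LINT x|MD. (w x)\<^sup>2) = (LINT x|MD. (v x)\<^sup>2 - 2 * m * v x + m\<^sup>2)"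
        by (simp add: w_def power2_eq_square algebra_simps)
      also have "\<dots> = (LINT x|MD. (v x)\<^sup>2) - 2 * m * (LINT x|MD. v x) + m\<^sup>2 * pi"
        using iv Linf_integrable[OF Linf_const] by (simp add: measure_MD)
      finally show ?thesis by (simp add: m_def power2_eq_square)
    qed
    have wp: "(LINT x|MD. w x * ground_mode k x) = ?c k * nu k" if "k \<in> ground_modes" for k
    proof -
      have "integrable MD (\<lambda>x. v x * ground_mode k x)" "integrable MD (\<lambda>x. m * ground_mode k x)"
        by (intro Linf_integrable Linf_mult Linf_cmult v(1) Linf_cont continuous_ground_mode)+
      then have "(LINT x|MD. w x * ground_mode k x) = (LINT x|MD. v x * ground_mode k x)"
        unfolding w_def left_diff_distrib by (simp add: integral_ground_mode[OF that])
      then show ?thesis using nu_pos[OF that] by (simp add: coef_def)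
    qed
    have Dv: "?D = (LINT x|MD. (v x)\<^sup>2) - (\<Sum>k\<in>ground_modes. (?c k)\<^sup>2 * nu k)" by (rule distance_to_projection[OF v(1)])
    have "2 * energy w \<le> 1/16 * (LINT x|MD. (w x)\<^sup>2) + (mu - 1/16) * (\<Sum>k\<in>ground_modes. (LINT x|MD. w x * ground_mode k x)\<^sup>2 / nu k)"
      by (rule spectral_gap[OF wL w0])
    also have "(\<Sum>k\<in>ground_modes. (LINT x|MD. w x * ground_mode k x)\<^sup>2 / nu k) = (\<Sum>k\<in>ground_modes. (?c k)\<^sup>2 * nu k)"
    proof (rule sum.cong[OF refl])
      fix k assume "k \<in> ground_modes"
      then show "(LINT x|MD. w x * ground_mode k x)\<^sup>2 / nu k = (?c k)\<^sup>2 * nu k"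
        using nu_pos[of k] by (simp add: wp power2_eq_square)
    qed
    also have "1/16 * (LINT x|MD. (w x)\<^sup>2) \<le> 1/16 * (LINT x|MD. (v x)\<^sup>2)" unfolding w2 by simp
    finally have gap: "2 * energy w \<le> mu * (LINT x|MD. (v x)\<^sup>2) - (mu - 1/16) * ?D"
      unfolding Dv by (simp add: algebra_simps)
    have sq: "(LINT x|MD. \<bar>f x\<bar> powr 2) \<le> b powr 2" if "f \<in> LI" "\<And>x. \<bar>f x\<bar> \<le> b'" "0 < b'" "2 * b' \<le> b" for f b b'
    proof -
      have "(LINT x|MD. \<bar>f x\<bar> powr 2) \<le> b'\<^sup>2 * pi"
      proof (rule integral_bounded)
        fix x
        show "\<bar>f x\<bar> powr 2 \<le> b'\<^sup>2" using that(2)[of x] that(3) abs_le_square_iff[of "f x" b'] by simp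
      qed (use that Linf_powr[of f 2] in auto)
      also have "\<dots> \<le> b'\<^sup>2 * 4" using pi_less_4 by (intro mult_left_mono) auto
      also have "\<dots> = (2 * b')\<^sup>2" by (simp add: power_mult_distrib)
      also have "\<dots> \<le> b\<^sup>2" using that by (intro power_mono) auto
      also have "\<dots> = b powr 2" using that by simp
      finally show ?thesis .
    qed
    have "\<bar>energy w - energy v\<bar> \<le> C * (8 * h) * (8 * M)"
    proof (rule C(2)[OF wL v(1)])
      show "(LINT x|MD. \<bar>w x - v x\<bar> powr 2) \<le> (8 * h) powr 2"
        by (rule sq[where b'="2*h"]) (use mb h in \<open>auto simp: w_def intro: Linf_diff v Linf_const\<close>)
      have wb: "\<bar>w x\<bar> \<le> 3 * M" for x using v(2)[of x] mb h M unfolding w_def by linarith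
      show "(LINT x|MD. \<bar>w x\<bar> powr 2) \<le> (8 * M) powr 2"
        by (rule sq[where b'="3*M", OF wL wb]) (use M in auto)
      show "(LINT x|MD. \<bar>v x\<bar> powr 2) \<le> (8 * M) powr 2"
        by (rule sq[where b'=M, OF v]) (use M in auto)
    qed (use h M in auto)
    then have "2 * energy v \<le> 2 * energy w + 128 * C * M * h" by (simp add: algebra_simps)
    then have "mu * S - C0 * h \<le> mu * (LINT x|MD. (v x)\<^sup>2) - (mu - 1/16) * ?D + 128 * C * M * h"
      using e gap by linarith
    moreover have "mu * (LINT x|MD. (v x)\<^sup>2) \<le> mu * (S + 8 * M * h)"
      using v2 mu_bounds(2) by (intro mult_left_mono) auto
    ultimately have "(mu - 1/16) * ?D \<le> (C0 + 128 * C * M + 8 * M * mu) * h" by (simp add: algebra_simps)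
    then have D: "?D \<le> K1 * h" using g by (simp add: K1_def field_simps)
    have D0: "0 \<le> ?D" by (rule Bochner_Integration.integral_nonneg) auto
    have c1: "?D \<le> K * h" using D Kall(2) h by (meson mult_right_mono less_imp_le order_trans)
    have "\<bar>(\<Sum>k\<in>ground_modes. (?c k)\<^sup>2 * nu k) - S\<bar> \<le> (8 * M + K1) * h"
      using v2 D D0 unfolding Dv by (simp add: algebra_simps)
    also have "\<dots> \<le> K * h" using Kall(3) h by (intro mult_right_mono) auto
    finally have c2: "\<bar>(\<Sum>k\<in>ground_modes. (?c k)\<^sup>2 * nu k) - S\<bar> \<le> K * h" .
    have vI: "(LINT x|MD. \<bar>v x\<bar>) \<le> M * 4"
    proof -
      have "(LINT x|MD. \<bar>v x\<bar>) \<le> M * pi" using v by (intro integral_bounded Linf_abs) auto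
      also have "\<dots> \<le> M * 4" using M pi_less_4 by (intro mult_left_mono) auto
      finally show ?thesis .
    qed
    have ck: "\<bar>?c k\<bar> \<le> Kc" if k: "k \<in> ground_modes" for k
    proof -
      have "\<bar>?c k\<bar> \<le> B / nu k * (LINT x|MD. \<bar>v x\<bar>)" by (rule coef_bound[OF B(1) B(2)[OF k] k v(1)])
      also have "\<dots> \<le> B / nu k * (M * 4)" using vI B(1) nu_pos[OF k] by (intro mult_left_mono) auto
      finally show ?thesis using Kc1[OF k] by simp
    qed
    have cb: "\<bar>comb ?c x\<bar> \<le> Kb" if x: "x \<in> disk" for x
    proof -
      have "\<bar>comb ?c x\<bar> \<le> B * (\<Sum>k\<in>ground_modes. \<bar>?c k\<bar>)" by (rule comb_bound[OF B x])
      also have "\<dots> \<le> B * (\<Sum>k\<in>ground_modes. Kc)" using B(1) ck by (intro mult_left_mono sum_mono) auto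
      also have "\<dots> = B * (3 * Kc)" by (simp add: ground_modes_def)
      finally show ?thesis using Kb(2) by simp
    qed
    have dL: "(\<lambda>x. v x - comb ?c x) \<in> LI" by (intro Linf_diff v cL)
    have L1: "(LINT x|MD. \<bar>v x - comb ?c x\<bar>) \<le> 3 * sqrt (K1 * h)"
      by (rule L1_le_L2[OF dL]) (use K1 h D in auto)
    have i3: "integrable MD (\<lambda>x. (v x) ^ 3)" "integrable MD (\<lambda>x. (comb ?c x) ^ 3)"
      by (intro Linf_integrable Linf_power v cL)+
    have "\<bar>(LINT x|MD. (v x) ^ 3) - (LINT x|MD. (comb ?c x) ^ 3)\<bar> = \<bar>LINT x|MD. (v x) ^ 3 - (comb ?c x) ^ 3\<bar>"
      using i3 by simp
    also have "\<dots> \<le> (LINT x|MD. \<bar>(v x) ^ 3 - (comb ?c x) ^ 3\<bar>)" by (rule integral_abs_bound)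
    also have "\<dots> \<le> (LINT x|MD. 3 * Kb\<^sup>2 * \<bar>v x - comb ?c x\<bar>)"
    proof (rule integral_mono)
      show "integrable MD (\<lambda>x. \<bar>(v x) ^ 3 - (comb ?c x) ^ 3\<bar>)" using i3 by auto
      show "integrable MD (\<lambda>x. 3 * Kb\<^sup>2 * \<bar>v x - comb ?c x\<bar>)" by (intro Linf_integrable Linf_cmult Linf_abs dL)
      fix x assume "x \<in> space MD"
      then show "\<bar>(v x) ^ 3 - (comb ?c x) ^ 3\<bar> \<le> 3 * Kb\<^sup>2 * \<bar>v x - comb ?c x\<bar>"
        using cb[of x] v(2)[of x] Kb(1) by (intro cube_diff_bound) auto
    qed
    also have "\<dots> = 3 * Kb\<^sup>2 * (LINT x|MD. \<bar>v x - comb ?c x\<bar>)" by simp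
    also have "\<dots> \<le> 3 * Kb\<^sup>2 * (3 * sqrt (K1 * h))" using L1 by (intro mult_left_mono) auto
    finally have "\<bar>(LINT x|MD. (comb ?c x) ^ 3) - T\<bar> \<le> 3 * Kb\<^sup>2 * (3 * sqrt (K1 * h)) + 12 * M\<^sup>2 * h"
      using v3 by linarith
    also have "\<dots> \<le> (3 * Kb\<^sup>2 * (3 * sqrt K1) + 12 * M\<^sup>2) * sqrt h"
    proof -
      have "h * h \<le> h" using h by (simp add: mult_left_le)
      then have "h \<le> sqrt h" using h by (intro real_le_rsqrt) (simp add: power2_eq_square)
      then have "12 * M\<^sup>2 * h \<le> 12 * M\<^sup>2 * sqrt h" by (intro mult_left_mono) auto
      then show ?thesis by (simp add: real_sqrt_mult algebra_simps)
    qed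
    also have "\<dots> \<le> K * sqrt h" using Kall(4) h by (intro mult_right_mono) auto
    finally have c3: "\<bar>(LINT x|MD. (comb ?c x) ^ 3) - T\<bar> \<le> K * sqrt h" .
    show "?D \<le> K * h \<and> \<bar>(\<Sum>k\<in>ground_modes. (?c k)\<^sup>2 * nu k) - S\<bar> \<le> K * h \<and>
      \<bar>(LINT x|MD. (comb ?c x) ^ 3) - T\<bar> \<le> K * sqrt h \<and>
      (\<forall>k\<in>ground_modes. \<bar>?c k\<bar> \<le> K) \<and> (\<forall>x\<in>disk. \<bar>comb ?c x\<bar> \<le> K)"
      using c1 c2 c3 ck cb Kall(5,6) by (meson order_trans)
  qed
qed

section \<open>Rearrangements and truncation\<close>

text \<open>The superlevel sets generate the Borel sets, so their measures determine the image measure.\<close>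

lemma rearrangement_distr:
  assumes f: "f \<in> borel_measurable MD" and g: "g \<in> borel_measurable MD"
    and eq: "\<And>s. measure lebesgue {x \<in> disk. f x > s} = measure lebesgue {x \<in> disk. g x > s}"
  shows "distr MD borel f = distr MD borel (g :: plane \<Rightarrow> real)"
proof (rule measure_eqI_lessThan)
  have e: "emeasure (distr MD borel f) {s<..} = ennreal (measure lebesgue {x \<in> disk. f x > s})"
    if f: "f \<in> borel_measurable MD" for f :: "plane \<Rightarrow> real" and s
  proof -
    have "emeasure (distr MD borel f) {s<..} = emeasure MD {x \<in> disk. f x > s}"
      using f by (subst emeasure_distr) (auto intro!: arg_cong[where f="emeasure MD"])
    also have "\<dots> = ennreal (measure MD {x \<in> disk. f x > s})"
      using finite_measure.emeasure_eq_measure[OF finite_measure_MD] by simp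
    also have "measure MD {x \<in> disk. f x > s} = measure lebesgue {x \<in> disk. f x > s}"
      by (rule measure_restrict_space) auto
    finally show ?thesis .
  qed
  show "emeasure (distr MD borel f) {s<..} < \<infinity>" for s by (simp add: e[OF f])
  show "emeasure (distr MD borel f) {s<..} = emeasure (distr MD borel g) {s<..}" for s
    by (simp add: e f g eq)
qed auto

lemma rearrangement_integral:
  fixes F :: "real \<Rightarrow> real"
  assumes "f \<in> borel_measurable MD" "g \<in> borel_measurable MD" "distr MD borel f = distr MD borel g" "F \<in> borel_measurable borel"
  shows "(LINT x|MD. F (f x)) = (LINT x|MD. F (g x))"
  using integral_distr[of f MD borel F] integral_distr[of g MD borel F] assms by simp

lemma rearrangement_Linf:
  assumes f: "f \<in> borel_measurable MD" and g: "g \<in> LI" and d: "distr MD borel f = distr MD borel g"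
  shows "f \<in> LI"
proof -
  obtain M where M: "AE x in MD. \<bar>g x\<bar> \<le> M" by (rule LinfE[OF g])
  have "AE y in distr MD borel g. \<bar>y\<bar> \<le> M"
    using M Linf_meas[OF g] by (subst AE_distr_iff) auto
  then have "AE x in MD. \<bar>f x\<bar> \<le> M"
    unfolding d[symmetric] using f by (subst (asm) AE_distr_iff) auto
  then show ?thesis by (rule LinfI[OF f])
qed

definition trunc :: "real \<Rightarrow> real \<Rightarrow> real" where "trunc M y = max (- M) (min M y)"

text \<open>Clipping is the metric projection onto \<open>[-M, M]\<close>: it is contractive, moves a value towards
  every \<open>z\<close> of the interval, and by no more than the distance to \<open>z\<close>.\<close>

lemma trunc_props:
  assumes "0 \<le> M"
  shows "\<bar>trunc M y\<bar> \<le> M" "\<bar>trunc M y - trunc M z\<bar> \<le> \<bar>y - z\<bar>" "\<bar>z\<bar> \<le> M \<Longrightarrow> trunc M z = z"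
    "\<bar>z\<bar> \<le> M \<Longrightarrow> \<bar>trunc M y - z\<bar> \<le> \<bar>y - z\<bar>" "\<bar>z\<bar> \<le> M \<Longrightarrow> \<bar>trunc M y - y\<bar> \<le> \<bar>y - z\<bar>"
  using assms unfolding trunc_def max_def min_def abs_if by (auto split: if_splits)

lemma trunc_borel [measurable]: "trunc M \<in> borel_measurable borel"
  unfolding trunc_def[abs_def] by measurable

lemma trunc_Linf: "0 \<le> M \<Longrightarrow> f \<in> LI \<Longrightarrow> (\<lambda>x. trunc M (f x)) \<in> LI"
  by (rule LinfI'[where M=M]) (auto simp: trunc_props intro: measurable_compose[OF Linf_meas trunc_borel])

text \<open>If \<open>w1\<close> is a rearrangement of \<open>w0\<close>, then so is the clipped \<open>w1\<close> of the clipped \<open>w0\<close>; and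
  \<open>w0\<close>, clipped at a height above the supremum of the given combination of eigenfunctions, is at
  least as close to that combination as \<open>w0\<close> itself. This yields the moments. Clipping changes the
  energy little because the clipped-off part of \<open>w1\<close> has the same \<open>L\<^sup>q\<close> norm as that of \<open>w0\<close>, which
  is bounded by the distance of \<open>w0\<close> from the combination.\<close>

lemma truncated_rearrangement:
  assumes q: "1 < q" "q \<le> 2" and M: "1 \<le> M" "\<And>x. x \<in> disk \<Longrightarrow> \<bar>comb a x\<bar> \<le> M"
  obtains C0 where "0 \<le> C0"
    "\<And>w0 w1 h. w0 \<in> LI \<Longrightarrow> w1 \<in> LI \<Longrightarrow> distr MD borel w1 = distr MD borel w0 \<Longrightarrow> energy w1 = energy w0 \<Longrightarrow>
      0 < h \<Longrightarrow> h \<le> 1 \<Longrightarrow> (LINT x|MD. \<bar>w0 x - comb a x\<bar> powr q) \<le> h powr q \<Longrightarrow>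
      \<bar>LINT x|MD. trunc M (w1 x)\<bar> \<le> 4 * h \<and>
      \<bar>(LINT x|MD. (trunc M (w1 x))\<^sup>2) - (LINT x|MD. (comb a x)\<^sup>2)\<bar> \<le> 8 * M * h \<and>
      \<bar>(LINT x|MD. (trunc M (w1 x)) ^ 3) - (LINT x|MD. (comb a x) ^ 3)\<bar> \<le> 12 * M\<^sup>2 * h \<and>
      mu * (LINT x|MD. (comb a x)\<^sup>2) - C0 * h \<le> 2 * energy (\<lambda>x. trunc M (w1 x)) \<and>
      (LINT x|MD. \<bar>trunc M (w0 x) - comb a x\<bar>) \<le> 4 * h"
proof -
  obtain C where C: "0 < C" "\<And>w1 w2 a b. w1 \<in> LI \<Longrightarrow> w2 \<in> LI \<Longrightarrow> 0 < a \<Longrightarrow> 0 < b \<Longrightarrow>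
     (LINT x|MD. \<bar>w1 x - w2 x\<bar> powr q) \<le> a powr q \<Longrightarrow> (LINT x|MD. \<bar>w1 x\<bar> powr q) \<le> b powr q \<Longrightarrow>
     (LINT x|MD. \<bar>w2 x\<bar> powr q) \<le> b powr q \<Longrightarrow> \<bar>energy w1 - energy w2\<bar> \<le> C * a * b"
    using energy_difference[OF q] by blast
  have M0: "0 \<le> M" using M by simp
  have cL: "comb a \<in> LI" by (rule Linf_cont[OF continuous_comb])
  show ?thesis
  proof (rule that[of "64 * C * M"])
    show "0 \<le> 64 * C * M" using C(1) M by simp
    fix w0 w1 :: "plane \<Rightarrow> real" and h :: real
    assume w: "w0 \<in> LI" "w1 \<in> LI" and d: "distr MD borel w1 = distr MD borel w0" and E: "energy w1 = energy w0"
      and h: "0 < h" "h \<le> 1" and close: "(LINT x|MD. \<bar>w0 x - comb a x\<bar> powr q) \<le> h powr q"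
    have tL: "(\<lambda>x. trunc M (w0 x)) \<in> LI" "(\<lambda>x. trunc M (w1 x)) \<in> LI" by (intro trunc_Linf M0 w)+
    have re: "(LINT x|MD. F (w1 x)) = (LINT x|MD. F (w0 x))" if "F \<in> borel_measurable borel" for F :: "real \<Rightarrow> real"
      by (rule rearrangement_integral[OF Linf_meas[OF w(2)] Linf_meas[OF w(1)] d that])
    have dL: "(\<lambda>x. w0 x - comb a x) \<in> LI" "(\<lambda>x. trunc M (w0 x) - comb a x) \<in> LI" by (intro Linf_diff w cL tL)+
    have L1: "(LINT x|MD. \<bar>trunc M (w0 x) - comb a x\<bar>) \<le> 4 * h"
    proof -
      have "(LINT x|MD. \<bar>trunc M (w0 x) - comb a x\<bar>) \<le> (LINT x|MD. \<bar>w0 x - comb a x\<bar>)"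
        using M by (intro integral_mono Linf_integrable Linf_abs dL trunc_props(4)) auto
      also have "\<dots> \<le> 4 * h" by (rule L1_le_Lq[OF q(1) dL(1) h(1) close])
      finally show ?thesis .
    qed
    have mom: "\<bar>(LINT x|MD. G (trunc M (w1 x))) - (LINT x|MD. G (comb a x))\<bar> \<le> L * (4 * h)"
      if G: "continuous_on UNIV G" and GL: "\<And>x y. \<bar>x\<bar> \<le> M \<Longrightarrow> \<bar>y\<bar> \<le> M \<Longrightarrow> \<bar>G x - G y\<bar> \<le> L * \<bar>x - y\<bar>" and L: "0 \<le> L"
        and GI: "\<And>f. f \<in> LI \<Longrightarrow> (\<lambda>x. G (f x)) \<in> LI" for G :: "real \<Rightarrow> real" and L
    proof -
      have [measurable]: "G \<in> borel_measurable borel" by (rule borel_measurable_continuous_onI[OF G])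
      have "(LINT x|MD. G (trunc M (w1 x))) = (LINT x|MD. G (trunc M (w0 x)))" by (rule re) measurable
      then have "\<bar>(LINT x|MD. G (trunc M (w1 x))) - (LINT x|MD. G (comb a x))\<bar> = \<bar>LINT x|MD. G (trunc M (w0 x)) - G (comb a x)\<bar>"
        using Linf_integrable[OF GI[OF tL(1)]] Linf_integrable[OF GI[OF cL]] by simp
      also have "\<dots> \<le> (LINT x|MD. \<bar>G (trunc M (w0 x)) - G (comb a x)\<bar>)" by (rule integral_abs_bound)
      also have "\<dots> \<le> (LINT x|MD. L * \<bar>trunc M (w0 x) - comb a x\<bar>)"
        using M trunc_props(1)[OF M0]
        by (intro integral_mono Linf_integrable Linf_cmult Linf_abs dL Linf_diff GI tL cL GL) auto
      also have "\<dots> = L * (LINT x|MD. \<bar>trunc M (w0 x) - comb a x\<bar>)" by simp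
      also have "\<dots> \<le> L * (4 * h)" by (rule mult_left_mono[OF L1 L])
      finally show ?thesis .
    qed
    have r1: "\<bar>LINT x|MD. trunc M (w1 x)\<bar> \<le> 4 * h"
      using mom[of "\<lambda>x. x" 1] by (simp add: integral_comb)
    have r2: "\<bar>(LINT x|MD. (trunc M (w1 x))\<^sup>2) - (LINT x|MD. (comb a x)\<^sup>2)\<bar> \<le> (2 * M) * (4 * h)"
    proof (rule mom[of "\<lambda>x. x\<^sup>2"])
      fix x y :: real assume "\<bar>x\<bar> \<le> M" "\<bar>y\<bar> \<le> M"
      then have "\<bar>x + y\<bar> * \<bar>x - y\<bar> \<le> (2 * M) * \<bar>x - y\<bar>" by (intro mult_right_mono) auto
      moreover have "x\<^sup>2 - y\<^sup>2 = (x + y) * (x - y)" by (simp add: power2_eq_square algebra_simps)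
      ultimately show "\<bar>x\<^sup>2 - y\<^sup>2\<bar> \<le> (2 * M) * \<bar>x - y\<bar>" by (simp add: abs_mult)
    qed (use M0 in \<open>auto intro!: continuous_intros Linf_power\<close>)
    have r3: "\<bar>(LINT x|MD. (trunc M (w1 x)) ^ 3) - (LINT x|MD. (comb a x) ^ 3)\<bar> \<le> (3 * M\<^sup>2) * (4 * h)"
      by (rule mom[of "\<lambda>x. x ^ 3"]) (use M0 in \<open>auto intro!: continuous_intros Linf_power cube_diff_bound\<close>)
    have p4: "c powr q * pi \<le> (4 * c) powr q" if "0 \<le> c" for c
    proof -
      have "pi \<le> 4 powr 1" using pi_less_4 by simp
      also have "\<dots> \<le> 4 powr q" using q by (intro powr_mono) auto
      finally have "c powr q * pi \<le> c powr q * 4 powr q" by (intro mult_left_mono) auto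
      then show ?thesis using that by (simp add: powr_mult mult.commute)
    qed
    have bd: "(LINT x|MD. \<bar>f x\<bar> powr q) \<le> (4 * M) powr q" if "f \<in> LI" "\<And>x. x \<in> disk \<Longrightarrow> \<bar>f x\<bar> \<le> M" for f
    proof -
      have "(LINT x|MD. \<bar>f x\<bar> powr q) \<le> M powr q * pi"
        using that q by (intro integral_bounded Linf_powr powr_mono2) auto
      then show ?thesis using p4[OF M0] by linarith
    qed
    have up: "(4 * M) powr q \<le> (16 * M) powr q" using q M by (intro powr_mono2) auto
    have b0: "(LINT x|MD. \<bar>comb a x\<bar> powr q) \<le> (16 * M) powr q" using bd[OF cL M(2)] up by linarith
    have b1: "(LINT x|MD. \<bar>trunc M (w1 x)\<bar> powr q) \<le> (16 * M) powr q" using bd[OF tL(2) trunc_props(1)[OF M0]] up by linarith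
    have b2: "(LINT x|MD. \<bar>w0 x\<bar> powr q) \<le> (16 * M) powr q"
    proof -
      have i: "integrable MD (\<lambda>x. \<bar>comb a x\<bar> powr q)" "integrable MD (\<lambda>x. \<bar>w0 x - comb a x\<bar> powr q)" "integrable MD (\<lambda>x. \<bar>w0 x\<bar> powr q)"
        using q by (auto intro!: Linf_integrable Linf_powr cL dL w)
      have "(LINT x|MD. \<bar>w0 x\<bar> powr q) \<le> (LINT x|MD. 2 powr q * (\<bar>comb a x\<bar> powr q + \<bar>w0 x - comb a x\<bar> powr q))"
      proof (rule integral_mono)
        fix x
        show "\<bar>w0 x\<bar> powr q \<le> 2 powr q * (\<bar>comb a x\<bar> powr q + \<bar>w0 x - comb a x\<bar> powr q)"
          using powr_add_bound[of q "comb a x" "w0 x - comb a x"] q by simp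
      qed (use i in auto)
      also have "\<dots> = 2 powr q * ((LINT x|MD. \<bar>comb a x\<bar> powr q) + (LINT x|MD. \<bar>w0 x - comb a x\<bar> powr q))"
        using i by simp
      also have "\<dots> \<le> 2 powr q * ((4 * M) powr q + (4 * M) powr q)"
      proof (intro mult_left_mono add_mono)
        show "(LINT x|MD. \<bar>comb a x\<bar> powr q) \<le> (4 * M) powr q" by (rule bd[OF cL M(2)])
        have "h powr q \<le> (4 * M) powr q" using h M q by (intro powr_mono2) auto
        then show "(LINT x|MD. \<bar>w0 x - comb a x\<bar> powr q) \<le> (4 * M) powr q" using close by linarith
      qed auto
      also have "\<dots> \<le> 2 powr q * (2 powr q * (4 * M) powr q)"
      proof -
        have "2 powr 1 \<le> 2 powr q" using q by (intro powr_mono) auto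
        then have "2 * (4 * M) powr q \<le> 2 powr q * (4 * M) powr q" by (intro mult_right_mono) auto
        then show ?thesis by (intro mult_left_mono) auto
      qed
      also have "\<dots> = (2 * (2 * (4 * M))) powr q" using M0 by (simp only: powr_mult)
      finally show ?thesis by simp
    qed
    have b3: "(LINT x|MD. \<bar>w1 x\<bar> powr q) \<le> (16 * M) powr q"
      using re[of "\<lambda>y. \<bar>y\<bar> powr q"] b2 by simp
    have t: "(LINT x|MD. \<bar>w1 x - trunc M (w1 x)\<bar> powr q) \<le> h powr q"
    proof -
      have "(LINT x|MD. \<bar>w1 x - trunc M (w1 x)\<bar> powr q) = (LINT x|MD. \<bar>w0 x - trunc M (w0 x)\<bar> powr q)"
        by (rule re[of "\<lambda>y. \<bar>y - trunc M y\<bar> powr q"]) measurable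
      also have "\<dots> \<le> (LINT x|MD. \<bar>w0 x - comb a x\<bar> powr q)"
      proof (rule integral_mono)
        fix x assume "x \<in> space MD"
        then show "\<bar>w0 x - trunc M (w0 x)\<bar> powr q \<le> \<bar>w0 x - comb a x\<bar> powr q"
          using trunc_props(5)[OF M0 M(2)[of x], of "w0 x"] q by (intro powr_mono2) (auto simp: abs_minus_commute)
      qed (use q in \<open>auto intro!: Linf_integrable Linf_powr Linf_diff w tL cL\<close>)
      finally show ?thesis using close by simp
    qed
    have e1: "\<bar>energy w0 - energy (comb a)\<bar> \<le> C * h * (16 * M)"
      by (rule C(2)[OF w(1) cL h(1) _ close b2 b0]) (use M in simp)
    have e2: "\<bar>energy w1 - energy (\<lambda>x. trunc M (w1 x))\<bar> \<le> C * h * (16 * M)"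
      by (rule C(2)[OF w(2) tL(2) h(1) _ t b3 b1]) (use M in simp)
    have "2 * energy (comb a) = mu * (LINT x|MD. (comb a x)\<^sup>2)" by (rule energy_comb) simp
    then have r4: "mu * (LINT x|MD. (comb a x)\<^sup>2) - 64 * C * M * h \<le> 2 * energy (\<lambda>x. trunc M (w1 x))"
      using e1 e2 E by (simp add: algebra_simps)
    show "\<bar>LINT x|MD. trunc M (w1 x)\<bar> \<le> 4 * h \<and>
      \<bar>(LINT x|MD. (trunc M (w1 x))\<^sup>2) - (LINT x|MD. (comb a x)\<^sup>2)\<bar> \<le> 8 * M * h \<and>
      \<bar>(LINT x|MD. (trunc M (w1 x)) ^ 3) - (LINT x|MD. (comb a x) ^ 3)\<bar> \<le> 12 * M\<^sup>2 * h \<and>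
      mu * (LINT x|MD. (comb a x)\<^sup>2) - 64 * C * M * h \<le> 2 * energy (\<lambda>x. trunc M (w1 x)) \<and>
      (LINT x|MD. \<bar>trunc M (w0 x) - comb a x\<bar>) \<le> 4 * h"
      using r1 r2 r3 r4 L1 by (simp add: algebra_simps)
  qed
qed

section \<open>Orbits\<close>

lemma Lp_norm_MD: "Lp_norm p disk f = (LINT x|MD. \<bar>f x\<bar> powr p) powr (1 / p)"
  by (simp add: Lp_norm_def set_integral_MD)

lemma Lp_norm_less_iff:
  assumes "0 < p" "0 < e"
  shows "Lp_norm p disk f < e \<longleftrightarrow> (LINT x|MD. \<bar>f x\<bar> powr p) < e powr p"
proof -
  let ?I = "LINT x|MD. \<bar>f x\<bar> powr p"
  have I: "0 \<le> ?I" by (rule Bochner_Integration.integral_nonneg) auto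
  have e: "e = (e powr p) powr (1/p)" using assms by (simp add: powr_powr)
  show ?thesis
  proof
    assume "Lp_norm p disk f < e"
    then have "(?I powr (1/p)) powr p < e powr p"
      unfolding Lp_norm_MD using assms by (intro powr_less_mono2) auto
    then show "?I < e powr p" using I assms by (simp add: powr_powr)
  next
    assume "?I < e powr p"
    then have "?I powr (1/p) < (e powr p) powr (1/p)" using I assms by (intro powr_less_mono2) auto
    then show "Lp_norm p disk f < e" using e by (simp add: Lp_norm_MD)
  qed
qed

lemma polar_coordinates:
  assumes "x \<in> disk" obtains r \<theta> where "0 \<le> r" "r < 1" "x = polar r \<theta>"
proof (rule that)
  show "0 \<le> norm x" "norm x < 1" using assms by (auto simp: mem_disk)
  have "to_complex x = of_real (norm x) * cis (Arg (to_complex x))"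
    using rcis_cmod_Arg[of "to_complex x"] by (simp add: rcis_def norm_to_complex)
  then have "Re (to_complex x) = norm x * cos (Arg (to_complex x))" "Im (to_complex x) = norm x * sin (Arg (to_complex x))"
    by (metis Re_complex_of_real Im_complex_of_real Re_rcis rcis_def, metis Im_rcis rcis_def)
  then show "x = polar (norm x) (Arg (to_complex x))"
    by (simp add: polar_def vec_eq_iff forall_2 to_complex_def)
qed

lemma comb_polar:
  "comb a (polar r \<theta>) = a (0, True) * bessel_J 0 (jj * r) + a (1, True) * (bessel_J 1 (jj * r) * cos \<theta>)
     + a (1, False) * (bessel_J 1 (jj * r) * sin \<theta>)"
proof -
  have "rsq (polar r \<theta>) = r\<^sup>2"
    by (simp add: rsq_def polar_def power_mult_distrib flip: distrib_left)
  then show ?thesis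
    by (simp add: comb_explicit bessel_J_radial_bessel Y_def re_or_im_def to_complex_def polar_def algebra_simps)
qed

text \<open>Read the coefficients of the two angular modes as a complex number \<open>z\<^sub>0\<close>. Rotations of the
  disk multiply it by unit numbers, so the orbit contains the member whose number has the same
  argument as that of \<open>c\<close>; the distance is then the difference of the moduli.\<close>

lemma orbit_rotate:
  assumes wb: "\<And>x. x \<in> disk \<Longrightarrow> wb x = comb a x"
  obtains a' where "comb a' \<in> rotation_orbit wb" "a' (0, True) = a (0, True)"
    "\<And>s. \<bar>c (1, s) - a' (1, s)\<bar> \<le> \<bar>sqrt ((c (1, True))\<^sup>2 + (c (1, False))\<^sup>2) - sqrt ((a (1, True))\<^sup>2 + (a (1, False))\<^sup>2)\<bar>"
proof -
  define z z0 where "z = Complex (c (1, True)) (c (1, False))" and "z0 = Complex (a (1, True)) (a (1, False))"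
  \<comment> \<open>The default angle is immaterial: if \<open>z = 0\<close>, all rotations of \<open>z0\<close> are at the same distance.\<close>
  define b where "b = (if z = 0 then 0 else Arg z0 - Arg z)"
  define w where "w = z0 * cis (- b)"
  have "cmod (z - w) = \<bar>cmod z - cmod z0\<bar>"
  proof (cases "z = 0")
    case False
    have "z0 = of_real (cmod z0) * cis (Arg z0)" "z = of_real (cmod z) * cis (Arg z)"
      using rcis_cmod_Arg[of z0] rcis_cmod_Arg[of z] by (simp_all add: rcis_def)
    then have "w = of_real (cmod z0) * cis (Arg z0) * cis (- b)" unfolding w_def by simp
    also have "\<dots> = of_real (cmod z0) * cis (Arg z)" using False by (simp add: b_def cis_mult mult.assoc)
    finally have "z - w = of_real (cmod z - cmod z0) * cis (Arg z)"
      using \<open>z = of_real (cmod z) * cis (Arg z)\<close> by (simp add: algebra_simps)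
    then show ?thesis by (simp only: norm_mult norm_of_real norm_cis mult_1_right)
  qed (simp add: w_def b_def norm_mult)
  then have zw: "\<bar>Re (z - w)\<bar> \<le> \<bar>cmod z - cmod z0\<bar>" "\<bar>Im (z - w)\<bar> \<le> \<bar>cmod z - cmod z0\<bar>"
    using abs_Re_le_cmod[of "z - w"] abs_Im_le_cmod[of "z - w"] by simp_all
  define a' where "a' k = (if k = (1, True) then Re w else if k = (1, False) then Im w else a k)" for k
  show ?thesis
  proof (rule that)
    show "a' (0, True) = a (0, True)" by (simp add: a'_def)
    show "\<bar>c (1, s) - a' (1, s)\<bar> \<le> \<bar>sqrt ((c (1, True))\<^sup>2 + (c (1, False))\<^sup>2) - sqrt ((a (1, True))\<^sup>2 + (a (1, False))\<^sup>2)\<bar>" for s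
      using zw by (cases s) (auto simp: a'_def z_def z0_def cmod_def)
    show "comb a' \<in> rotation_orbit wb" unfolding rotation_orbit_def
    proof (rule CollectI, intro exI[of _ b] ballI allI)
      fix r \<theta> :: real assume r: "r \<in> {0..<1}"
      have "norm (polar r (\<theta> + b)) = r"
      proof -
        have "(norm (polar r (\<theta> + b)))\<^sup>2 = r\<^sup>2"
          by (simp add: norm2_plane polar_def power_mult_distrib flip: distrib_left)
        then show ?thesis using r by (simp add: power2_eq_iff_nonneg)
      qed
      then have "wb (polar r (\<theta> + b)) = comb a (polar r (\<theta> + b))" using r by (intro wb) (simp add: mem_disk)
      moreover have "Re w * cos \<theta> + Im w * sin \<theta> = a (1, True) * cos (\<theta> + b) + a (1, False) * sin (\<theta> + b)"
        by (simp add: w_def z0_def cos_add sin_add algebra_simps)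
      then have "bessel_J 1 (jj * r) * (Re w * cos \<theta> + Im w * sin \<theta>) = bessel_J 1 (jj * r) * (a (1, True) * cos (\<theta> + b) + a (1, False) * sin (\<theta> + b))"
        by simp
      ultimately show "comb a' (polar r \<theta>) = wb (polar r (\<theta> + b))"
        unfolding comb_polar by (simp add: a'_def algebra_simps)
    qed
  qed
qed

section \<open>Auxiliary estimates\<close>

text \<open>The converse estimate for bounded \<open>d\<close>: closeness in mean square implies closeness in every
  \<open>L\<^sup>p\<close>, also for \<open>p > 2\<close>.\<close>

lemma powr_bounded_le_square:
  fixes d e p K :: real assumes "0 < p" "0 < e" "\<bar>d\<bar> \<le> K"
  shows "\<bar>d\<bar> powr p \<le> e powr p + K powr p / e\<^sup>2 * d\<^sup>2"
proof (cases "\<bar>d\<bar> \<le> e")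
  case True
  then have "\<bar>d\<bar> powr p \<le> e powr p" using assms by (intro powr_mono2) auto
  then show ?thesis by (simp add: add_increasing2)
next
  case False
  then have "1 \<le> d\<^sup>2 / e\<^sup>2" using assms abs_le_square_iff[of e d] by simp
  then have "K powr p * 1 \<le> K powr p * (d\<^sup>2 / e\<^sup>2)" by (intro mult_left_mono) auto
  moreover have "\<bar>d\<bar> powr p \<le> K powr p" using assms by (intro powr_mono2) auto
  ultimately have "\<bar>d\<bar> powr p \<le> K powr p / e\<^sup>2 * d\<^sup>2" by simp
  then show ?thesis by (simp add: add_increasing)
qed

text \<open>Hoelder's inequality in qualitative form, on a set of finite measure; this reduces \<open>p\<close> to
  \<open>q = min p 2\<close>.\<close>

lemma Lp_controls_Lq:
  assumes q: "1 \<le> q" "q \<le> p" and h: "0 < h"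
  obtains \<delta> where "0 < \<delta>" "\<And>d. d \<in> LI \<Longrightarrow> (LINT x|MD. \<bar>d x\<bar> powr p) \<le> \<delta> powr p \<Longrightarrow> (LINT x|MD. \<bar>d x\<bar> powr q) \<le> h powr q"
proof -
  define e where "e = h / 8"
  have e: "0 < e" using h by (simp add: e_def)
  have epi: "e powr q * pi \<le> h powr q / 2"
  proof -
    have "e powr q = h powr q * (1/8) powr q" unfolding e_def using h powr_mult[of h "1/8" q] by simp
    also have "\<dots> \<le> h powr q * (1/8) powr 1" using q by (intro mult_left_mono powr_mono') auto
    finally have "e powr q * pi \<le> h powr q * (1/8) * 4" using pi_less_4 by (intro mult_mono) auto
    then show ?thesis by simp
  qed
  define X where "X = h powr q / 2 / e powr (q - p)"
  have X: "0 < X" using h e by (simp add: X_def)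
  show ?thesis
  proof (rule that[of "X powr (1/p)"])
    show "0 < X powr (1/p)" using X by simp
    fix d assume d: "d \<in> LI" and le: "(LINT x|MD. \<bar>d x\<bar> powr p) \<le> (X powr (1/p)) powr p"
    have le': "(LINT x|MD. \<bar>d x\<bar> powr p) \<le> X" using le X q by (simp add: powr_powr)
    have i: "integrable MD (\<lambda>x. \<bar>d x\<bar> powr p)" "integrable MD (\<lambda>x. \<bar>d x\<bar> powr q)"
      using q by (auto intro!: Linf_integrable Linf_powr d)
    have "(LINT x|MD. \<bar>d x\<bar> powr q) \<le> (LINT x|MD. e powr q + e powr (q - p) * \<bar>d x\<bar> powr p)"
      using i Linf_integrable[OF Linf_const] q e by (intro integral_mono powr_split) auto
    also have "\<dots> = e powr q * pi + e powr (q - p) * (LINT x|MD. \<bar>d x\<bar> powr p)"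
      using i Linf_integrable[OF Linf_const] by (simp add: measure_MD)
    also have "\<dots> \<le> e powr q * pi + e powr (q - p) * X" using le' by (intro add_left_mono mult_left_mono) auto
    also have "e powr (q - p) * X = h powr q / 2" using e by (simp add: X_def)
    finally show "(LINT x|MD. \<bar>d x\<bar> powr q) \<le> h powr q" using epi by simp
  qed
qed

text \<open>A nonzero polynomial has finitely many roots, so exceptional values can be found arbitrarily
  close to any point.\<close>

lemma cubic_nonconstant:
  fixes C1 C3 g0 a b :: real
  assumes "C1 \<noteq> 0" "a < b"
  obtains s where "a < s" "s < b" "C3 * s ^ 3 + C1 * s \<noteq> g0"
proof -
  let ?P = "[:- g0, C1, 0, C3:]"
  have "finite {x. poly ?P x = 0}" by (rule poly_roots_finite) (use assms in simp)
  moreover have "infinite {a<..<b}" using assms by simp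
  ultimately have "\<not> {a<..<b} \<subseteq> {x. poly ?P x = 0}" using finite_subset by blast
  then obtain s where "s \<in> {a<..<b}" "s \<notin> {x. poly ?P x = 0}" by blast
  then have "a < s" "s < b" "poly ?P s \<noteq> 0" by (auto simp del: poly_pCons)
  moreover have "poly ?P s = C3 * s ^ 3 + C1 * s - g0" by (simp add: algebra_simps power3_eq_cube)
  ultimately show ?thesis using that[of s] by simp
qed

lemma powr_add3_bound:
  fixes x y z p :: real assumes "0 \<le> p"
  shows "\<bar>x + y + z\<bar> powr p \<le> 4 powr p * (\<bar>x\<bar> powr p + \<bar>y\<bar> powr p + \<bar>z\<bar> powr p)"
proof -
  have "\<bar>x + y + z\<bar> powr p \<le> 2 powr p * (\<bar>x\<bar> powr p + \<bar>y + z\<bar> powr p)"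
    using powr_add_bound[OF assms, of x "y + z"] by (simp add: add.assoc)
  also have "\<dots> \<le> 2 powr p * (2 powr p * \<bar>x\<bar> powr p + 2 powr p * (\<bar>y\<bar> powr p + \<bar>z\<bar> powr p))"
  proof (intro mult_left_mono add_mono powr_add_bound assms)
    have "1 \<le> 2 powr p" using assms by (intro ge_one_powr_ge_zero) auto
    then show "\<bar>x\<bar> powr p \<le> 2 powr p * \<bar>x\<bar> powr p" using mult_right_mono[of 1 "2 powr p" "\<bar>x\<bar> powr p"] by simp
  qed auto
  also have "\<dots> = 4 powr p * (\<bar>x\<bar> powr p + \<bar>y\<bar> powr p + \<bar>z\<bar> powr p)"
    using powr_mult[of 2 2 p] by (simp add: algebra_simps)
  finally show ?thesis .
qed

section \<open>Solutions\<close>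

text \<open>What the dynamics contributes: boundedness, the conserved quantities, and continuity in time
  in \<open>L\<^sup>1\<close>.\<close>

lemma yudovich_facts:
  assumes y: "yudovich_solution w0 w" and w0: "w0 \<in> LI"
  shows "w t \<in> LI" "distr MD borel (w t) = distr MD borel w0" "energy (w t) = energy w0"
    "((\<lambda>\<tau>. LINT x|MD. \<bar>w \<tau> x - w t x\<bar>) \<longlongrightarrow> 0) (at t)" "AE x in MD. w 0 x = w0 x"
proof -
  have Ys: "\<forall>s\<ge>1. (\<forall>t. w t \<in> Lp s disk) \<and> (\<forall>t. ((\<lambda>\<tau>. Lp_norm s disk (\<lambda>x. w \<tau> x - w t x)) \<longlongrightarrow> 0) (at t))"
    and Y0: "AE x in MD. w 0 x = w0 x"
    and Yr: "\<And>t s. measure lebesgue {x \<in> disk. w t x > s} = measure lebesgue {x \<in> disk. w0 x > s}"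
    and YE: "\<And>t. energy (w t) = energy w0"
    using y unfolding yudovich_solution_def by auto
  have Y1: "(\<forall>t. w t \<in> Lp 1 disk) \<and> (\<forall>t. ((\<lambda>\<tau>. Lp_norm 1 disk (\<lambda>x. w \<tau> x - w t x)) \<longlongrightarrow> 0) (at t))"
    using Ys[THEN spec, of 1] by simp
  have L1: "w t \<in> Lp 1 disk" for t using Y1 by simp
  have m: "w t \<in> borel_measurable MD" for t using L1[of t] by (simp add: Lp_def)
  show d: "distr MD borel (w t) = distr MD borel w0"
    by (rule rearrangement_distr[OF m Linf_meas[OF w0] Yr])
  show "w t \<in> LI" by (rule rearrangement_Linf[OF m w0 d])
  show "energy (w t) = energy w0" "AE x in MD. w 0 x = w0 x" by (fact YE Y0)+
  have "((\<lambda>\<tau>. Lp_norm 1 disk (\<lambda>x. w \<tau> x - w t x)) \<longlongrightarrow> 0) (at t)" using Y1 by simp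
  moreover have "Lp_norm 1 disk (\<lambda>x. w \<tau> x - w t x) = (LINT x|MD. \<bar>w \<tau> x - w t x\<bar>)" for \<tau>
    by (simp add: Lp_norm_MD)
  ultimately show "((\<lambda>\<tau>. LINT x|MD. \<bar>w \<tau> x - w t x\<bar>) \<longlongrightarrow> 0) (at t)" by simp
qed

lemma coef_continuous_in_time:
  fixes w :: "real \<Rightarrow> plane \<Rightarrow> real"
  assumes w: "\<And>t. w t \<in> LI" and c: "\<And>t. ((\<lambda>\<tau>. LINT x|MD. \<bar>w \<tau> x - w t x\<bar>) \<longlongrightarrow> 0) (at t)"
    and M: "0 \<le> M" and k: "k \<in> ground_modes"
  shows "continuous_on UNIV (\<lambda>t. coef (\<lambda>x. trunc M (w t x)) k)"
proof (rule continuous_at_imp_continuous_on, rule ballI)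
  fix t :: real
  obtain B where B: "0 < B" "\<And>k x. k \<in> ground_modes \<Longrightarrow> x \<in> disk \<Longrightarrow> \<bar>ground_mode k x\<bar> \<le> B" using ground_mode_bound by blast
  have tL: "(\<lambda>x. trunc M (w t x)) \<in> LI" for t by (rule trunc_Linf[OF M w])
  have "((\<lambda>\<tau>. coef (\<lambda>x. trunc M (w \<tau> x)) k - coef (\<lambda>x. trunc M (w t x)) k) \<longlongrightarrow> 0) (at t)"
  proof (rule Lim_null_comparison)
    show "((\<lambda>\<tau>. B / nu k * (LINT x|MD. \<bar>w \<tau> x - w t x\<bar>)) \<longlongrightarrow> 0) (at t)"
      using tendsto_mult[OF tendsto_const[of "B / nu k"] c[of t]] by simp
    show "\<forall>\<^sub>F \<tau> in at t. norm (coef (\<lambda>x. trunc M (w \<tau> x)) k - coef (\<lambda>x. trunc M (w t x)) k) \<le> B / nu k * (LINT x|MD. \<bar>w \<tau> x - w t x\<bar>)"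
    proof (rule always_eventually, rule allI)
      fix \<tau>
      have "norm (coef (\<lambda>x. trunc M (w \<tau> x)) k - coef (\<lambda>x. trunc M (w t x)) k) = \<bar>coef (\<lambda>x. trunc M (w \<tau> x) - trunc M (w t x)) k\<bar>"
        by (simp add: coef_diff[OF tL tL])
      also have "\<dots> \<le> B / nu k * (LINT x|MD. \<bar>trunc M (w \<tau> x) - trunc M (w t x)\<bar>)"
        by (rule coef_bound[OF B(1) B(2)[OF k] k Linf_diff[OF tL tL]])
      also have "\<dots> \<le> B / nu k * (LINT x|MD. \<bar>w \<tau> x - w t x\<bar>)"
        using B(1) nu_pos[OF k]
        by (intro mult_left_mono integral_mono Linf_integrable Linf_abs Linf_diff tL w trunc_props(2)[OF M]) auto
      finally show "norm (coef (\<lambda>x. trunc M (w \<tau> x)) k - coef (\<lambda>x. trunc M (w t x)) k) \<le> B / nu k * (LINT x|MD. \<bar>w \<tau> x - w t x\<bar>)" .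
    qed
  qed
  then show "isCont (\<lambda>t. coef (\<lambda>x. trunc M (w t x)) k) t"
    unfolding isCont_def by (rule LIM_zero_cancel)
qed

text \<open>The intermediate value theorem: a continuous function cannot pass a value that it never
  takes.\<close>

lemma trapped:
  fixes f :: "real \<Rightarrow> real"
  assumes c: "continuous_on UNIV f" and f0: "s1 < f 0" "f 0 < s2" and av: "\<And>t. f t \<noteq> s1" "\<And>t. f t \<noteq> s2"
  shows "s1 < f t \<and> f t < s2"
proof -
  have "connected (range f)" by (rule connected_continuous_image[OF c connected_UNIV])
  then have cl: "{f x..f y} \<subseteq> range f" for x y by (intro connected_contains_Icc) auto
  have "\<not> s2 \<le> f t"
  proof
    assume "s2 \<le> f t"
    then have "s2 \<in> range f" using cl[of 0 t] f0 by auto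
    then show False using av by auto
  qed
  moreover have "\<not> f t \<le> s1"
  proof
    assume "f t \<le> s1"
    then have "s1 \<in> range f" using cl[of t 0] f0 by auto
    then show False using av by auto
  qed
  ultimately show ?thesis by simp
qed

lemma nu_1: "nu (1, s) = nu (1, True)"
  by (simp add: nu_def angular_mass_def)

lemma sum_ground_modes: "(\<Sum>k\<in>ground_modes. F k) = F (0, True) + F (1, True) + F (1, False)"
  by (simp add: ground_modes_def add.assoc)

text \<open>The argument for a member of the span that is not zero. The tolerance \<open>r\<close> for the radial
  coefficient is chosen first. Then barriers \<open>s1 < a0 < s2\<close> within \<open>r\<close> of the initial coefficient
  \<open>a0\<close> are chosen at which the cubic \<open>g\<close> differs from \<open>g a0\<close>. Finally \<open>h\<close>, and with it \<open>\<delta>\<close>, is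
  taken so small that the almost conserved quantities keep \<open>g (f t)\<close> closer to \<open>g a0\<close> than \<open>g s1\<close>
  and \<open>g s2\<close> are. The radial coefficient \<open>f t\<close> can never be at a barrier, and remains between
  them.\<close>

theorem stability_nonzero:
  assumes p: "1 < p" and wb: "\<And>x. x \<in> disk \<Longrightarrow> wb x = comb al x" and S0: "0 < (\<Sum>k\<in>ground_modes. (al k)\<^sup>2 * nu k)" and eps: "0 < \<epsilon>"
  shows "\<exists>\<delta>>0. \<forall>w0\<in>LI. \<forall>w. yudovich_solution w0 w \<longrightarrow> (LINT x|MD. \<bar>w0 x - comb al x\<bar> powr p) < \<delta> powr p \<longrightarrow>
     (\<forall>t. \<exists>\<eta>\<in>rotation_orbit wb. (LINT x|MD. \<bar>w t x - \<eta> x\<bar> powr p) < \<epsilon> powr p)"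
proof -
  let ?k0 = "(0, True) :: nat \<times> bool"
  have kK: "?k0 \<in> ground_modes" "(1, s) \<in> ground_modes" for s by (cases s; simp add: ground_modes_def)+
  define n0 n1 where "n0 = nu ?k0" and "n1 = nu (1, True)"
  have n: "0 < n0" "0 < n1" using nu_pos kK by (auto simp: n0_def n1_def)
  define S where "S = (\<Sum>k\<in>ground_modes. (al k)\<^sup>2 * nu k)"
  have S: "0 < S" using S0 by (simp add: S_def)
  have nsum: "(\<Sum>k\<in>ground_modes. (c k)\<^sup>2 * nu k) = n0 * (c ?k0)\<^sup>2 + n1 * ((c (1, True))\<^sup>2 + (c (1, False))\<^sup>2)" for c
    unfolding sum_ground_modes nu_1[of False] by (simp add: n0_def n1_def algebra_simps)
  have SI: "S = (LINT x|MD. (comb al x)\<^sup>2)"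
    using comb_norm[of al al] by (simp add: S_def power2_eq_square)
  define a0 where "a0 = al ?k0"
  \<comment> \<open>The third moment as a function of the radial coefficient \<open>s\<close> when the squared \<open>L\<^sup>2\<close> norm is
    \<open>S\<close>.\<close>
  define g where "g s = (moment_radial - 3 * moment_mixed * n0 / n1) * s ^ 3 + (3 * moment_mixed * S / n1) * s" for s
  have g_eq: "moment_radial * c ?k0 ^ 3 + 3 * moment_mixed * c ?k0 * ((c (1, True))\<^sup>2 + (c (1, False))\<^sup>2) - g (c ?k0)
     = 3 * moment_mixed / n1 * c ?k0 * ((\<Sum>k\<in>ground_modes. (c k)\<^sup>2 * nu k) - S)" for c
    unfolding nsum g_def using n by (simp add: field_simps power2_eq_square power3_eq_cube)
  have T: "(LINT x|MD. (comb al x) ^ 3) = g a0"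
    unfolding third_moment using g_eq[of al] by (simp add: S_def a0_def)
  have C1: "3 * moment_mixed * S / n1 \<noteq> 0" using moment_mixed_pos S n by simp
  obtain B where B: "0 < B" "\<And>k x. k \<in> ground_modes \<Longrightarrow> x \<in> disk \<Longrightarrow> \<bar>ground_mode k x\<bar> \<le> B" using ground_mode_bound by blast
  obtain M' where M': "0 < M'" "\<And>x. norm x \<le> 1 \<Longrightarrow> \<bar>comb al x\<bar> \<le> M'" using continuous_bounded_disk[OF continuous_comb] by blast
  define M where "M = max 1 M'"
  have M: "1 \<le> M" "\<And>x. x \<in> disk \<Longrightarrow> \<bar>comb al x\<bar> \<le> M"
    using M' by (auto simp: M_def mem_disk intro: order_trans[OF M'(2)] max.coboundedI2)
  have M0: "0 \<le> M" using M by simp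
  \<comment> \<open>The energy estimates require an exponent in \<open>(1, 2]\<close>.\<close>
  define q where "q = min p 2"
  have q: "1 < q" "q \<le> 2" "q \<le> p" using p by (auto simp: q_def)
  have cL: "comb c \<in> LI" for c by (rule Linf_cont[OF continuous_comb])
  obtain C0 where C0: "0 \<le> C0" and tr: "\<And>w0 w1 h. w0 \<in> LI \<Longrightarrow> w1 \<in> LI \<Longrightarrow> distr MD borel w1 = distr MD borel w0 \<Longrightarrow> energy w1 = energy w0 \<Longrightarrow>
      0 < h \<Longrightarrow> h \<le> 1 \<Longrightarrow> (LINT x|MD. \<bar>w0 x - comb al x\<bar> powr q) \<le> h powr q \<Longrightarrow>
      \<bar>LINT x|MD. trunc M (w1 x)\<bar> \<le> 4 * h \<and>
      \<bar>(LINT x|MD. (trunc M (w1 x))\<^sup>2) - (LINT x|MD. (comb al x)\<^sup>2)\<bar> \<le> 8 * M * h \<and>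
      \<bar>(LINT x|MD. (trunc M (w1 x)) ^ 3) - (LINT x|MD. (comb al x) ^ 3)\<bar> \<le> 12 * M\<^sup>2 * h \<and>
      mu * (LINT x|MD. (comb al x)\<^sup>2) - C0 * h \<le> 2 * energy (\<lambda>x. trunc M (w1 x)) \<and>
      (LINT x|MD. \<bar>trunc M (w0 x) - comb al x\<bar>) \<le> 4 * h"
    by (rule truncated_rearrangement[OF q(1,2) M], assumption) (rule that)
  obtain K where K: "0 < K" and near: "\<And>v h S T. v \<in> LI \<Longrightarrow> \<forall>x. \<bar>v x\<bar> \<le> M \<Longrightarrow> 0 < h \<Longrightarrow> h \<le> 1 \<Longrightarrow> \<bar>LINT x|MD. v x\<bar> \<le> 4 * h \<Longrightarrow>
      \<bar>(LINT x|MD. (v x)\<^sup>2) - S\<bar> \<le> 8 * M * h \<Longrightarrow> \<bar>(LINT x|MD. (v x) ^ 3) - T\<bar> \<le> 12 * M\<^sup>2 * h \<Longrightarrow>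
      mu * S - C0 * h \<le> 2 * energy v \<Longrightarrow>
      (LINT x|MD. (v x - comb (coef v) x)\<^sup>2) \<le> K * h \<and>
      \<bar>(\<Sum>k\<in>ground_modes. (coef v k)\<^sup>2 * nu k) - S\<bar> \<le> K * h \<and>
      \<bar>(LINT x|MD. (comb (coef v) x) ^ 3) - T\<bar> \<le> K * sqrt h \<and>
      (\<forall>k\<in>ground_modes. \<bar>coef v k\<bar> \<le> K) \<and> (\<forall>x\<in>disk. \<bar>comb (coef v) x\<bar> \<le> K)"
    by (rule near_maximiser[OF M(1) C0]) (rule that)
  \<comment> \<open>Three errors of this size are added below, with factors \<open>4\<^sup>p\<close> and up to \<open>\<pi>\<close>; \<open>4 / 64 = 1 / 16\<close>
    leaves room for them.\<close>
  define e where "e = \<epsilon> / 64"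
  have e: "0 < e" using eps by (simp add: e_def)
  define Q where "Q = n0 / n1 * (2 * \<bar>a0\<bar> + 2)"
  have Q0: "0 \<le> Q" using n by (simp add: Q_def)
  obtain r where r: "0 < r" "r < 1" "B * (r + 2 * sqrt (Q * r)) < e"
  proof -
    have "((\<lambda>r. B * (r + 2 * sqrt (Q * r))) \<longlongrightarrow> B * (0 + 2 * sqrt (Q * 0))) (at_right 0)"
      by (intro tendsto_intros)
    then have "\<forall>\<^sub>F r in at_right 0. B * (r + 2 * sqrt (Q * r)) < e" using e by (intro order_tendstoD(2)) auto
    moreover have "\<forall>\<^sub>F r in at_right 0. 0 < r \<and> r < (1::real)"
      by (intro eventually_conj eventually_at_right_less order_tendstoD(2)[OF tendsto_ident_at]) simp
    ultimately have "\<forall>\<^sub>F r in at_right 0. 0 < r \<and> r < 1 \<and> B * (r + 2 * sqrt (Q * r)) < e" by eventually_elim blast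
    from eventually_happens'[OF trivial_limit_at_right_real this] show ?thesis using that by blast
  qed
  obtain s1 where s1: "a0 - r < s1" "s1 < a0" "g s1 \<noteq> g a0"
    using cubic_nonconstant[OF C1, of "a0 - r" a0] r(1) unfolding g_def by auto
  obtain s2 where s2: "a0 < s2" "s2 < a0 + r" "g s2 \<noteq> g a0"
    using cubic_nonconstant[OF C1, of a0 "a0 + r"] r(1) unfolding g_def by auto
  define ga where "ga = min \<bar>g s1 - g a0\<bar> \<bar>g s2 - g a0\<bar>"
  have ga: "0 < ga" using s1 s2 by (simp add: ga_def)
  define gap where "gap = min (a0 - s1) (s2 - a0)"
  have gap: "0 < gap" using s1 s2 by (simp add: gap_def)
  define K5 where "K5 = K + 3 * moment_mixed / n1 * K * K"
  define Kb where "Kb = M + K"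
  define K6 where "K6 = 4 powr p * (Kb powr p / e\<^sup>2 * K)"
  obtain h where h: "0 < h" "h < 1" "K5 * sqrt h < ga" "B / n0 * (4 * h) < gap" "K6 * h < \<epsilon> powr p / 8" "K * h < n0 * r"
  proof -
    have t: "((\<lambda>h. K5 * sqrt h) \<longlongrightarrow> K5 * sqrt 0) (at_right 0)" "((\<lambda>h. B / n0 * (4 * h)) \<longlongrightarrow> B / n0 * (4 * 0)) (at_right 0)"
      "((\<lambda>h. K6 * h) \<longlongrightarrow> K6 * 0) (at_right 0)" "((\<lambda>h. K * h) \<longlongrightarrow> K * 0) (at_right 0)"
      by (intro tendsto_intros)+
    have "\<forall>\<^sub>F h in at_right 0. K5 * sqrt h < ga" "\<forall>\<^sub>F h in at_right 0. B / n0 * (4 * h) < gap"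
      "\<forall>\<^sub>F h in at_right 0. K6 * h < \<epsilon> powr p / 8" "\<forall>\<^sub>F h in at_right 0. K * h < n0 * r"
      using order_tendstoD(2)[OF t(1), of ga] order_tendstoD(2)[OF t(2), of gap] order_tendstoD(2)[OF t(3), of "\<epsilon> powr p / 8"]
        order_tendstoD(2)[OF t(4), of "n0 * r"] ga gap eps n r by auto
    moreover have "\<forall>\<^sub>F h in at_right 0. 0 < h \<and> h < (1::real)"
      by (intro eventually_conj eventually_at_right_less order_tendstoD(2)[OF tendsto_ident_at]) simp
    ultimately have "\<forall>\<^sub>F h in at_right 0. 0 < h \<and> h < 1 \<and> K5 * sqrt h < ga \<and> B / n0 * (4 * h) < gap \<and> K6 * h < \<epsilon> powr p / 8 \<and> K * h < n0 * r"
      by eventually_elim blast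
    from eventually_happens'[OF trivial_limit_at_right_real this] show ?thesis using that by blast
  qed
  obtain d1 where d1: "0 < d1" "\<And>d. d \<in> LI \<Longrightarrow> (LINT x|MD. \<bar>d x\<bar> powr p) \<le> d1 powr p \<Longrightarrow> (LINT x|MD. \<bar>d x\<bar> powr q) \<le> h powr q"
    using Lp_controls_Lq[of q p h] q h(1) by auto
  define \<delta> where "\<delta> = min d1 e"
  have \<delta>: "0 < \<delta>" "\<delta> \<le> d1" "\<delta> \<le> e" using d1 e by (auto simp: \<delta>_def)
  show ?thesis
  proof (intro exI[of _ \<delta>] conjI ballI allI impI \<delta>(1))
    fix w0 w t
    assume w0: "w0 \<in> LI" and y: "yudovich_solution w0 w" and close: "(LINT x|MD. \<bar>w0 x - comb al x\<bar> powr p) < \<delta> powr p"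
    note yf = yudovich_facts[OF y w0]
    have dL: "(\<lambda>x. w0 x - comb al x) \<in> LI" by (intro Linf_diff w0 cL)
    have "\<delta> powr p \<le> d1 powr p" using \<delta> p by (intro powr_mono2) auto
    then have cq: "(LINT x|MD. \<bar>w0 x - comb al x\<bar> powr q) \<le> h powr q" using d1(2)[OF dL] close by simp
    define v where "v t x = trunc M (w t x)" for t x
    have vL: "v t \<in> LI" for t unfolding v_def by (intro trunc_Linf M0 yf(1))
    have h1: "h \<le> 1" using h by simp
    note trt = tr[OF w0 yf(1) yf(2) yf(3) h(1) h1 cq, folded v_def SI, unfolded T]
    have vM: "\<bar>v t x\<bar> \<le> M" for t x unfolding v_def by (rule trunc_props(1)[OF M0])
    have nr: "(LINT x|MD. (v t x - comb (coef (v t)) x)\<^sup>2) \<le> K * h"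
      "\<bar>(\<Sum>k\<in>ground_modes. (coef (v t) k)\<^sup>2 * nu k) - S\<bar> \<le> K * h"
      "\<bar>(LINT x|MD. (comb (coef (v t)) x) ^ 3) - g a0\<bar> \<le> K * sqrt h"
      "\<And>k. k \<in> ground_modes \<Longrightarrow> \<bar>coef (v t) k\<bar> \<le> K" "\<And>x. x \<in> disk \<Longrightarrow> \<bar>comb (coef (v t)) x\<bar> \<le> K" for t
      using near[OF vL[of t] allI[OF vM] h(1) h1, of S "g a0"] trt[of t] by auto
    define f where "f t = coef (v t) ?k0" for t
    have gf: "\<bar>g (f t) - g a0\<bar> < ga" for t
    proof -
      have "(LINT x|MD. (comb (coef (v t)) x) ^ 3) - g (f t) = 3 * moment_mixed / n1 * f t * ((\<Sum>k\<in>ground_modes. (coef (v t) k)\<^sup>2 * nu k) - S)"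
        unfolding third_moment f_def by (rule g_eq)
      then have "\<bar>(LINT x|MD. (comb (coef (v t)) x) ^ 3) - g (f t)\<bar> = 3 * moment_mixed / n1 * (\<bar>f t\<bar> * \<bar>(\<Sum>k\<in>ground_modes. (coef (v t) k)\<^sup>2 * nu k) - S\<bar>)"
        using moment_mixed_pos n by (simp add: abs_mult)
      also have "\<dots> \<le> 3 * moment_mixed / n1 * (K * (K * h))"
        using nr(2)[of t] nr(4)[OF kK(1), of t] moment_mixed_pos n K h by (intro mult_left_mono mult_mono) (auto simp: f_def)
      also have "\<dots> \<le> 3 * moment_mixed / n1 * (K * (K * sqrt h))"
      proof -
        have "h * h \<le> h" using h by (simp add: mult_left_le)
        then have "h \<le> sqrt h" using h by (intro real_le_rsqrt) (simp add: power2_eq_square)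
        then show ?thesis using moment_mixed_pos n K by (intro mult_left_mono) auto
      qed
      finally have "\<bar>g (f t) - g a0\<bar> \<le> 3 * moment_mixed / n1 * (K * (K * sqrt h)) + K * sqrt h" using nr(3)[of t] by linarith
      also have "\<dots> = K5 * sqrt h" by (simp add: K5_def algebra_simps)
      finally show ?thesis using h(3) by simp
    qed
    have fc: "continuous_on UNIV f"
      unfolding f_def v_def by (rule coef_continuous_in_time[OF yf(1) yf(4) M0 kK(1)])
    have f0: "\<bar>f 0 - a0\<bar> < gap"
    proof -
      have "f 0 - a0 = coef (\<lambda>x. v 0 x - comb al x) ?k0"
        by (simp add: coef_diff[OF vL cL] f_def a0_def coef_comb[OF kK(1)])
      then have "\<bar>f 0 - a0\<bar> \<le> B / n0 * (LINT x|MD. \<bar>v 0 x - comb al x\<bar>)"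
        using coef_bound[OF B(1) B(2)[OF kK(1)] kK(1) Linf_diff[OF vL[of 0] cL[of al]]] by (simp add: n0_def)
      also have "(LINT x|MD. \<bar>v 0 x - comb al x\<bar>) = (LINT x|MD. \<bar>trunc M (w0 x) - comb al x\<bar>)"
      proof (rule integral_cong_AE)
        show "AE x in MD. \<bar>v 0 x - comb al x\<bar> = \<bar>trunc M (w0 x) - comb al x\<bar>"
          using yf(5) by eventually_elim (simp add: v_def)
      qed (intro Linf_meas Linf_abs Linf_diff vL cL trunc_Linf M0 w0)+
      also have "B / n0 * \<dots> \<le> B / n0 * (4 * h)" using trt[of 0] B n by (intro mult_left_mono) auto
      finally show ?thesis using h(4) by simp
    qed
    have trap: "s1 < f t \<and> f t < s2" for t
    proof (rule trapped[OF fc])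
      show "s1 < f 0" "f 0 < s2" using f0 unfolding gap_def by linarith+
      show "f t \<noteq> s1" "f t \<noteq> s2" for t using gf[of t] by (auto simp: ga_def)
    qed
    define c where "c = coef (v t)"
    have c0: "\<bar>c ?k0 - a0\<bar> < r" using trap[of t] s1 s2 unfolding f_def c_def by linarith
    let ?rho = "\<lambda>c :: nat \<times> bool \<Rightarrow> real. (c (1, True))\<^sup>2 + (c (1, False))\<^sup>2"
    obtain a' where a': "comb a' \<in> rotation_orbit wb" "a' ?k0 = a0" "\<And>s. \<bar>c (1, s) - a' (1, s)\<bar> \<le> \<bar>sqrt (?rho c) - sqrt (?rho al)\<bar>"
      using orbit_rotate[OF wb, of c] unfolding a0_def by metis
    have rho: "\<bar>sqrt (?rho c) - sqrt (?rho al)\<bar> \<le> sqrt (Q * r)"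
    proof -
      have "\<bar>(c ?k0)\<^sup>2 - a0\<^sup>2\<bar> \<le> r * (2 * \<bar>a0\<bar> + 1)"
      proof -
        have "(c ?k0)\<^sup>2 - a0\<^sup>2 = (c ?k0 - a0) * (c ?k0 + a0)" by (simp add: power2_eq_square algebra_simps)
        moreover have "\<bar>c ?k0 + a0\<bar> \<le> 2 * \<bar>a0\<bar> + 1" using c0 r by linarith
        ultimately show ?thesis using c0 by (simp add: abs_mult mult_mono)
      qed
      then have x: "n0 * \<bar>(c ?k0)\<^sup>2 - a0\<^sup>2\<bar> \<le> n0 * (r * (2 * \<bar>a0\<bar> + 1))" using n by (intro mult_left_mono) auto
      have neq: "n1 * (?rho c - ?rho al) = ((\<Sum>k\<in>ground_modes. (c k)\<^sup>2 * nu k) - S) - n0 * ((c ?k0)\<^sup>2 - a0\<^sup>2)"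
        unfolding S_def nsum a0_def by (simp add: algebra_simps)
      have "n1 * \<bar>?rho c - ?rho al\<bar> = \<bar>n1 * (?rho c - ?rho al)\<bar>" using n by (simp add: abs_mult)
      also have "\<dots> = \<bar>((\<Sum>k\<in>ground_modes. (c k)\<^sup>2 * nu k) - S) - n0 * ((c ?k0)\<^sup>2 - a0\<^sup>2)\<bar>" unfolding neq ..
      also have "\<dots> \<le> K * h + n0 * \<bar>(c ?k0)\<^sup>2 - a0\<^sup>2\<bar>"
        using nr(2)[of t] abs_triangle_ineq4[of "(\<Sum>k\<in>ground_modes. (c k)\<^sup>2 * nu k) - S" "n0 * ((c ?k0)\<^sup>2 - a0\<^sup>2)"] n
        by (simp add: c_def abs_mult)
      also have "\<dots> \<le> n0 * r + n0 * (r * (2 * \<bar>a0\<bar> + 1))" using h(6) x by linarith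
      also have "\<dots> = n1 * (Q * r)" using n by (simp add: Q_def field_simps)
      finally have rr: "\<bar>?rho c - ?rho al\<bar> \<le> Q * r" using n by simp
      have "\<bar>sqrt A - sqrt B\<bar> \<le> sqrt \<bar>A - B\<bar>" if "0 \<le> A" "0 \<le> B" for A B
      proof (rule real_le_rsqrt)
        have "\<bar>sqrt A - sqrt B\<bar> * \<bar>sqrt A - sqrt B\<bar> \<le> \<bar>sqrt A - sqrt B\<bar> * (sqrt A + sqrt B)"
          using that by (intro mult_left_mono) (auto simp: abs_le_iff)
        also have "\<dots> = \<bar>(sqrt A - sqrt B) * (sqrt A + sqrt B)\<bar>" using that by (simp add: abs_mult)
        also have "(sqrt A - sqrt B) * (sqrt A + sqrt B) = A - B" using that by (simp add: algebra_simps)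
        finally show "\<bar>sqrt A - sqrt B\<bar>\<^sup>2 \<le> \<bar>A - B\<bar>" by (simp only: power2_eq_square)
      qed
      then have "\<bar>sqrt (?rho c) - sqrt (?rho al)\<bar> \<le> sqrt \<bar>?rho c - ?rho al\<bar>" by simp
      also have "\<dots> \<le> sqrt (Q * r)" using rr by simp
      finally show ?thesis .
    qed
    have sup: "\<bar>comb c x - comb a' x\<bar> \<le> e" if x: "x \<in> disk" for x
    proof -
      have "\<bar>comb c x - comb a' x\<bar> \<le> B * (\<Sum>k\<in>ground_modes. \<bar>c k - a' k\<bar>)" unfolding comb_diff by (rule comb_bound[OF B x])
      also have "\<dots> \<le> B * (r + 2 * sqrt (Q * r))"
        unfolding sum_ground_modes using a'(2) a'(3)[of True] a'(3)[of False] rho c0 B(1) by (intro mult_left_mono) auto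
      finally show ?thesis using r(3) by simp
    qed
    have I3: "(LINT x|MD. \<bar>comb c x - comb a' x\<bar> powr p) \<le> e powr p * pi"
      using sup p by (intro integral_bounded Linf_powr Linf_diff cL powr_mono2) auto
    have I1: "(LINT x|MD. \<bar>w t x - v t x\<bar> powr p) \<le> e powr p"
    proof -
      have "(LINT x|MD. \<bar>w t x - trunc M (w t x)\<bar> powr p) = (LINT x|MD. \<bar>w0 x - trunc M (w0 x)\<bar> powr p)"
        by (rule rearrangement_integral[OF Linf_meas[OF yf(1)] Linf_meas[OF w0] yf(2), of "\<lambda>y. \<bar>y - trunc M y\<bar> powr p"]) measurable
      also have "\<dots> \<le> (LINT x|MD. \<bar>w0 x - comb al x\<bar> powr p)"
      proof (rule integral_mono)
        fix x assume "x \<in> space MD"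
        then show "\<bar>w0 x - trunc M (w0 x)\<bar> powr p \<le> \<bar>w0 x - comb al x\<bar> powr p"
          using trunc_props(5)[OF M0 M(2)[of x], of "w0 x"] p by (intro powr_mono2) (auto simp: abs_minus_commute)
      qed (use p in \<open>auto intro!: Linf_integrable Linf_powr Linf_diff w0 cL trunc_Linf M0\<close>)
      also have "\<dots> \<le> \<delta> powr p" using close by simp
      also have "\<dots> \<le> e powr p" using \<delta> p by (intro powr_mono2) auto
      finally show ?thesis by (simp add: v_def)
    qed
    have I2: "(LINT x|MD. \<bar>v t x - comb c x\<bar> powr p) \<le> e powr p * pi + Kb powr p / e\<^sup>2 * (K * h)"
    proof -
      have i: "integrable MD (\<lambda>x. (v t x - comb c x)\<^sup>2)" by (intro Linf_integrable Linf_power Linf_diff vL cL)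
      have "(LINT x|MD. \<bar>v t x - comb c x\<bar> powr p) \<le> (LINT x|MD. e powr p + Kb powr p / e\<^sup>2 * (v t x - comb c x)\<^sup>2)"
      proof (rule integral_mono)
        fix x assume "x \<in> space MD"
        then have "\<bar>v t x - comb c x\<bar> \<le> Kb" using vM[of t x] nr(5)[of x t] unfolding Kb_def c_def by auto
        then show "\<bar>v t x - comb c x\<bar> powr p \<le> e powr p + Kb powr p / e\<^sup>2 * (v t x - comb c x)\<^sup>2"
          using p e by (intro powr_bounded_le_square) auto
      qed (use p i Linf_integrable[OF Linf_const] in \<open>auto intro!: Linf_integrable[OF Linf_powr] Linf_diff vL cL\<close>)
      also have "\<dots> = e powr p * pi + Kb powr p / e\<^sup>2 * (LINT x|MD. (v t x - comb c x)\<^sup>2)"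
        using i Linf_integrable[OF Linf_const] by (simp add: measure_MD)
      also have "\<dots> \<le> e powr p * pi + Kb powr p / e\<^sup>2 * (K * h)"
        using nr(1)[of t] by (intro add_left_mono mult_left_mono) (auto simp: c_def)
      finally show ?thesis .
    qed
    have ii: "integrable MD (\<lambda>x. \<bar>w t x - v t x\<bar> powr p)" "integrable MD (\<lambda>x. \<bar>v t x - comb c x\<bar> powr p)"
      "integrable MD (\<lambda>x. \<bar>comb c x - comb a' x\<bar> powr p)" "integrable MD (\<lambda>x. \<bar>w t x - comb a' x\<bar> powr p)"
      using p by (auto intro!: Linf_integrable Linf_powr Linf_diff vL cL yf(1))
    have "(LINT x|MD. \<bar>w t x - comb a' x\<bar> powr p) \<le> (LINT x|MD. 4 powr p * (\<bar>w t x - v t x\<bar> powr p + \<bar>v t x - comb c x\<bar> powr p + \<bar>comb c x - comb a' x\<bar> powr p))"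
    proof (rule integral_mono)
      fix x
      show "\<bar>w t x - comb a' x\<bar> powr p \<le> 4 powr p * (\<bar>w t x - v t x\<bar> powr p + \<bar>v t x - comb c x\<bar> powr p + \<bar>comb c x - comb a' x\<bar> powr p)"
        using powr_add3_bound[of p "w t x - v t x" "v t x - comb c x" "comb c x - comb a' x"] p by simp
    qed (use ii in auto)
    also have "\<dots> = 4 powr p * ((LINT x|MD. \<bar>w t x - v t x\<bar> powr p) + (LINT x|MD. \<bar>v t x - comb c x\<bar> powr p) + (LINT x|MD. \<bar>comb c x - comb a' x\<bar> powr p))"
      using ii by simp
    also have "\<dots> \<le> 4 powr p * (e powr p + (e powr p * pi + Kb powr p / e\<^sup>2 * (K * h)) + e powr p * pi)"
      by (intro mult_left_mono add_mono I1 I2 I3) auto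
    also have "\<dots> = 4 powr p * e powr p * (1 + 2 * pi) + K6 * h" by (simp add: K6_def algebra_simps)
    also have "4 powr p * e powr p = (\<epsilon> / 16) powr p" using eps by (simp add: e_def flip: powr_mult)
    also have "(\<epsilon> / 16) powr p * (1 + 2 * pi) + K6 * h < \<epsilon> powr p"
    proof -
      have "(\<epsilon> / 16) powr p = \<epsilon> powr p * (1/16) powr p" using eps powr_mult[of \<epsilon> "1/16" p] by simp
      also have "\<dots> \<le> \<epsilon> powr p * (1/16) powr 1" using p by (intro mult_left_mono powr_mono') auto
      finally have "(\<epsilon> / 16) powr p * (1 + 2 * pi) \<le> \<epsilon> powr p * (1/16) * (1 + 2 * 4)"
        using pi_less_4 by (intro mult_mono) auto
      moreover have "0 < \<epsilon> powr p" using eps by simp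
      moreover have "X + k < E" if "X \<le> E * (1/16) * (1 + 2 * 4)" "0 < E" "k < E / 8" for X E k :: real
      proof -
        have "E * (1/16) * (1 + 2 * 4) = 9/16 * E" by simp
        with that show ?thesis by linarith
      qed
      ultimately show ?thesis using h(5) by blast
    qed
    finally show "\<exists>\<eta>\<in>rotation_orbit wb. (LINT x|MD. \<bar>w t x - \<eta> x\<bar> powr p) < \<epsilon> powr p"
      using a'(1) by blast
  qed
qed

theorem theorem1p2:
  fixes p :: real and \<omega>bar :: "real^2 \<Rightarrow> real"
  assumes "1 < p" and "\<omega>bar \<in> bessel_span"
  shows "\<forall>\<epsilon>>0. \<exists>\<delta>>0. \<forall>\<omega>0\<in>Linf disk. \<forall>\<omega>.
           yudovich_solution \<omega>0 \<omega> \<longrightarrow>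
           Lp_norm p disk (\<lambda>x. \<omega>0 x - \<omega>bar x) < \<delta> \<longrightarrow>
           (\<forall>t. \<exists>\<eta>\<in>rotation_orbit \<omega>bar. Lp_norm p disk (\<lambda>x. \<omega> t x - \<eta> x) < \<epsilon>)"
proof (intro allI impI)
  fix \<epsilon> :: real assume eps: "0 < \<epsilon>"
  have p: "0 < p" using assms(1) by simp
  obtain a b c where abc: "\<And>r \<theta>. r \<in> {0..<1} \<Longrightarrow> \<omega>bar (polar r \<theta>) = a * bessel_J 0 (jj * r)
     + b * (bessel_J 1 (jj * r) * cos \<theta>) + c * (bessel_J 1 (jj * r) * sin \<theta>)"
    using assms(2) unfolding bessel_span_def by blast
  define al where "al k = (if k = (0, True) then a else if k = (1, True) then b else c)" for k :: "nat \<times> bool"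
  have wb: "\<omega>bar x = comb al x" if xd: "x \<in> disk" for x
  proof -
    obtain r \<theta> where "0 \<le> r" "r < 1" "x = polar r \<theta>" by (rule polar_coordinates[OF xd])
    then show ?thesis using abc[of r \<theta>] by (simp add: comb_polar al_def)
  qed
  have conv: "(LINT x|MD. \<bar>f x - \<omega>bar x\<bar> powr p) = (LINT x|MD. \<bar>f x - comb al x\<bar> powr p)" for f
    by (rule Bochner_Integration.integral_cong) (auto simp: wb)
  show "\<exists>\<delta>>0. \<forall>\<omega>0\<in>Linf disk. \<forall>\<omega>. yudovich_solution \<omega>0 \<omega> \<longrightarrow>
           Lp_norm p disk (\<lambda>x. \<omega>0 x - \<omega>bar x) < \<delta> \<longrightarrow>
           (\<forall>t. \<exists>\<eta>\<in>rotation_orbit \<omega>bar. Lp_norm p disk (\<lambda>x. \<omega> t x - \<eta> x) < \<epsilon>)"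
  proof (cases "0 < (\<Sum>k\<in>ground_modes. (al k)\<^sup>2 * nu k)")
    case True
    have "\<exists>\<delta>>0. \<forall>w0\<in>LI. \<forall>w. yudovich_solution w0 w \<longrightarrow> (LINT x|MD. \<bar>w0 x - comb al x\<bar> powr p) < \<delta> powr p \<longrightarrow>
       (\<forall>t. \<exists>\<eta>\<in>rotation_orbit \<omega>bar. (LINT x|MD. \<bar>w t x - \<eta> x\<bar> powr p) < \<epsilon> powr p)"
      by (rule stability_nonzero[OF assms(1) _ True eps]) (rule wb)
    then obtain \<delta> where \<delta>: "0 < \<delta>" "\<forall>w0\<in>LI. \<forall>w. yudovich_solution w0 w \<longrightarrow> (LINT x|MD. \<bar>w0 x - comb al x\<bar> powr p) < \<delta> powr p \<longrightarrow>
       (\<forall>t. \<exists>\<eta>\<in>rotation_orbit \<omega>bar. (LINT x|MD. \<bar>w t x - \<eta> x\<bar> powr p) < \<epsilon> powr p)"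
      by blast
    show ?thesis
      using \<delta> unfolding Lp_norm_less_iff[OF p eps] by (intro exI[of _ \<delta>]) (auto simp: Lp_norm_less_iff[OF p \<delta>(1)] conv)
  next
    case False
    have nn: "0 \<le> (al k)\<^sup>2 * nu k" if "k \<in> ground_modes" for k using nu_pos[OF that] by simp
    have "0 \<le> (\<Sum>k\<in>ground_modes. (al k)\<^sup>2 * nu k)" by (rule sum_nonneg) (rule nn)
    then have "(\<Sum>k\<in>ground_modes. (al k)\<^sup>2 * nu k) = 0" using False by linarith
    then have "\<forall>k\<in>ground_modes. (al k)\<^sup>2 * nu k = 0" by (subst (asm) sum_nonneg_eq_0_iff) (use finite_ground_modes nn in auto)
    then have "al k = 0" if "k \<in> ground_modes" for k using nu_pos[OF that] that by fastforce
    then have z: "comb al x = 0" for x by (simp add: comb_def)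
    have orb: "\<omega>bar \<in> rotation_orbit \<omega>bar" unfolding rotation_orbit_def by (rule CollectI, rule exI[of _ 0]) simp
    show ?thesis
    \<comment> \<open>Stability of the zero vorticity is conservation of the \<open>L\<^sup>p\<close> norm.\<close>
    proof (intro exI[of _ \<epsilon>] conjI eps ballI allI impI)
      fix w0 w t assume w0: "w0 \<in> LI" and y: "yudovich_solution w0 w" and close: "Lp_norm p disk (\<lambda>x. w0 x - \<omega>bar x) < \<epsilon>"
      note yf = yudovich_facts[OF y w0]
      have "(LINT x|MD. \<bar>w t x\<bar> powr p) = (LINT x|MD. \<bar>w0 x\<bar> powr p)"
        by (rule rearrangement_integral[OF Linf_meas[OF yf(1)] Linf_meas[OF w0] yf(2), of "\<lambda>y. \<bar>y\<bar> powr p"]) measurable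
      then have "Lp_norm p disk (\<lambda>x. w t x - \<omega>bar x) < \<epsilon>"
        using close unfolding Lp_norm_less_iff[OF p eps] conv z by simp
      then show "\<exists>\<eta>\<in>rotation_orbit \<omega>bar. Lp_norm p disk (\<lambda>x. w t x - \<eta> x) < \<epsilon>" using orb by blast
    qed
  qed
qed

end
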